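(* Let $k=p/q$ be admissible, $t=k+2$, $N=2q+p-1$, $l=q-1$, and $S=\{N-it-j: i=0,\dots,l;\ j=1,\dots,N\}$. Then $\{L(k,r\omega): r\in S\}$ is a complete list of the irreducible $L(k,0)$-modules from the category $\mathcal O$. Equivalently, the irreducible $L(k,0)$-modules from the category $\mathcal O$ are exactly the irreducible highest weight $\hat{\mathfrak g}$-modules whose highest weight lies in $$P^{k}=\{(k-n+mt)\Lambda_0+(n-mt)\Lambda_1: m,n\in\mathbb Z_{\ge0},\ n\le 2q+p-2,\ m\le q-1\}.$$
   Context: Conventions for $\mathfrak g$ and $\hat{\mathfrak g}$: - $\mathfrak g=sl(2,\mathbb C)$ with basis $e,f,h$; $\omega$ is the fundamental weight, $\omega(h)=1$. - $\hat{\mathfrak g}=\mathfrak g\otimes\mathbb C[t,t^{-1}]\oplus\mathbb Cc$, with $x(n)=x\otimes t^n$ and $[x(m),y(n)]=[x,y](m+n)+m\delta_{m+n,0}\mathrm{tr}(xy)c$. - $\Lambda_0,\Lambda_1$ are the fundamental weights: $\Lambda_0(c)=\Lambda_1(c)=1$, $\Lambda_0(h(0))=0$, $\Lambda_1(h(0))=1$. Admissibility: $k=p/q$ is admissible if $q\in\mathbb N$, $p\in\mathbb Z$, $\gcd(p,q)=1$, $2q+p-2\ge0$. Modules: - For a $\mathfrak g$-module $U$, $M(k,U)=U(\hat{\mathfrak g})\otimes_{U(\mathfrak g\otimes\mathbb C[t]\oplus\mathbb Cc)}U$, with $\mathfrak g\otimes t\mathbb C[t]$ acting as $0$ and $c$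 acting as $k$. - $M(k,\lambda)=M(k,V(\lambda))$, where $V(\lambda)$ is the irreducible highest weight $\mathfrak g$-module. - $L(k,\lambda)$ is the irreducible quotient of $M(k,\lambda)$. - $M(k,0)$ is a VOA, and $L(k,0)$ is its simple quotient VOA. An $L(k,0)$-module (in the sense of a $\mathbb Z_{\ge0}$-graded VOA module) is naturally a $\hat{\mathfrak g}$-module of level $k$: $x(n)$ acts as the coefficient of $z^{-n-1}$ in $Y_M(x(-1)\mathbf 1,z)$. "Category $\mathcal O$" refers to the category $\mathcal O$ of $\hat{\mathfrak g}$-modules. *)

theory Defs
  imports Complex_Main
begin

datatype sl2b = E | F | H

text \<open>Coefficient of the basis vector z in the bracket [x,y].\<close>
fun br :: "sl2b \<Rightarrow> sl2b \<Rightarrow> sl2b \<Rightarrow> complex" where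
  "br E F z = (if z = H then 1 else 0)"
| "br F E z = (if z = H then -1 else 0)"
| "br H E z = (if z = E then 2 else 0)"
| "br E H z = (if z = E then -2 else 0)"
| "br H F z = (if z = F then -2 else 0)"
| "br F H z = (if z = F then 2 else 0)"
| "br _ _ z = 0"

fun trf :: "sl2b \<Rightarrow> sl2b \<Rightarrow> complex" where
  "trf E F = 1"
| "trf F E = 1"
| "trf H H = 2"
| "trf _ _ = 0"

definition fin_dim :: "(complex \<Rightarrow> 'w::ab_group_add \<Rightarrow> 'w) \<Rightarrow> 'w set \<Rightarrow> bool" where
  "fin_dim s U \<longleftrightarrow> (\<exists>B. finite B \<and> U \<subseteq> module.span s B)"

definition graded_decomp :: "(complex \<Rightarrow> 'w::ab_group_add \<Rightarrow> 'w) \<Rightarrow> (nat \<Rightarrow> 'w set) \<Rightarrow> bool" where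
  "graded_decomp s Wg \<longleftrightarrow>
     (\<forall>d. module.subspace s (Wg d)) \<and>
     (\<forall>w. \<exists>!c. (\<forall>d. c d \<in> Wg d) \<and> finite {d. c d \<noteq> 0} \<and> w = (\<Sum>d\<in>{d. c d \<noteq> 0}. c d))"

text \<open>act x n is the action of x(n) = x \<otimes> t^n; c acts as k.
  [x(m),y(n)] = [x,y](m+n) + m \<delta>_{m+n,0} tr(xy) c.\<close>
definition ghat_module :: "complex \<Rightarrow> (complex \<Rightarrow> 'w::ab_group_add \<Rightarrow> 'w) \<Rightarrow> (sl2b \<Rightarrow> int \<Rightarrow> 'w \<Rightarrow> 'w) \<Rightarrow> bool" where
  "ghat_module k s act \<longleftrightarrow>
     vector_space s \<and> (\<forall>x n. Vector_Spaces.linear s s (act x n)) \<and>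
     (\<forall>x y m n w. act x m (act y n w) - act y n (act x m w) =
        (\<Sum>z\<in>{E, F, H}. s (br x y z) (act z (m + n) w)) +
        (if m + n = 0 then s (of_int m * trf x y * k) w else 0))"

definition ghat_irred :: "(complex \<Rightarrow> 'w::ab_group_add \<Rightarrow> 'w) \<Rightarrow> (sl2b \<Rightarrow> int \<Rightarrow> 'w \<Rightarrow> 'w) \<Rightarrow> bool" where
  "ghat_irred s act \<longleftrightarrow> (\<exists>w::'w. w \<noteq> 0) \<and>
     (\<forall>U. module.subspace s U \<and> (\<forall>x n. \<forall>w\<in>U. act x n w \<in> U) \<and> U \<noteq> {0} \<longrightarrow> U = UNIV)"

text \<open>W is isomorphic to L(k, r\<omega>): an irreducible level-k module generated by
  (i.e. containing, by irreducibility) a highest weight vector w with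
  x(n)w = 0 (n >= 1), e(0)w = 0, h(0)w = r w.\<close>
definition hw_irrep :: "complex \<Rightarrow> (complex \<Rightarrow> 'w::ab_group_add \<Rightarrow> 'w) \<Rightarrow> (sl2b \<Rightarrow> int \<Rightarrow> 'w \<Rightarrow> 'w) \<Rightarrow> complex \<Rightarrow> bool" where
  "hw_irrep k s act r \<longleftrightarrow> ghat_module k s act \<and> ghat_irred s act \<and>
     (\<exists>w. w \<noteq> 0 \<and> (\<forall>x n. n \<ge> 1 \<longrightarrow> act x n w = 0) \<and> act E 0 w = 0 \<and> act H 0 w = s r w)"

text \<open>Category O (Kac), with the derivation d realised by an operator D on W satisfying
  [D, x(n)] = n x(n).  Weights are pairs (h(0)-eigenvalue, D-eigenvalue); the simple roots are
  alpha_1 = (2,0) (root of e(0)) and alpha_0 = (-2,1) (root of f(1)).\<close>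
definition in_cat_O :: "complex \<Rightarrow> (complex \<Rightarrow> 'w::ab_group_add \<Rightarrow> 'w) \<Rightarrow> (sl2b \<Rightarrow> int \<Rightarrow> 'w \<Rightarrow> 'w) \<Rightarrow> bool" where
  "in_cat_O k s act \<longleftrightarrow> ghat_module k s act \<and>
     (\<exists>D Lams. Vector_Spaces.linear s s D \<and>
        (\<forall>x n w. D (act x n w) - act x n (D w) = s (of_int n) (act x n w)) \<and>
        (let wsp = (\<lambda>(\<mu>, \<nu>). {w. act H 0 w = s \<mu> w \<and> D w = s \<nu> w}) in
          (\<forall>w. \<exists>Fs g. finite Fs \<and> (\<forall>\<omega>\<in>Fs. g \<omega> \<in> wsp \<omega>) \<and> w = (\<Sum>\<omega>\<in>Fs. g \<omega>)) \<and>
          (\<forall>\<omega>. fin_dim s (wsp \<omega>)) \<and>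
          finite Lams \<and>
          (\<forall>\<mu> \<nu>. wsp (\<mu>, \<nu>) \<noteq> {0} \<longrightarrow>
             (\<exists>(l1, l2)\<in>Lams. \<exists>a b::nat.
                l1 - \<mu> = - 2 * of_nat a + 2 * of_nat b \<and> l2 - \<nu> = of_nat a))))"

section \<open>Vertex algebras and their modules (u_n w written Y u n w)\<close>

text \<open>Borcherds (Jacobi) identity in components:
  sum_{i>=0} (m choose i) (u_{l+i} v)_{m+n-i} w
   = sum_{i>=0} (-1)^i (l choose i) (u_{m+l-i} v_{n+i} w - (-1)^l v_{n+l-i} u_{m+i} w).
  Both sums are finite by truncation; we require equality of the partial sums for all
  sufficiently large cut-offs.\<close>
definition borcherds :: "(complex \<Rightarrow> 'w::ab_group_add \<Rightarrow> 'w) \<Rightarrow> ('v \<Rightarrow> int \<Rightarrow> 'v \<Rightarrow> 'v) \<Rightarrow> ('v \<Rightarrow> int \<Rightarrow> 'w \<Rightarrow> 'w) \<Rightarrow> bool" where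
  "borcherds s Y YW \<longleftrightarrow> (\<forall>u v w m n l. eventually (\<lambda>B.
     (\<Sum>i<B. s ((of_int m :: complex) gchoose i) (YW (Y u (l + int i) v) (m + n - int i) w)) =
     (\<Sum>i<B. s ((-1) ^ i * ((of_int l :: complex) gchoose i))
                 (YW u (m + l - int i) (YW v (n + int i) w)
                  - s ((-1::complex) powi l) (YW v (n + l - int i) (YW u (m + int i) w)))))
     sequentially)"

definition vertex_algebra :: "(complex \<Rightarrow> 'v::ab_group_add \<Rightarrow> 'v) \<Rightarrow> ('v \<Rightarrow> int \<Rightarrow> 'v \<Rightarrow> 'v) \<Rightarrow> 'v \<Rightarrow> bool" where
  "vertex_algebra s Y one \<longleftrightarrow> vector_space s \<and>
     (\<forall>u n. Vector_Spaces.linear s s (Y u n)) \<and>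
     (\<forall>n v. Vector_Spaces.linear s s (\<lambda>u. Y u n v)) \<and>
     (\<forall>u v. \<exists>N. \<forall>n\<ge>N. Y u n v = 0) \<and>
     (\<forall>n v. Y one n v = (if n = -1 then v else 0)) \<and>
     (\<forall>u n. n \<ge> 0 \<longrightarrow> Y u n one = 0) \<and> (\<forall>u. Y u (-1) one = u) \<and>
     borcherds s Y Y"

definition va_module :: "(complex \<Rightarrow> 'v::ab_group_add \<Rightarrow> 'v) \<Rightarrow> ('v \<Rightarrow> int \<Rightarrow> 'v \<Rightarrow> 'v) \<Rightarrow> 'v \<Rightarrow>
     (complex \<Rightarrow> 'w::ab_group_add \<Rightarrow> 'w) \<Rightarrow> ('v \<Rightarrow> int \<Rightarrow> 'w \<Rightarrow> 'w) \<Rightarrow> bool" where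
  "va_module sV Y one sW YW \<longleftrightarrow> vector_space sW \<and>
     (\<forall>u n. Vector_Spaces.linear sW sW (YW u n)) \<and>
     (\<forall>n w. Vector_Spaces.linear sV sW (\<lambda>u. YW u n w)) \<and>
     (\<forall>u w. \<exists>N. \<forall>n\<ge>N. YW u n w = 0) \<and>
     (\<forall>n w. YW one n w = (if n = -1 then w else 0)) \<and>
     borcherds sW Y YW"

definition grading_compat :: "(nat \<Rightarrow> 'v set) \<Rightarrow> (nat \<Rightarrow> 'w::zero set) \<Rightarrow> ('v \<Rightarrow> int \<Rightarrow> 'w \<Rightarrow> 'w) \<Rightarrow> bool" where
  "grading_compat Vg Wg YW \<longleftrightarrow> (\<forall>d e v w m. v \<in> Vg d \<longrightarrow> w \<in> Wg e \<longrightarrow>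
     YW v m w \<in> (if int e + int d - m - 1 \<ge> 0 then Wg (nat (int e + int d - m - 1)) else {0}))"

definition graded_module :: "(complex \<Rightarrow> 'v::ab_group_add \<Rightarrow> 'v) \<Rightarrow> ('v \<Rightarrow> int \<Rightarrow> 'v \<Rightarrow> 'v) \<Rightarrow> 'v \<Rightarrow> (nat \<Rightarrow> 'v set) \<Rightarrow>
     (complex \<Rightarrow> 'w::ab_group_add \<Rightarrow> 'w) \<Rightarrow> ('v \<Rightarrow> int \<Rightarrow> 'w \<Rightarrow> 'w) \<Rightarrow> (nat \<Rightarrow> 'w set) \<Rightarrow> bool" where
  "graded_module sV Y one Vg sW YW Wg \<longleftrightarrow>
     va_module sV Y one sW YW \<and> graded_decomp sW Wg \<and> grading_compat Vg Wg YW"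

definition va_module_irred :: "(complex \<Rightarrow> 'w::ab_group_add \<Rightarrow> 'w) \<Rightarrow> ('v \<Rightarrow> int \<Rightarrow> 'w \<Rightarrow> 'w) \<Rightarrow> bool" where
  "va_module_irred s YW \<longleftrightarrow> (\<exists>w::'w. w \<noteq> 0) \<and>
     (\<forall>U. module.subspace s U \<and> (\<forall>v n. \<forall>w\<in>U. YW v n w \<in> U) \<and> U \<noteq> {0} \<longrightarrow> U = UNIV)"

text \<open>(V, Y, one, Vg) together with a : sl2 -> V (a x = x(-1) 1) is (isomorphic to) L(k,0):
  a graded vertex algebra on which the modes x(n) := (a x)_n give a level-k
  ghat-module structure, irreducible as ghat-module, with a x of degree 1 and the
  vacuum of degree 0.  Irreducibility forces V = L(k,0) as ghat-module (one is a
  highest weight vector of weight k Lambda_0 by the creation property), and the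
  vertex algebra structure and grading are then uniquely determined since V is
  generated by the fields Y(x(-1)1, z) = x(z).\<close>
definition is_Lk0 :: "complex \<Rightarrow> (complex \<Rightarrow> 'v::ab_group_add \<Rightarrow> 'v) \<Rightarrow> ('v \<Rightarrow> int \<Rightarrow> 'v \<Rightarrow> 'v) \<Rightarrow> 'v \<Rightarrow>
     (sl2b \<Rightarrow> 'v) \<Rightarrow> (nat \<Rightarrow> 'v set) \<Rightarrow> bool" where
  "is_Lk0 k sV Y one a Vg \<longleftrightarrow>
     vertex_algebra sV Y one \<and> one \<noteq> 0 \<and>
     graded_decomp sV Vg \<and> grading_compat Vg Vg Y \<and> one \<in> Vg 0 \<and> (\<forall>x. a x \<in> Vg 1) \<and>
     ghat_module k sV (\<lambda>x n. Y (a x) n) \<and> ghat_irred sV (\<lambda>x n. Y (a x) n)"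

definition admissible :: "int \<Rightarrow> nat \<Rightarrow> bool" where
  "admissible p q \<longleftrightarrow> q \<ge> 1 \<and> gcd p (int q) = 1 \<and> 2 * int q + p - 2 \<ge> 0"

definition lev :: "int \<Rightarrow> nat \<Rightarrow> complex" where
  "lev p q = of_int p / of_nat q"

definition S_set :: "int \<Rightarrow> nat \<Rightarrow> complex set" where
  "S_set p q = {of_int (2 * int q + p - 1) - of_nat i * (lev p q + 2) - of_int j | i j.
                 i \<le> q - 1 \<and> 1 \<le> j \<and> j \<le> 2 * int q + p - 1}"

text \<open>P^k, a weight a Lambda_0 + b Lambda_1 being recorded as the pair (a, b);
  such a weight takes the value a + b on c and b on h(0).\<close>
definition P_set :: "int \<Rightarrow> nat \<Rightarrow> (complex \<times> complex) set" where
  "P_set p q = {(lev p q - of_nat n + of_nat m * (lev p q + 2), of_nat n - of_nat m * (lev p q + 2)) | m n.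
                 int n \<le> 2 * int q + p - 2 \<and> m \<le> q - 1}"

end

theory Submission
  imports Defs "HOL-Analysis.Gamma_Function" "HOL-Computational_Algebra.Polynomial"
    "HOL-Computational_Algebra.Formal_Power_Series"
begin

text \<open>Write \<open>k + 2 = (N + 1) / q\<close>. Reflections, realised by complex powers of the generator
  \<open>e(-1)\<close>, carry a trivial singular vector of a Verma module to one of the vacuum module whose zero mode is a nonzero
  polynomial of degree at most \<open>N q\<close> in the top weight. Conversely every vector of the maximal ideal has vanishing
  zero mode on each of the \<open>N q\<close> tops with weight in \<open>S\<close>: vanishing on the \<open>(n + 1)\<close>-dimensional tops is
  transported along the weights \<open>m (k + 2) - 2 - n\<close> by spectral flow and interpolation, and a first failure
  would be an eigenvector of the Sugawara operator whose degree is too small. So the polynomial has exactly the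
  roots \<open>S\<close>. For \<open>r\<close> in \<open>S\<close> the vertex operators on the highest weight module are products of the
  currents; Dong's lemma gives locality, hence the Borcherds identity, and the vanishing zero modes make the
  maximal ideal act by zero.\<close>

text \<open>A reflected singular vector helps only if its zero mode is known not to vanish, and
  there is no usable formula for the vector. Nonvanishing is therefore carried by one functional,
  \<open>chr\<close>. Let y_0 act on powers of x as multiplication by x and y_1 as -d/dx; a word w
  sends x^\<mu> to \<open>chr \<mu> w\<close> times another power of x. A complex power of y_0
  merely shifts the exponent, so the functional survives reflection, and at \<mu> = 0 it is, up to a
  Gamma quotient, the leading coefficient of the zero mode in the top weight. The degree is
  controlled by the same functional: after each reflection the vector is replaced by a minimal one
  that \<open>chr\<close> still sees, and for such a vector the Casimir operator forces a quadratic
  equation between its two letter counts. The resulting bounds add up to N q, the size of S. Vectors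
  enter this part only through the values of functionals on words, so no PBW basis has to be
  constructed.\<close>

section \<open>Formal combinations and the free highest weight module\<close>

text \<open>Combinations are unreduced lists. Equality of vectors is never tested, only values of
  functionals, so repeated words and zero coefficients do no harm.\<close>

definition lc :: "('a => complex) => (complex \<times> 'a) list => complex" where
 "lc g P = (\<Sum>(c, w)\<leftarrow>P. c * g w)"

lemma lc_simps [simp]:
 "lc g [] = 0" "lc g (x # P) = fst x * g (snd x) + lc g P" "lc g (P @ Q) = lc g P + lc g Q"
 by (auto simp: lc_def split: prod.splits)

lemma lc_cong: "(!!c w. (c, w) \<in> set P ==> g w = h w) ==> lc g P = lc h P"
 by (induction P) (auto, metis)

lemma lc_add: "lc (%w. g w + h w) P = lc g P + lc h P"
 by (induction P) (auto simp: algebra_simps)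
lemma lc_diff: "lc (%w. g w - h w) P = lc g P - lc h P"
 by (induction P) (auto simp: algebra_simps)
lemma lc_cmult: "lc (%w. c * g w) P = c * lc g P"
 by (induction P) (auto simp: algebra_simps)
lemma lc_zero [simp]: "lc (%w. 0) P = 0"
 by (induction P) auto

definition bindc :: "('a => (complex \<times> 'b) list) => (complex \<times> 'a) list => (complex \<times> 'b) list" where
 "bindc f P = concat (map (%(c, w). map (%(d, u). (c * d, u)) (f w)) P)"

lemma lc_scale: "lc g (map (%(d, u). (c * d, u)) P) = c * lc g P"
 by (induction P) (auto simp: algebra_simps)

lemma lc_bindc: "lc g (bindc f P) = lc (%w. lc g (f w)) P"
 by (induction P) (auto simp: bindc_def lc_scale)

lemma set_bindc: "(d, u) \<in> set (bindc f P) ==> \<exists>c w e. (c, w) \<in> set P \<and> (e, u) \<in> set (f w)"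
 by (auto simp: bindc_def)

definition c0 :: "bool list => nat" where "c0 w = count_list w False"
definition c1 :: "bool list => nat" where "c1 w = count_list w True"

lemma c_simps [simp]: "c0 [] = 0" "c1 [] = 0" "c0 (False # w) = Suc (c0 w)" "c0 (True # w) = c0 w"
 "c1 (False # w) = c1 w" "c1 (True # w) = Suc (c1 w)"
 by (auto simp: c0_def c1_def)

definition homog :: "nat => nat => (complex \<times> bool list) list => bool" where
 "homog A B P \<longleftrightarrow> (\<forall>(c, w)\<in>set P. c0 w = A \<and> c1 w = B)"

text \<open>The eigenvalue of the coroot h_i on w v: a highest weight (l0, l1) minus rows of the
  affine Cartan matrix with entries 2 and -2. The letter \<open>False\<close> is y_0 and
  \<open>True\<close> is y_1.\<close>

definition kap :: "complex => complex => bool => bool list => complex" where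
 "kap l0 l1 i w = (if i then l1 - 2 * of_nat (c1 w) + 2 * of_nat (c0 w)
          else l0 - 2 * of_nat (c0 w) + 2 * of_nat (c1 w))"

text \<open>Linear functionals stand for vectors: \<open>del l0 l1 i g w\<close> is \<open>g\<close> applied to the
 vector \<open>e\<^sub>i w v\<close> of the free highest weight module.\<close>
fun del :: "complex => complex => bool => (bool list => complex) => bool list => complex" where
 "del l0 l1 i g [] = 0"
| "del l0 l1 i g (j # w) = del l0 l1 i (%w. g (j # w)) w + (if i = j then kap l0 l1 i w * g w else 0)"

text \<open>The head of the list acts first on the vector, because operators act on functionals
  contravariantly.\<close>

fun delw :: "complex => complex => bool list => (bool list => complex) => bool list => complex" where
 "delw l0 l1 [] g = g"
| "delw l0 l1 (q # Q) g = del l0 l1 q (delw l0 l1 Q g)"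

definition ind :: "bool list => complex" where "ind w = (if w = [] then 1 else 0)"

text \<open>The maximal proper submodule: \<open>ind\<close> reads off the coefficient of the
  highest weight vector, and no sequence of raising operators leads from \<open>P\<close> back to
  it.\<close>

definition Rad :: "complex => complex => (complex \<times> bool list) list => bool" where
 "Rad l0 l1 P \<longleftrightarrow> (\<forall>Q. lc (delw l0 l1 Q ind) P = 0)"

fun chr :: "complex => bool list => complex" where
 "chr \<mu> [] = 1"
| "chr \<mu> (False # w) = chr \<mu> w"
| "chr \<mu> (True # w) = - (\<mu> + of_nat (c0 w) - of_nat (c1 w)) * chr \<mu> w"

text \<open>The property transported by the reflections; \<open>A\<close> and \<open>B\<close> count
  the letters y_0 and y_1.\<close>

definition bad :: "complex => complex => complex => nat => nat => bool" where
 "bad l0 l1 \<mu> A B \<longleftrightarrow> (\<exists>P. homog A B P \<and> Rad l0 l1 P \<and> lc (chr \<mu>) P \<noteq> 0)"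

text \<open>The raising operator of \<open>del\<close> on vectors instead of functionals;
  \<open>lc_dl\<close> is the duality between the two.\<close>

fun dl :: "complex => complex => bool => bool list => (complex \<times> bool list) list" where
 "dl l0 l1 i [] = []"
| "dl l0 l1 i (j # w) = map (%(c, u). (c, j # u)) (dl l0 l1 i w) @
  (if i = j then [(kap l0 l1 i w, w)] else [])"

lemma lc_map1: "lc g (map (%(c, w). (c, f w)) P) = lc (%w. g (f w)) P"
 by (induction P) (auto simp: algebra_simps)

lemma lc_dl: "lc g (dl l0 l1 i w) = del l0 l1 i g w"
 by (induction w arbitrary: g) (auto simp: lc_map1)

lemma set_dl: "(c, u) \<in> set (dl l0 l1 i w) ==>
 (if i then c0 u = c0 w \<and> Suc (c1 u) = c1 w else Suc (c0 u) = c0 w \<and> c1 u = c1 w)"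
proof (induction w arbitrary: u c)
 case (Cons j w)
 then show ?case by (cases j; cases i) (fastforce split: if_splits)+
qed auto

definition dP :: "complex => complex => bool => (complex \<times> bool list) list => (complex \<times> bool list) list" where
 "dP l0 l1 i P = bindc (dl l0 l1 i) P"

lemma lc_dP: "lc g (dP l0 l1 i P) = lc (del l0 l1 i g) P"
 by (simp add: dP_def lc_bindc lc_dl)

lemma Rad_dP: "Rad l0 l1 P ==> Rad l0 l1 (dP l0 l1 i P)"
 unfolding Rad_def lc_dP by (metis delw.simps(2))

lemma homog_dP0: "homog A B P ==> homog (A - 1) B (dP l0 l1 False P)"
 unfolding homog_def dP_def by (fastforce dest!: set_bindc set_dl)
lemma homog_dP1: "homog A B P ==> homog A (B - 1) (dP l0 l1 True P)"
 unfolding homog_def dP_def by (fastforce dest!: set_bindc set_dl)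

lemma dP_empty0: "homog 0 B P ==> dP l0 l1 False P = []"
proof (rule ccontr)
 assume h: "homog 0 B P" and "dP l0 l1 False P \<noteq> []"
 then obtain c u where "(c, u) \<in> set (dP l0 l1 False P)" by (metis list.set_sel(1) surj_pair)
 then show False using h unfolding homog_def dP_def by (fastforce dest!: set_bindc set_dl)
qed
lemma dP_empty1: "homog A 0 P ==> dP l0 l1 True P = []"
proof (rule ccontr)
 assume h: "homog A 0 P" and "dP l0 l1 True P \<noteq> []"
 then obtain c u where "(c, u) \<in> set (dP l0 l1 True P)" by (metis list.set_sel(1) surj_pair)
 then show False using h unfolding homog_def dP_def by (fastforce dest!: set_bindc set_dl)
qed

lemma del_linear:
 "del l0 l1 i (%w. g w + h w) w = del l0 l1 i g w + del l0 l1 i h w"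
 "del l0 l1 i (%w. g w - h w) w = del l0 l1 i g w - del l0 l1 i h w"
 "del l0 l1 i (%w. c * g w) w = c * del l0 l1 i g w"
 "del l0 l1 i (%w. 0) w = 0"
 by (simp_all add: lc_dl[symmetric] lc_add lc_diff lc_cmult)

text \<open>A raising operator removes exactly one letter, so a factor depending only on the counts
  comes out with one argument lowered. Integer arguments let the lowered count be -1.\<close>

lemma del_wt:
 "del l0 l1 True (%w. f (int (c0 w)) (int (c1 w)) * g w) w
  = f (int (c0 w)) (int (c1 w) - 1) * del l0 l1 True g w"
 "del l0 l1 False (%w. f (int (c0 w)) (int (c1 w)) * g w) w
  = f (int (c0 w) - 1) (int (c1 w)) * del l0 l1 False g w"
proof -
 have *: "int (c1 u) = int (c1 w) - 1 \<and> c0 u = c0 w" if "(c, u) \<in> set (dl l0 l1 True w)" for c u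
  using set_dl[OF that] by auto
 have **: "int (c0 u) = int (c0 w) - 1 \<and> c1 u = c1 w" if "(c, u) \<in> set (dl l0 l1 False w)" for c u
  using set_dl[OF that] by auto
 show "del l0 l1 True (%w. f (int (c0 w)) (int (c1 w)) * g w) w
  = f (int (c0 w)) (int (c1 w) - 1) * del l0 l1 True g w"
  unfolding lc_dl[symmetric] lc_cmult[symmetric] by (rule lc_cong) (use * in auto)
 show "del l0 l1 False (%w. f (int (c0 w)) (int (c1 w)) * g w) w
  = f (int (c0 w) - 1) (int (c1 w)) * del l0 l1 False g w"
  unfolding lc_dl[symmetric] lc_cmult[symmetric] by (rule lc_cong) (use ** in auto)
qed

lemma chr_True_fun: "(%w. chr \<mu> (True # w)) =
 (%w. (%a b. - (\<mu> + of_int a - of_int b)) (int (c0 w)) (int (c1 w)) * chr \<mu> w)"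
 by auto

text \<open>The Casimir operator contains the sum of f_\<alpha> e_\<alpha> over the positive roots.
  In the representation by x and -d/dx every negative root vector vanishes except y_0, y_1 and
  [y_0, y_1] = 1, and these give the three groups of terms on the left. The factor on the right is
  half the difference of |\<lambda> + \<rho>|^2 and |\<lambda> + \<rho> - A \<alpha>_0 - B
  \<alpha>_1|^2.\<close>

lemma casimir_chr:
 defines "A w \<equiv> of_nat (c0 w) :: complex" and "B w \<equiv> of_nat (c1 w) :: complex"
 shows "del l0 l1 False (chr \<mu>) w - (\<mu> + A w - B w + 1) * del l0 l1 True (chr \<mu>) w
  + (del l0 l1 False (del l0 l1 True (chr \<mu>)) w - del l0 l1 True (del l0 l1 False (chr \<mu>)) w) / 2
  = (A w * (l0 + 1) + B w * (l1 + 1) - (A w - B w)\<^sup>2) * chr \<mu> w"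
proof (induction w)
 case Nil
 then show ?case by (simp add: A_def B_def)
next
 case (Cons j w)
 note del_wt1 = del_wt(1)[where f = "%a b. - (\<mu> + of_int a - of_int b)"]
 note del_wt2 = del_wt(2)[where f = "%a b. - (\<mu> + of_int a - of_int b)"]
 define X0 X1 X01 X10 C where "X0 = del l0 l1 False (chr \<mu>) w" "X1 = del l0 l1 True (chr \<mu>) w"
  "X01 = del l0 l1 False (del l0 l1 True (chr \<mu>)) w" "X10 = del l0 l1 True (del l0 l1 False (chr \<mu>)) w"
  "C = chr \<mu> w"
 define a b where "a = A w" and "b = B w"
 have IH: "X0 - (\<mu> + a - b + 1) * X1 + (X01 - X10) / 2
  = (a * (l0 + 1) + b * (l1 + 1) - (a - b)\<^sup>2) * C"
  using Cons unfolding X0_X1_X01_X10_C_def a_def b_def .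
 show ?case
 proof (cases j)
  case False
  have Aj: "A (j # w) = a + 1" "B (j # w) = b" using False by (auto simp: A_def B_def a_def b_def)
  have f1: "(%w. chr \<mu> (j # w)) = chr \<mu>" using False by auto
  have k0: "kap l0 l1 False w = l0 - 2 * a + 2 * b"
   by (simp add: kap_def a_def b_def A_def B_def)
  have d0: "del l0 l1 False (chr \<mu>) (j # w) = X0 + (l0 - 2 * a + 2 * b) * C"
   using False by (simp add: X0_X1_X01_X10_C_def k0)
  have d1: "del l0 l1 True (chr \<mu>) (j # w) = X1"
   using False by (simp add: X0_X1_X01_X10_C_def)
  have d01: "del l0 l1 False (del l0 l1 True (chr \<mu>)) (j # w) = X01 + (l0 - 2 * a + 2 * b) * X1"
   using False by (simp add: X0_X1_X01_X10_C_def k0)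
  have e: "(%w. kap l0 l1 False w * chr \<mu> w) = (%w. (%a b. l0 - 2 * of_int a + 2 * of_int b) (int (c0 w)) (int (c1 w)) * chr \<mu> w)"
   by (auto simp: kap_def)
  have "del l0 l1 True (del l0 l1 False (chr \<mu>)) (j # w)
    = X10 + del l0 l1 True (%w. kap l0 l1 False w * chr \<mu> w) w"
   using False by (simp add: X0_X1_X01_X10_C_def del_linear)
  also have "\<dots> = X10 + (l0 - 2 * a + 2 * b - 2) * X1"
   unfolding e del_wt(1)[where f = "%a b. l0 - 2 * of_int a + 2 * of_int b"]
   by (simp add: X0_X1_X01_X10_C_def a_def b_def A_def B_def algebra_simps)
  finally have d10: "del l0 l1 True (del l0 l1 False (chr \<mu>)) (j # w) = X10 + (l0 - 2 * a + 2 * b - 2) * X1" .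
  have c: "chr \<mu> (j # w) = C" using False by (simp add: X0_X1_X01_X10_C_def)
  show ?thesis unfolding d0 d1 d01 d10 c Aj using IH
   by (simp add: power2_eq_square field_simps)
 next
  case True
  have Aj: "A (j # w) = a" "B (j # w) = b + 1" using True by (auto simp: A_def B_def a_def b_def)
  have k1: "kap l0 l1 True w = l1 - 2 * b + 2 * a"
   by (simp add: kap_def a_def b_def A_def B_def)
  have c: "chr \<mu> (j # w) = - (\<mu> + a - b) * C" using True
   by (simp add: X0_X1_X01_X10_C_def a_def b_def A_def B_def)
  have d0': "del l0 l1 False (chr \<mu>) (True # w) = - (\<mu> + a - 1 - b) * X0"
   unfolding del.simps chr_True_fun del_wt2
   by (simp add: X0_X1_X01_X10_C_def a_def b_def A_def B_def algebra_simps)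
  have d1': "del l0 l1 True (chr \<mu>) (True # w) = - (\<mu> + a - b + 1) * X1 + (l1 - 2 * b + 2 * a) * C"
   unfolding del.simps chr_True_fun del_wt1 k1
   by (simp add: X0_X1_X01_X10_C_def a_def b_def A_def B_def algebra_simps)
  have jT: "j = True" using True by simp
  have d0: "del l0 l1 False (chr \<mu>) (j # w) = - (\<mu> + a - 1 - b) * X0"
   unfolding jT by (rule d0')
  have d1: "del l0 l1 True (chr \<mu>) (j # w) = - (\<mu> + a - b + 1) * X1 + (l1 - 2 * b + 2 * a) * C"
   unfolding jT by (rule d1')
  have f1: "(%w. del l0 l1 True (chr \<mu>) (True # w)) = (%w. (%a b. - (\<mu> + of_int a - of_int b + 1)) (int (c0 w)) (int (c1 w))
       * del l0 l1 True (chr \<mu>) w +  (%a b. l1 - 2 * of_int b + 2 * of_int a) (int (c0 w)) (int (c1 w)) * chr \<mu> w)"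
   unfolding del.simps chr_True_fun del_wt1 kap_def by (rule ext) (simp add: algebra_simps)
  have f0: "(%w. del l0 l1 False (chr \<mu>) (True # w)) = (%w. (%a b. - (\<mu> + of_int a - of_int b - 1)) (int (c0 w)) (int (c1 w))
       * del l0 l1 False (chr \<mu>) w)"
   unfolding del.simps chr_True_fun del_wt2 kap_def by (rule ext) (simp add: algebra_simps)
  have "del l0 l1 False (del l0 l1 True (chr \<mu>)) (j # w) = del l0 l1 False (%w. del l0 l1 True (chr \<mu>) (True # w)) w"
   using True by simp
  also have "\<dots> = - (\<mu> + a - b) * X01 + (l1 - 2 * b + 2 * a - 2) * X0"
   unfolding f1 del_linear del_wt(2)[where f = "%a b. - (\<mu> + of_int a - of_int b + 1)"]
    del_wt(2)[where f = "%a b. l1 - 2 * of_int b + 2 * of_int a"]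
   by (simp add: X0_X1_X01_X10_C_def a_def b_def A_def B_def algebra_simps)
  finally have d01: "del l0 l1 False (del l0 l1 True (chr \<mu>)) (j # w) = - (\<mu> + a - b) * X01 + (l1 - 2 * b + 2 * a - 2) * X0" .
  have "del l0 l1 True (del l0 l1 False (chr \<mu>)) (j # w) =
   del l0 l1 True (%w. del l0 l1 False (chr \<mu>) (True # w)) w + (l1 - 2 * b + 2 * a) * X0"
   using True by (simp add: k1 X0_X1_X01_X10_C_def)
  also have "\<dots> = - (\<mu> + a - b) * X10 + (l1 - 2 * b + 2 * a) * X0"
   unfolding f0 del_wt(1)[where f = "%a b. - (\<mu> + of_int a - of_int b - 1)"]
   by (simp add: X0_X1_X01_X10_C_def a_def b_def A_def B_def algebra_simps)
  finally have d10: "del l0 l1 True (del l0 l1 False (chr \<mu>)) (j # w) = - (\<mu> + a - b) * X10 + (l1 - 2 * b + 2 * a) * X0" .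
  have "(- (\<mu> + a - 1 - b) * X0) - (\<mu> + a - (b + 1) + 1) * (- (\<mu> + a - b + 1) * X1 + (l1 - 2 * b + 2 * a) * C)
   + ((- (\<mu> + a - b) * X01 + (l1 - 2 * b + 2 * a - 2) * X0) - (- (\<mu> + a - b) * X10 + (l1 - 2 * b + 2 * a) * X0)) / 2
   = - (\<mu> + a - b) * (X0 - (\<mu> + a - b + 1) * X1 + (X01 - X10) / 2 + (l1 - 2 * b + 2 * a) * C)"
   by (simp add: field_simps)
  also have "\<dots> = (a * (l0 + 1) + (b + 1) * (l1 + 1) - (a - (b + 1))\<^sup>2) * (- (\<mu> + a - b) * C)"
   unfolding IH by (simp add: power2_eq_square algebra_simps)
  finally show ?thesis unfolding d0 d1 d01 d10 c Aj .
 qed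
qed

text \<open>If nothing smaller is bad, \<open>chr\<close> kills all raised images of the vector, so
  the left side of \<open>casimir_chr\<close> vanishes on it and the scalar on the right must be
  0.\<close>

lemma bad_minimal:
 assumes "bad l0 l1 \<mu> A B"
 obtains A' B' where "A' \<le> A" "B' \<le> B" "bad l0 l1 \<mu> A' B'"
  "of_nat A' * (l0 + 1) + of_nat B' * (l1 + 1) = (of_nat A' - of_nat B' :: complex)\<^sup>2"
proof -
 have "\<exists>A' B'. A' \<le> A \<and> B' \<le> B \<and> bad l0 l1 \<mu> A' B' \<and>
  of_nat A' * (l0 + 1) + of_nat B' * (l1 + 1) = (of_nat A' - of_nat B' :: complex)\<^sup>2"
  using assms
 proof (induction "A + B" arbitrary: A B rule: less_induct)
  case less
  obtain P where P: "homog A B P" "Rad l0 l1 P" "lc (chr \<mu>) P \<noteq> 0"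
   using less.prems unfolding bad_def by blast
  show ?case
  proof (cases "\<exists>A' B'. A' \<le> A \<and> B' \<le> B \<and> A' + B' < A + B \<and> bad l0 l1 \<mu> A' B'")
   case True
   then show ?thesis using less.hyps by (meson order_trans)
  next
   case False
   have nb: "lc (chr \<mu>) Q = 0" if "homog A' B' Q" "Rad l0 l1 Q" "A' \<le> A" "B' \<le> B" "A' + B' < A + B" for Q A' B'
    using False that unfolding bad_def by blast
   have z0: "lc (del l0 l1 False (chr \<mu>)) P = 0"
   proof (cases "A = 0")
    case True
    then show ?thesis using dP_empty0[of B P] P(1) lc_dP[of "chr \<mu>" l0 l1 False P] by simp
   next
    case False
    then show ?thesis using nb[OF homog_dP0[OF P(1)] Rad_dP[OF P(2)]] by (simp add: lc_dP)
   qed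
   have z1: "lc (del l0 l1 True (chr \<mu>)) P = 0"
   proof (cases "B = 0")
    case True
    then show ?thesis using dP_empty1[of A P] P(1) lc_dP[of "chr \<mu>" l0 l1 True P] by simp
   next
    case False
    then show ?thesis using nb[OF homog_dP1[OF P(1)] Rad_dP[OF P(2)]] by (simp add: lc_dP)
   qed
   have z01: "lc (del l0 l1 False (del l0 l1 True (chr \<mu>))) P = 0"
   proof (cases "A = 0 ")
    case True
    then show ?thesis using dP_empty0[of B P] P(1) lc_dP[of "del l0 l1 True (chr \<mu>)" l0 l1 False P] by simp
   next
    case False
    show ?thesis
     using nb[OF homog_dP1[OF homog_dP0[OF P(1)]] Rad_dP[OF Rad_dP[OF P(2)]]] False
     by (simp add: lc_dP)
   qed
   have z10: "lc (del l0 l1 True (del l0 l1 False (chr \<mu>))) P = 0"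
   proof (cases "B = 0")
    case True
    then show ?thesis using dP_empty1[of A P] P(1) lc_dP[of "del l0 l1 False (chr \<mu>)" l0 l1 True P] by simp
   next
    case False
    show ?thesis
     using nb[OF homog_dP0[OF homog_dP1[OF P(1)]] Rad_dP[OF Rad_dP[OF P(2)]]] False
     by (simp add: lc_dP)
   qed
   define R where "R = of_nat A * (l0 + 1) + of_nat B * (l1 + 1) - (of_nat A - of_nat B :: complex)\<^sup>2"
   have "R * lc (chr \<mu>) P = lc (%w. R * chr \<mu> w) P" by (simp add: lc_cmult)
   also have "\<dots> = lc (%w. del l0 l1 False (chr \<mu>) w - (\<mu> + of_nat A - of_nat B + 1) * del l0 l1 True (chr \<mu>) w
    + 1/2 * (del l0 l1 False (del l0 l1 True (chr \<mu>)) w - del l0 l1 True (del l0 l1 False (chr \<mu>)) w)) P"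
   proof (rule lc_cong)
    fix c w assume "(c, w) \<in> set P"
    then have "c0 w = A" "c1 w = B" using P(1) by (auto simp: homog_def)
    then show "R * chr \<mu> w = del l0 l1 False (chr \<mu>) w - (\<mu> + of_nat A - of_nat B + 1) * del l0 l1 True (chr \<mu>) w
    + 1/2 * (del l0 l1 False (del l0 l1 True (chr \<mu>)) w - del l0 l1 True (del l0 l1 False (chr \<mu>)) w)"
     using casimir_chr[of l0 l1 \<mu> w] by (simp add: R_def)
   qed
   also have "\<dots> = 0" by (simp only: lc_add lc_diff lc_cmult z0 z1 z01 z10) simp
   finally have "R = 0" using P(3) by simp
   then show ?thesis using less.prems unfolding R_def by auto
  qed
 qed
 then show ?thesis using that by blast
qed

text \<open>At \<mu> = 0 words act on the constant 1, and a word with more derivatives than factors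
  x kills it.\<close>

lemma bad_geq:
 assumes "bad l0 l1 0 A B" shows "B \<le> A"
proof -
 obtain P where P: "homog A B P" "lc (chr 0) P \<noteq> 0" using assms by (auto simp: bad_def)
 have "chr 0 w = 0" if "c0 w < c1 w" for w
  using that
 proof (induction w)
  case (Cons j w)
  show ?case
  proof (cases j)
   case True
   then show ?thesis using Cons by (cases "c0 w = c1 w") auto
  qed (use Cons in auto)
 qed simp
 then have "lc (chr 0) P = lc (%w. 0) P" if "A < B"
  by (intro lc_cong) (use P(1) that in \<open>auto simp: homog_def\<close>)
 then show ?thesis using P(2) by (metis lc_zero not_le_imp_less)
qed

subsection \<open>Exchanging the two simple roots\<close>

lemma c_map_Not [simp]: "c0 (map Not w) = c1 w" "c1 (map Not w) = c0 w"
proof (induction w)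
 case (Cons j w)
 { case 1 then show ?case using Cons by (cases j) auto }
 { case 2 then show ?case using Cons by (cases j) auto }
qed auto

lemma del_swap: "del l1 l0 (\<not> i) g (map Not w) = del l0 l1 i (%w. g (map Not w)) w"
 by (induction w arbitrary: g) (auto simp: kap_def)

lemma delw_swap: "delw l1 l0 (map Not Q) ind (map Not w) = delw l0 l1 Q ind w"
proof (induction Q arbitrary: w)
 case (Cons q Q)
 then show ?case using del_swap[of l1 l0 q "delw l1 l0 (map Not Q) ind" w] by simp
qed (simp add: ind_def)

text \<open>In the basis x^s / Gamma(s + 1) the letter y_1 is a signed shift and y_0 multiplies by s
  + 1, so the letters trade roles under s -> - s - 1. Nonintegrality of \<mu> keeps all Gamma
  factors finite and nonzero.\<close>

lemma chr_swap:
 assumes "\<mu> \<notin> \<int>"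
 shows "chr \<mu> w = Gamma (\<mu> + 1) * (-1) ^ c1 w * inverse (Gamma (\<mu> + 1 + of_nat (c0 w) - of_nat (c1 w))) * chr (- \<mu> - 1) (map Not w)"
proof -
 have ni: "\<mu> + of_nat a - of_nat b \<notin> \<int>\<^sub>\<le>\<^sub>0" "\<mu> + 1 + of_nat a - of_nat b \<notin> \<int>\<^sub>\<le>\<^sub>0" for a b :: nat
 proof -
  have "\<mu> = (\<mu> + of_nat a - of_nat b) - of_int (int a - int b)" by simp
  then have 1: "\<mu> + of_nat a - of_nat b \<notin> \<int>" using assms
   by (metis Ints_diff Ints_of_int)
  have "\<mu> = (\<mu> + 1 + of_nat a - of_nat b) - of_int (1 + int a - int b)" by simp
  then have 2: "\<mu> + 1 + of_nat a - of_nat b \<notin> \<int>" using assms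
   by (metis Ints_diff Ints_of_int)
  show "\<mu> + of_nat a - of_nat b \<notin> \<int>\<^sub>\<le>\<^sub>0" "\<mu> + 1 + of_nat a - of_nat b \<notin> \<int>\<^sub>\<le>\<^sub>0"
   using 1 2 nonpos_Ints_subset_Ints by blast+
 qed
 show ?thesis
 proof (induction w)
  case Nil
  then show ?case using ni(2)[of 0 0] by (simp add: Gamma_eq_zero_iff)
 next
  case (Cons j w)
  define s where "s = \<mu> + of_nat (c0 w) - of_nat (c1 w)"
  have s: "s \<notin> \<int>\<^sub>\<le>\<^sub>0" "s + 1 \<notin> \<int>\<^sub>\<le>\<^sub>0" using ni[of "c0 w" "c1 w"] by (auto simp: s_def algebra_simps)
  then have s0: "s \<noteq> 0" "s + 1 \<noteq> 0" by auto
  have g: "Gamma (s + 1) = s * Gamma s" "Gamma (s + 1 + 1) = (s + 1) * Gamma (s + 1)"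
   using Gamma_plus1[OF s(1)] Gamma_plus1[OF s(2)] by auto
  have gn: "Gamma s \<noteq> 0" "Gamma (s + 1) \<noteq> 0" using s by (auto simp: Gamma_eq_zero_iff)
  have IH: "chr \<mu> w = Gamma (\<mu> + 1) * (-1) ^ c1 w * inverse (Gamma (s + 1)) * chr (- \<mu> - 1) (map Not w)"
   using Cons by (simp add: s_def algebra_simps)
  show ?case
  proof (cases j)
   case False
   have a: "chr (- \<mu> - 1) (map Not (j # w)) = (s + 1) * chr (- \<mu> - 1) (map Not w)"
    using False by (simp add: s_def algebra_simps)
   have b: "\<mu> + 1 + of_nat (c0 (j # w)) - of_nat (c1 (j # w)) = s + 1 + 1"
    using False by (simp add: s_def)
   have c: "inverse (Gamma (s + 1 + 1)) * (s + 1) = inverse (Gamma (s + 1))"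
    unfolding g(2) inverse_mult_distrib using s0 by simp
   have "Gamma (\<mu> + 1) * (-1) ^ c1 (j # w) * inverse (Gamma (s + 1 + 1)) * ((s + 1) * chr (- \<mu> - 1) (map Not w))
    = Gamma (\<mu> + 1) * (-1) ^ c1 w * (inverse (Gamma (s + 1 + 1)) * (s + 1)) * chr (- \<mu> - 1) (map Not w)"
    using False by simp
   also have "\<dots> = chr \<mu> (j # w)" unfolding c using IH False by simp
   finally show ?thesis unfolding a b by simp
  next
   case True
   have "chr (- \<mu> - 1) (map Not (j # w)) = chr (- \<mu> - 1) (map Not w)"
    using True by simp
   moreover have "\<mu> + 1 + of_nat (c0 (j # w)) - of_nat (c1 (j # w)) = s"
    using True by (simp add: s_def)
   moreover have "chr \<mu> (j # w) = - s * chr \<mu> w" using True by (simp add: s_def)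
   ultimately show ?thesis using True IH s0 gn g by (simp add: field_simps)
  qed
 qed
qed

lemma bad_swap:
 assumes "\<mu> \<notin> \<int>" "bad l0 l1 \<mu> A B"
 shows "bad l1 l0 (- \<mu> - 1) B A"
proof -
 obtain P where P: "homog A B P" "Rad l0 l1 P" "lc (chr \<mu>) P \<noteq> 0"
  using assms(2) unfolding bad_def by blast
 define P' where "P' = map (%(c, w). (c, map Not w)) P"
 have 1: "homog B A P'" using P(1) unfolding homog_def P'_def by auto
 have 2: "Rad l1 l0 P'" unfolding Rad_def
 proof
  fix Q
  have "lc (delw l1 l0 Q ind) P' = lc (%w. delw l1 l0 Q ind (map Not w)) P"
   by (simp add: P'_def lc_map1)
  also have "\<dots> = lc (delw l0 l1 (map Not Q) ind) P"
   using delw_swap[of l1 l0 "map Not Q"] by (simp add: comp_def)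
  finally show "lc (delw l1 l0 Q ind) P' = 0" using P(2) by (simp add: Rad_def)
 qed
 have "lc (chr \<mu>) P = Gamma (\<mu> + 1) * (-1) ^ B * inverse (Gamma (\<mu> + 1 + of_nat A - of_nat B)) * lc (chr (- \<mu> - 1)) P'"
  unfolding P'_def lc_map1 lc_cmult[symmetric]
  by (rule lc_cong) (use P(1) chr_swap[OF assms(1)] in \<open>auto simp: homog_def\<close>)
 then have "lc (chr (- \<mu> - 1)) P' \<noteq> 0" using P(3) by auto
 then show ?thesis using 1 2 unfolding bad_def by blast
qed

subsection \<open>Reflection: complex powers of the first generator\<close>

datatype zl = Z0 | Z1 | Z2

text \<open>The letters stand for \<open>y\<^sub>1\<close>, \<open>[y\<^sub>0, y\<^sub>1]\<close> and \<open>[y\<^sub>0, [y\<^sub>0, y\<^sub>1]]\<close>; a pair \<open>(u, y)\<close> of a word and a complex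
 number stands for the vector \<open>u y\<^sub>0\<^sup>y v\<close>, and again a vector is seen through the functionals \<open>G\<close> on it.\<close>
type_synonym zfun = "zl list => complex => complex"

text \<open>Left multiplication by y_0, pushed through the letters to the power at the end. The
  value 0 for \<open>Z2\<close> is the Serre relation.\<close>

fun Y0 :: "zfun => zfun" where
 "Y0 G [] y = G [] (y + 1)"
| "Y0 G (z # u) y = Y0 (%u. G (z # u)) u y + (case z of Z0 => G (Z1 # u) y | Z1 => G (Z2 # u) y | Z2 => 0)"

definition Y1 :: "zfun => zfun" where "Y1 G u y = G (Z0 # u) y"

text \<open>Counts the factors y_0 hidden inside the letters, so that
  \<open>y + of_nat (dz u)\<close> is the full y_0-degree of a vector.\<close>

fun dz :: "zl list => nat" where
 "dz [] = 0" | "dz (Z0 # u) = dz u" | "dz (Z1 # u) = Suc (dz u)" | "dz (Z2 # u) = Suc (Suc (dz u))"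

definition hh :: "complex => complex => bool => zfun" where
 "hh l0 l1 i u y = (if i then l1 - 2 * of_nat (length u) + 2 * (y + of_nat (dz u))
  else l0 - 2 * (y + of_nat (dz u)) + 2 * of_nat (length u))"

text \<open>The first clause extends e_0 y_0^y v = y (l0 - y + 1) y_0^(y-1) v to complex y; the
  numbers 2 are the commutators of e_0 with the letters.\<close>

fun D0 :: "complex => zfun => zfun" where
 "D0 l0 G [] y = y * (l0 - y + 1) * G [] (y - 1)"
| "D0 l0 G (z # u) y = D0 l0 (%u. G (z # u)) u y +
  (case z of Z0 => 0 | Z1 => 2 * G (Z0 # u) y | Z2 => 2 * G (Z1 # u) y)"

fun D1 :: "complex => complex => zfun => zfun" where
 "D1 l0 l1 G [] y = 0"
| "D1 l0 l1 G (z # u) y = D1 l0 l1 (%u. G (z # u)) u y +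
  (case z of Z0 => hh l0 l1 True u y * G u y | Z1 => - 2 * Y0 G u y | Z2 => 0)"

definition DD :: "complex => complex => bool => zfun => zfun" where
 "DD l0 l1 i = (if i then D1 l0 l1 else D0 l0)"

definition YY :: "bool => zfun => zfun" where "YY i = (if i then Y1 else Y0)"

lemma Y0_lin: "Y0 (%u y. G u y + G' u y) u y = Y0 G u y + Y0 G' u y"
 "Y0 (%u y. c * G u y) u y = c * Y0 G u y"
 by (induction u arbitrary: G G') (auto simp: algebra_simps split: zl.splits)
lemma D0_lin: "D0 l0 (%u y. G u y + G' u y) u y = D0 l0 G u y + D0 l0 G' u y"
 "D0 l0 (%u y. c * G u y) u y = c * D0 l0 G u y"
 by (induction u arbitrary: G G') (auto simp: algebra_simps split: zl.splits)
lemma D1_lin: "D1 l0 l1 (%u y. G u y + G' u y) u y = D1 l0 l1 G u y + D1 l0 l1 G' u y"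
 "D1 l0 l1 (%u y. c * G u y) u y = c * D1 l0 l1 G u y"
 by (induction u arbitrary: G G') (auto simp: algebra_simps Y0_lin split: zl.splits)

lemma fun_Cons:
 "(%u. Y0 G (Z0 # u)) = (%u y. Y0 (%u. G (Z0 # u)) u y + G (Z1 # u) y)"
 "(%u. Y0 G (Z1 # u)) = (%u y. Y0 (%u. G (Z1 # u)) u y + G (Z2 # u) y)"
 "(%u. Y0 G (Z2 # u)) = (%u y. Y0 (%u. G (Z2 # u)) u y)"
 "(%u. D0 l0 G (Z0 # u)) = (%u y. D0 l0 (%u. G (Z0 # u)) u y)"
 "(%u. D0 l0 G (Z1 # u)) = (%u y. D0 l0 (%u. G (Z1 # u)) u y + 2 * G (Z0 # u) y)"
 "(%u. D0 l0 G (Z2 # u)) = (%u y. D0 l0 (%u. G (Z2 # u)) u y + 2 * G (Z1 # u) y)"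
 "(%u. D1 l0 l1 G (Z0 # u)) = (%u y. D1 l0 l1 (%u. G (Z0 # u)) u y + hh l0 l1 True u y * G u y)"
 "(%u. D1 l0 l1 G (Z1 # u)) = (%u y. D1 l0 l1 (%u. G (Z1 # u)) u y + (- 2) * Y0 G u y)"
 "(%u. D1 l0 l1 G (Z2 # u)) = (%u y. D1 l0 l1 (%u. G (Z2 # u)) u y)"
 by (intro ext; simp)+

lemma hh_Cons:
 "hh l0 l1 True (Z0 # u) y = hh l0 l1 True u y + (- 2)"
 "hh l0 l1 True (Z1 # u) y = hh l0 l1 True u y"
 "hh l0 l1 True (Z2 # u) y = hh l0 l1 True u y + 2"
 "hh l0 l1 False (Z0 # u) y = hh l0 l1 False u y + 2"
 "hh l0 l1 False (Z1 # u) y = hh l0 l1 False u y"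
 "hh l0 l1 False (Z2 # u) y = hh l0 l1 False u y + (- 2)"
 by (simp_all add: hh_def algebra_simps)

lemma Y0_hh: "Y0 (%u y. hh l0 l1 i u y * G u y) u y = (hh l0 l1 i u y + (if i then 2 else -2)) * Y0 G u y"
proof (induction u arbitrary: G)
 case (Cons z u)
 then show ?case
  by (cases z; cases i) (simp_all only: Y0.simps zl.case hh_Cons distrib_right Y0_lin if_True if_False Cons, simp_all add: algebra_simps)
qed (simp add: hh_def algebra_simps)

lemma YD:
 "Y0 (D0 l0 G) u y = D0 l0 (Y0 G) u y + hh l0 l1 False u y * G u y"
proof (induction u arbitrary: G)
 case Nil
 then show ?case by (simp add: hh_def algebra_simps)
next
 case (Cons z u)
 then show ?case
  by (cases z) (simp_all only: Y0.simps D0.simps zl.case fun_Cons hh_Cons Y0_lin D0_lin Cons, simp_all add: algebra_simps)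
qed

lemma YD1: "Y0 (D1 l0 l1 G) u y = D1 l0 l1 (Y0 G) u y"
proof (induction u arbitrary: G)
 case (Cons z u)
 then show ?case
  by (cases z) (simp_all only: Y0.simps D1.simps zl.case fun_Cons hh_Cons Y0_lin D1_lin Y0_hh if_True Cons, simp_all add: algebra_simps)
qed simp

text \<open>This is [e_i, y_j] = \<delta>_ij h_i, the relation from which the recursion of
  \<open>del\<close> arises.\<close>

lemma YY_DD: "YY j (DD l0 l1 i G) u y = DD l0 l1 i (YY j G) u y + (if i = j then hh l0 l1 i u y * G u y else 0)"
proof (cases j)
 case True
 have "(%u y. G (Z0 # u) y) = (%u. G (Z0 # u))" by simp
 then show ?thesis using True by (auto simp: YY_def DD_def Y1_def[abs_def])
next
 case False
 then show ?thesis by (auto simp: YY_def DD_def YD[of l0 _ _ _ l1] YD1)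
qed

fun ev :: "bool list => zfun => complex => complex" where
 "ev [] G x = G [] x"
| "ev (i # w) G x = ev w (YY i G) x"

lemma YY_lin: "YY i (%u y. G u y + G' u y) = (%u y. YY i G u y + YY i G' u y)"
 "YY i (%u y. c * G u y) = (%u y. c * YY i G u y)"
 by (intro ext; cases i; simp add: YY_def Y1_def Y0_lin)+

lemma ev_lin: "ev w (%u y. G u y + G' u y) x = ev w G x + ev w G' x"
 "ev w (%u y. c * G u y) x = c * ev w G x"
 by (induction w arbitrary: G G') (auto simp: YY_lin)

lemma YY_hh: "YY j (%u y. hh l0 l1 i u y * G u y) u y = (hh l0 l1 i u y + (if i = j then -2 else 2)) * YY j G u y"
proof (cases j)
 case True
 then show ?thesis by (simp add: YY_def Y1_def) (simp add: hh_def algebra_simps)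
next
 case False
 then show ?thesis using Y0_hh[of l0 l1 i G u y] by (auto simp: YY_def)
qed

lemma ev_hh: "ev w (%u y. hh l0 l1 i u y * G u y) x = kap (l0 - 2 * x) (l1 + 2 * x) i w * ev w G x"
proof (induction w arbitrary: G)
 case Nil
 then show ?case by (simp add: hh_def kap_def)
next
 case (Cons j w)
 have "ev (j # w) (%u y. hh l0 l1 i u y * G u y) x =
  ev w (%u y. hh l0 l1 i u y * YY j G u y + (if i = j then -2 else 2) * YY j G u y) x"
  by (auto simp: YY_hh[abs_def] distrib_right)
 also have "\<dots> = (kap (l0 - 2 * x) (l1 + 2 * x) i w + (if i = j then -2 else 2)) * ev w (YY j G) x"
  unfolding ev_lin Cons by (simp add: distrib_right)
 also have "kap (l0 - 2 * x) (l1 + 2 * x) i w + (if i = j then -2 else 2) = kap (l0 - 2 * x) (l1 + 2 * x) i (j # w)"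
  by (cases i; cases j) (auto simp: kap_def)
 finally show ?case by simp
qed

text \<open>The hypothesis says that y_0^x v is singular; its weight is (l0 - 2 x, l1 + 2 x), so
  words applied to it obey the recursion of \<open>del\<close> for that weight. The two solutions
  are x = 0 and x = l0 + 1.\<close>

lemma ev_DD:
 assumes "x * (l0 - x + 1) = 0"
 shows "ev w (DD l0 l1 i G) x = del (l0 - 2 * x) (l1 + 2 * x) i (%w. ev w G x) w"
proof (induction w arbitrary: G)
 case Nil
 then show ?case using assms by (simp add: DD_def)
next
 case (Cons j w)
 have "ev (j # w) (DD l0 l1 i G) x = ev w (%u y. DD l0 l1 i (YY j G) u y + (if i = j then 1 else 0) * (hh l0 l1 i u y * G u y)) x"
  by (auto simp: YY_DD[abs_def] intro!: arg_cong[where f = "%f. ev w f x"])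
 also have "\<dots> = del (l0 - 2 * x) (l1 + 2 * x) i (%w. ev w (YY j G) x) w + (if i = j then kap (l0 - 2 * x) (l1 + 2 * x) i w * ev w G x else 0)"
  unfolding ev_lin ev_hh Cons by simp
 finally show ?case by simp
qed

definition polyf :: "(complex => complex) => bool" where
 "polyf f \<longleftrightarrow> (\<exists>p. \<forall>x. f x = poly p x)"

lemma polyf_intros:
 "polyf (%x. c)" "polyf (%x. x)"
 "polyf f ==> polyf g ==> polyf (%x. f x + g x)"
 "polyf f ==> polyf g ==> polyf (%x. f x - g x)"
 "polyf f ==> polyf (%x. - f x)"
 "polyf f ==> polyf g ==> polyf (%x. f x * g x)"
proof -
 show "polyf (%x. c)" unfolding polyf_def by (rule exI[of _ "[:c:]"]) simp
 show "polyf (%x. x)" unfolding polyf_def by (rule exI[of _ "[:0, 1:]"]) simp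
 show "polyf (%x. f x + g x)" if "polyf f" "polyf g" using that unfolding polyf_def by (metis poly_add)
 show "polyf (%x. f x - g x)" if "polyf f" "polyf g" using that unfolding polyf_def by (metis poly_diff)
 show "polyf (%x. - f x)" if "polyf f" using that unfolding polyf_def by (metis poly_minus)
 show "polyf (%x. f x * g x)" if "polyf f" "polyf g" using that unfolding polyf_def by (metis poly_mult)
qed

lemma polyf_comp: "polyf f ==> polyf g ==> polyf (%x. f (g x))"
 unfolding polyf_def
proof (elim exE)
 fix p r assume "\<forall>x. f x = poly p x" "\<forall>x. g x = poly r x"
 then show "\<exists>p. \<forall>x. f (g x) = poly p x" by (intro exI[of _ "pcompose p r"]) (simp add: poly_pcompose)
qed

text \<open>Carries identities from large natural exponents to complex ones.\<close>

lemma polyf_zero: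
 assumes "polyf f" "!!n. n \<ge> M ==> f (of_nat n) = 0"
 shows "f x = 0"
proof -
 obtain p where p: "!!x. f x = poly p x" using assms(1) unfolding polyf_def by blast
 have "of_nat ` {M..} \<subseteq> {x. poly p x = (0::complex)}" using assms(2) by (auto simp: p)
 moreover have "infinite (of_nat ` {M..} :: complex set)"
  by (metis (no_types) finite_imageD inj_on_subset infinite_Ici inj_of_nat subset_UNIV)
 ultimately have "p = 0" using poly_roots_finite finite_subset by blast
 then show ?thesis by (simp add: p)
qed

definition polyG :: "zfun => bool" where "polyG G \<longleftrightarrow> (\<forall>u. polyf (G u))"

lemma polyG_Cons: "polyG G ==> polyG (%u. G (z # u))"
 by (simp add: polyG_def)

lemma polyG_ops:
 assumes "polyG G"
 shows "polyf (Y0 G u)" "polyf (D0 l0 G u)" "polyf (D1 l0 l1 G u)"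
proof -
 have s: "polyf (%y. G u (y + c))" if "polyG G" for G u c
  using that by (intro polyf_comp[of "G u" "%y. y + c"] polyf_intros) (auto simp: polyG_def)
 have Y: "polyf (Y0 G u)" if "polyG G" for G u using that
 proof (induction u arbitrary: G)
  case Nil then show ?case using s[of G "[]" 1] by (simp add: Y0.simps(1)[abs_def])
 next
  case (Cons z u)
  have "polyf (Y0 (%u. G (z # u)) u)" using Cons by (simp add: polyG_Cons)
  then show ?case using Cons.prems by (cases z) (auto simp: polyG_def intro!: polyf_intros)
 qed
 then show "polyf (Y0 G u)" using assms .
 show "polyf (D0 l0 G u)" using assms
 proof (induction u arbitrary: G)
  case Nil
  have "polyf (%y. y * (l0 - y + 1) * G [] (y + - 1))" using s[of G "[]" "-1"] Nil by (intro polyf_intros)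
  then show ?case by simp
 next
  case (Cons z u)
  have "polyf (D0 l0 (%u. G (z # u)) u)" using Cons by (simp add: polyG_Cons)
  then show ?case using Cons.prems by (cases z) (auto simp: polyG_def intro!: polyf_intros)
 qed
 show "polyf (D1 l0 l1 G u)" using assms
 proof (induction u arbitrary: G)
  case Nil
  show ?case by (simp add: D1.simps(1)[abs_def] polyf_intros(1))
 next
  case (Cons z u)
  have "polyf (D1 l0 l1 (%u. G (z # u)) u)" using Cons by (simp add: polyG_Cons)
  then show ?case using Cons.prems Y[OF Cons.prems] by (cases z) (auto simp: polyG_def hh_def intro!: polyf_intros)
 qed
qed

lemma polyG_DD: "polyG G ==> polyG (DD l0 l1 i G)"
 using polyG_ops by (auto simp: DD_def polyG_def)

text \<open>\<open>Yx x G\<close> is \<open>G\<close> evaluated after multiplication by the complex power \<open>y\<^sub>0\<^sup>x\<close>, moved to the right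
 with \<open>y\<^sub>0\<^sup>x z = \<Sum>\<^sub>j (x choose j) (ad y\<^sub>0)\<^sup>j(z) y\<^sub>0\<^sup>x\<^sup>-\<^sup>j\<close>.\<close>
fun Yx :: "complex => zfun => zfun" where
 "Yx x G [] y = G [] (y + x)"
| "Yx x G (z # u) y = Yx x (%u. G (z # u)) u y + (case z of
   Z0 => x * Yx (x - 1) (%u. G (Z1 # u)) u y + x * (x - 1) / 2 * Yx (x - 2) (%u. G (Z2 # u)) u y
  | Z1 => x * Yx (x - 1) (%u. G (Z2 # u)) u y | Z2 => 0)"

lemma Yx_lin: "Yx x (%u y. G u y + G' u y) u y = Yx x G u y + Yx x G' u y"
 by (induction u arbitrary: G G' x) (auto simp: algebra_simps split: zl.splits)

lemma Yx_0: "Yx 0 G u y = G u y"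
 by (induction u arbitrary: G) (auto split: zl.splits)

lemma Yx_plus1: "Yx (x + 1) G u y = Yx x (Y0 G) u y"
proof (induction u arbitrary: G x)
 case (Cons z u)
 have c: "Yx x (Y0 G) u y = Yx (x + 1) G u y" "Yx (x - 1) (Y0 G) u y = Yx x G u y"
  "Yx (x - 2) (Y0 G) u y = Yx (x - 1) G u y" for G
  using Cons[of x G] Cons[of "x - 1" G] Cons[of "x - 2" G] by (simp_all add: algebra_simps)
 have "x + 1 - 1 = x" "x + 1 - 2 = x - 1" by simp_all
 then show ?case
  by (cases z) (simp_all only: Yx.simps zl.case fun_Cons Yx_lin c, simp_all add: field_simps)
qed (simp add: algebra_simps)

lemma polyf_shift: "polyf f ==> polyf (%x. f (x + c))" "polyf f ==> polyf (%x. f (x - c))"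
 by (rule polyf_comp[of f "%x. x + c"], assumption, intro polyf_intros)
  (rule polyf_comp[of f "%x. x - c"], assumption, intro polyf_intros)

lemma polyf_Yx: "polyG G ==> polyf (%x. Yx x G u y)"
proof (induction u arbitrary: G)
 case Nil
 then have "polyf (%x. G [] (x + y))" by (intro polyf_shift) (auto simp: polyG_def)
 then show ?case by (simp add: add.commute)
next
 case (Cons z u)
 have IH: "polyf (%x. Yx x (%u. G (z' # u)) u y)" for z'
  using Cons by (simp add: polyG_Cons)
 have "polyf (%x. x * (x - 1) * (1 / 2))" by (intro polyf_intros)
 then have h: "polyf (%x. x * (x - 1) / 2)" by simp
 note IH2 = polyf_shift(2)[OF IH]
 show ?case
 proof (cases z)
  case Z0
  show ?thesis unfolding Z0 Yx.simps zl.case by (intro polyf_intros IH IH2 h)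
 next
  case Z1
  show ?thesis unfolding Z1 Yx.simps zl.case by (intro polyf_intros IH IH2 h)
 next
  case Z2
  show ?thesis unfolding Z2 Yx.simps zl.case by (intro polyf_intros IH IH2 h)
 qed
qed

lemma polyf_ev:
 assumes "!!u y. polyf (%x. Fn x u y)"
 shows "polyf (%x. ev w (Fn x) l)"
 using assms
proof (induction w arbitrary: Fn)
 case (Cons i w)
 have "polyf (%x. Y0 (Fn x) u y)" if "!!u y. polyf (%x. Fn x u y)" for Fn u y
  using that
 proof (induction u arbitrary: Fn)
  case (Cons z u)
  have "polyf (%x. Y0 (%u. Fn x (z # u)) u y)" using Cons by simp
  then show ?case using Cons.prems by (cases z) (auto intro!: polyf_intros)
 qed simp
 then have "polyf (%x. YY i (Fn x) u y)" for u y
  using Cons.prems by (cases i) (auto simp: YY_def Y1_def)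
 then show ?case using Cons.IH by simp
qed simp

text \<open>At natural exponents the binomial formula of \<open>Yx\<close> is repeated
  multiplication; this anchors the interpolation in the exponent.\<close>

lemma ev_append: "ev (replicate n False @ w) G x = ev w (Yx (of_nat n) G) x"
proof (induction n arbitrary: G)
 case 0
 have "Yx 0 G = G" by (intro ext) (simp add: Yx_0)
 then show ?case by simp
next
 case (Suc n)
 have "ev (replicate (Suc n) False @ w) G x = ev w (Yx (of_nat n) (Y0 G)) x"
  by (simp add: YY_def Suc)
 also have "Yx (of_nat n) (Y0 G) = Yx (of_nat (Suc n)) G"
  using Yx_plus1[of "of_nat n" G] by (intro ext) (simp add: add.commute)
 finally show ?case .
qed

text \<open>A functional of functionals \<open>\<Phi>\<close> is a vector; here it is required to
  lie in the module generated from v by words, without complex powers of y_0.\<close>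

definition realz :: "nat => nat => (zfun => complex) => bool" where
 "realz A B \<Phi> \<longleftrightarrow> (\<exists>P. homog A B P \<and> (\<forall>G. \<Phi> G = lc (%w. ev w G 0) P))"

lemma realz_add: "realz A B \<Phi> ==> realz A B \<Psi> ==> realz A B (%G. \<Phi> G + \<Psi> G)"
 unfolding realz_def by (elim exE, rule_tac x = "P @ Pa" in exI) (auto simp: homog_def)

lemma realz_cmult: "realz A B \<Phi> ==> realz A B (%G. c * \<Phi> G)"
 unfolding realz_def
 by (elim exE, rule_tac x = "map (%(d, w). (c * d, w)) P" in exI) (auto simp: homog_def lc_scale)

lemma realz_zero: "realz A B (%G. 0)"
 unfolding realz_def by (rule exI[of _ "[]"]) (auto simp: homog_def)

lemma realz_words:
 assumes "realz A B \<Phi>"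
 shows "realz (A + c0 v) (B + c1 v) (%G. \<Phi> (%u y. fold YY v G u y))"
proof -
 obtain P where P: "homog A B P" "!!G. \<Phi> G = lc (%w. ev w G 0) P" using assms unfolding realz_def by blast
 have e: "ev (v @ w) G 0 = ev w (fold YY v G) 0" for w G by (induction v arbitrary: G) auto
 have c: "c0 (v @ w) = c0 w + c0 v" "c1 (v @ w) = c1 w + c1 v" for w by (auto simp: c0_def c1_def)
 show ?thesis unfolding realz_def
  by (rule exI[of _ "map (%(c, w). (c, v @ w)) P"])
   (use P in \<open>auto simp: homog_def lc_map1 e c\<close>)
qed

lemma realz_letter:
 assumes "realz A B \<Phi>"
 shows "realz A (Suc B) (%G. \<Phi> (%u. G (Z0 # u)))" "realz (Suc A) (Suc B) (%G. \<Phi> (%u. G (Z1 # u)))"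
  "realz (Suc (Suc A)) (Suc B) (%G. \<Phi> (%u. G (Z2 # u)))"
proof -
 have f1: "(%u. G (Z0 # u)) = (%u y. fold YY [True] G u y)" for G
  by (auto simp: YY_def Y1_def)
 have f2: "(%u. G (Z1 # u)) = (%u y. fold YY [False, True] G u y + (-1) * fold YY [True, False] G u y)" for G
  by (intro ext) (simp add: YY_def Y1_def Y0_lin, simp add: Y1_def[abs_def])
 have Y1d: "Y1 G = (%u. G (Z0 # u))" for G by (intro ext) (simp add: Y1_def)
 have f3: "(%u. G (Z2 # u)) = (%u y. fold YY [False, False, True] G u y + ((-2) * fold YY [False, True, False] G u y
   + fold YY [True, False, False] G u y))" for G
  by (intro ext) (simp add: YY_def Y1d fun_Cons Y0_lin)
 obtain P where P: "homog A B P" "!!G. \<Phi> G = lc (%w. ev w G 0) P" using assms unfolding realz_def by blast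
 have lin: "\<Phi> (%u y. G u y + G' u y) = \<Phi> G + \<Phi> G'" "\<Phi> (%u y. c * G u y) = c * \<Phi> G" for G G' c
  unfolding P(2) by (simp_all add: ev_lin lc_add lc_cmult)
 show "realz A (Suc B) (%G. \<Phi> (%u. G (Z0 # u)))"
  unfolding f1 using realz_words[OF assms, of "[True]"] by simp
 show "realz (Suc A) (Suc B) (%G. \<Phi> (%u. G (Z1 # u)))"
  unfolding f2 lin
  using realz_words[OF assms, of "[False, True]"] realz_words[OF assms, of "[True, False]"]
  by (intro realz_add realz_cmult) simp_all
 show "realz (Suc (Suc A)) (Suc B) (%G. \<Phi> (%u. G (Z2 # u)))"
  unfolding f3 lin
  using realz_words[OF assms, of "[False, False, True]"] realz_words[OF assms, of "[False, True, False]"]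
   realz_words[OF assms, of "[True, False, False]"]
  by (intro realz_add realz_cmult) simp_all
qed

text \<open>Passing one letter costs y_0^x at most two factors, so an exponent at least twice the
  length of the word stays natural and nonnegative to the end.\<close>

lemma realz_Yx:
 assumes "y + x = of_nat M" "M \<ge> 2 * length u"
 shows "realz (dz u + M) (length u) (%G. Yx x G u y)"
 using assms
proof (induction u arbitrary: x M)
 case Nil
 have e: "ev (replicate M False) G 0 = G [] (of_nat M)" for G
  using ev_append[of M "[]" G 0] by simp
 have c: "c0 (replicate M False) = M" "c1 (replicate M False) = 0" by (induction M) auto
 show ?case unfolding realz_def
  by (rule exI[of _ "[(1, replicate M False)]"]) (use Nil in \<open>auto simp: homog_def e c\<close>)
next
 case (Cons z u)
 have m: "y + (x - 1) = of_nat (M - 1)" "y + (x - 2) = of_nat (M - 2)" using Cons.prems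
  by (auto simp: of_nat_diff algebra_simps)
 have IH: "realz (dz u + M) (length u) (%G. Yx x G u y)"
  "realz (dz u + (M - 1)) (length u) (%G. Yx (x - 1) G u y)"
  "realz (dz u + (M - 2)) (length u) (%G. Yx (x - 2) G u y)"
  using Cons.IH[OF Cons.prems(1)] Cons.IH[OF m(1)] Cons.IH[OF m(2)] Cons.prems(2) by auto
 have s: "Suc (dz u + (M - Suc 0)) = dz u + M" "Suc (Suc (dz u + (M - 2))) = dz u + M"
  "Suc (Suc (dz u + (M - Suc 0))) = Suc (dz u + M)"
  using Cons.prems(2) by auto
 show ?case
 proof (cases z)
  case Z0
  have "realz (dz u + M) (Suc (length u)) (%G. Yx x (%u. G (Z0 # u)) u y + (x * Yx (x - 1) (%u. G (Z1 # u)) u y + x * (x - 1) / 2 * Yx (x - 2) (%u. G (Z2 # u)) u y))"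
   using realz_letter(1)[OF IH(1)] realz_letter(2)[OF IH(2)] realz_letter(3)[OF IH(3)]
   by (intro realz_add realz_cmult) (simp_all add: s)
  then show ?thesis using Z0 by simp
 next
  case Z1
  have "realz (Suc (dz u + M)) (Suc (length u)) (%G. Yx x (%u. G (Z1 # u)) u y + x * Yx (x - 1) (%u. G (Z2 # u)) u y)"
   using realz_letter(2)[OF IH(1)] realz_letter(3)[OF IH(2)]
   by (intro realz_add realz_cmult) (simp_all add: s)
  then show ?thesis using Z1 by simp
 next
  case Z2
  then show ?thesis using realz_letter(3)[OF IH(1)] by simp
 qed
qed

lemma Y0_expand:
 "\<exists>L. (\<forall>(c, u', n)\<in>set L. length u' = length u \<and> dz u' + n = Suc (dz u)) \<and>
  (\<forall>G y. Y0 G u y = lc (%(u', n). G u' (y + of_nat n)) L)"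
proof (induction u)
 case Nil
 show ?case by (rule exI[of _ "[(1, [], 1)]"]) auto
next
 case (Cons z u)
 then obtain L where L: "!!c u' n. (c, u', n)\<in>set L ==> length u' = length u \<and> dz u' + n = Suc (dz u)"
  "!!G y. Y0 G u y = lc (%(u', n). G u' (y + of_nat n)) L" by blast
 define L' where "L' = map (%(c, u', n). (c, z # u', n)) L @
  (case z of Z0 => [(1, Z1 # u, 0)] | Z1 => [(1, Z2 # u, 0)] | Z2 => [])"
 have dzc: "dz (z # v) = dz v + dz [z]" for v by (cases z) auto
 have "length u' = length (z # u) \<and> dz u' + n = Suc (dz (z # u))" if "(c, u', n)\<in>set L'" for c u' n
  using that L(1) unfolding L'_def dzc[of u] by (cases z) (fastforce simp: dzc)+
 moreover have "lc (%(u', n). G u' (y + of_nat n)) (map (%(c, u', n). (c, z # u', n)) L) =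
  lc (%(u', n). G (z # u') (y + of_nat n)) L" for G :: zfun and y
  by (induction L) auto
 then have "Y0 G (z # u) y = lc (%(u', n). G u' (y + of_nat n)) L'" for G y
  unfolding L'_def by (cases z) (simp_all add: L(2)[of "%u. G (_ # u)"])
 ultimately show ?case by (intro exI[of _ L']) auto
qed

text \<open>The list depends on the word only, so one expansion serves all exponents and all
  functionals.\<close>

lemma ev_expand:
 "\<exists>L. (\<forall>(c, u, n)\<in>set L. length u = c1 w \<and> dz u + n = c0 w) \<and>
  (\<forall>G x. ev w G x = lc (%(u, n). G u (x + of_nat n)) L)"
proof (induction w)
 case Nil
 show ?case by (rule exI[of _ "[(1, [], 0)]"]) auto
next
 case (Cons i w)
 then obtain L where L: "!!c u n. (c, u, n)\<in>set L ==> length u = c1 w \<and> dz u + n = c0 w"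
  "!!G x. ev w G x = lc (%(u, n). G u (x + of_nat n)) L" by blast
 show ?case
 proof (cases i)
  case True
  have "lc (%(u, n). G u (y + of_nat n)) (map (%(c, u', n). (c, Z0 # u', n)) L) =
  lc (%(u, n). G (Z0 # u) (y + of_nat n)) L" for G :: zfun and y
   by (induction L) auto
  then have "\<forall>G x. ev (i # w) G x = lc (%(u, n). G u (x + of_nat n)) (map (%(c, u', n). (c, Z0 # u', n)) L)"
   using True L(2) by (simp add: YY_def Y1_def)
  moreover have "\<forall>(c, u, n)\<in>set (map (%(c, u', n). (c, Z0 # u', n)) L). length u = c1 (i # w) \<and> dz u + n = c0 (i # w)"
   using True L(1) by (clarsimp simp: split_paired_all)
  ultimately show ?thesis by blast
 next
  case False
  have "\<exists>K. \<forall>u. (\<forall>(c, u', n)\<in>set (K u). length u' = length u \<and> dz u' + n = Suc (dz u)) \<and>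
   (\<forall>G y. Y0 G u y = lc (%(u', n). G u' (y + of_nat n)) (K u))"
   by (intro choice allI Y0_expand)
  then obtain K where K: "!!u. (\<forall>(c, u', n)\<in>set (K u). length u' = length u \<and> dz u' + n = Suc (dz u)) \<and>
   (\<forall>G y. Y0 G u y = lc (%(u', n). G u' (y + of_nat n)) (K u))" by blast
  have K1: "length u' = length u \<and> dz u' + n = Suc (dz u)" if "(c, u', n) \<in> set (K u)" for c u u' n
   using K[of u] that by auto
  have K2: "Y0 G u y = lc (%(u', n). G u' (y + of_nat n)) (K u)" for G u y
   using K[of u] by blast
  define L' where "L' = bindc (%(u, n). map (%(c, u', n'). (c, u', n' + n)) (K u)) L"
  have 1: "length u = c1 w \<and> dz u + n = Suc (c0 w)" if m: "(c, u, n) \<in> set L'" for c u n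
  proof -
   obtain d p e where "(d, p) \<in> set L" "(e, u, n) \<in> set ((%(u, n). map (%(c, u', n'). (c, u', n' + n)) (K u)) p)"
    using set_bindc[OF m[unfolded L'_def]] by blast
   then obtain v m where a: "(d, v, m) \<in> set L" "(e, u, n) \<in> set (map (%(c, u', n'). (c, u', n' + m)) (K v))"
    by (cases p) auto
   then obtain n' where n': "(e, u, n') \<in> set (K v)" "n = n' + m" by auto
   show ?thesis using K1[OF n'(1)] L(1)[OF a(1)] n'(2) by auto
  qed
  have 2: "lc (%(u, n). G u (x + of_nat n)) (map (%(c, u', n'). (c, u', n' + n)) R) = lc (%(u, n'). G u (x + of_nat n + of_nat n')) R"
   for G :: zfun and x n R by (induction R) (auto simp: algebra_simps)
  have "ev (i # w) G x = lc (%(u, n). G u (x + of_nat n)) L'" for G x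
  proof -
   have "ev (i # w) G x = lc (%(u, n). Y0 G u (x + of_nat n)) L" using False L(2)[of "Y0 G" x] by (simp add: YY_def)
   also have "\<dots> = lc (%(u, n). lc (%(u, n'). G u (x + of_nat n + of_nat n')) (K u)) L"
    by (simp only: K2)
   also have "\<dots> = lc (%(u, n). G u (x + of_nat n)) L'"
    unfolding L'_def lc_bindc
   proof (rule lc_cong)
    fix c p
    show "(case p of (u, n) => lc (%(u, n'). G u (x + of_nat n + of_nat n')) (K u)) =
     lc (%(u, n). G u (x + of_nat n)) (case p of (u, n) => map (%(c, u', n'). (c, u', n' + n)) (K u))"
     by (cases p) (simp add: 2)
   qed
   finally show ?thesis .
  qed
  then show ?thesis using 1 False by (intro exI[of _ L']) auto
 qed
qed

lemma realz_ev_Yx: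
 assumes "l + x = of_nat M" "M \<ge> 2 * c1 w"
 shows "realz (c0 w + M) (c1 w) (%G. ev w (Yx x G) l)"
proof -
 obtain L where L: "!!c u n. (c, u, n)\<in>set L ==> length u = c1 w \<and> dz u + n = c0 w"
  "!!G x. ev w G x = lc (%(u, n). G u (x + of_nat n)) L" using ev_expand[of w] by blast
 have "realz (c0 w + M) (c1 w) (%G. lc (%(u, n). Yx x G u (l + of_nat n)) K)" if "set K \<subseteq> set L" for K
  using that
 proof (induction K)
  case Nil
  then show ?case by (simp add: realz_zero)
 next
  case (Cons a K)
  obtain c u n where a: "a = (c, u, n)" by (cases a)
  have u: "length u = c1 w" "dz u + n = c0 w" using L(1)[of c u n] Cons.prems a by auto
  have "realz (dz u + (M + n)) (length u) (%G. Yx x G u (l + of_nat n))"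
   by (rule realz_Yx) (use assms u in \<open>auto simp: algebra_simps\<close>)
  then have "realz (c0 w + M) (c1 w) (%G. Yx x G u (l + of_nat n))" using u by (simp add: algebra_simps)
  then show ?case using Cons by (simp add: a realz_add realz_cmult)
 qed
 then show ?thesis using L(2) by simp
qed

lemma c_replicate: "c0 (replicate n False @ w) = n + c0 w" "c1 (replicate n False @ w) = c1 w"
 "c0 (w @ replicate n False) = n + c0 w" "c1 (w @ replicate n False) = c1 w"
 by (induction n) (auto simp: c0_def c1_def)

text \<open>Moving a raising operator past y_0 yields y_0 times a raised vector, again in the
  radical, and for e_0 a multiple of the vector itself, a single scalar because \<open>P\<close> is
  homogeneous.\<close>

lemma Rad_False: "Rad l0 l1 P ==> homog A B P ==> Rad l0 l1 (map (%(c, w). (c, False # w)) P)"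
 unfolding Rad_def
proof
 fix Q assume R: "\<forall>Q. lc (delw l0 l1 Q ind) P = 0" and h: "homog A B P"
 have gen: "lc (%w. delw l0 l1 Q ind (False # w)) P = 0" if "homog A B P" "\<forall>Q. lc (delw l0 l1 Q ind) P = 0" for Q A B P
  using that
 proof (induction Q arbitrary: A B P)
  case Nil
  then show ?case by (simp add: ind_def)
 next
  case (Cons i Q)
  have r: "\<forall>Q. lc (delw l0 l1 Q ind) (dP l0 l1 i P) = 0" for i
   using Rad_dP[of l0 l1 P i] Cons.prems(2) by (simp add: Rad_def)
  have 1: "lc (%w. del l0 l1 i (%w. delw l0 l1 Q ind (False # w)) w) P = 0"
  proof (cases i)
   case True
   show ?thesis using Cons.IH[OF homog_dP1[OF Cons.prems(1)] r] True by (simp add: lc_dP)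
  next
   case False
   show ?thesis using Cons.IH[OF homog_dP0[OF Cons.prems(1)] r] False by (simp add: lc_dP)
  qed
  show ?case
  proof (cases i)
   case True
   then show ?thesis using 1 by simp
  next
   case False
   have "lc (%w. kap l0 l1 False w * delw l0 l1 Q ind w) P
    = lc (%w. (l0 - 2 * of_nat A + 2 * of_nat B) * delw l0 l1 Q ind w) P"
    by (rule lc_cong) (use Cons.prems(1) in \<open>auto simp: homog_def kap_def\<close>)
   also have "\<dots> = 0" unfolding lc_cmult using Cons.prems(2) by simp
   finally show ?thesis using 1 False by (simp add: lc_add)
  qed
 qed
 show "lc (delw l0 l1 Q ind) (map (%(c, w). (c, False # w)) P) = 0"
  using gen[OF h R] by (simp add: lc_map1)
qed

lemma Rad_Falses:
 assumes "Rad l0 l1 P" "homog A B P"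
 shows "Rad l0 l1 (map (%(c, w). (c, replicate n False @ w)) P)"
proof (induction n)
 case 0
 then show ?case using assms by (simp add: case_prod_beta)
next
 case (Suc n)
 have h: "homog (n + A) B (map (%(c, w). (c, replicate n False @ w)) P)"
  using assms(2) by (auto simp: homog_def c_replicate)
 have "map (%(c, w). (c, False # w)) (map (%(c, w). (c, replicate n False @ w)) P)
  = map (%(c, w). (c, replicate (Suc n) False @ w)) P"
  by auto
 then show ?case using Rad_False[OF Suc h] by metis
qed

text \<open>Dual to all pure powers y_0^y v at once instead of to v alone. This makes it polynomial
  in y, as interpolation requires; \<open>delw_full\<close> shows that raising words of full degree
  do not see the difference.\<close>

definition dlt :: zfun where "dlt u y = (if u = [] then 1 else 0)"

fun DDw :: "complex => complex => bool list => zfun => zfun" where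
 "DDw l0 l1 [] G = G"
| "DDw l0 l1 (q # Q) G = DD l0 l1 q (DDw l0 l1 Q G)"

lemma DDw_append: "DDw l0 l1 (Q @ Q') G = DDw l0 l1 Q (DDw l0 l1 Q' G)"
 by (induction Q) auto

lemma polyG_DDw: "polyG (DDw l0 l1 Q dlt)"
proof (induction Q)
 case Nil
 then show ?case by (auto simp: polyG_def dlt_def polyf_intros)
qed (simp add: polyG_DD)

lemma ev_DDw:
 assumes "x * (l0 - x + 1) = 0"
 shows "ev w (DDw l0 l1 Q G) x = delw (l0 - 2 * x) (l1 + 2 * x) Q (%w. ev w G x) w"
proof (induction Q arbitrary: w)
 case (Cons q Q)
 have "(%w. ev w (DDw l0 l1 Q G) x) = delw (l0 - 2 * x) (l1 + 2 * x) Q (%w. ev w G x)"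
  using Cons by auto
 then show ?case using ev_DD[OF assms, where G = "DDw l0 l1 Q G"] by simp
qed simp

lemma ev_dlt: "ev w dlt x = (if c1 w = 0 then 1 else 0)"
proof -
 have Y0d: "YY False dlt = dlt"
 proof (intro ext)
  fix u y show "YY False dlt u y = dlt u y"
  proof (cases u)
   case (Cons z v)
   have "(%u. dlt (z # u)) = (%u y. 0 * dlt u y)" by (intro ext) (simp add: dlt_def)
   then have "Y0 (%u. dlt (z # u)) v y = 0" using Y0_lin(2)[of 0 dlt v y] by simp
   then show ?thesis using Cons by (cases z) (auto simp: YY_def dlt_def)
  qed (auto simp: YY_def dlt_def)
 qed
 show ?thesis
 proof (induction w)
  case (Cons i w)
  have "YY True dlt = (%u y. 0 * dlt u y)" by (intro ext) (simp add: YY_def Y1_def dlt_def)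
  then have "ev w (YY True dlt) x = 0" using ev_lin(2)[of w 0 dlt x] by simp
  then show ?case using Cons Y0d by (cases i) auto
 qed (simp add: dlt_def)
qed

lemma length_c: "length w = c0 w + c1 w"
proof (induction w)
 case (Cons i w)
 then show ?case by (cases i) auto
qed simp

text \<open>Raising by a word of exactly the degree of \<open>w\<close> ends in a multiple of v,
  where both functionals take the same value.\<close>

lemma delw_full:
 assumes "c0 Q = c0 w" "c1 Q = c1 w"
 shows "delw l0 l1 Q (%w. if c1 w = 0 then 1 else 0) w = delw l0 l1 Q ind w"
 using assms
proof (induction Q arbitrary: w)
 case Nil
 then have "w = []" using length_c[of w] by simp
 then show ?case by (simp add: ind_def)
next
 case (Cons q Q)
 show ?case unfolding delw.simps lc_dl[symmetric]
 proof (rule lc_cong)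
  fix c u assume "(c, u) \<in> set (dl l0 l1 q w)"
  from set_dl[OF this] Cons.prems show "delw l0 l1 Q (%w. if c1 w = 0 then 1 else 0) u = delw l0 l1 Q ind u"
   by (intro Cons.IH) (cases q; auto)+
 qed
qed

lemma delw_nonfull:
 assumes "c0 Q \<noteq> c0 w \<or> c1 Q \<noteq> c1 w"
 shows "delw l0 l1 Q ind w = 0"
 using assms
proof (induction Q arbitrary: w)
 case Nil
 then have "w \<noteq> []" by auto
 then show ?case by (simp add: ind_def)
next
 case (Cons q Q)
 have "lc (delw l0 l1 Q ind) (dl l0 l1 q w) = lc (%_. 0) (dl l0 l1 q w)"
 proof (rule lc_cong)
  fix c u assume "(c, u) \<in> set (dl l0 l1 q w)"
  from set_dl[OF this] Cons.prems show "delw l0 l1 Q ind u = 0"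
   by (intro Cons.IH) (cases q; auto)+
 qed
 then show ?case by (simp add: lc_dl)
qed

text \<open>Each step multiplies by z (l0 - z + 1), and the hypothesis keeps both factors away from
  0 for every z on the way down.\<close>

lemma DDw_zeros:
 assumes "!!n::nat. n < m ==> y + of_nat n \<noteq> - 1 \<and> l0 - y - of_nat n \<noteq> 0"
 shows "\<exists>c\<noteq>0. \<forall>G. DDw l0 l1 (replicate m False) G [] (y + of_nat m) = c * G [] y"
 using assms
proof (induction m)
 case 0
 then show ?case by (intro exI[of _ 1]) auto
next
 case (Suc m)
 then obtain c where c: "c \<noteq> 0" "!!G. DDw l0 l1 (replicate m False) G [] (y + of_nat m) = c * G [] y"
  by auto
 define d where "d = (y + of_nat (Suc m)) * (l0 - (y + of_nat (Suc m)) + 1)"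
 have "y + of_nat m \<noteq> - 1" "l0 - y - of_nat m \<noteq> 0" using Suc.prems[of m] by auto
 moreover have "y + of_nat (Suc m) = y + of_nat m + 1" "l0 - (y + of_nat (Suc m)) + 1 = l0 - y - of_nat m" by simp_all
 ultimately have "d \<noteq> 0" unfolding d_def by (metis add_eq_0_iff2 mult_eq_0_iff)
 moreover have "DDw l0 l1 (replicate (Suc m) False) G [] (y + of_nat (Suc m)) = d * (c * G [] y)" for G
 proof -
  have "DDw l0 l1 (replicate (Suc m) False) G [] (y + of_nat (Suc m))
    = d * DDw l0 l1 (replicate m False) G [] (y + of_nat (Suc m) - 1)"
   by (simp only: replicate_Suc DDw.simps DD_def if_False D0.simps d_def)
  also have "y + of_nat (Suc m) - 1 = y + of_nat m" by simp
  finally show ?thesis by (simp only: c(2))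
 qed
 ultimately show ?case using c(1) by (intro exI[of _ "d * c"]) (simp add: mult.assoc)
qed

lemma lc_prefix: "lc (%(u', n). g u' n) (map (%(c, u', n). (c, z # u', n)) L) = lc (%(u', n). g (z # u') n) L"
 by (induction L) auto

lemma DD_expand:
 "\<exists>L. (\<forall>(c, u', n)\<in>set L. length u' + (if i then 1 else 0) = length u \<and>
     int (dz u') + n + (if i then 0 else 1) = int (dz u)) \<and>
  (\<forall>G. DD l0 l1 i G u y = lc (%(u', n). G u' (y + of_int n)) L)"
proof (induction u)
 case Nil
 show ?case
 proof (cases i)
  case True
  then show ?thesis by (intro exI[of _ "[]"]) (auto simp: DD_def)
 next
  case False
  then show ?thesis by (intro exI[of _ "[(y * (l0 - y + 1), [], -1)]"]) (auto simp: DD_def)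
 qed
next
 case (Cons z u)
 then obtain L where L: "!!c u' n. (c, u', n)\<in>set L ==> length u' + (if i then 1 else 0) = length u \<and>
     int (dz u') + n + (if i then 0 else 1) = int (dz u)"
  "!!G. DD l0 l1 i G u y = lc (%(u', n). G u' (y + of_int n)) L" by blast
 obtain K where K: "!!c u' n. (c, u', n)\<in>set K ==> length u' = length u \<and> dz u' + n = Suc (dz u)"
  "!!G. Y0 G u y = lc (%(u', n). G u' (y + of_nat n)) K" using Y0_expand[of u] by blast
 have dzc: "dz (z # v) = dz v + dz [z]" for v by (cases z) auto
 define L1 where "L1 = map (%(c, u', n). (c, z # u', n)) L"
 define L2 where "L2 = (if i then (case z of Z0 => [(hh l0 l1 True u y, u, 0)] | Z1 => map (%(c, u', n). (- (2 * c), u', int n)) K | Z2 => [])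
  else (case z of Z0 => [] | Z1 => [(2, Z0 # u, 0)] | Z2 => [(2, Z1 # u, 0)]))"
 have 1: "\<forall>(c, u', n)\<in>set (L1 @ L2). length u' + (if i then 1 else 0) = length (z # u) \<and>
     int (dz u') + n + (if i then 0 else 1) = int (dz (z # u))"
 proof -
  have "length u' + (if i then 1 else 0) = length (z # u) \<and>
     int (dz u') + n + (if i then 0 else 1) = int (dz (z # u))" if m: "(c, u', n)\<in>set L1" for c u' n
  proof -
   obtain v where v: "u' = z # v" "(c, v, n) \<in> set L" using m unfolding L1_def by auto
   show ?thesis using L(1)[OF v(2)] unfolding v(1) dzc[of u] dzc[of v] by auto
  qed
  moreover have "length u' + (if i then 1 else 0) = length (z # u) \<and>
     int (dz u') + n + (if i then 0 else 1) = int (dz (z # u))" if m: "(c, u', n)\<in>set L2" for c u' n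
  proof (cases "i \<and> z = Z1")
   case True
   then obtain d m' where "(d, u', m') \<in> set K" "n = int m'" using m unfolding L2_def by auto
   then show ?thesis using K(1)[of d u' m'] True by auto
  next
   case False
   then show ?thesis using m unfolding L2_def by (cases z; cases i) auto
  qed
  ultimately show ?thesis by auto
 qed
 have m: "lc (%(u', n). G u' (y + of_int n)) (map (%(c, u', n). (- (2 * c), u', int n)) K)
   = - 2 * lc (%(u', n). G u' (y + of_nat n)) K" for G :: zfun
  by (induction K) (auto simp: algebra_simps)
 have D: "DD l0 l1 i G (z # u) y = lc (%(u', n). G u' (y + of_int n)) (L1 @ L2)" for G
 proof -
  have "DD l0 l1 i G (z # u) y = DD l0 l1 i (%u. G (z # u)) u y + lc (%(u', n). G u' (y + of_int n)) L2"
   by (cases i; cases z) (simp_all add: DD_def L2_def K(2) m)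
  then show ?thesis unfolding L(2) L1_def lc_simps lc_prefix .
 qed
 show ?case by (rule exI[of _ "L1 @ L2"], rule conjI, rule 1, rule allI, rule D)
qed

text \<open>Each letter contains exactly one y_1, so as many operators e_1 as letters leave nothing
  but a power of y_0, whose exponent is fixed by the degree.\<close>

lemma DDw_expand:
 assumes "length u = c1 Q"
 shows "\<exists>\<kappa>. \<forall>G. DDw l0 l1 Q G u y = \<kappa> * G [] (y + of_nat (dz u) - of_nat (c0 Q))"
 using assms
proof (induction Q arbitrary: u y)
 case Nil
 then show ?case by (intro exI[of _ 1]) auto
next
 case (Cons q Q)
 obtain L where L: "!!c u' n. (c, u', n)\<in>set L ==> length u' + (if q then 1 else 0) = length u \<and>
     int (dz u') + n + (if q then 0 else 1) = int (dz u)"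
  "!!G. DD l0 l1 q G u y = lc (%(u', n). G u' (y + of_int n)) L" using DD_expand[of q u l0 l1 y] by blast
 have "\<exists>\<kappa>. \<forall>G. lc (%(u', n). DDw l0 l1 Q G u' (y + of_int n)) K = \<kappa> * G [] (y + of_nat (dz u) - of_nat (c0 (q # Q)))"
  if "set K \<subseteq> set L" for K
  using that
 proof (induction K)
  case Nil
  then show ?case by (intro exI[of _ 0]) auto
 next
  case (Cons a K)
  then obtain \<kappa> where \<kappa>: "!!G. lc (%(u', n). DDw l0 l1 Q G u' (y + of_int n)) K = \<kappa> * G [] (y + of_nat (dz u) - of_nat (c0 (q # Q)))"
   by auto
  obtain c u' n where a: "a = (c, u', n)" by (cases a)
  have u': "length u' + (if q then 1 else 0) = length u" "int (dz u') + n + (if q then 0 else 1) = int (dz u)"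
   using L(1)[of c u' n] Cons.prems a by auto
  have "length u' = c1 Q" using u'(1) \<open>length u = c1 (q # Q)\<close> by (cases q) auto
  then obtain d where d: "!!G. DDw l0 l1 Q G u' (y + of_int n) = d * G [] (y + of_int n + of_nat (dz u') - of_nat (c0 Q))"
   using \<open>!!u y. length u = c1 Q ==> \<exists>\<kappa>. \<forall>G. DDw l0 l1 Q G u y = \<kappa> * G [] (y + of_nat (dz u) - of_nat (c0 Q))\<close> by blast
  have "complex_of_int (int (dz u') + n + (if q then 0 else 1)) = complex_of_int (int (dz u))" using u'(2) by simp
  then have e: "y + of_int n + of_nat (dz u') - of_nat (c0 Q) = y + of_nat (dz u) - of_nat (c0 (q # Q))"
   by (cases q) (auto simp: algebra_simps)
  show ?case using \<kappa> d[unfolded e] by (intro exI[of _ "c * d + \<kappa>"]) (auto simp: a algebra_simps)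
 qed
 then show ?case using L(2) by simp
qed

lemma ev_DDw_expand:
 assumes "c1 w = c1 Q"
 shows "\<exists>\<kappa>. \<forall>G. ev w (DDw l0 l1 Q G) x = \<kappa> * G [] (x + of_nat (c0 w) - of_nat (c0 Q))"
proof -
 obtain L where L: "!!c u n. (c, u, n)\<in>set L ==> length u = c1 w \<and> dz u + n = c0 w"
  "!!G x. ev w G x = lc (%(u, n). G u (x + of_nat n)) L" using ev_expand[of w] by blast
 have "\<exists>\<kappa>. \<forall>G. lc (%(u', n). DDw l0 l1 Q G u' (x + of_nat n)) K = \<kappa> * G [] (x + of_nat (c0 w) - of_nat (c0 Q))"
  if "set K \<subseteq> set L" for K
  using that
 proof (induction K)
  case Nil
  then show ?case by (intro exI[of _ 0]) auto
 next
  case (Cons a K)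
  then obtain \<kappa> where \<kappa>: "!!G. lc (%(u', n). DDw l0 l1 Q G u' (x + of_nat n)) K = \<kappa> * G [] (x + of_nat (c0 w) - of_nat (c0 Q))"
   by auto
  obtain c u n where a: "a = (c, u, n)" by (cases a)
  have u: "length u = c1 Q" "dz u + n = c0 w"
   using L(1)[of c u n] Cons.prems a assms by auto
  obtain d where d: "!!G. DDw l0 l1 Q G u (x + of_nat n) = d * G [] (x + of_nat n + of_nat (dz u) - of_nat (c0 Q))"
   using DDw_expand[OF u(1)] by blast
  have e: "x + of_nat n + of_nat (dz u) - of_nat (c0 Q) = x + of_nat (c0 w) - of_nat (c0 Q)"
   by (simp add: u(2)[symmetric])
  show ?case using \<kappa> d[unfolded e] by (intro exI[of _ "c * d + \<kappa>"]) (auto simp: a algebra_simps)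
 qed
 then show ?thesis using L(2) by simp
qed

lemma lc_DDw_expand:
 assumes "homog A B P" "c1 Q = B"
 shows "\<exists>\<kappa>. \<forall>G. lc (%w. ev w (DDw l0 l1 Q G) x) P = \<kappa> * G [] (x + of_nat A - of_nat (c0 Q))"
 using assms
proof (induction P)
 case Nil
 then show ?case by (intro exI[of _ 0]) auto
next
 case (Cons a P)
 then obtain \<kappa> where \<kappa>: "!!G. lc (%w. ev w (DDw l0 l1 Q G) x) P = \<kappa> * G [] (x + of_nat A - of_nat (c0 Q))"
  by (auto simp: homog_def)
 obtain c w where a: "a = (c, w)" by (cases a)
 have w: "c0 w = A" "c1 w = c1 Q" using Cons.prems a by (auto simp: homog_def)
 obtain d where "!!G. ev w (DDw l0 l1 Q G) x = d * G [] (x + of_nat (c0 w) - of_nat (c0 Q))"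
  using ev_DDw_expand[OF w(2)] by blast
 then show ?case using \<kappa> w by (intro exI[of _ "c * d + \<kappa>"]) (auto simp: a algebra_simps)
qed

text \<open>The functional \<open>chr\<close> continued to vectors with a complex power of y_0: the
  letters act as -d/dx, 1 and 0, and y_0^y raises the exponent by y.\<close>

fun Gchr :: "complex => zfun" where
 "Gchr \<mu> [] y = 1"
| "Gchr \<mu> (Z0 # u) y = - (\<mu> + y + of_nat (dz u) - of_nat (length u)) * Gchr \<mu> u y"
| "Gchr \<mu> (Z1 # u) y = Gchr \<mu> u y"
| "Gchr \<mu> (Z2 # u) y = 0"

lemma Yx_wt: "Yx x (%u y. (a + y + of_nat (dz u) - of_nat (length u)) * G u y) u y
  = (a + y + x + of_nat (dz u) - of_nat (length u)) * Yx x G u y"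
proof (induction u arbitrary: G x a)
 case (Cons z u)
 have e: "(%u y. (a + y + of_nat (dz (z' # u)) - of_nat (length (z' # u))) * G (z' # u) y) =
  (%u y. (a + of_nat (dz [z']) - 1 + y + of_nat (dz u) - of_nat (length u)) * G (z' # u) y)" for z'
  by (intro ext; cases z') (auto simp: algebra_simps)
 show ?case by (cases z) (simp_all only: Yx.simps zl.case e Cons, simp_all add: field_simps)
qed (simp add: algebra_simps)

text \<open>Multiplication by a power of x changes the exponent and never the coefficient.\<close>

lemma Yx_Gchr: "Yx x (Gchr \<mu>) u y = Gchr \<mu> u y"
proof (induction u arbitrary: x)
 case (Cons z u)
 have e0: "(%u. Gchr \<mu> (Z0 # u)) = (%u y. (\<mu> + y + of_nat (dz u) - of_nat (length u)) * ((-1) * Gchr \<mu> u y))"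
  by (intro ext) (simp add: algebra_simps)
 have e1: "(%u. Gchr \<mu> (Z1 # u)) = Gchr \<mu>" by (intro ext) simp
 have e2: "(%u. Gchr \<mu> (Z2 # u)) = (%u y. 0)" by (intro ext) simp
 have z: "Yx x (%u y. 0) u y = 0" for x
  using Yx_lin[of x "%u y. 0" "%u y. 0" u y] by simp
 have m: "Yx x (%u y. (-1) * Gchr \<mu> u y) u y = - Yx x (Gchr \<mu>) u y" for x
  using Yx_lin[of x "%u y. (-1) * Gchr \<mu> u y" "Gchr \<mu>" u y] z[of x] by (simp add: add_eq_0_iff)
 show ?case
  by (cases z) (simp_all only: Yx.simps zl.case e0 e1 e2 z Yx_wt m Cons, simp_all add: algebra_simps)
qed simp

lemma ev_Gchr: "ev w (Gchr \<mu>) x = chr (\<mu> + x) w"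
proof (induction w)
 case (Cons i w)
 show ?case
 proof (cases i)
  case True
  have "YY True (Gchr \<mu>) = (%u y. (1/2) * (hh (2 - 2 * \<mu>) 0 False u y * Gchr \<mu> u y) + (- 1) * Gchr \<mu> u y)"
   by (intro ext) (simp add: YY_def Y1_def hh_def field_simps)
  then have "ev (i # w) (Gchr \<mu>) x = ev w (%u y. (1/2) * (hh (2 - 2 * \<mu>) 0 False u y * Gchr \<mu> u y) + (- 1) * Gchr \<mu> u y) x"
   using True by simp
  also have "\<dots> = (1/2) * (kap (2 - 2 * \<mu> - 2 * x) (0 + 2 * x) False w * chr (\<mu> + x) w) + (- 1) * chr (\<mu> + x) w"
   unfolding ev_lin ev_hh Cons ..
  also have "\<dots> = chr (\<mu> + x) (i # w)" using True by (simp add: kap_def field_simps)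
  finally show ?thesis .
 next
  case False
  have "YY False (Gchr \<mu>) = Gchr \<mu>"
   using Yx_plus1[of 0 "Gchr \<mu>"] by (intro ext) (simp add: YY_def Yx_Gchr Yx_0)
  then show ?thesis using False Cons by simp
 qed
qed simp

lemma polyf_lc:
 assumes "!!w. polyf (%x. g x w)" shows "polyf (%x. lc (g x) P)"
proof (induction P)
 case Nil
 show ?case by (simp add: polyf_intros(1))
next
 case (Cons a P)
 show ?case unfolding lc_simps by (intro polyf_intros(1,3,6) Cons assms)
qed

text \<open>In the module of reflected highest weight the vector y_0^l v with l = - l0 - 1 is
  singular of weight (l0, l1), so P can be applied to it. Multiplying by y_0^x with l + x natural
  brings the result back among honest vectors, and \<open>chr\<close> is unaffected by either
  power.\<close>

theorem bad_reflect:
 assumes bad: "bad l0 l1 \<mu> A B" and l0: "l0 \<notin> \<int>"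
 shows "\<exists>A'. bad (- l0 - 2) (l1 + 2 * l0 + 2) (\<mu> + l0 + 1) A' B"
proof -
 obtain P where P: "homog A B P" "Rad l0 l1 P" "lc (chr \<mu>) P \<noteq> 0"
  using bad unfolding bad_def by blast
 define m0 m1 l where "m0 = - l0 - 2" "m1 = l1 + 2 * l0 + 2" "l = m0 + 1"
 have l: "l * (m0 - l + 1) = 0" "m0 - 2 * l = l0" "m1 + 2 * l = l1" by (auto simp: m0_m1_l_def)
 have nint1: "l0 + of_int n \<noteq> of_int m" for n m :: int
 proof
  assume "l0 + of_int n = of_int m"
  then have "l0 = of_int (m - n)" by (simp add: algebra_simps)
  then show False using l0 by simp
 qed
 have nint2: "- l0 - 1 + of_int n \<noteq> of_int m" for n m :: int
 proof
  assume "- l0 - 1 + of_int n = of_int m"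
  then have "l0 = of_int (n - 1 - m)" by (simp add: algebra_simps)
  then show False using l0 by simp
 qed
 \<comment> \<open>At natural x the vector is y_0^n P y_0^l v, where the radical property of P
   applies. Both sides are polynomial in x, so the complex exponent needed below is reached by
   interpolation.\<close>
 have zero: "lc (%w. ev w (Yx x (DDw m0 m1 Q dlt)) l) P = 0" if Q: "c1 Q = B" for Q x
 proof (rule polyf_zero[where M = "c0 Q" and f = "%x. lc (%w. ev w (Yx x (DDw m0 m1 Q dlt)) l) P"])
  have "polyf (%x. ev w (Yx x (DDw m0 m1 Q dlt)) l)" for w
   by (rule polyf_ev) (rule polyf_Yx[OF polyG_DDw])
  then show "polyf (%x. lc (%w. ev w (Yx x (DDw m0 m1 Q dlt)) l) P)"
   by (rule polyf_lc)
 next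
  fix n assume n: "n \<ge> c0 Q"
  \<comment> \<open>The number of further e_0 that take the remaining power of y_0 down to
    y_0^l.\<close>
  define m where "m = A + n - c0 Q"
  define P' where "P' = map (%(c, w). (c, replicate n False @ w)) P"
  note cr = c_replicate
  have h: "homog (A + n) B P'" using P(1) by (auto simp: P'_def homog_def cr)
  obtain \<kappa> where \<kappa>: "!!G. lc (%w. ev w (DDw m0 m1 Q G) l) P' = \<kappa> * G [] (l + of_nat (A + n) - of_nat (c0 Q))"
   using lc_DDw_expand[OF h Q] by blast
  have mm: "l + of_nat (A + n) - of_nat (c0 Q) = l + of_nat m" using n by (simp add: m_def of_nat_diff)
  obtain d where d: "d \<noteq> 0" "!!G. DDw m0 m1 (replicate m False) G [] (l + of_nat m) = d * G [] l"
  proof -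
   have 1: "l + of_nat n \<noteq> - 1" for n :: nat
    using nint2[of "int n" "-1"] by (simp add: m0_m1_l_def)
   have "m0 - l - of_nat n = of_int (- 1 - int n)" for n :: nat by (simp add: m0_m1_l_def)
   then have 2: "m0 - l - of_nat n \<noteq> 0" for n :: nat by (simp only: of_int_eq_0_iff)
   then show ?thesis using that DDw_zeros[of m l m0 m1] 1 2 by blast
  qed
  have "lc (%w. ev w (DDw m0 m1 (Q @ replicate m False) dlt) l) P' = 0"
  proof -
   have "lc (%w. ev w (DDw m0 m1 (Q @ replicate m False) dlt) l) P' =
    lc (delw l0 l1 (Q @ replicate m False) ind) P'"
   proof (rule lc_cong)
    fix c w assume "(c, w) \<in> set P'"
    then have w: "c0 w = A + n" "c1 w = B" using h by (auto simp: homog_def)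
    show "ev w (DDw m0 m1 (Q @ replicate m False) dlt) l = delw l0 l1 (Q @ replicate m False) ind w"
     unfolding ev_DDw[OF l(1)] l(2,3) ev_dlt
     by (rule delw_full) (use w Q n in \<open>auto simp: cr m_def\<close>)
   qed
   then show ?thesis using Rad_Falses[OF P(2,1), of n] by (simp add: Rad_def P'_def)
  qed
  then have "\<kappa> * d = 0" unfolding DDw_append \<kappa> mm d(2) by (simp add: dlt_def)
  then have "lc (%w. ev w (DDw m0 m1 Q dlt) l) P' = 0" using \<kappa>[of dlt] d(1) by simp
  then show "lc (%w. ev w (Yx (of_nat n) (DDw m0 m1 Q dlt)) l) P = 0"
   by (simp add: P'_def lc_map1 ev_append)
 qed
 \<comment> \<open>A word with B letters y_1 expands into words of B letters, and
   \<open>realz_Yx\<close> asks for twice that length.\<close>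
 define M where "M = 2 * B"
 define x where "x = of_nat M - l"
 have "realz (A + M) B (%G. lc (%w. ev w (Yx x G) l) K)" if "set K \<subseteq> set P" for K
  using that
 proof (induction K)
  case (Cons a K)
  obtain c w where a: "a = (c, w)" by (cases a)
  have w: "c0 w = A" "c1 w = B" using Cons.prems a P(1) by (auto simp: homog_def)
  show ?case using realz_ev_Yx[of l x M w] Cons w
   by (auto simp: a x_def M_def intro!: realz_add realz_cmult)
 qed (simp add: realz_zero)
 then obtain P' where P': "homog (A + M) B P'" "!!G. lc (%w. ev w (Yx x G) l) P = lc (%w. ev w G 0) P'"
  unfolding realz_def by blast
 have "Rad m0 m1 P'" unfolding Rad_def
 proof
  fix Q
  show "lc (delw m0 m1 Q ind) P' = 0"
  proof (cases "c0 Q = A + M \<and> c1 Q = B")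
   case True
   have "lc (delw m0 m1 Q ind) P' = lc (%w. ev w (DDw m0 m1 Q dlt) 0) P'"
   proof (rule lc_cong)
    fix c w assume "(c, w) \<in> set P'"
    then have w: "c0 w = A + M" "c1 w = B" using P'(1) by (auto simp: homog_def)
    show "delw m0 m1 Q ind w = ev w (DDw m0 m1 Q dlt) 0"
     using ev_DDw[of 0 m0 w m1 Q dlt] delw_full[of Q w] w True by (simp add: ev_dlt)
   qed
   also have "\<dots> = 0" using zero[of Q x] True P'(2) by simp
   finally show ?thesis .
  next
   case False
   have "lc (delw m0 m1 Q ind) P' = lc (%_. 0) P'"
    by (rule lc_cong, rule delw_nonfull) (use False P'(1) in \<open>auto simp: homog_def\<close>)
   then show ?thesis by simp
  qed
 qed
 moreover have "lc (chr (\<mu> + l0 + 1)) P' \<noteq> 0"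
 proof -
  have "lc (chr (\<mu> + l0 + 1)) P' = lc (%w. ev w (Gchr (\<mu> + l0 + 1)) 0) P'" by (simp add: ev_Gchr)
  also have "\<dots> = lc (%w. ev w (Gchr (\<mu> + l0 + 1)) l) P"
   unfolding P'(2)[symmetric] by (simp add: Yx_Gchr[abs_def])
  also have "\<dots> = lc (chr \<mu>) P" by (simp add: ev_Gchr m0_m1_l_def)
  finally show ?thesis using P(3) by simp
 qed
 ultimately have "bad m0 m1 (\<mu> + l0 + 1) (A + M) B" using P'(1) unfolding bad_def by blast
 then show ?thesis unfolding m0_m1_l_def by blast
qed

section \<open>The chain of reflections ending at the vacuum weight\<close>

lemma not_Ints_mult:
 assumes "coprime (N + 1) q" "0 < m" "m < q"
 shows "of_nat m * (of_nat (N + 1) / of_nat q) \<notin> (\<int> :: complex set)"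
proof
 assume "of_nat m * (of_nat (N + 1) / of_nat q) \<in> (\<int> :: complex set)"
 then obtain z :: int where "of_nat m * (of_nat (N + 1) / of_nat q) = (of_int z :: complex)"
  by (elim Ints_cases)
 then have "(of_nat (m * (N + 1)) :: complex) = of_int (z * int q)"
  using assms by (simp add: field_simps)
 then have "int (m * (N + 1)) = z * int q" by (metis of_int_eq_iff of_int_of_nat_eq)
 then have "int q dvd int (m * (N + 1))" by simp
 then have "q dvd m * (N + 1)" by (metis int_dvd_int_iff)
 then have "q dvd m" using assms(1) by (metis coprime_commute coprime_dvd_mult_left_iff)
 then show False using assms by (auto dest: dvd_imp_le)
qed

lemma not_Ints_shift: "x \<notin> \<int> ==> x + of_int n \<notin> \<int>" "x \<notin> \<int> ==> - x \<notin> (\<int> :: complex set)"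
 by (metis Ints_diff Ints_of_int add_diff_cancel_right') (metis Ints_minus minus_minus)

text \<open>After the reflection the vector is made minimal. With D = A' - B' its quadratic equation
  reads q D (D + 1) = (N + 1) (m D + B'), and for D > N the bound on B' makes the right side too
  small.\<close>

lemma stage_step:
 fixes t :: complex
 assumes cop: "coprime (N + 1) q" and t: "t = of_nat (N + 1) / of_nat q" and m: "0 < m" "m < q"
  and bad: "bad (- (of_nat m * t)) (of_nat (m + 1) * t - 2) \<mu> A B" and B: "B \<le> (q - m) * N"
 shows "\<exists>A' B'. bad (of_nat m * t - 2) (- (of_nat (m - 1) * t)) (\<mu> - of_nat m * t + 1) A' B'
  \<and> B' \<le> (q - m) * N \<and> A' \<le> B' + N"
proof -
 have "- (of_nat m * t) \<notin> \<int>" using not_Ints_mult[OF cop m] not_Ints_shift(2) t by auto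
 from bad_reflect[OF bad this] obtain A1 where
  "bad (- (- (of_nat m * t)) - 2) (of_nat (m + 1) * t - 2 + 2 * (- (of_nat m * t)) + 2) (\<mu> + (- (of_nat m * t)) + 1) A1 B" by blast
 moreover have "- (- (of_nat m * t)) - 2 = of_nat m * t - 2"
  "of_nat (m + 1) * t - 2 + 2 * (- (of_nat m * t)) + 2 = - (of_nat (m - 1) * t)"
  "\<mu> + (- (of_nat m * t)) + 1 = \<mu> - of_nat m * t + 1"
  using m by (simp_all add: of_nat_diff algebra_simps)
 ultimately have "bad (of_nat m * t - 2) (- (of_nat (m - 1) * t)) (\<mu> - of_nat m * t + 1) A1 B" by (simp only:)
 then obtain A' B' where 1: "A' \<le> A1" "B' \<le> B" "bad (of_nat m * t - 2) (- (of_nat (m - 1) * t)) (\<mu> - of_nat m * t + 1) A' B'"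
  and 2: "of_nat A' * (of_nat m * t - 2 + 1) + of_nat B' * (- (of_nat (m - 1) * t) + 1) = (of_nat A' - of_nat B' :: complex)\<^sup>2"
  by (rule bad_minimal)
 define D where "D = int A' - int B'"
 have qn: "of_nat q \<noteq> (0::complex)" using m by simp
 have qt: "of_nat q * t = of_nat (N + 1)" using t qn by simp
 have "of_nat q * (of_nat A' * (of_nat m * t - 2 + 1) + of_nat B' * (- (of_nat (m - 1) * t) + 1))
  = of_nat A' * (of_nat m * (of_nat q * t) - of_nat q) + of_nat B' * ((1 - of_nat m) * (of_nat q * t) + of_nat q)"
  using m by (simp add: of_nat_diff algebra_simps)
 then have "of_nat A' * (of_nat m * of_nat (N + 1) - of_nat q) + of_nat B' * ((1 - of_nat m) * of_nat (N + 1) + of_nat q)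
  = of_nat q * (of_nat A' - of_nat B' :: complex)\<^sup>2" unfolding 2 qt by simp
 then have "(of_int (int A' * (int m * int (N + 1) - int q) + int B' * ((1 - int m) * int (N + 1) + int q)) :: complex)
  = of_int (int q * D\<^sup>2)" unfolding D_def by simp
 then have "int A' * (int m * int (N + 1) - int q) + int B' * ((1 - int m) * int (N + 1) + int q) = int q * D\<^sup>2"
  by (simp only: of_int_eq_iff)
 then have e: "int q * D * (D + 1) = (int N + 1) * (int m * D + int B')"
  unfolding D_def by (simp add: power2_eq_square algebra_simps)
 have Bb: "int B' \<le> (int q - int m) * int N"
 proof -
  have "int B' \<le> int ((q - m) * N)" using 1(2) B by linarith
  then show ?thesis using m by (simp add: of_nat_diff)
 qed
 have "D \<le> int N"
 proof (rule ccontr)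
  assume "\<not> D \<le> int N"
  then have D: "D \<ge> int N + 1" by simp
  have "D * (int q * D + int q - (int N + 1) * int m) = (int N + 1) * int B'" using e by (simp add: algebra_simps)
  also have "\<dots> \<le> (int N + 1) * ((int q - int m) * int N)" using Bb by (intro mult_left_mono) auto
  finally have le: "D * (int q * D + int q - (int N + 1) * int m) \<le> (int N + 1) * ((int q - int m) * int N)" .
  have "int q * D \<ge> int q * (int N + 1)" using D by (intro mult_left_mono) auto
  then have g: "int q * D + int q - (int N + 1) * int m \<ge> (int N + 1) * (int q - int m) + int q"
   by (simp add: algebra_simps)
  have p: "(int N + 1) * (int q - int m) \<ge> 0" using m by simp
  have "D * (int q * D + int q - (int N + 1) * int m) \<ge> (int N + 1) * ((int N + 1) * (int q - int m) + int q)"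
   using D g p by (intro mult_mono) auto
  moreover have "(int N + 1) * ((int N + 1) * (int q - int m) + int q) > (int N + 1) * ((int q - int m) * int N)"
   using m by (intro mult_strict_left_mono) (auto simp: algebra_simps)
  ultimately show False using le by linarith
 qed
 then have "A' \<le> B' + N" unfolding D_def by linarith
 then show ?thesis using 1 B by (meson order_trans)
qed

lemma c_replicateT: "c0 (replicate n True) = 0" "c1 (replicate n True) = n"
 "c0 (replicate n False) = n" "c1 (replicate n False) = 0"
 by (induction n) auto

lemma delw_replicate0:
 assumes "l0 = of_nat N - 1" "N > 0"
 shows "delw l0 l1 Q ind (replicate N False) = 0"
proof -
 have d: "del l0 l1 i g (replicate n False) = (if i then 0 else of_nat n * (l0 - of_nat n + 1) * g (replicate (n - 1) False))" for i g n
 proof (induction n arbitrary: g)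
  case (Suc n)
  show ?case
  proof (cases n)
   case (Suc k)
   then show ?thesis using Suc.IH[of "%w. g (False # w)"] by (auto simp: kap_def c_replicateT algebra_simps)
  qed (auto simp: kap_def)
 qed simp
 show ?thesis
 proof (cases Q)
  case Nil
  then show ?thesis using assms by (simp add: ind_def)
 next
  case (Cons q Q')
  then show ?thesis using d[of q "delw l0 l1 Q' ind" N] assms by simp
 qed
qed

text \<open>For l0 = N - 1 the vector y_0^N v is singular, and \<open>chr\<close> is 1 on pure
  powers of y_0.\<close>

lemma bad_top: "N > 0 ==> bad (of_nat N - 1) l1 \<mu> N 0"
 unfolding bad_def
proof (intro exI conjI)
 assume N: "N > 0"
 show "homog N 0 [(1, replicate N False)]" by (simp add: homog_def c_replicateT)
 show "Rad (of_nat N - 1) l1 [(1, replicate N False)]" by (simp add: Rad_def delw_replicate0[OF _ N])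
 have "chr \<mu> (replicate n False) = 1" for n by (induction n) auto
 then show "lc (chr \<mu>) [(1, replicate N False)] \<noteq> 0" by simp
qed

text \<open>The chain starts at m = q - 1, where (m + 1) t - 2 = N - 1 and a pure power is singular,
  and descends to m = 1. The third parameter is chosen so that alternating reflections and swaps end
  at \<mu> = 0; its multiple of t lies strictly between 0 and q, so it is never an integer and every
  swap is permitted.\<close>

lemma stage:
 fixes t :: complex
 assumes cop: "coprime (N + 1) q" and t: "t = of_nat (N + 1) / of_nat q" and N: "N > 0" and m: "0 < m" "m < q"
 shows "\<exists>A B. bad (- (of_nat m * t)) (of_nat (m + 1) * t - 2) (of_nat ((m + 1) div 2) * t - 1) A B \<and> B \<le> (q - m) * N"
 using m
proof (induction "q - m" arbitrary: m)
 case 0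
 then show ?case by simp
next
 case (Suc j)
 have ni: "- (of_nat a * t - 1) - 1 \<notin> \<int>" "of_nat a * t - 1 \<notin> \<int>" if "0 < a" "a < q" for a
 proof -
  have "of_nat a * t \<notin> \<int>" using not_Ints_mult[OF cop that] t by simp
  then show "of_nat a * t - 1 \<notin> \<int>" using not_Ints_shift(1)[of "of_nat a * t" "-1"] by simp
  have "- (of_nat a * t - 1) - 1 = - (of_nat a * t)" by simp
  then show "- (of_nat a * t - 1) - 1 \<notin> \<int>" using not_Ints_shift(2)[of "of_nat a * t"] \<open>of_nat a * t \<notin> \<int>\<close> by simp
 qed
 show ?case
 proof (cases "m = q - 1")
  case True
  define \<mu> where "\<mu> = of_nat ((m + 1) div 2) * t - 1"
  have "bad (of_nat N - 1) (- (of_nat m * t)) (- \<mu> - 1) N 0" using bad_top N by blast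
  moreover have "- \<mu> - 1 \<notin> \<int>" unfolding \<mu>_def using Suc.prems True by (intro ni) auto
  ultimately have "bad (- (of_nat m * t)) (of_nat N - 1) (- (- \<mu> - 1) - 1) 0 N" using bad_swap by blast
  moreover have "of_nat N - 1 = of_nat (m + 1) * t - 2" using True Suc.prems t by simp
  ultimately have "bad (- (of_nat m * t)) (of_nat (m + 1) * t - 2) \<mu> 0 N" by simp
  then show ?thesis using True Suc.prems unfolding \<mu>_def by (intro exI[of _ 0] exI[of _ N]) auto
 next
  case False
  then have m1: "Suc m < q" using Suc.prems by auto
  obtain A B where AB: "bad (- (of_nat (Suc m) * t)) (of_nat (Suc m + 1) * t - 2) (of_nat ((Suc m + 1) div 2) * t - 1) A B" "B \<le> (q - Suc m) * N"
   using Suc.hyps(1)[of "Suc m", OF _ _ m1] Suc.hyps(2) by (metis Suc_diff_Suc Suc_lessD add_left_imp_eq m1 plus_1_eq_Suc zero_less_Suc)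
  define \<mu> where "\<mu> = of_nat ((Suc m + 1) div 2) * t - 1"
  obtain A' B' where *: "bad (of_nat (Suc m) * t - 2) (- (of_nat (Suc m - 1) * t)) (\<mu> - of_nat (Suc m) * t + 1) A' B'"
   "B' \<le> (q - Suc m) * N" "A' \<le> B' + N"
   using stage_step[OF cop t _ m1 AB] unfolding \<mu>_def by blast
  define a where "a = (m + 1) div 2"
  \<comment> \<open>The two halves of m + 1 are exchanged by a reflection followed by a
    swap.\<close>
  have "(Suc m + 1) div 2 + a = Suc m" unfolding a_def by presburger
  then have "of_nat ((Suc m + 1) div 2) = (of_nat (Suc m) - of_nat a :: complex)" by (metis add_diff_cancel_right' of_nat_add)
  then have mu: "\<mu> - of_nat (Suc m) * t + 1 = - (of_nat a * t - 1) - 1" unfolding \<mu>_def by (simp only:) (simp add: algebra_simps)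
  have "0 < a" "a < q" unfolding a_def using Suc.prems by auto
  then have "bad (- (of_nat (Suc m - 1) * t)) (of_nat (Suc m) * t - 2) (- (- (of_nat a * t - 1) - 1) - 1) B' A'"
   using bad_swap[OF ni(1)] *(1) unfolding mu by blast
  moreover have "A' \<le> (q - m) * N"
  proof -
   have "(q - m) * N = (q - Suc m) * N + N" using m1
    by (metis Suc_diff_Suc Suc_lessD add.commute mult_Suc)
   then show ?thesis using * by linarith
  qed
  ultimately show ?thesis unfolding a_def by (intro exI[of _ B'] exI[of _ A']) auto
 qed
qed

theorem null_vector_exists:
 fixes t :: complex
 assumes cop: "coprime (N + 1) q" and t: "t = of_nat (N + 1) / of_nat q" and N: "N > 0" and q: "q > 0"
 obtains A B where "bad (t - 2) 0 0 A B" "B \<le> A" "A \<le> B + N" "B \<le> (q - 1) * N"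
proof (cases "q = 1")
 case True
 then have "bad (t - 2) 0 0 N 0" using bad_top[OF N, of 0 0] t by simp
 then show ?thesis using that[of N 0] True by auto
next
 case False
 then have q1: "1 < q" using q by simp
 obtain A B where AB: "bad (- (of_nat 1 * t)) (of_nat (1 + 1) * t - 2) (of_nat ((1 + 1) div 2) * t - 1) A B" "B \<le> (q - 1) * N"
  using stage[OF cop t N, of 1] q1 by auto
 obtain A' B' where "bad (of_nat 1 * t - 2) (- (of_nat (1 - 1) * t)) (of_nat ((1 + 1) div 2) * t - 1 - of_nat 1 * t + 1) A' B'"
  "B' \<le> (q - 1) * N" "A' \<le> B' + N"
  using stage_step[OF cop t _ q1 AB] by auto
 then have "bad (t - 2) 0 0 A' B'" "B' \<le> (q - 1) * N" "A' \<le> B' + N" by auto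
 then show ?thesis using that bad_geq by blast
qed

section \<open>Words of the vacuum module and their zero modes\<close>

text \<open>A word \<open>[(x\<^sub>1, n\<^sub>1), (x\<^sub>2, n\<^sub>2), \<dots>]\<close> stands for the vector \<open>x\<^sub>1(- n\<^sub>1 - 1) x\<^sub>2(- n\<^sub>2 - 1) \<dots> 1\<close> of the
 vacuum module.\<close>
type_synonym word = "(sl2b \<times> nat) list"
type_synonym comb = "(complex \<times> word) list"

fun wx :: "sl2b => int" where "wx E = 1" | "wx F = -1" | "wx H = 0"
definition wt :: "word => int" where "wt w = (\<Sum>(x, n)\<leftarrow>w. wx x)"
definition dg :: "word => nat" where "dg w = (\<Sum>(x, n)\<leftarrow>w. Suc n)"

lemma wt_simps [simp]: "wt [] = 0" "wt ((x, n) # w) = wx x + wt w" by (auto simp: wt_def)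
lemma dg_simps [simp]: "dg [] = 0" "dg ((x, n) # w) = Suc n + dg w" by (auto simp: dg_def)

text \<open>Matrix coefficients of the dense \<open>sl\<^sub>2\<close>-module with basis \<open>v\<^sub>\<mu>\<close>, normalised by \<open>f v\<^sub>\<mu> = v\<^sub>\<mu>\<^sub>-\<^sub>2\<close>, on which
 twice the Casimir operator is the scalar \<open>c\<close>; a highest weight vector of weight \<open>r\<close> has \<open>c = r (r + 2)\<close>.\<close>
fun av :: "complex => sl2b => complex => complex" where
 "av c E \<mu> = (c - \<mu> * (\<mu> + 2)) / 4" | "av c F \<mu> = 1" | "av c H \<mu> = \<mu>"

text \<open>The coefficient of the zero mode of a word on top vectors, \<open>x(- n - 1) v\<close> having zero mode
 \<open>(-1)\<^sup>n o(v) x\<close>.\<close>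
fun pw :: "complex => word => complex => complex" where
 "pw c [] \<mu> = 1"
| "pw c ((x, n) # w) \<mu> = (-1) ^ n * av c x \<mu> * pw c w (\<mu> + 2 * of_int (wx x))"

definition scl :: "complex => comb => comb" where "scl a P = map (%(c, w). (a * c, w)) P"
definition pre :: "sl2b => nat => comb => comb" where "pre x n P = map (%(c, w). (c, (x, n) # w)) P"

lemma lc_scl [simp]: "lc g (scl a P) = a * lc g P" by (simp add: scl_def lc_scale)
lemma lc_pre [simp]: "lc g (pre x n P) = lc (%w. g ((x, n) # w)) P" by (simp add: pre_def lc_map1)

fun brk :: "sl2b => sl2b => (complex \<times> sl2b) list" where
 "brk E F = [(1, H)]" | "brk F E = [(-1, H)]" | "brk H E = [(2, E)]" | "brk E H = [(-2, E)]"
| "brk H F = [(-2, F)]" | "brk F H = [(2, F)]" | "brk _ _ = []"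

text \<open>The vector \<open>x(n) w\<close>, rewritten as a combination of words.\<close>
fun am :: "complex => sl2b => int => word => comb" where
 "am k x n [] = (if n < 0 then [(1, [(x, nat (- n - 1))])] else [])"
| "am k x n ((y, m) # w) = (if n < 0 then [(1, (x, nat (- n - 1)) # (y, m) # w)]
  else pre y m (am k x n w)
   @ concat (map (%(d, z). scl d (am k z (n - int m - 1) w)) (brk x y))
   @ (if n = int m + 1 \<and> trf x y \<noteq> 0 then [(of_int n * trf x y * k, w)] else []))"

lemma am_neg: "n < 0 ==> am k x n w = [(1, (x, nat (- n - 1)) # w)]"
 by (cases w) auto

lemma brk_wx: "(d, z) \<in> set (brk x y) ==> wx z = wx x + wx y"
 by (cases x; cases y) auto

lemma trf_wx: "trf x y \<noteq> 0 ==> wx x + wx y = 0"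
 by (cases x; cases y) auto

lemma set_scl: "(c, u) \<in> set (scl a P) \<longleftrightarrow> (\<exists>d. (d, u) \<in> set P \<and> c = a * d)"
 by (auto simp: scl_def)
lemma set_pre: "(c, u) \<in> set (pre x n P) \<longleftrightarrow> (\<exists>v. (c, v) \<in> set P \<and> u = (x, n) # v)"
 by (auto simp: pre_def)

lemma am_homog:
 "(c, u) \<in> set (am k x n w) ==> wt u = wx x + wt w \<and> int (dg u) = int (dg w) - n"
proof (induction w arbitrary: x n c u)
 case Nil
 then show ?case by (auto split: if_splits)
next
 case (Cons a w)
 obtain y m where a: "a = (y, m)" by (cases a)
 show ?case
 proof (cases "n < 0")
  case True
  then show ?thesis using Cons.prems by (auto simp: a)
 next
  case False
  then consider (1) v where "(c, v) \<in> set (am k x n w)" "u = (y, m) # v"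
   | (2) d z e where "(d, z) \<in> set (brk x y)" "(e, u) \<in> set (am k z (n - int m - 1) w)"
   | (3) "n = int m + 1" "trf x y \<noteq> 0" "u = w"
   using Cons.prems by (auto simp: a set_pre set_scl split: if_splits)
  then show ?thesis
  proof cases
   case 1
   then show ?thesis using Cons.IH[OF 1(1)] by (auto simp: a)
  next
   case 2
   then show ?thesis using Cons.IH[OF 2(2)] brk_wx[OF 2(1)] by (auto simp: a)
  next
   case 3
   then show ?thesis using trf_wx[OF 3(2)] by (auto simp: a)
  qed
 qed
qed

lemma am_big: "n > int (dg w) ==> am k x n w = []"
proof (rule ccontr)
 assume n: "n > int (dg w)" and "am k x n w \<noteq> []"
 then obtain c u where "(c, u) \<in> set (am k x n w)" by (metis list.set_sel(1) surj_pair)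
 then show False using am_homog[of c u k x n w] n by auto
qed

text \<open>Reading a word moves the weight by one step at a time, so a word of total weight above i
  must leave \<mu> + 2 i by a letter E, whose coefficient there is 0.\<close>

lemma pw_crossing:
 assumes "av c E (\<mu> + 2 * of_int i) = 0" "0 \<le> i" "i < wt w"
 shows "pw c w \<mu> = 0"
 using assms
proof (induction w arbitrary: \<mu> i)
 case (Cons a w)
 obtain x n where a: "a = (x, n)" by (cases a)
 show ?case
 proof (cases x)
  case E
  show ?thesis
  proof (cases "i = 0")
   case True
   then show ?thesis using Cons.prems by (simp add: a E)
  next
   case False
   have "pw c w (\<mu> + 2) = 0"
    by (rule Cons.IH[of _ "i - 1"]) (use Cons.prems False in \<open>auto simp: a E algebra_simps\<close>)
   then show ?thesis by (simp add: a E)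
  qed
 next
  case F
  have "pw c w (\<mu> - 2) = 0"
   by (rule Cons.IH[of _ "i + 1"]) (use Cons.prems in \<open>auto simp: a F algebra_simps\<close>)
  then show ?thesis by (simp add: a F)
 next
  case H
  have "pw c w \<mu> = 0"
   by (rule Cons.IH[of _ "i"]) (use Cons.prems in \<open>auto simp: a H algebra_simps\<close>)
  then show ?thesis by (simp add: a H)
 qed
qed simp

definition px :: "complex => complex => sl2b => int => word => complex => complex" where
 "px k c x n w \<mu> = lc (%u. pw c u \<mu>) (am k x n w)"

lemma lc_concat: "lc g (concat Ps) = (\<Sum>P\<leftarrow>Ps. lc g P)" by (induction Ps) auto

lemma px_neg: "n < 0 ==> px k c x n w \<mu> = (-1) ^ nat (- n - 1) * av c x \<mu> * pw c w (\<mu> + 2 * of_int (wx x))"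
 by (simp add: px_def am_neg)

lemma px_Nil: "n \<ge> 0 ==> px k c x n [] \<mu> = 0" by (simp add: px_def)

lemma px_Cons: "n \<ge> 0 ==> px k c x n ((y, m) # w) \<mu> = (-1) ^ m * av c y \<mu> * px k c x n w (\<mu> + 2 * of_int (wx y))
  + (\<Sum>(d, z)\<leftarrow>brk x y. d * px k c z (n - int m - 1) w \<mu>)
  + (if n = int m + 1 then of_int n * trf x y * k * pw c w \<mu> else 0)"
proof -
 assume n: "n \<ge> 0"
 have "lc (%u. pw c u \<mu>) (concat (map (%(d, z). scl d (am k z (n - int m - 1) w)) (brk x y)))
  = (\<Sum>(d, z)\<leftarrow>brk x y. d * px k c z (n - int m - 1) w \<mu>)"
  unfolding lc_concat px_def by (simp add: comp_def case_prod_beta')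
 then show ?thesis using n by (simp add: px_def lc_cmult)
qed

lemma px_big: "n > int (dg w) ==> px k c x n w \<mu> = 0"
 by (simp add: px_def am_big)

text \<open>The mode x(0) is a derivation, so on zero modes it becomes the commutator with
  x.\<close>

lemma px_0: "px k c x 0 w \<mu> = av c x (\<mu> + 2 * of_int (wt w)) * pw c w \<mu> - av c x \<mu> * pw c w (\<mu> + 2 * of_int (wx x))"
proof (induction w arbitrary: x \<mu>)
 case Nil
 then show ?case by (simp add: px_def)
next
 case (Cons a w)
 obtain y m where a: "a = (y, m)" by (cases a)
 have n: "nat (- (0 - int m - 1) - 1) = m" by simp
 have p: "px k c z (0 - int m - 1) w \<mu> = (-1) ^ m * av c z \<mu> * pw c w (\<mu> + 2 * of_int (wx z))" for z
  by (subst px_neg) (simp_all add: n)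
 have p': "px k c z (- int m - 1) w \<mu> = (-1) ^ m * av c z \<mu> * pw c w (\<mu> + 2 * of_int (wx z))" for z
  using p by simp
 show ?case unfolding a px_Cons[OF order_refl] Cons
  by (cases x; cases y) (simp_all add: p' field_simps)
qed

text \<open>The share of the positive modes of x in the Sugawara operator: in x'(-n) x(n) w the
  outer letter contributes the sign (-1)^(n - 1).\<close>

definition Xs :: "complex => complex => nat => sl2b => word => complex => complex" where
 "Xs k c N x w \<mu> = (\<Sum>n=1..N. (-1) ^ (n - 1) * px k c x (int n) w \<mu>)"

lemma Xs_stable: "N \<ge> dg w ==> Xs k c N x w \<mu> = Xs k c (dg w) x w \<mu>"
 unfolding Xs_def by (rule sum.mono_neutral_right) (auto simp: px_big)

text \<open>The range splits at m + 1: below it the modes are negative and all terms agree, at m + 1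
  stands the mode 0, and the rest is \<open>Xs\<close> again.\<close>

lemma Xs_shift:
 assumes "N \<ge> dg w + m + 1"
 shows "(\<Sum>n=1..N. (-1) ^ (n - 1) * px k c z (int n - int m - 1) w \<mu>)
  = (-1) ^ m * (px k c z 0 w \<mu> - of_nat m * av c z \<mu> * pw c w (\<mu> + 2 * of_int (wx z)) - Xs k c N z w \<mu>)"
proof -
 let ?f = "%n. (-1) ^ (n - 1) * px k c z (int n - int m - 1) w \<mu>"
 have "{1..N} = {1..m} \<union> ({m+1} \<union> {m+2..N})" using assms by auto
 then have "sum ?f {1..N} = sum ?f {1..m} + (?f (m + 1) + sum ?f {m+2..N})"
  by (simp only:) (subst sum.union_disjoint; (subst sum.union_disjoint)?; auto)
 also have "sum ?f {1..m} = (\<Sum>n=1..m. - ((-1) ^ m * av c z \<mu> * pw c w (\<mu> + 2 * of_int (wx z))))"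
 proof (rule sum.cong[OF refl])
  fix n assume n: "n \<in> {1..m}"
  have e: "nat (int m - int n) = m - n" using n by auto
  have "(-1 :: complex) ^ (n - 1) * (-1) ^ (m - n) = (-1) ^ (m - 1)"
   unfolding power_add[symmetric] using n by (intro arg_cong[where f = "%i. (-1) ^ i"]) auto
  also have "\<dots> = - ((-1) ^ m)" using n by (cases m) auto
  finally show "?f n = - ((-1) ^ m * av c z \<mu> * pw c w (\<mu> + 2 * of_int (wx z)))"
   using n by (subst px_neg) (simp_all add: e mult.assoc[symmetric])
 qed
 also have "\<dots> = (-1) ^ m * (- of_nat m * av c z \<mu> * pw c w (\<mu> + 2 * of_int (wx z)))" by simp
 also have "?f (m + 1) = (-1) ^ m * px k c z 0 w \<mu>" by simp
 also have "sum ?f {m+2..N} = (\<Sum>n=1..N-m-1. (-1) ^ (n + m + 1 - 1) * px k c z (int (n + m + 1) - int m - 1) w \<mu>)"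
  by (rule sum.reindex_bij_witness[where i = "%n. n + m + 1" and j = "%n. n - m - 1"]) auto
 also have "\<dots> = (\<Sum>n=1..N-m-1. - ((-1) ^ m) * ((-1) ^ (n - 1) * px k c z (int n) w \<mu>))"
 proof (rule sum.cong[OF refl])
  fix n assume "n \<in> {1..N-m-1}"
  then obtain j where "n = Suc j" by (cases n) auto
  then show "(-1) ^ (n + m + 1 - 1) * px k c z (int (n + m + 1) - int m - 1) w \<mu>
   = - ((-1) ^ m) * ((-1) ^ (n - 1) * px k c z (int n) w \<mu>)"
   by (simp add: power_add)
 qed
 also have "\<dots> = - ((-1) ^ m) * Xs k c (N - m - 1) z w \<mu>" by (simp add: Xs_def sum_distrib_left)
 also have "Xs k c (N - m - 1) z w \<mu> = Xs k c N z w \<mu>"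
  using Xs_stable[of w N] Xs_stable[of w "N - m - 1"] assms by simp
 finally show ?thesis by (simp add: algebra_simps)
qed

lemma Xs_Cons:
 assumes "N \<ge> dg w + m + 1"
 shows "Xs k c N x ((y, m) # w) \<mu> = (-1) ^ m * (av c y \<mu> * Xs k c N x w (\<mu> + 2 * of_int (wx y))
  + (\<Sum>(d, z)\<leftarrow>brk x y. d * (px k c z 0 w \<mu> - of_nat m * av c z \<mu> * pw c w (\<mu> + 2 * of_int (wx z)) - Xs k c N z w \<mu>))
  + (of_nat m + 1) * trf x y * k * pw c w \<mu>)"
proof -
 have "Xs k c N x ((y, m) # w) \<mu> = (\<Sum>n=1..N. (-1) ^ (n - 1) * ((-1) ^ m * av c y \<mu> * px k c x (int n) w (\<mu> + 2 * of_int (wx y)))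
   + (-1) ^ (n - 1) * (\<Sum>(d, z)\<leftarrow>brk x y. d * px k c z (int n - int m - 1) w \<mu>)
   + (if n = m + 1 then (-1) ^ (n - 1) * (of_nat n * trf x y * k * pw c w \<mu>) else 0))"
  unfolding Xs_def by (rule sum.cong[OF refl]) (simp add: px_Cons algebra_simps)
 also have "\<dots> = (-1) ^ m * av c y \<mu> * Xs k c N x w (\<mu> + 2 * of_int (wx y))
  + (\<Sum>n=1..N. (-1) ^ (n - 1) * (\<Sum>(d, z)\<leftarrow>brk x y. d * px k c z (int n - int m - 1) w \<mu>))
  + (-1) ^ m * ((of_nat m + 1) * trf x y * k * pw c w \<mu>)"
  unfolding sum.distrib using assms by (simp add: Xs_def sum_distrib_left algebra_simps)
 also have "(\<Sum>n=1..N. (-1) ^ (n - 1) * (\<Sum>(d, z)\<leftarrow>brk x y. d * px k c z (int n - int m - 1) w \<mu>))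
  = (\<Sum>(d, z)\<leftarrow>brk x y. d * (\<Sum>n=1..N. (-1) ^ (n - 1) * px k c z (int n - int m - 1) w \<mu>))"
  by (cases x; cases y) (simp_all add: sum_distrib_left algebra_simps sum_negf)
 also have "\<dots> = (\<Sum>(d, z)\<leftarrow>brk x y. d * ((-1) ^ m * (px k c z 0 w \<mu> - of_nat m * av c z \<mu> * pw c w (\<mu> + 2 * of_int (wx z)) - Xs k c N z w \<mu>)))"
  unfolding Xs_shift[OF assms] ..
 also have "\<dots> = (-1) ^ m * (\<Sum>(d, z)\<leftarrow>brk x y. d * (px k c z 0 w \<mu> - of_nat m * av c z \<mu> * pw c w (\<mu> + 2 * of_int (wx z)) - Xs k c N z w \<mu>))"
  by (cases x; cases y) (simp_all add: algebra_simps)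
 finally show ?thesis by (simp add: algebra_simps)
qed

text \<open>(k + 2) L_0 is half the Casimir of the zero modes plus the sum of x'(-n) x(n) over n >=
  1, and L_0 is the degree. With o the zero mode, the Casimir part consists of double commutators,
  which expand to (c / 2) o - e o f - f o e - (h o h) / 2. Working on words gives the identity
  before any quotient is taken.\<close>

theorem sugawara_words:
 assumes "N \<ge> dg w"
 shows "(k + 2) * of_nat (dg w) * pw c w \<mu> =
  c / 2 * pw c w \<mu> - av c E (\<mu> - 2 + 2 * of_int (wt w)) * pw c w (\<mu> - 2) - av c E \<mu> * pw c w (\<mu> + 2)
   - \<mu> * (\<mu> + 2 * of_int (wt w)) / 2 * pw c w \<mu>
  + Xs k c N E w (\<mu> - 2) + av c E \<mu> * Xs k c N F w (\<mu> + 2) + \<mu> / 2 * Xs k c N H w \<mu>"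
 using assms
proof (induction w arbitrary: \<mu>)
 case Nil
 have "Xs k c N x [] \<mu> = 0" for x \<mu> by (simp add: Xs_def px_Nil)
 then show ?case by (simp add: field_simps)
next
 case (Cons a w)
 obtain y m where a: "a = (y, m)" by (cases a)
 have N: "N \<ge> dg w + m + 1" "N \<ge> dg w" using Cons.prems by (auto simp: a)
 define e where "e = (-1 :: complex) ^ m"
 define R where "R \<mu> = c / 2 * pw c w \<mu> - av c E (\<mu> - 2 + 2 * of_int (wt w)) * pw c w (\<mu> - 2) - av c E \<mu> * pw c w (\<mu> + 2)
   - \<mu> * (\<mu> + 2 * of_int (wt w)) / 2 * pw c w \<mu>
  + Xs k c N E w (\<mu> - 2) + av c E \<mu> * Xs k c N F w (\<mu> + 2) + \<mu> / 2 * Xs k c N H w \<mu>" for \<mu>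
 have IH: "(k + 2) * of_nat (dg w) * pw c w \<mu> = R \<mu>" for \<mu> unfolding R_def by (rule Cons.IH[OF N(2)])
 define R' where "R' = c / 2 * pw c (a # w) \<mu> - av c E (\<mu> - 2 + 2 * of_int (wt (a # w))) * pw c (a # w) (\<mu> - 2) - av c E \<mu> * pw c (a # w) (\<mu> + 2)
   - \<mu> * (\<mu> + 2 * of_int (wt (a # w))) / 2 * pw c (a # w) \<mu>
  + Xs k c N E (a # w) (\<mu> - 2) + av c E \<mu> * Xs k c N F (a # w) (\<mu> + 2) + \<mu> / 2 * Xs k c N H (a # w) \<mu>"
 have "R' = e * av c y \<mu> * (R (\<mu> + 2 * of_int (wx y)) + (k + 2) * (of_nat m + 1) * pw c w (\<mu> + 2 * of_int (wx y)))"
  unfolding R'_def R_def a Xs_Cons[OF N(1)] e_def[symmetric] px_0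
  by (cases y) (simp_all add: e_def[symmetric] field_simps)
 then have "R' = e * av c y \<mu> * ((k + 2) * (of_nat (dg w) + of_nat m + 1) * pw c w (\<mu> + 2 * of_int (wx y)))"
  unfolding IH[symmetric] by (simp add: algebra_simps)
 then show ?case unfolding R'_def[symmetric] by (simp add: a e_def algebra_simps)
qed

section \<open>Vector-valued combinations and modules over the affine algebra\<close>

definition lin :: "(complex => 'm => 'm) => ('a => 'm) => (complex \<times> 'a) list => 'm::ab_group_add" where
 "lin s f P = (\<Sum>(c, w)\<leftarrow>P. s c (f w))"

lemma lin_simps [simp]:
 "lin s f [] = 0" "lin s f (x # P) = s (fst x) (f (snd x)) + lin s f P" "lin s f (P @ Q) = lin s f P + lin s f Q"
 by (auto simp: lin_def split: prod.splits)

lemma lin_cong: "(!!c w. (c, w) \<in> set P ==> f w = g w) ==> lin s f P = lin s g P"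
 by (induction P) (auto, metis)

locale cvs = vector_space s for s :: "complex => 'm::ab_group_add => 'm"
begin

lemma lin_map: "lin s f (map (%(c, w). (a * c, g w)) P) = s a (lin s (%w. f (g w)) P)"
 by (induction P) (auto simp: scale_right_distrib)

lemma lin_map1: "lin s f (map (%(c, w). (c, g w)) P) = lin s (%w. f (g w)) P"
 by (induction P) auto

lemma lin_scl: "lin s f (scl a P) = s a (lin s f P)"
 using lin_map[of f a "%w. w"] by (simp add: scl_def)

lemma lin_pre: "lin s f (pre x n P) = lin s (%w. f ((x, n) # w)) P"
 by (simp add: pre_def lin_map1)

lemma lin_bindc: "lin s f (bindc g P) = lin s (%w. lin s f (g w)) P"
proof (induction P)
 case (Cons a P)
 have "lin s f (map (%(d, u). (c * d, u)) Q) = s c (lin s f Q)" for c Q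
  using lin_map[of f c "%w. w" Q] by simp
 then show ?case using Cons by (simp add: bindc_def case_prod_beta)
qed (simp add: bindc_def)

lemma lin_add: "lin s (%w. f w + g w) P = lin s f P + lin s g P"
 by (induction P) (auto simp: scale_right_distrib)

lemma lin_zero: "lin s (%w. 0) P = 0"
 by (induction P) auto

lemma lin_mem: "subspace U ==> (!!c w. (c, w) \<in> set P ==> f w \<in> U) ==> lin s f P \<in> U"
proof (induction P)
 case (Cons a P)
 have "lin s f P \<in> U" using Cons by auto
 moreover have "s (fst a) (f (snd a)) \<in> U" using Cons.prems by (intro subspace_scale) (auto intro: Cons.prems(2)[of "fst a"])
 ultimately show ?case using Cons.prems(1) by (simp add: subspace_add)
qed (simp add: subspace_0)

lemma ev_am:
 assumes f: "!!x n w. f ((x, n) # w) = act x (- int n - 1) (f w)"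
  and vac: "!!x n. n \<ge> 0 ==> act x n (f []) = 0"
  and com: "!!x y n m w. n \<ge> 0 ==> act x n (act y (- int m - 1) (f w)) = act y (- int m - 1) (act x n (f w))
    + (\<Sum>(d, z)\<leftarrow>brk x y. s d (act z (n - int m - 1) (f w)))
    + (if n = int m + 1 then s (of_int n * trf x y * k) (f w) else 0)"
  and lin: "!!y m P. act y (- int m - 1) (lin s f P) = lin s (%w. act y (- int m - 1) (f w)) P"
 shows "act x n (f w) = lin s f (am k x n w)"
proof (induction w arbitrary: x n)
 case Nil
 have "- int (nat (- n - 1)) - 1 = n" if "n < 0" using that by auto
 then show ?case using vac f[of x "nat (- n - 1)" "[]"] by (auto simp: not_less)
next
 case (Cons a w)
 obtain y m where a: "a = (y, m)" by (cases a)
 show ?case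
 proof (cases "n < 0")
  case True
  then have "- int (nat (- n - 1)) - 1 = n" by auto
  then show ?thesis using f[of x "nat (- n - 1)" "a # w"] True by (simp add: a)
 next
  case False
  then have n: "n \<ge> 0" by simp
  have c: "lin s f (concat (map (%(d, z). scl d (am k z (n - int m - 1) w)) L))
   = (\<Sum>(d, z)\<leftarrow>L. s d (act z (n - int m - 1) (f w)))" for L
   by (induction L) (auto simp: lin_scl Cons)
  have "act x n (f (a # w)) = act y (- int m - 1) (lin s f (am k x n w))
    + (\<Sum>(d, z)\<leftarrow>brk x y. s d (act z (n - int m - 1) (f w)))
    + (if n = int m + 1 then s (of_int n * trf x y * k) (f w) else 0)"
   unfolding a f com[OF n] by (simp only: Cons)
  also have "\<dots> = lin s f (am k x n (a # w))"
   using n by (auto simp: a lin lin_pre f c)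
  finally show ?thesis .
 qed
qed

end

fun evw :: "(sl2b => int => 'm => 'm) => 'm => word => 'm" where
 "evw act vac [] = vac"
| "evw act vac ((x, n) # w) = act x (- int n - 1) (evw act vac w)"

locale ghat =
 fixes k :: complex and s :: "complex => 'm::ab_group_add => 'm" and act :: "sl2b => int => 'm => 'm"
 assumes gm: "ghat_module k s act"
begin

sublocale vs: cvs s using gm unfolding ghat_module_def cvs_def by blast

lemma lin_act: "Vector_Spaces.linear s s (act x n)" using gm unfolding ghat_module_def by blast

lemma act_add: "act x n (u + v) = act x n u + act x n v"
 and act_scale: "act x n (s c u) = s c (act x n u)"
 using lin_act[of x n] by (auto simp: Vector_Spaces.linear_iff)

lemma act_0 [simp]: "act x n 0 = 0"
proof -
 have "act x n 0 + act x n 0 = act x n 0 + 0" using act_add[of x n 0 0, symmetric] by simp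
 then show ?thesis by (rule add_left_imp_eq)
qed
lemma act_minus: "act x n (- u) = - act x n u"
proof (rule minus_unique[symmetric])
 show "act x n u + act x n (- u) = 0" using act_add[of x n u "- u", symmetric] by simp
qed
lemma act_diff: "act x n (u - v) = act x n u - act x n v" using act_add[of x n u "- v"] by (simp add: act_minus)
lemma act_sum: "act x n (\<Sum>i\<in>I. f i) = (\<Sum>i\<in>I. act x n (f i))"
 by (induction I rule: infinite_finite_induct) (auto simp: act_add)
lemma act_lin: "act x n (lin s f P) = lin s (%w. act x n (f w)) P"
 by (induction P) (auto simp: act_add act_scale)

lemma comm: "act x m (act y n w) = act y n (act x m w) + (\<Sum>(d, z)\<leftarrow>brk x y. s d (act z (m + n) w))
  + (if m + n = 0 then s (of_int m * trf x y * k) w else 0)"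
proof -
 have "act x m (act y n w) - act y n (act x m w) =
    (\<Sum>z\<in>{E, F, H}. s (br x y z) (act z (m + n) w)) +
    (if m + n = 0 then s (of_int m * trf x y * k) w else 0)"
  using gm unfolding ghat_module_def by blast
 moreover have "(\<Sum>z\<in>{E, F, H}. s (br x y z) (act z (m + n) w)) = (\<Sum>(d, z)\<leftarrow>brk x y. s d (act z (m + n) w))"
  by (cases x; cases y) auto
 ultimately have "act x m (act y n w) - act y n (act x m w) = (\<Sum>(d, z)\<leftarrow>brk x y. s d (act z (m + n) w)) +
    (if m + n = 0 then s (of_int m * trf x y * k) w else 0)" by (simp only:)
 then have "act x m (act y n w) = (\<Sum>(d, z)\<leftarrow>brk x y. s d (act z (m + n) w)) +
    (if m + n = 0 then s (of_int m * trf x y * k) w else 0) + act y n (act x m w)" by (simp only: diff_eq_eq)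
 then show ?thesis by (simp only: ac_simps)
qed

lemma comm_EF: "act E m (act F n w) = act F n (act E m w) + act H (m + n) w + (if m + n = 0 then s (of_int m * k) w else 0)"
 and comm_FE: "act F m (act E n w) = act E n (act F m w) - act H (m + n) w + (if m + n = 0 then s (of_int m * k) w else 0)"
 and comm_HE: "act H m (act E n w) = act E n (act H m w) + s 2 (act E (m + n) w)"
 and comm_HF: "act H m (act F n w) = act F n (act H m w) - s 2 (act F (m + n) w)"
 and comm_HH: "act H m (act H n w) = act H n (act H m w) + (if m + n = 0 then s (of_int m * 2 * k) w else 0)"
 and comm_EE: "act E m (act E n w) = act E n (act E m w)"
 and comm_FF: "act F m (act F n w) = act F n (act F m w)"
proof -
 show "act E m (act F n w) = act F n (act E m w) + act H (m + n) w + (if m + n = 0 then s (of_int m * k) w else 0)"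
  by (subst comm) simp
 show "act F m (act E n w) = act E n (act F m w) - act H (m + n) w + (if m + n = 0 then s (of_int m * k) w else 0)"
  by (subst comm) simp
 show "act H m (act E n w) = act E n (act H m w) + s 2 (act E (m + n) w)"
  by (subst comm) simp
 show "act H m (act F n w) = act F n (act H m w) - s 2 (act F (m + n) w)"
  by (subst comm) simp
 show "act H m (act H n w) = act H n (act H m w) + (if m + n = 0 then s (of_int m * 2 * k) w else 0)"
  by (subst comm) simp
 show "act E m (act E n w) = act E n (act E m w)"
  by (subst comm) simp
 show "act F m (act F n w) = act F n (act F m w)"
  by (subst comm) simp
qed

lemma subspace_full:
 assumes irr: "ghat_irred s act" and U: "vs.subspace U" "!!x n u. u \<in> U ==> act x n u \<in> U" "u \<in> U" "u \<noteq> 0"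
 shows "v \<in> U"
proof -
 have "U = UNIV" using irr U unfolding ghat_irred_def by (metis singletonD)
 then show ?thesis by simp
qed

text \<open>The bracket of e(0) and f(1) is h(1), and bracketing with h(1) raises the modes of e and
  f one at a time.\<close>

lemma nplus:
 assumes "act E 0 v = 0" "act F 1 v = 0"
 shows "n \<ge> 1 ==> act x n v = 0"
proof -
 have h1: "act H 1 v = 0" using comm_EF[of 0 1 v] assms by simp
 have sc: "s 2 u = 0 \<longleftrightarrow> u = 0" for u by simp
 have e: "act E (int n) v = 0" for n
 proof (induction n)
  case (Suc n)
  have "s 2 (act E (1 + int n) v) = 0" using comm_HE[of 1 "int n" v] h1 Suc by simp
  then show ?case by simp
 qed (use assms in simp)
 have f: "act F (int (Suc n)) v = 0" for n
 proof (induction n)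
  case (Suc n)
  have "s 2 (act F (1 + int (Suc n)) v) = 0" using comm_HF[of 1 "int (Suc n)" v] h1 Suc by simp
  then show ?case by simp
 qed (use assms in simp)
 have h: "act H (int (Suc n)) v = 0" for n
  using comm_EF[of 0 "int (Suc n)" v] e[of 0] f[of n] by simp
 assume n: "n \<ge> 1"
 define j where "j = nat (n - 1)"
 have nj: "n = int (Suc j)" using n by (simp add: j_def)
 show "act x n v = 0"
  by (cases x) (use e[of "Suc j"] f[of j] h[of j] in \<open>auto simp: nj\<close>)
qed

inductive_set clo :: "'m => 'm set" for v where
 clo_base: "v \<in> clo v"
| clo_step: "u \<in> clo v ==> n \<le> 0 ==> act x n u \<in> clo v"

text \<open>A positive mode moves right past the nonpositive ones until it reaches v; the brackets
  left behind are covered by the induction hypothesis.\<close>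

lemma clo_stable:
 assumes "!!x n. n \<ge> 1 ==> act x n v = 0" "u \<in> clo v"
 shows "act x n u \<in> vs.span (clo v)"
 using assms(2)
proof (induction arbitrary: x n)
 case clo_base
 show ?case
 proof (cases "n \<le> 0")
  case True
  then show ?thesis using clo.clo_step[OF clo.clo_base] by (auto intro: vs.span_base)
 next
  case False
  then show ?thesis using assms(1)[of n x] by (simp add: vs.span_zero)
 qed
next
 case (clo_step u m y)
 have l: "(\<Sum>(d, z)\<leftarrow>L. s d (act z (n + m) u)) \<in> vs.span (clo v)" for L
  by (induction L) (auto intro!: vs.span_add vs.span_scale clo_step.IH vs.span_zero)
 have "act y m w \<in> vs.span (clo v)" if "w \<in> vs.span (clo v)" for w
  using that
 proof (induction rule: vs.span_induct_alt)
  case (step c w' z)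
  then show ?case using clo.clo_step[OF step(1) clo_step.hyps(2), of y]
   by (simp add: act_add act_scale vs.span_add vs.span_scale vs.span_base)
 qed (simp add: vs.span_zero)
 then have "act y m (act x n u) \<in> vs.span (clo v)" using clo_step.IH by blast
 moreover have "(if n + m = 0 then s (of_int n * trf x y * k) u else 0) \<in> vs.span (clo v)"
  using clo_step.hyps(1) by (auto intro: vs.span_scale vs.span_zero vs.span_base)
 ultimately show ?case unfolding comm[of x n y m u] using l by (intro vs.span_add)
qed

lemma act_span:
 assumes "!!x n u. u \<in> B ==> act x n u \<in> vs.span B" "w \<in> vs.span B"
 shows "act x n w \<in> vs.span B"
 using assms(2)
proof (induction rule: vs.span_induct_alt)
 case (step c w' z)
 then show ?case using assms(1)[of w'] by (simp add: act_add act_scale vs.span_add vs.span_scale)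
qed (simp add: vs.span_zero)

lemma clo_span:
 assumes irr: "ghat_irred s act" and v: "!!x n. n \<ge> 1 ==> act x n v = 0" "v \<noteq> 0"
 shows "w \<in> vs.span (clo v)"
 by (rule subspace_full[OF irr vs.subspace_span])
  (use act_span[of "clo v"] clo_stable[OF v(1)] vs.span_base[OF clo_base[of v]] v(2) in auto)

text \<open>A singular vector of depth d > 0 generates the whole module by nonpositive modes alone,
  hence only depths at least d, and the vector \<open>w0\<close> of depth 0 is out of reach.\<close>

lemma no_singular:
 fixes Gr :: "int => 'm set"
 assumes irr: "ghat_irred s act" and v: "!!x n. n \<ge> 1 ==> act x n v = 0" "v \<in> Gr d" "d > 0"
  and sub: "!!d. vs.subspace (Gr d)"
  and Gr: "!!d x n u. u \<in> Gr d ==> act x n u \<in> Gr (d - n)"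
  and indep: "!!D g. finite D ==> (!!d. d \<in> D ==> g d \<in> Gr d) ==> (\<Sum>d\<in>D. g d) = 0 ==> (!!d. d \<in> D ==> g d = 0)"
  and top: "w0 \<in> Gr 0" "w0 \<noteq> 0"
 shows "v = 0"
proof (rule ccontr)
 assume nz: "v \<noteq> 0"
 have c: "\<exists>d' \<ge> d. u \<in> Gr d'" if "u \<in> clo v" for u
  using that
 proof induction
  case clo_base
  then show ?case using v(2) by blast
 next
  case (clo_step u n x)
  then obtain d' where "d' \<ge> d" "u \<in> Gr d'" by blast
  then show ?case using Gr[of u d' x n] clo_step.hyps(2) by (intro exI[of _ "d' - n"]) auto
 qed
 have ex: "\<exists>D g. finite D \<and> (\<forall>d'\<in>D. d' \<ge> d \<and> g d' \<in> Gr d') \<and> w = (\<Sum>d'\<in>D. g d')" if "w \<in> vs.span (clo v)" for w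
  using that
 proof (induction rule: vs.span_induct_alt)
  case base
  show ?case by (rule exI[of _ "{}"]) auto
 next
  case (step c u w)
  from step.IH obtain D g where D0: "finite D \<and> (\<forall>d'\<in>D. d' \<ge> d \<and> g d' \<in> Gr d') \<and> w = (\<Sum>d'\<in>D. g d')"
   by (elim exE)
  then have D: "finite D" "!!d'. d'\<in>D ==> d' \<ge> d \<and> g d' \<in> Gr d'" "w = (\<Sum>d'\<in>D. g d')"
   by blast+
  obtain e where e: "e \<ge> d" "u \<in> Gr e" using c[OF step(1)] by blast
  define g' where "g' d' = (if d' = e then s c u else 0) + (if d' \<in> D then g d' else 0)" for d'
  have "(\<Sum>d'\<in>insert e D. g' d') = s c u + w"
  proof -
   have "(\<Sum>d'\<in>insert e D. g' d') = (\<Sum>d'\<in>insert e D. if d' = e then s c u else 0) + (\<Sum>d'\<in>insert e D. if d' \<in> D then g d' else 0)"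
    by (simp only: g'_def sum.distrib)
   also have "(\<Sum>d'\<in>insert e D. if d' \<in> D then g d' else 0) = w"
    unfolding D(3) using D(1) by (intro sum.mono_neutral_cong_right) auto
   finally show ?thesis using D(1) by simp
  qed
  moreover have "\<forall>d'\<in>insert e D. d' \<ge> d \<and> g' d' \<in> Gr d'"
   using e D(2) by (auto simp: g'_def intro!: vs.subspace_add[OF sub] vs.subspace_scale[OF sub] vs.subspace_0[OF sub])
  ultimately show ?case using D(1)
   by (intro exI[of _ "insert e D"] exI[of _ g'] conjI) (simp_all only: finite_insert)
 qed
 have "w0 \<in> vs.span (clo v)" by (rule clo_span[OF irr _ nz]) (rule v(1))
 from ex[OF this] obtain D g where D0: "finite D \<and> (\<forall>d'\<in>D. d' \<ge> d \<and> g d' \<in> Gr d') \<and> w0 = (\<Sum>d'\<in>D. g d')"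
  by (elim exE)
 then have D: "finite D" "!!d'. d'\<in>D ==> d' \<ge> d \<and> g d' \<in> Gr d'" "w0 = (\<Sum>d'\<in>D. g d')"
  by blast+
 \<comment> \<open>Placing - w0 in depth 0 turns the expansion of w0 into a vanishing sum of
   homogeneous vectors.\<close>
 define g' where "g' d' = (if d' = 0 then - w0 else g d')" for d'
 have "0 \<notin> D" using D(2)[of 0] v(3) by auto
 moreover have "(\<Sum>d'\<in>D. g' d') = (\<Sum>d'\<in>D. g d')"
  by (rule sum.cong) (use \<open>0 \<notin> D\<close> in \<open>auto simp: g'_def\<close>)
 moreover have "g' 0 = - w0" by (simp add: g'_def)
 ultimately have "(\<Sum>d'\<in>insert 0 D. g' d') = - w0 + (\<Sum>d'\<in>D. g d')"
  using sum.insert[OF D(1) \<open>0 \<notin> D\<close>, of g'] by (simp only:)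
 then have "(\<Sum>d'\<in>insert 0 D. g' d') = 0" using D(3) by simp
 moreover have "g' d' \<in> Gr d'" if "d' \<in> insert 0 D" for d'
  using D(2)[of d'] that top(1) vs.subspace_neg[OF sub, of w0 0] that by (auto simp: g'_def)
 ultimately have "g' 0 = 0" using D(1) by (intro indep[of "insert 0 D" g' 0]) simp_all
 then show False using top by (simp add: g'_def)
qed

end

lemma graded_indep:
 assumes "vector_space s" "graded_decomp s Wg" "finite D" "!!d. d \<in> D ==> g d \<in> Wg d" "(\<Sum>d\<in>D. g d) = 0" "d \<in> D"
 shows "g d = 0"
proof -
 interpret vector_space s by fact
 have sub: "subspace (Wg d)" for d using assms(2) unfolding graded_decomp_def by blast
 define c where "c d = (if d \<in> D then g d else 0)" for d
 have f: "finite {d. c d \<noteq> 0}" by (rule finite_subset[OF _ assms(3)]) (auto simp: c_def)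
 have c: "\<forall>d. c d \<in> Wg d" using assms(4) subspace_0[OF sub] by (auto simp: c_def)
 have "(\<Sum>d\<in>{d. c d \<noteq> 0}. c d) = (\<Sum>d\<in>D. c d)"
  using assms(3) by (intro sum.mono_neutral_left) (auto simp: c_def)
 also have "\<dots> = (\<Sum>d\<in>D. g d)" by (rule sum.cong) (auto simp: c_def)
 finally have s0: "0 = (\<Sum>d\<in>{d. c d \<noteq> 0}. c d)" using assms(5) by simp
 define Q where "Q c \<longleftrightarrow> (\<forall>d. c d \<in> Wg d) \<and> finite {d. c d \<noteq> 0} \<and> 0 = (\<Sum>d\<in>{d. c d \<noteq> 0}. c d)" for c
 have ex: "\<exists>!c. Q c" using assms(2) unfolding graded_decomp_def Q_def by blast
 moreover have "Q c" unfolding Q_def using c f s0 by blast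
 moreover have "Q (%_. 0)" unfolding Q_def using subspace_0[OF sub] by simp
 ultimately have "c = (%_. 0)" by blast
 then have "c d = 0" by simp
 then show ?thesis using assms(6) by (simp add: c_def)
qed

section \<open>The simple vertex algebra and its relations\<close>

locale Lk0 =
 fixes k :: complex and sV :: "complex => 'v::ab_group_add => 'v" and Y :: "'v => int => 'v => 'v"
  and one :: 'v and a :: "sl2b => 'v" and Vg :: "nat => 'v set"
 assumes L: "is_Lk0 k sV Y one a Vg"
begin

definition act :: "sl2b => int => 'v => 'v" where "act x n = Y (a x) n"

lemma gmV: "ghat_module k sV act" and irrV: "ghat_irred sV act" and one_nz: "one \<noteq> 0"
 and one_Vg: "one \<in> Vg 0" and a_Vg: "a x \<in> Vg 1" and grV: "graded_decomp sV Vg" and gcV: "grading_compat Vg Vg Y"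
 and vaV: "vertex_algebra sV Y one"
 using L unfolding is_Lk0_def act_def[abs_def] by blast+

sublocale V: ghat k sV act by unfold_locales (rule gmV)

lemma vac: "n \<ge> 0 ==> act x n one = 0"
 using vaV unfolding vertex_algebra_def act_def by blast

abbreviation ev :: "word => 'v" where "ev \<equiv> evw act one"

lemma act_ev: "act x n (ev w) = lin sV ev (am k x n w)"
proof (rule V.vs.ev_am)
 show "act x n (act y (- int m - 1) (ev w)) = act y (- int m - 1) (act x n (ev w))
    + (\<Sum>(d, z)\<leftarrow>brk x y. sV d (act z (n - int m - 1) (ev w)))
    + (if n = int m + 1 then sV (of_int n * trf x y * k) (ev w) else 0)" for x y n m w
 proof -
  have e: "n + (- int m - 1) = n - int m - 1" "(n - int m - 1 = 0) = (n = int m + 1)" by auto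
  show ?thesis using V.comm[of x n y "- int m - 1" "ev w"] unfolding e .
 qed
qed (auto simp: vac V.act_lin)

text \<open>The relations among words in V. They represent the maximal ideal of the universal vacuum
  module, which is itself never constructed.\<close>

definition J :: "comb => bool" where "J P \<longleftrightarrow> lin sV ev P = 0"

definition amP :: "sl2b => int => comb => comb" where "amP x n P = bindc (am k x n) P"

lemma lin_amP: "lin sV ev (amP x n P) = act x n (lin sV ev P)"
 unfolding amP_def V.vs.lin_bindc V.act_lin by (rule lin_cong) (simp add: act_ev)

lemma lin_preP: "lin sV ev (pre x n P) = act x (- int n - 1) (lin sV ev P)"
 by (simp add: V.vs.lin_pre V.act_lin)

lemma J_amP: "J P ==> J (amP x n P)" by (simp add: J_def lin_amP)
lemma J_pre: "J P ==> J (pre x n P)" by (simp add: J_def lin_preP)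
lemma J_append: "J P ==> J Q ==> J (P @ Q)" by (simp add: J_def)

lemma span_ev: "\<exists>P. v = lin sV ev P"
proof -
 define U where "U = range (lin sV ev)"
 have "V.vs.subspace U" unfolding V.vs.subspace_def
 proof (intro conjI allI ballI)
  show "0 \<in> U" unfolding U_def by (metis lin_simps(1) rangeI)
  show "x + y \<in> U" if "x \<in> U" "y \<in> U" for x y using that unfolding U_def by (auto simp: lin_simps(3)[symmetric] simp del: lin_simps)
  show "sV c x \<in> U" if "x \<in> U" for c x using that unfolding U_def by (auto simp: V.vs.lin_scl[symmetric])
 qed
 moreover have "act x n u \<in> U" if "u \<in> U" for x n u using that unfolding U_def by (auto simp: lin_amP[symmetric])
 moreover have "one \<in> U" unfolding U_def by (rule range_eqI[of _ _ "[(1, [])]"]) simp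
 ultimately show ?thesis using V.subspace_full[OF irrV, of U one v] one_nz unfolding U_def by auto
qed

text \<open>The grading continued by 0 to negative degrees, so that modes shift it
  uniformly.\<close>

definition Gr :: "int => 'v set" where "Gr d = (if d \<ge> 0 then Vg (nat d) else {0})"

lemma sub_Vg: "V.vs.subspace (Vg d)" using grV unfolding graded_decomp_def by blast
lemma sub_Gr: "V.vs.subspace (Gr d)" by (simp add: Gr_def sub_Vg V.vs.subspace_single_0)

lemma act_Gr: "u \<in> Gr d ==> act x n u \<in> Gr (d - n)"
proof (cases "d \<ge> 0")
 case True
 assume "u \<in> Gr d"
 then have "u \<in> Vg (nat d)" using True by (simp add: Gr_def)
 then have "Y (a x) n u \<in> (if int (nat d) + int 1 - n - 1 \<ge> 0 then Vg (nat (int (nat d) + int 1 - n - 1)) else {0})"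
  using gcV a_Vg[of x] unfolding grading_compat_def by blast
 then show ?thesis using True by (simp add: Gr_def act_def split: if_splits)
next
 case False
 assume "u \<in> Gr d"
 then have "u = 0" using False by (simp add: Gr_def)
 then show ?thesis using V.vs.subspace_0[OF sub_Gr, of "d - n"] by simp
qed

lemma Gr_indep: "finite D ==> (!!d. d \<in> D ==> g d \<in> Gr d) ==> (\<Sum>d\<in>D. g d) = 0 ==> d \<in> D ==> g d = 0"
proof -
 assume D: "finite D" "!!d. d \<in> D ==> g d \<in> Gr d" "(\<Sum>d\<in>D. g d) = 0" "d \<in> D"
 have neg: "g d = 0" if "d \<in> D" "d < 0" for d using D(2)[OF that(1)] that(2) by (simp add: Gr_def)
 have "(\<Sum>d\<in>D. g d) = (\<Sum>d\<in>{d\<in>D. d \<ge> 0}. g d)"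
  using D(1) neg by (intro sum.mono_neutral_right) (auto simp: not_le)
 also have "\<dots> = (\<Sum>d\<in>nat ` {d\<in>D. d \<ge> 0}. g (int d))"
  by (subst sum.reindex) (auto simp: inj_on_def intro!: sum.cong)
 finally have s: "(\<Sum>d\<in>nat ` {d\<in>D. d \<ge> 0}. g (int d)) = 0" using D(3) by simp
 show "g d = 0"
 proof (cases "d \<ge> 0")
  case True
  have "g (int (nat d)) = 0"
  proof (rule graded_indep[OF V.vs.vector_space_axioms grV _ _ s])
   show "finite (nat ` {d \<in> D. 0 \<le> d})" using D(1) by simp
   show "g (int d) \<in> Vg d" if m: "d \<in> nat ` {d \<in> D. 0 \<le> d}" for d
   proof -
    from m obtain e where "e \<in> D" "e \<ge> 0" "d = nat e" by auto
    then show ?thesis using D(2)[of e] by (simp add: Gr_def)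
   qed
   show "nat d \<in> nat ` {d \<in> D. 0 \<le> d}" using True D(4) by auto
  qed
  then show ?thesis using True by simp
 qed (use neg D(4) in auto)
qed

lemma singular_zero:
 assumes "v \<in> Gr d" "d > 0" "!!x n. n \<ge> 1 ==> act x n v = 0"
 shows "v = 0"
 using assms(3) assms(1,2) sub_Gr act_Gr Gr_indep
 by (rule V.no_singular[OF irrV]) (use one_Vg one_nz in \<open>auto simp: Gr_def\<close>)

lemma ev_Gr: "ev w \<in> Gr (int (dg w))"
proof (induction w)
 case Nil
 then show ?case using one_Vg by (simp add: Gr_def)
next
 case (Cons b w)
 obtain x n where b: "b = (x, n)" by (cases b)
 show ?case using act_Gr[OF Cons, of x "- int n - 1"] by (simp add: b algebra_simps)
qed

lemma J_degree:
 assumes "J P" shows "J (filter (%(c, w). dg w = d) P)"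
proof -
 define g where "g e = lin sV ev (filter (%(c, w). dg w = nat e) P)" for e
 define D where "D = (%(c, w). int (dg w)) ` set P"
 have "g e \<in> Gr e" if "e \<in> D" for e
  unfolding g_def
 proof (rule V.vs.lin_mem[OF sub_Gr])
  fix c w assume "(c, w) \<in> set (filter (%(c, w). dg w = nat e) P)"
  then have "int (dg w) = e" using that by (auto simp: D_def)
  then show "ev w \<in> Gr e" using ev_Gr[of w] by simp
 qed
 moreover have "(\<Sum>e\<in>D. g e) = lin sV ev P"
 proof -
  have "(\<Sum>e\<in>D'. lin sV ev (filter (%(c, w). dg w = nat e) P)) = lin sV ev P"
   if "finite D'" "(%(c, w). int (dg w)) ` set P \<subseteq> D'" "\<forall>e\<in>D'. e \<ge> 0" for D'
   using that
  proof (induction P)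
   case (Cons b P)
   obtain c w where b: "b = (c, w)" by (cases b)
   have "(\<Sum>e\<in>D'. lin sV ev (filter (%(c, w). dg w = nat e) (b # P)))
    = (\<Sum>e\<in>D'. (if e = int (dg w) then sV c (ev w) else 0) + lin sV ev (filter (%(c, w). dg w = nat e) P))"
    by (rule sum.cong) (use Cons.prems in \<open>auto simp: b\<close>)
   also have "\<dots> = sV c (ev w) + lin sV ev P"
    unfolding sum.distrib using Cons by (auto simp: b)
   finally show ?case by (simp add: b)
  qed simp
  from this[of D] show ?thesis unfolding g_def by (simp add: D_def case_prod_beta)
 qed
 moreover have fin: "finite D" by (simp add: D_def)
 ultimately have z: "g e = 0" if "e \<in> D" for e using Gr_indep[of D g e] assms that by (simp add: J_def)
 show ?thesis
 proof (cases "int d \<in> D")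
  case True
  then show ?thesis using z[OF True] by (simp add: g_def J_def)
 next
  case False
  then have "filter (%(c, w). dg w = d) P = []" by (auto simp: D_def filter_empty_conv)
  then show ?thesis by (simp add: J_def)
 qed
qed

subsection \<open>Words in the simple root vectors\<close>

text \<open>Here y_0 = e(-1) and y_1 = f(0); the matching raising operators are f(1) and e(0), and
  the highest weight is (k, 0).\<close>

fun evy :: "bool list => 'v" where
 "evy [] = one" | "evy (False # w) = act E (-1) (evy w)" | "evy (True # w) = act F 0 (evy w)"

lemma act_H0_evy: "act H 0 (evy w) = sV (2 * of_nat (c0 w) - 2 * of_nat (c1 w)) (evy w)"
proof (induction w)
 case (Cons i w)
 define c where "c = 2 * of_nat (c0 w) - (2 * of_nat (c1 w) :: complex)"
 show ?case
 proof (cases i)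
  case True
  have "act H 0 (evy (i # w)) = sV c (act F 0 (evy w)) - sV 2 (act F 0 (evy w))"
   using True V.comm_HF[of 0 0 "evy w"] by (simp add: Cons V.act_scale c_def)
  also have "\<dots> = sV (c - 2) (evy (i # w))"
   using True V.vs.scale_left_diff_distrib[of c 2 "act F 0 (evy w)"] by simp
  also have "c - 2 = 2 * of_nat (c0 (i # w)) - 2 * of_nat (c1 (i # w))" using True by (simp add: c_def)
  finally show ?thesis .
 next
  case False
  have "act H 0 (evy (i # w)) = sV c (act E (-1) (evy w)) + sV 2 (act E (-1) (evy w))"
   using False V.comm_HE[of 0 "-1" "evy w"] by (simp add: Cons V.act_scale c_def)
  also have "\<dots> = sV (c + 2) (evy (i # w))"
   using False V.vs.scale_left_distrib[of c 2 "act E (-1) (evy w)"] by simp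
  also have "c + 2 = 2 * of_nat (c0 (i # w)) - 2 * of_nat (c1 (i # w))" using False by (simp add: c_def)
  finally show ?thesis .
 qed
qed (simp add: vac)

lemma lin_prefix: "lin sV evy (map (%(c, u). (c, j # u)) P) = act (if j then F else E) (if j then 0 else -1) (lin sV evy P)"
 by (induction P) (auto simp: V.act_add V.act_scale)

lemma act_dl0: "act F 1 (evy w) = lin sV evy (dl k 0 False w)"
proof (induction w)
 case (Cons i w)
 show ?case
 proof (cases i)
  case True
  then show ?thesis using Cons V.comm_FF[of 1 0 "evy w"] by (simp add: lin_prefix)
 next
  case False
  define c where "c = 2 * of_nat (c0 w) - (2 * of_nat (c1 w) :: complex)"
  have "act F 1 (act E (-1) (evy w)) = act E (-1) (act F 1 (evy w)) - sV c (evy w) + sV k (evy w)"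
   using V.comm_FE[of 1 "-1" "evy w"] by (simp add: act_H0_evy c_def)
  also have "\<dots> = act E (-1) (act F 1 (evy w)) + sV (k - c) (evy w)"
   by (simp add: V.vs.scale_left_diff_distrib)
  also have "k - c = kap k 0 False w" by (simp add: c_def kap_def)
  finally have "act F 1 (act E (-1) (evy w)) = act E (-1) (act F 1 (evy w)) + sV (kap k 0 False w) (evy w)" .
  then show ?thesis using False Cons by (simp add: lin_prefix)
 qed
qed (simp add: vac)

lemma act_dl1: "act E 0 (evy w) = lin sV evy (dl k 0 True w)"
proof (induction w)
 case (Cons i w)
 show ?case
 proof (cases i)
  case False
  then show ?thesis using Cons V.comm_EE[of 0 "-1" "evy w"] by (simp add: lin_prefix)
 next
  case True
  have "act E 0 (act F 0 (evy w)) = act F 0 (act E 0 (evy w)) + sV (kap k 0 True w) (evy w)"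
   using V.comm_EF[of 0 0 "evy w"] by (simp add: act_H0_evy kap_def)
  then show ?thesis using True Cons by (simp add: lin_prefix)
 qed
qed (simp add: vac)

lemma evy_Gr: "evy w \<in> Gr (int (c0 w))"
proof (induction w)
 case Nil
 then show ?case using one_Vg by (simp add: Gr_def)
next
 case (Cons i w)
 show ?case using act_Gr[OF Cons, of E "-1"] act_Gr[OF Cons, of F 0] by (cases i) (auto simp: algebra_simps)
qed

lemma evy_c0: "c0 w = 0 ==> w \<noteq> [] ==> evy w = 0"
proof (induction w)
 case (Cons i w)
 then show ?case by (cases i; cases "w = []") (auto simp: vac)
qed simp

text \<open>By induction all raised images vanish in V, so the image is a singular vector of
  positive degree and irreducibility kills it. In degree 0 a nonempty word in f(0) annihilates the
  vacuum.\<close>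

lemma Rad_zero:
 assumes "homog A B P" "Rad k 0 P" shows "lin sV evy P = 0"
 using assms
proof (induction "A + B" arbitrary: A B P rule: less_induct)
 case less
 show ?case
 proof (cases "A = 0")
  case True
  show ?thesis
  proof (cases "B = 0")
   case True
   have w: "w = []" if "(c, w) \<in> set P" for c w
    using less.prems(1) that length_c[of w] True \<open>A = 0\<close> by (auto simp: homog_def)
   have "lin sV evy P = lin sV (%_. one) P" by (rule lin_cong) (auto dest: w)
   also have "\<dots> = sV (lc (%_. 1) P) one"
    by (induction P) (auto simp: V.vs.scale_left_distrib)
   also have "lc (%_. 1) P = lc ind P" by (rule lc_cong) (auto dest: w simp: ind_def)
   also have "lc ind P = 0" using less.prems(2)[unfolded Rad_def, rule_format, of "[]"] by simp
   finally show ?thesis by simp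
  next
   case False
   have "lin sV evy P = lin sV (%_. 0) P"
    by (rule lin_cong, rule evy_c0) (use less.prems(1) \<open>A = 0\<close> False in \<open>auto simp: homog_def\<close>)
   then show ?thesis by (simp add: V.vs.lin_zero)
  qed
 next
  case False
  have mem: "lin sV evy P \<in> Gr (int A)"
  proof (rule V.vs.lin_mem[OF sub_Gr])
   fix c w assume "(c, w) \<in> set P"
   then show "evy w \<in> Gr (int A)" using evy_Gr[of w] less.prems(1) by (auto simp: homog_def)
  qed
  have 0: "act F 1 (lin sV evy P) = 0"
  proof -
   have "act F 1 (lin sV evy P) = lin sV evy (dP k 0 False P)"
    unfolding dP_def V.vs.lin_bindc V.act_lin by (rule lin_cong) (simp add: act_dl0)
   also have "\<dots> = 0" using less.hyps[OF _ homog_dP0[OF less.prems(1)] Rad_dP[OF less.prems(2)]] False by simp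
   finally show ?thesis .
  qed
  have 1: "act E 0 (lin sV evy P) = 0"
  proof -
   have "act E 0 (lin sV evy P) = lin sV evy (dP k 0 True P)"
    unfolding dP_def V.vs.lin_bindc V.act_lin by (rule lin_cong) (simp add: act_dl1)
   also have "\<dots> = 0"
   proof (cases "B = 0")
    case True
    then show ?thesis using dP_empty1[of A P] less.prems(1) by simp
   next
    case False
    then show ?thesis using less.hyps[OF _ homog_dP1[OF less.prems(1)] Rad_dP[OF less.prems(2)]] by simp
   qed
   finally show ?thesis .
  qed
  show ?thesis using singular_zero[OF mem] V.nplus[OF 1 0] False by simp
 qed
qed

fun conv :: "bool list => comb" where
 "conv [] = [(1, [])]" | "conv (False # w) = pre E 0 (conv w)" | "conv (True # w) = amP F 0 (conv w)"

lemma lin_conv: "lin sV ev (conv w) = evy w"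
proof (induction w)
 case (Cons i w)
 then show ?case by (cases i) (simp_all add: lin_preP lin_amP)
qed simp

lemma conv_homog: "(c, u) \<in> set (conv w) ==> wt u = int (c0 w) - int (c1 w) \<and> dg u = c0 w"
proof (induction w arbitrary: c u)
 case (Cons i w)
 show ?case
 proof (cases i)
  case True
  then obtain d v e where "(d, v) \<in> set (conv w)" "(e, u) \<in> set (am k F 0 v)"
   using Cons.prems set_bindc[of c u "am k F 0" "conv w"] by (auto simp: amP_def)
  then show ?thesis using Cons.IH[of d v] am_homog[of e u k F 0 v] True by auto
 qed (use Cons in \<open>auto simp: set_pre\<close>)
qed simp

end

subsection \<open>Zero modes on the top level\<close>

definition pm :: "int => complex => comb => complex => complex" where
 "pm m c P \<mu> = lc (%w. if wt w = m then pw c w \<mu> else 0) P"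

lemma pm_simps [simp]: "pm m c [] \<mu> = 0" "pm m c (P @ Q) \<mu> = pm m c P \<mu> + pm m c Q \<mu>"
 by (auto simp: pm_def)

lemma pm_scl: "pm m c (scl a P) \<mu> = a * pm m c P \<mu>" by (simp add: pm_def)

lemma pm_pre: "pm m c (pre x n P) \<mu> = (-1) ^ n * av c x \<mu> * pm (m - wx x) c P (\<mu> + 2 * of_int (wx x))"
proof -
 have "(%w. if wt ((x, n) # w) = m then pw c ((x, n) # w) \<mu> else 0)
  = (%w. (-1) ^ n * av c x \<mu> * (if wt w = m - wx x then pw c w (\<mu> + 2 * of_int (wx x)) else 0))" by auto
 then show ?thesis unfolding pm_def lc_pre by (simp only: lc_cmult)
qed

lemma pm_crossing:
 assumes "av c E (\<mu> + 2 * of_int i) = 0" "0 \<le> i" "i < m"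
 shows "pm m c P \<mu> = 0"
proof -
 have "pm m c P \<mu> = lc (%w. 0) P"
  unfolding pm_def by (rule lc_cong) (use pw_crossing[OF assms(1,2)] assms(3) in auto)
 then show ?thesis by simp
qed

lemma pm_am: "pm m c (am k x n w) \<mu> = (if wt w = m - wx x then px k c x n w \<mu> else 0)"
proof (cases "wt w = m - wx x")
 case True
 then have "pm m c (am k x n w) \<mu> = px k c x n w \<mu>"
  unfolding pm_def px_def by (intro lc_cong) (use am_homog in auto)
 then show ?thesis using True by simp
next
 case False
 then have "pm m c (am k x n w) \<mu> = lc (%w. 0) (am k x n w)"
  unfolding pm_def by (intro lc_cong) (use am_homog in auto)
 then show ?thesis using False by simp
qed

lemma polyf_pw: "polyf (pw c w)"
proof (induction w)
 case Nil
 have "pw c [] = (%\<mu>. 1)" by auto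
 then show ?case by (simp add: polyf_intros)
next
 case (Cons b w)
 obtain x n where b: "b = (x, n)" by (cases b)
 have 1: "polyf (av c x)"
 proof (cases x)
  case E
  have "polyf (%\<mu>. (1 / 4) * (c - \<mu> * (\<mu> + 2)))" by (intro polyf_intros)
  moreover have "av c x = (%\<mu>. (1 / 4) * (c - \<mu> * (\<mu> + 2)))" using E by auto
  ultimately show ?thesis by simp
 next
  case F
  have "av c F = (%\<mu>. 1)" by auto
  then show ?thesis using F by (simp add: polyf_intros)
 next
  case H
  have "av c H = (%\<mu>. \<mu>)" by auto
  then show ?thesis using H by (simp add: polyf_intros)
 qed
 have 2: "polyf (%\<mu>. pw c w (\<mu> + 2 * of_int (wx x)))" by (rule polyf_shift[OF Cons])
 have "polyf (%\<mu>. (-1) ^ n * (av c x \<mu> * pw c w (\<mu> + 2 * of_int (wx x))))"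
  by (intro polyf_intros 1 2)
 moreover have "pw c (b # w) = (%\<mu>. (-1) ^ n * (av c x \<mu> * pw c w (\<mu> + 2 * of_int (wx x))))" by (auto simp: b)
 ultimately show ?case by simp
qed

lemma polyf_pm: "polyf (pm m c P)"
 unfolding pm_def[abs_def]
proof (rule polyf_lc)
 show "polyf (%x. if wt w = m then pw c w x else 0)" for w
  by (cases "wt w = m") (simp_all add: polyf_pw polyf_intros)
qed

context Lk0 begin

lemma pm_amP: "pm m c (amP x n P) \<mu> = lc (%w. if wt w = m - wx x then px k c x n w \<mu> else 0) P"
 using pm_am[unfolded pm_def] by (simp add: amP_def pm_def lc_bindc)

lemma pm_amP0: "pm m c (amP x 0 P) \<mu> = av c x (\<mu> + 2 * of_int (m - wx x)) * pm (m - wx x) c P \<mu>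
  - av c x \<mu> * pm (m - wx x) c P (\<mu> + 2 * of_int (wx x))"
proof -
 have "(%w. if wt w = m - wx x then px k c x 0 w \<mu> else 0)
  = (%w. av c x (\<mu> + 2 * of_int (m - wx x)) * (if wt w = m - wx x then pw c w \<mu> else 0)
    - av c x \<mu> * (if wt w = m - wx x then pw c w (\<mu> + 2 * of_int (wx x)) else 0))"
  by (auto simp: px_0)
 then show ?thesis unfolding pm_amP unfolding pm_def by (simp only: lc_diff lc_cmult)
qed

text \<open>With o the zero mode, o(e(-1) w) = o(w) e and o(e(0) w) = e o(w) - o(w) e. The sum has
  zero mode e o(w), so multiplication by e from the left is available inside the ideal.\<close>

definition leftE :: "comb => comb" where "leftE P = pre E 0 P @ amP E 0 P"

lemma J_leftE: "J P ==> J (leftE P)" by (simp add: leftE_def J_append J_pre J_amP)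

lemma pm_leftE: "pm m c (leftE P) \<mu> = av c E (\<mu> + 2 * of_int (m - 1)) * pm (m - 1) c P \<mu>"
 by (simp only: leftE_def pm_simps pm_pre pm_amP0) simp

text \<open>Only one matrix coefficient is recorded, from the highest weight to itself;
  \<open>ZZ_range\<close> recovers the others.\<close>

definition ZZ :: "complex => bool" where
 "ZZ r \<longleftrightarrow> (\<forall>P. J P \<longrightarrow> pm 0 (r * (r + 2)) P r = 0)"

text \<open>Vanishing on the whole dense family with this Casimir value, not only along one highest
  weight string.\<close>

definition Good :: "complex => bool" where
 "Good c \<longleftrightarrow> (\<forall>P m \<mu>. J P \<longrightarrow> pm m c P \<mu> = 0)"

lemma ZZ_down:
 assumes "ZZ r" "J P" shows "pm (int j) (r * (r + 2)) P (r - 2 * of_nat j) = 0"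
 using assms(2)
proof (induction j arbitrary: P)
 case 0
 then show ?case using assms(1) by (simp add: ZZ_def)
next
 case (Suc j)
 have "pm (int j) (r * (r + 2)) (pre F 0 P) (r - 2 * of_nat j) = 0" by (rule Suc.IH[OF J_pre[OF Suc.prems]])
 then show ?case by (simp add: pm_pre algebra_simps)
qed

text \<open>The coefficient leads from weight r - 2 j to r - 2 b. Multiplying by e from the left
  lifts the target r - 2 (b + 1) to r - 2 b with the factor (b + 1) (r - b), which must not
  vanish.\<close>

lemma ZZ_range:
 fixes b j :: nat
 assumes "ZZ r" "J P" "!!i. i < b ==> r \<noteq> of_nat i"
 shows "pm (int j - int b) (r * (r + 2)) P (r - 2 * of_nat j) = 0"
 using assms(2,3)
proof (induction b arbitrary: P)
 case 0
 then show ?case using ZZ_down[OF assms(1) 0(1)] by simp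
next
 case (Suc b)
 have 0: "pm (int j - int b) (r * (r + 2)) (leftE P) (r - 2 * of_nat j) = 0"
  by (rule Suc.IH[OF J_leftE[OF Suc.prems(1)]]) (use Suc.prems(2) in auto)
 have "av (r * (r + 2)) E (r - 2 * of_nat j + 2 * of_int (int j - int b - 1)) = (of_nat b + 1) * (r - of_nat b)"
  by (simp add: field_simps)
 moreover have "(of_nat b + 1 :: complex) \<noteq> 0" using of_nat_neq_0[of b] by (simp add: add.commute)
 ultimately have "av (r * (r + 2)) E (r - 2 * of_nat j + 2 * of_int (int j - int b - 1)) \<noteq> 0"
  using Suc.prems(2)[of b] by simp
 moreover have "int j - int (Suc b) = int j - int b - 1" by simp
 ultimately show ?case using 0 unfolding pm_leftE by (simp only: mult_eq_0_iff) blast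
qed

text \<open>For r outside the natural numbers no factor vanishes, so the coefficient is 0 at r - 2 j
  for all large j, and it is polynomial in the weight.\<close>

lemma Good_ZZ:
 assumes "ZZ r" "r \<notin> \<nat>" shows "Good (r * (r + 2))"
 unfolding Good_def
proof (intro allI impI)
 fix P m \<mu> assume P: "J P"
 have "polyf (%x. pm m (r * (r + 2)) P (r - 2 * x))"
  by (rule polyf_comp[OF polyf_pm]) (intro polyf_intros)
 moreover have "pm m (r * (r + 2)) P (r - 2 * of_nat j) = 0" if "j \<ge> nat m" for j
 proof -
  have "int j - int (nat (int j - m)) = m" using that by auto
  moreover have "r \<noteq> of_nat i" for i using assms(2) by auto
  ultimately show ?thesis using ZZ_range[OF assms(1) P, of "nat (int j - m)" j] by simp
 qed
 ultimately have "pm m (r * (r + 2)) P (r - 2 * ((r - \<mu>) / 2)) = 0" by (rule polyf_zero)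
 moreover have "r - 2 * ((r - \<mu>) / 2) = \<mu>" by (simp add: field_simps)
 ultimately show "pm m (r * (r + 2)) P \<mu> = 0" by (simp only:)
qed

subsection \<open>Spectral flow\<close>

text \<open>The coefficient of z^n in exp(1/2 sum_{j >= 1} (-1)^(j - 1) h(j) z^j / j), computed from
  its logarithmic derivative. This is the operator that twists vertex operators in spectral
  flow.\<close>

fun Dl :: "nat => 'v => 'v" where
 "Dl 0 v = v"
| "Dl (Suc n) v = sV (1 / (2 * of_nat (Suc n))) (\<Sum>j\<le>n. sV ((-1) ^ j) (act H (int j + 1) (Dl (n - j) v)))"

lemma Dl_Suc: "sV (2 * of_nat (Suc n)) (Dl (Suc n) v) = (\<Sum>j\<le>n. sV ((-1) ^ j) (act H (int j + 1) (Dl (n - j) v)))"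
proof -
 have "2 * of_nat (Suc n) * (1 / (2 * of_nat (Suc n))) = (1::complex)" by (simp del: of_nat_Suc)
 then show ?thesis by (simp only: Dl.simps V.vs.scale_scale) simp
qed

lemma Dl_eqI:
 assumes "(\<Sum>j\<le>n. sV ((-1) ^ j) (act H (int j + 1) (Dl (n - j) v))) = sV (2 * of_nat (Suc n)) u"
 shows "Dl (Suc n) v = u"
proof -
 have "(1 / (2 * of_nat (Suc n))) * (2 * of_nat (Suc n)) = (1::complex)" by (simp del: of_nat_Suc)
 then show ?thesis by (simp only: Dl.simps assms V.vs.scale_scale) simp
qed

lemma Dl_add: "Dl n (u + v) = Dl n u + Dl n v"
proof (induction n rule: less_induct)
 case (less n)
 show ?case
 proof (cases n)
  case (Suc i)
  have "(\<Sum>j\<le>i. sV ((-1) ^ j) (act H (int j + 1) (Dl (i - j) (u + v))))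
   = (\<Sum>j\<le>i. sV ((-1) ^ j) (act H (int j + 1) (Dl (i - j) u)) + sV ((-1) ^ j) (act H (int j + 1) (Dl (i - j) v)))"
   by (rule sum.cong) (use less Suc in \<open>auto simp: V.act_add V.vs.scale_right_distrib\<close>)
  then show ?thesis by (simp add: Suc sum.distrib V.vs.scale_right_distrib)
 qed simp
qed

lemma Dl_scale: "Dl n (sV c v) = sV c (Dl n v)"
proof (induction n rule: less_induct)
 case (less n)
 show ?case
 proof (cases n)
  case (Suc i)
  have "(\<Sum>j\<le>i. sV ((-1) ^ j) (act H (int j + 1) (Dl (i - j) (sV c v))))
   = (\<Sum>j\<le>i. sV c (sV ((-1) ^ j) (act H (int j + 1) (Dl (i - j) v))))"
   by (rule sum.cong) (use less Suc in \<open>auto simp: V.act_scale\<close>)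
  also have "\<dots> = sV c (\<Sum>j\<le>i. sV ((-1) ^ j) (act H (int j + 1) (Dl (i - j) v)))"
   by (simp only: V.vs.scale_sum_right)
  finally show ?thesis unfolding Suc Dl.simps by (simp only: V.vs.scale_left_commute)
 qed simp
qed

lemma Dl_Gr: "v \<in> Gr d ==> Dl n v \<in> Gr (d - int n)"
proof (induction n rule: less_induct)
 case (less n)
 show ?case
 proof (cases n)
  case (Suc i)
  have "act H (int j + 1) (Dl (i - j) v) \<in> Gr (d - int n)" if "j \<le> i" for j
   using act_Gr[OF less.IH[OF _ less.prems], of "i - j" H "int j + 1"] that Suc by (simp add: of_nat_diff algebra_simps)
  then show ?thesis unfolding Suc Dl.simps
   by (intro V.vs.subspace_scale[OF sub_Gr] V.vs.subspace_sum[OF sub_Gr]) (auto simp: Suc)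
 qed (use less in simp)
qed

lemma Dl_zero: "v \<in> Gr d ==> d < int n ==> Dl n v = 0"
 using Dl_Gr[of v d n] by (simp add: Gr_def)

text \<open>The coefficients of z times that exponential; the case 0 lets the relations below be
  stated without an index shift.\<close>

definition Dm :: "nat => 'v => 'v" where "Dm n v = (if n = 0 then 0 else Dl (n - 1) v)"

lemma Dm_simps [simp]: "Dm 0 v = 0" "Dm (Suc n) v = Dl n v" by (auto simp: Dm_def)

lemma Dm_Suc: "sV (2 * of_nat n) (Dl n v) = (\<Sum>j\<le>n. sV ((-1) ^ j) (act H (int j + 1) (Dm (n - j) v)))"
proof (cases n)
 case (Suc i)
 have "(\<Sum>j\<le>n. sV ((-1) ^ j) (act H (int j + 1) (Dm (n - j) v)))
  = (\<Sum>j\<le>i. sV ((-1) ^ j) (act H (int j + 1) (Dm (n - j) v)))"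
  by (simp add: Suc)
 also have "\<dots> = (\<Sum>j\<le>i. sV ((-1) ^ j) (act H (int j + 1) (Dl (i - j) v)))"
  by (rule sum.cong) (auto simp: Suc Suc_diff_le)
 finally show ?thesis unfolding Suc Dl_Suc ..
qed simp

text \<open>Bracketing with h(j) / 2 shifts the mode of e by j. With T this shift, the exponent sums
  to log(1 + z T), so conjugating e gives the factor 1 + z T.\<close>

lemma Dl_E: "Dl n (act E m v) = act E m (Dl n v) + act E (m + 1) (Dm n v)"
proof (induction n rule: less_induct)
 case (less n)
 show ?case
 proof (cases n)
  case (Suc i)
  have a: "sV ((-1) ^ j) (act H (int j + 1) (Dl (i - j) (act E m v)))
   = act E m (sV ((-1) ^ j) (act H (int j + 1) (Dl (i - j) v)))
   + act E (m + 1) (sV ((-1) ^ j) (act H (int j + 1) (Dm (i - j) v)))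
   + sV 2 (sV ((-1) ^ j) (act E (m + 1 + int j) (Dl (i - j) v)) - sV ((-1) ^ Suc j) (act E (m + 1 + int (Suc j)) (Dm (i - j) v)))" for j
  proof -
   have "Dl (i - j) (act E m v) = act E m (Dl (i - j) v) + act E (m + 1) (Dm (i - j) v)"
    using less.IH[of "i - j"] Suc by simp
   moreover have "act H (int j + 1) (act E m u) = act E m (act H (int j + 1) u) + sV 2 (act E (m + 1 + int j) u)"
    and "act H (int j + 1) (act E (m + 1) u) = act E (m + 1) (act H (int j + 1) u) + sV 2 (act E (m + 1 + int (Suc j)) u)" for u
   proof -
    have e: "int j + 1 + m = m + 1 + int j" "int j + 1 + (m + 1) = m + 1 + int (Suc j)" by auto
    show "act H (int j + 1) (act E m u) = act E m (act H (int j + 1) u) + sV 2 (act E (m + 1 + int j) u)"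
     unfolding V.comm_HE e(1) ..
    show "act H (int j + 1) (act E (m + 1) u) = act E (m + 1) (act H (int j + 1) u) + sV 2 (act E (m + 1 + int (Suc j)) u)"
     unfolding V.comm_HE e(2) ..
   qed
   ultimately show ?thesis
    by (simp add: V.act_add V.act_scale V.vs.scale_right_distrib mult.commute del: of_nat_Suc)
  qed
  have tel: "(\<Sum>j\<le>i. sV ((-1) ^ j) (act E (m + 1 + int j) (Dl (i - j) v)) - sV ((-1) ^ Suc j) (act E (m + 1 + int (Suc j)) (Dm (i - j) v)))
   = act E (m + 1) (Dl i v)"
  proof -
   define g where "g j = sV ((-1) ^ j) (act E (m + 1 + int j) (Dm (Suc i - j) v))" for j
   have "(\<Sum>j\<le>i. g j - g (Suc j)) = g 0 - g (Suc i)" by (rule sum_telescope)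
   moreover have "(\<Sum>j\<le>i. g j - g (Suc j)) = (\<Sum>j\<le>i. sV ((-1) ^ j) (act E (m + 1 + int j) (Dl (i - j) v)) - sV ((-1) ^ Suc j) (act E (m + 1 + int (Suc j)) (Dm (i - j) v)))"
    by (rule sum.cong) (auto simp: g_def Suc_diff_le)
   ultimately show ?thesis by (simp add: g_def)
  qed
  have "(\<Sum>j\<le>i. sV ((-1) ^ j) (act H (int j + 1) (Dl (i - j) (act E m v))))
   = act E m (sV (2 * of_nat (Suc i)) (Dl (Suc i) v)) + act E (m + 1) (sV (2 * of_nat i) (Dl i v)) + sV 2 (act E (m + 1) (Dl i v))"
   unfolding a sum.distrib V.vs.scale_sum_right[symmetric] V.act_sum[symmetric] tel Dl_Suc[of i v] Dm_Suc[of i v] ..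
  also have "\<dots> = sV (2 * of_nat (Suc i)) (act E m (Dl (Suc i) v)) + sV (2 * of_nat i + 2) (act E (m + 1) (Dl i v))"
   by (simp only: V.act_scale V.vs.scale_left_distrib[of "2 * of_nat i" 2] add.assoc)
  also have "2 * of_nat i + 2 = 2 * (of_nat (Suc i) :: complex)" by simp
  finally have "(\<Sum>j\<le>i. sV ((-1) ^ j) (act H (int j + 1) (Dl (i - j) (act E m v))))
   = sV (2 * of_nat (Suc i)) (act E m (Dl (Suc i) v) + act E (m + 1) (Dl i v))"
   by (simp only: V.vs.scale_right_distrib)
  then show ?thesis using Dl_eqI by (simp add: Suc)
 qed simp
qed

text \<open>For f the sign of the bracket is opposite and the factor is the inverse of 1 + z T,
  expanded as a geometric series.\<close>

lemma Dl_F_sum: "Dl n (act F m v) = (\<Sum>j\<le>n. sV ((-1) ^ j) (act F (m + int j) (Dl (n - j) v)))"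
proof (induction n arbitrary: m rule: less_induct)
 case (less n)
 define B where "B n m = (\<Sum>j\<le>n. sV ((-1) ^ j) (act F (m + int j) (Dl (n - j) v)))" for n m
 have BS: "B (Suc i) m = act F m (Dl (Suc i) v) - B i (m + 1)" for i m
 proof -
  have "B (Suc i) m = act F m (Dl (Suc i) v) + (\<Sum>j\<le>i. sV ((-1) ^ Suc j) (act F (m + int (Suc j)) (Dl (Suc i - Suc j) v)))"
   unfolding B_def by (subst sum.atMost_Suc_shift) simp
  also have "(\<Sum>j\<le>i. sV ((-1) ^ Suc j) (act F (m + int (Suc j)) (Dl (Suc i - Suc j) v))) = - B i (m + 1)"
   unfolding B_def sum_negf[symmetric] by (rule sum.cong) (auto simp: add.assoc)
  finally show ?thesis by simp
 qed
 show ?case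
 proof (cases n)
  case (Suc i)
  have IH: "Dl l (act F m v) = B l m" if "l \<le> i" for l m using less.IH[of l m] that Suc by (simp add: B_def)
  have IH': "Dl l (act F m v) = act F m (Dl l v) - Dm l (act F (m + 1) v)" if "l \<le> i" for l
  proof (cases l)
   case l: (Suc l')
   then show ?thesis using IH[of l' "m + 1"] IH[of l m] BS[of l' m] that by simp
  qed simp
  have a: "sV ((-1) ^ j) (act H (int j + 1) (Dl (i - j) (act F m v)))
   = act F m (sV ((-1) ^ j) (act H (int j + 1) (Dl (i - j) v)))
    - sV ((-1) ^ j) (act H (int j + 1) (Dm (i - j) (act F (m + 1) v)))
    - sV 2 (sV ((-1) ^ j) (act F (m + 1 + int j) (Dl (i - j) v)))" if "j \<le> i" for j
  proof -
   have "act H (int j + 1) (act F m u) = act F m (act H (int j + 1) u) - sV 2 (act F (m + 1 + int j) u)" for u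
   proof -
    have e: "int j + 1 + m = m + 1 + int j" by auto
    show ?thesis unfolding V.comm_HF e ..
   qed
   then show ?thesis
    using IH'[of "i - j"] by (simp add: V.act_diff V.act_scale V.vs.scale_right_diff_distrib mult.commute)
  qed
  have "(\<Sum>j\<le>i. sV ((-1) ^ j) (act H (int j + 1) (Dl (i - j) (act F m v))))
   = (\<Sum>j\<le>i. act F m (sV ((-1) ^ j) (act H (int j + 1) (Dl (i - j) v)))
    - sV ((-1) ^ j) (act H (int j + 1) (Dm (i - j) (act F (m + 1) v)))
    - sV 2 (sV ((-1) ^ j) (act F (m + 1 + int j) (Dl (i - j) v))))"
   by (rule sum.cong) (auto simp: a)
  also have "\<dots> = act F m (sV (2 * of_nat (Suc i)) (Dl (Suc i) v)) - sV (2 * of_nat i) (Dl i (act F (m + 1) v)) - sV 2 (B i (m + 1))"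
   unfolding sum_subtractf V.vs.scale_sum_right[symmetric] V.act_sum[symmetric] Dl_Suc[of i v] Dm_Suc[of i "act F (m + 1) v"] B_def ..
  also have "\<dots> = sV (2 * of_nat (Suc i)) (act F m (Dl (Suc i) v)) - sV (2 * of_nat i + 2) (B i (m + 1))"
   by (simp only: V.act_scale V.vs.scale_left_distrib[of "2 * of_nat i" 2] IH[OF order_refl] diff_diff_eq)
  also have "2 * of_nat i + 2 = 2 * (of_nat (Suc i) :: complex)" by simp
  finally have "(\<Sum>j\<le>i. sV ((-1) ^ j) (act H (int j + 1) (Dl (i - j) (act F m v))))
   = sV (2 * of_nat (Suc i)) (B (Suc i) m)"
   by (simp only: V.vs.scale_right_diff_distrib BS)
  then show ?thesis using Dl_eqI by (simp add: Suc B_def)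
 qed simp
qed

lemma Dl_F: "Dl n (act F m v) + Dm n (act F (m + 1) v) = act F m (Dl n v)"
proof (cases n)
 case (Suc i)
 have "Dl (Suc i) (act F m v) = act F m (Dl (Suc i) v) + (\<Sum>j\<le>i. sV ((-1) ^ Suc j) (act F (m + int (Suc j)) (Dl (Suc i - Suc j) v)))"
  unfolding Dl_F_sum by (subst sum.atMost_Suc_shift) simp
 also have "(\<Sum>j\<le>i. sV ((-1) ^ Suc j) (act F (m + int (Suc j)) (Dl (Suc i - Suc j) v))) = - Dl i (act F (m + 1) v)"
  unfolding Dl_F_sum sum_negf[symmetric] by (rule sum.cong) (auto simp: add.assoc)
 finally show ?thesis by (simp add: Suc)
qed simp

text \<open>Only h(m + 1) fails to commute with h(- m - 1), and the bracket is central; this term is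
  the source of the shift by k.\<close>

lemma Dl_H: "Dl n (act H (- int (Suc m)) v) = act H (- int (Suc m)) (Dl n v)
  + (if n \<ge> Suc m then sV ((-1) ^ m * k) (Dl (n - Suc m) v) else 0)"
proof (induction n rule: less_induct)
 case (less n)
 show ?case
 proof (cases n)
  case (Suc i)
  define C where "C l = (if l \<ge> Suc m then sV ((-1) ^ m * k) (Dl (l - Suc m) v) else 0)" for l
  have a: "sV ((-1) ^ j) (act H (int j + 1) (Dl (i - j) (act H (- int (Suc m)) v)))
   = act H (- int (Suc m)) (sV ((-1) ^ j) (act H (int j + 1) (Dl (i - j) v)))
   + sV ((-1) ^ j) (act H (int j + 1) (C (i - j)))
   + (if j = m then sV ((-1) ^ m * (of_nat (Suc m) * 2 * k)) (Dl (i - m) v) else 0)" for j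
  proof -
   have "Dl (i - j) (act H (- int (Suc m)) v) = act H (- int (Suc m)) (Dl (i - j) v) + C (i - j)"
    using less.IH[of "i - j"] Suc by (simp add: C_def)
   moreover have "act H (int j + 1) (act H (- int (Suc m)) u) = act H (- int (Suc m)) (act H (int j + 1) u)
    + (if j = m then sV (of_nat (Suc m) * 2 * k) u else 0)" for u
   proof -
    have e: "(int j + 1 + - int (Suc m) = 0) = (j = m)" by auto
    show ?thesis unfolding V.comm_HH[of "int j + 1" "- int (Suc m)" u] e by (auto simp: add.commute)
   qed
   ultimately show ?thesis
    by (simp add: V.act_add V.act_scale V.vs.scale_right_distrib)
  qed
  have c: "(\<Sum>j\<le>i. sV ((-1) ^ j) (act H (int j + 1) (C (i - j)))) = (if i \<ge> Suc m then sV ((-1) ^ m * k) (sV (2 * of_nat (i - m)) (Dl (i - m) v)) else 0)"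
  proof (cases "i \<ge> Suc m")
   case True
   define i' where "i' = i - Suc m"
   have i: "i = i' + Suc m" using True by (simp add: i'_def)
   have "(\<Sum>j\<le>i. sV ((-1) ^ j) (act H (int j + 1) (C (i - j)))) = (\<Sum>j\<le>i'. sV ((-1) ^ j) (act H (int j + 1) (C (i - j))))"
    by (rule sum.mono_neutral_right) (auto simp: i C_def)
   also have "\<dots> = (\<Sum>j\<le>i'. sV ((-1) ^ m * k) (sV ((-1) ^ j) (act H (int j + 1) (Dl (i' - j) v))))"
   proof (rule sum.cong[OF refl])
    fix j assume "j \<in> {..i'}"
    then have "C (i - j) = sV ((-1) ^ m * k) (Dl (i' - j) v)" by (auto simp: C_def i)
    then show "sV ((-1) ^ j) (act H (int j + 1) (C (i - j))) = sV ((-1) ^ m * k) (sV ((-1) ^ j) (act H (int j + 1) (Dl (i' - j) v)))"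
     by (simp only: V.act_scale V.vs.scale_left_commute)
   qed
   also have "\<dots> = sV ((-1) ^ m * k) (sV (2 * of_nat (Suc i')) (Dl (Suc i') v))"
    by (simp only: V.vs.scale_sum_right[symmetric] Dl_Suc)
   also have "Suc i' = i - m" by (simp add: i)
   finally show ?thesis using True by simp
  next
   case False
   then show ?thesis by (auto simp: C_def intro!: sum.neutral)
  qed
  have "(\<Sum>j\<le>i. sV ((-1) ^ j) (act H (int j + 1) (Dl (i - j) (act H (- int (Suc m)) v))))
   = act H (- int (Suc m)) (sV (2 * of_nat (Suc i)) (Dl (Suc i) v))
    + (if i \<ge> Suc m then sV ((-1) ^ m * k) (sV (2 * of_nat (i - m)) (Dl (i - m) v)) else 0)
    + (if m \<le> i then sV ((-1) ^ m * (of_nat (Suc m) * 2 * k)) (Dl (i - m) v) else 0)"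
   unfolding a sum.distrib V.act_sum[symmetric] Dl_Suc c by (simp add: sum.delta)
  also have "\<dots> = sV (2 * of_nat (Suc i)) (act H (- int (Suc m)) (Dl (Suc i) v))
    + (if m \<le> i then sV ((-1) ^ m * k * (2 * of_nat (i - m)) + (-1) ^ m * (of_nat (Suc m) * 2 * k)) (Dl (i - m) v) else 0)"
   by (auto simp only: V.act_scale V.vs.scale_scale V.vs.scale_left_distrib split: if_split) (auto simp: not_less_eq_eq)
  also have "\<dots> = sV (2 * of_nat (Suc i)) (act H (- int (Suc m)) (Dl (Suc i) v) + C (Suc i))"
  proof -
   have "(-1) ^ m * k * (2 * of_nat (i - m)) + (-1) ^ m * (of_nat (Suc m) * 2 * k) = 2 * of_nat (Suc i) * ((-1) ^ m * k)" if "m \<le> i"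
    using that by (simp add: of_nat_diff algebra_simps)
   then show ?thesis by (auto simp: C_def V.vs.scale_right_distrib V.vs.scale_scale)
  qed
  finally show ?thesis unfolding Suc by (intro Dl_eqI[THEN trans]) (auto simp: C_def)
 qed simp
qed

end

context Lk0 begin

context
 fixes \<mu> :: complex
 assumes Z: "!!P. J P ==> pm 0 (\<mu> * (\<mu> - 2)) P \<mu> = 0"
begin

text \<open>The hypothesis makes the value independent of the words chosen for v. At the Casimir
  value \<mu> (\<mu> - 2) the map e from weight \<mu> - 2 to \<mu> vanishes, so \<mu> plays the part
  of a lowest weight.\<close>

definition ph :: "'v => complex" where "ph v = pm 0 (\<mu> * (\<mu> - 2)) (SOME P. v = lin sV ev P) \<mu>"

lemma ph_lin: "ph (lin sV ev P) = pm 0 (\<mu> * (\<mu> - 2)) P \<mu>"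
proof -
 define Q where "Q = (SOME Q. lin sV ev P = lin sV ev Q)"
 have "lin sV ev P = lin sV ev Q" unfolding Q_def by (rule someI[where x = P]) simp
 then have "J (P @ scl (- 1) Q)" by (simp add: J_def V.vs.lin_scl)
 from Z[OF this] show ?thesis by (simp add: ph_def Q_def[symmetric] pm_scl)
qed

lemma ph_add: "ph (u + v) = ph u + ph v"
proof -
 obtain P Q where "u = lin sV ev P" "v = lin sV ev Q" using span_ev by blast
 then show ?thesis using ph_lin[of "P @ Q"] by (simp add: ph_lin)
qed

lemma ph_scale: "ph (sV c v) = c * ph v"
proof -
 obtain P where "v = lin sV ev P" using span_ev by blast
 then show ?thesis using ph_lin[of "scl c P"] by (simp add: ph_lin V.vs.lin_scl pm_scl)
qed

lemma ph_0: "ph 0 = 0" using ph_scale[of 0 0] by simp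

text \<open>After f has lowered \<mu> to \<mu> - 2, returning would require crossing the vanishing
  e.\<close>

lemma ph_F1: "ph (act F (-1) v) = 0"
proof -
 obtain P where P: "v = lin sV ev P" using span_ev by blast
 have "act F (-1) v = lin sV ev (pre F 0 P)" by (simp add: lin_preP P)
 then have "ph (act F (-1) v) = pm 1 (\<mu> * (\<mu> - 2)) P (\<mu> - 2)" by (simp add: ph_lin pm_pre)
 also have "\<dots> = 0" by (rule pm_crossing[of _ _ 0]) (auto simp: algebra_simps)
 finally show ?thesis .
qed

lemma ph_E: "ph (act E (-1) v) + ph (act E 0 v) = 0"
proof -
 obtain P where P: "v = lin sV ev P" using span_ev by blast
 have "act E (-1) v + act E 0 v = lin sV ev (leftE P)" by (simp add: leftE_def lin_preP lin_amP P)
 then show ?thesis using ph_add[of "act E (-1) v" "act E 0 v"] by (simp add: ph_lin pm_leftE)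
qed

lemma ph_H: "ph (act H (-1) v) = \<mu> * ph v"
proof -
 obtain P where P: "v = lin sV ev P" using span_ev by blast
 have "act H (-1) v = lin sV ev (pre H 0 P)" by (simp add: lin_preP P)
 then show ?thesis by (simp add: ph_lin pm_pre P)
qed

lemma ph_shift: "ph (act x (- int n - 2) v) = - ph (act x (- int n - 1) v)"
proof -
 obtain P where P: "v = lin sV ev P" using span_ev by blast
 have "act x (- int n - 2) v = lin sV ev (pre x (Suc n) P)" "act x (- int n - 1) v = lin sV ev (pre x n P)"
 proof -
  have m: "- int (Suc n) - 1 = - int n - 2" by simp
  show "act x (- int n - 2) v = lin sV ev (pre x (Suc n) P)" unfolding lin_preP m P ..
 qed (simp add: lin_preP P)
 then show ?thesis by (simp only: ph_lin pm_pre) simp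
qed

lemma ph_F: "ph (act F (- int n - 1) v) = 0"
proof (induction n)
 case (Suc n)
 have m: "- int (Suc n) - 1 = - int n - 2" by simp
 show ?case unfolding m using ph_shift[of F n v] Suc by simp
qed (simp add: ph_F1)

text \<open>\<open>ph\<close> after the exponential at z = 1; once \<open>N\<close> exceeds the
  degree of v the sum is complete.\<close>

definition Ps :: "nat => 'v => complex" where "Ps N v = (\<Sum>i\<le>N. ph (Dl i v))"

lemma Ps_lin: "Ps N (lin sV ev P) = lc (%w. Ps N (ev w)) P"
proof -
 have 0: "Dl i 0 = 0" for i using Dl_scale[of i 0 0] by simp
 show ?thesis
  by (induction P) (auto simp: Ps_def 0 ph_0 Dl_add Dl_scale ph_add ph_scale sum.distrib sum_distrib_left)
qed

lemma sum_Dm: "g 0 = (0::complex) ==> Dl N v = 0 ==> (\<Sum>i\<le>N. g (Dm i v)) = (\<Sum>i\<le>N. g (Dl i v))"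
proof (cases N)
 case (Suc M)
 assume "g 0 = 0" "Dl N v = 0"
 then show ?thesis unfolding Suc by (subst sum.atMost_Suc_shift) (simp del: Dl.simps)
qed simp

lemma Ps_E: "Dl N v = 0 ==> Ps N (act E m v) = (\<Sum>i\<le>N. ph (act E m (Dl i v))) + (\<Sum>i\<le>N. ph (act E (m + 1) (Dl i v)))"
 using sum_Dm[of "%u. ph (act E (m + 1) u)" N v] by (simp add: Ps_def Dl_E ph_add sum.distrib ph_0)

lemma Ps_F: "Dl N (act F (m + 1) v) = 0 ==> Ps N (act F m v) + Ps N (act F (m + 1) v) = (\<Sum>i\<le>N. ph (act F m (Dl i v)))"
 using sum_Dm[of ph N "act F (m + 1) v"]
 by (simp add: Ps_def ph_0 Dl_F[symmetric] ph_add sum.distrib)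

lemma Ps_H:
 assumes "!!i. i + m \<ge> N ==> Dl i v = 0" "Suc m \<le> N"
 shows "Ps N (act H (- int (Suc m)) v) = (\<Sum>i\<le>N. ph (act H (- int (Suc m)) (Dl i v))) + (-1) ^ m * k * Ps N v"
proof -
 have "(\<Sum>i\<le>N. ph (if i \<ge> Suc m then sV ((-1) ^ m * k) (Dl (i - Suc m) v) else 0))
   = (\<Sum>i\<in>{Suc m..N}. (-1) ^ m * k * ph (Dl (i - Suc m) v))"
  by (rule sum.mono_neutral_cong_right) (auto simp: ph_0 ph_scale)
 also have "\<dots> = (\<Sum>i\<le>N - Suc m. (-1) ^ m * k * ph (Dl i v))"
  by (rule sum.reindex_bij_witness[of _ "%i. i + Suc m" "%i. i - Suc m"]) (use assms(2) in auto)
 also have "\<dots> = (\<Sum>i\<le>N. (-1) ^ m * k * ph (Dl i v))"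
 proof (rule sum.mono_neutral_left)
  show "\<forall>i\<in>{..N} - {..N - Suc m}. (-1) ^ m * k * ph (Dl i v) = 0"
  proof
   fix i assume "i \<in> {..N} - {..N - Suc m}"
   then have "i + m \<ge> N" by auto
   then show "(-1) ^ m * k * ph (Dl i v) = 0" using assms(1) by (simp add: ph_0)
  qed
 qed auto
 finally show ?thesis by (simp only: Ps_def Dl_H ph_add sum.distrib sum_distrib_left)
qed

lemma Dl_zero_letter: "dg w + n < N ==> Dl N (act x (- int n) (ev w)) = 0"
 using act_Gr[OF ev_Gr[of w], of x "- int n"] by (intro Dl_zero) auto

lemma Ps_shift:
 assumes "dg w + Suc n < N"
 shows "Ps N (act x (- int n - 1) (ev w)) = (-1) ^ n * Ps N (act x (-1) (ev w))"
 using assms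
proof (induction n)
 case (Suc n)
 have m: "- int (Suc n) - 1 = - int n - 2" by simp
 have z: "Dl i (ev w) = 0" if "i > dg w" for i using Dl_zero[OF ev_Gr] that by simp
 have "Ps N (act x (- int n - 2) (ev w)) = - Ps N (act x (- int n - 1) (ev w))"
 proof (cases x)
  case E
  have s: "ph (act E (- int n - 2 + 1) u) = - ph (act E (- int n) u)" for u
  proof (cases n)
   case 0
   then show ?thesis using ph_E[of u] by (simp add: eq_neg_iff_add_eq_0)
  next
   case (Suc n')
   have "- int n - 2 + 1 = - int n' - 2" "- int n = - int n' - 1" using Suc by auto
   then show ?thesis using ph_shift[of E n' u] by (simp only:)
  qed
  have e: "- int n - 1 + 1 = - int n" by simp
  have "Dl N (ev w) = 0" using z[of N] Suc.prems by simp
  then show ?thesis using Ps_E[of N "ev w" "- int n - 2"] Ps_E[of N "ev w" "- int n - 1"]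
   unfolding E s e ph_shift sum_negf by (simp only:) simp
 next
  case F
  have e: "- int n - 2 + 1 = - int n - 1" by simp
  have "(\<Sum>i\<le>N. ph (act F (- int n - 2) (Dl i (ev w)))) = 0"
   using ph_F[of "Suc n"] unfolding m by simp
  moreover have "Dl N (act F (- int n - 2 + 1) (ev w)) = 0"
   using Dl_zero_letter[of w "Suc n" N F] Suc.prems by (simp add: e add.commute)
  ultimately show ?thesis using Ps_F[of N "- int n - 2" "ev w"] by (simp add: F e eq_neg_iff_add_eq_0)
 next
  case H
  have e: "- int n - 2 = - int (Suc (Suc n))" "- int n - 1 = - int (Suc n)" by auto
  have "Ps N (act H (- int (Suc (Suc n))) (ev w)) = (\<Sum>i\<le>N. ph (act H (- int (Suc (Suc n))) (Dl i (ev w)))) + (-1) ^ Suc n * k * Ps N (ev w)"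
   by (rule Ps_H) (use z Suc.prems in auto)
  moreover have "Ps N (act H (- int (Suc n)) (ev w)) = (\<Sum>i\<le>N. ph (act H (- int (Suc n)) (Dl i (ev w)))) + (-1) ^ n * k * Ps N (ev w)"
   by (rule Ps_H) (use z Suc.prems in auto)
  moreover have "ph (act H (- int (Suc (Suc n))) u) = - ph (act H (- int (Suc n)) u)" for u
   using ph_shift[of H n u] unfolding e .
  ultimately show ?thesis unfolding H e by (simp add: sum_negf)
 qed
 then show ?case using Suc unfolding m by simp
qed simp

text \<open>On the flowed functional e(-1) gives 0, h(-1) gives k + \<mu> and f(-1) gives minus
  f(0): the rules for the zero mode at a highest weight vector of weight k + \<mu>. They determine
  the value on every word.\<close>

lemma Ps_ev:
 assumes "dg w < N"
 shows "Ps N (ev w) = (if wt w = 0 then pw ((k + \<mu>) * (k + \<mu> + 2)) w (k + \<mu>) else 0)"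
 using assms
proof (induction "dg w" arbitrary: w rule: less_induct)
 case less
 define c where "c = (k + \<mu>) * (k + \<mu> + 2)"
 have z: "Dl i (ev w') = 0" if "i > dg w'" for i w' using Dl_zero[OF ev_Gr] that by simp
 show ?case
 proof (cases w)
  case Nil
  have "Ps N one = (\<Sum>i\<in>{0}. ph (Dl i one))"
   unfolding Ps_def by (rule sum.mono_neutral_right) (use z[of "[]"] in \<open>auto simp: ph_0\<close>)
  also have "\<dots> = 1" using ph_lin[of "[(1, [])]"] by (simp add: pm_def)
  finally show ?thesis by (simp add: Nil)
 next
  case (Cons b u)
  obtain x n where b: "b = (x, n)" by (cases b)
  have u: "dg u < dg w" "dg u + Suc n < N" using less.prems by (auto simp: Cons b)
  have IH: "Ps N (ev v) = (if wt v = 0 then pw c v (k + \<mu>) else 0)" if "dg v = dg u" for v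
   using less.hyps[of v] that u by (auto simp: c_def)
  have av: "av c E (k + \<mu>) = 0" by (simp add: c_def)
  have "Ps N (act x (-1) (ev u)) = (if wt w = 0 then av c x (k + \<mu>) * pw c u (k + \<mu> + 2 * of_int (wx x)) else 0)"
  proof (cases x)
   case E
   have "Ps N (act E (-1) (ev u)) = (\<Sum>i\<le>N. ph (act E (-1) (Dl i (ev u))) + ph (act E 0 (Dl i (ev u))))"
    using Ps_E[OF z[of u N], of "-1"] u by (simp add: sum.distrib)
   then have "Ps N (act E (-1) (ev u)) = 0" by (simp add: ph_E)
   then show ?thesis using av by (simp add: E)
  next
   case H
   have "Ps N (act H (- int (Suc 0)) (ev u)) = (\<Sum>i\<le>N. ph (act H (- int (Suc 0)) (Dl i (ev u)))) + (-1) ^ 0 * k * Ps N (ev u)"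
    by (rule Ps_H) (use z[of u] u in auto)
   also have "\<dots> = (k + \<mu>) * Ps N (ev u)"
    by (simp add: ph_H Ps_def sum_distrib_left[symmetric] algebra_simps)
   finally show ?thesis using IH[of u] by (simp add: H Cons b)
  next
   case F
   have "Dl N (act F (-1 + 1) (ev u)) = 0" using Dl_zero_letter[of u 0 N F] u by simp
   then have "Ps N (act F (-1) (ev u)) = - Ps N (act F 0 (ev u))"
    using Ps_F[of N "-1" "ev u"] by (simp add: ph_F1 eq_neg_iff_add_eq_0)
   also have "act F 0 (ev u) = lin sV ev (am k F 0 u)" by (rule act_ev)
   also have "Ps N \<dots> = pm 0 c (am k F 0 u) (k + \<mu>)"
    unfolding Ps_lin pm_def by (rule lc_cong, rule IH) (use am_homog in force)
   also have "\<dots> = (if wt u = 1 then pw c u (k + \<mu>) - pw c u (k + \<mu> - 2) else 0)"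
    by (simp add: pm_am px_0)
   also have "\<dots> = (if wt u = 1 then - pw c u (k + \<mu> - 2) else 0)"
    using pw_crossing[of c "k + \<mu>" 0 u] av by simp
   finally show ?thesis by (auto simp: F Cons b)
  qed
  then have "Ps N (ev w) = (-1) ^ n * (if wt w = 0 then av c x (k + \<mu>) * pw c u (k + \<mu> + 2 * of_int (wx x)) else 0)"
   using Ps_shift[OF u(2), of x] by (simp add: Cons b)
  then show ?thesis unfolding c_def by (simp add: Cons b)
 qed
qed

text \<open>Vanishing at lowest weight \<mu> becomes vanishing at highest weight k + \<mu>, because
  the flowed functional depends only on the vector of V, which is 0 for elements of the
  ideal.\<close>

lemma flow: "ZZ (k + \<mu>)"
 unfolding ZZ_def
proof (intro allI impI)
 fix P assume "J P"
 define N where "N = Suc (\<Sum>(c, w)\<leftarrow>P. dg w)"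
 have N: "dg w < N" if "(c, w) \<in> set P" for c w
  using that unfolding N_def by (induction P) auto
 have "pm 0 ((k + \<mu>) * (k + \<mu> + 2)) P (k + \<mu>) = lc (%w. Ps N (ev w)) P"
  unfolding pm_def by (rule lc_cong) (use Ps_ev N in auto)
 also have "\<dots> = Ps N (lin sV ev P)" by (rule Ps_lin[symmetric])
 also have "lin sV ev P = 0" using \<open>J P\<close> by (simp add: J_def)
 also have "Ps N 0 = 0" using Ps_lin[of N "[]"] by simp
 finally show "pm 0 ((k + \<mu>) * (k + \<mu> + 2)) P (k + \<mu>) = 0" .
qed

end

text \<open>The (n + 1)-dimensional top has lowest weight - n.\<close>

lemma flow_nat: "ZZ (of_nat n) ==> ZZ (k - of_nat n)"
proof -
 assume z: "ZZ (of_nat n)"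
 have "pm 0 (- of_nat n * (- of_nat n - 2)) P (- of_nat n) = 0" if "J P" for P
 proof -
  have "(- of_nat n * (- of_nat n - 2) :: complex) = of_nat n * (of_nat n + 2)" by (simp add: algebra_simps)
  then show ?thesis using ZZ_range[OF z that, of n n] by simp
 qed
 from flow[OF this] show ?thesis by simp
qed

text \<open>For such r every weight with Casimir value r (r + 2) is available, in particular the
  lowest weight r + 2.\<close>

lemma flow_generic: "ZZ r ==> r \<notin> \<nat> ==> ZZ (r + (k + 2))"
proof -
 assume "ZZ r" "r \<notin> \<nat>"
 then have g: "Good (r * (r + 2))" by (rule Good_ZZ)
 have "pm 0 ((r + 2) * ((r + 2) - 2)) P (r + 2) = 0" if "J P" for P
 proof -
  have "(r + 2) * ((r + 2) - 2) = r * (r + 2)" by simp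
  then show ?thesis using g that unfolding Good_def by (simp only:)
 qed
 from flow[OF this] show ?thesis by (simp add: ac_simps)
qed

end

subsection \<open>Degree bounds\<close>

fun avC :: "sl2b => complex => complex poly" where
 "avC E \<mu> = [:- (\<mu> * (\<mu> + 2)) / 4, 1 / 4:]" | "avC F \<mu> = 1" | "avC H \<mu> = [:\<mu>:]"

fun pwC :: "word => complex => complex poly" where
 "pwC [] \<mu> = 1"
| "pwC ((x, n) # w) \<mu> = smult ((-1) ^ n) (avC x \<mu> * pwC w (\<mu> + 2 * of_int (wx x)))"

lemma poly_pwC: "poly (pwC w \<mu>) c = pw c w \<mu>"
proof (induction w arbitrary: \<mu>)
 case (Cons b w)
 obtain x n where b: "b = (x, n)" by (cases b)
 have "poly (avC x \<mu>) c = av c x \<mu>" by (cases x) (auto simp: field_simps)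
 then show ?case by (simp add: b Cons)
qed simp

lemma dg_wt: "int (dg w) + wt w \<ge> 0"
proof (induction w)
 case (Cons b w)
 then show ?case by (cases b; cases "fst b") auto
qed simp

text \<open>The Casimir value enters only through letters E, linearly, and each E adds 1 to the
  weight and at least 1 to the degree of the word.\<close>

lemma degree_pwC: "2 * int (degree (pwC w \<mu>)) \<le> int (dg w) + wt w"
proof (induction w arbitrary: \<mu>)
 case (Cons b w)
 obtain x n where b: "b = (x, n)" by (cases b)
 let ?q = "pwC w (\<mu> + 2 * of_int (wx x))"
 have "degree (pwC (b # w) \<mu>) \<le> degree (avC x \<mu>) + degree ?q"
  unfolding b pwC.simps by (rule order_trans[OF degree_smult_le degree_mult_le])
 moreover have "2 * int (degree (avC x \<mu>)) \<le> 1 + wx x" by (cases x) auto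
 moreover have "2 * int (degree ?q) \<le> int (dg w) + wt w" by (rule Cons)
 ultimately show ?case by (simp add: b)
qed simp

text \<open>The coefficient of c in a letter E is the constant 1/4; weights occur only in lower
  order terms. This is what makes \<kappa> a constant in \<open>obstruction\<close>.\<close>

lemma coeff_pwC: "int (dg w) + wt w \<le> 2 * int M ==> coeff (pwC w \<mu>) M = coeff (pwC w \<nu>) M"
proof (induction w arbitrary: \<mu> \<nu> M)
 case (Cons b w)
 obtain x n where b: "b = (x, n)" by (cases b)
 have z: "coeff (pwC w \<mu>) M = 0" if "int (dg w) + wt w < 2 * int M" for \<mu>
  using degree_pwC[of w \<mu>] that by (intro coeff_eq_0) linarith
 show ?case
 proof (cases x)
  case E
  obtain M' where M: "M = Suc M'" using Cons.prems dg_wt[of w] by (cases M) (auto simp: b E)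
  have "coeff (pwC w \<mu>) M = 0" for \<mu> by (rule z) (use Cons.prems in \<open>auto simp: b E\<close>)
  moreover have "coeff (pwC w (\<mu> + 2)) M' = coeff (pwC w (\<nu> + 2)) M'"
   by (rule Cons.IH) (use Cons.prems in \<open>auto simp: b E M\<close>)
  ultimately show ?thesis by (simp add: b E M)
 next
  case F
  have "coeff (pwC w (\<mu> - 2)) M = coeff (pwC w (\<nu> - 2)) M"
   by (rule Cons.IH) (use Cons.prems in \<open>auto simp: b F\<close>)
  then show ?thesis by (simp add: b F)
 next
  case H
  have "coeff (pwC w \<mu>) M = 0" for \<mu> by (rule z) (use Cons.prems in \<open>auto simp: b H\<close>)
  then show ?thesis by (simp add: b H)
 qed
qed simp

fun pmC :: "int => comb => complex => complex poly" where
 "pmC m [] \<mu> = 0" | "pmC m (b # P) \<mu> = (if wt (snd b) = m then smult (fst b) (pwC (snd b) \<mu>) else 0) + pmC m P \<mu>"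

lemma poly_pmC: "poly (pmC m P \<mu>) c = pm m c P \<mu>"
 by (induction P) (auto simp: pm_def poly_pwC)

definition hom :: "nat => comb => bool" where "hom d P \<longleftrightarrow> (\<forall>(c, w)\<in>set P. dg w = d)"

lemma degree_pmC: "hom d P ==> pmC m P \<mu> \<noteq> 0 ==> 2 * int (degree (pmC m P \<mu>)) \<le> int d + m"
proof (induction P)
 case (Cons b P)
 define p where "p = (if wt (snd b) = m then smult (fst b) (pwC (snd b) \<mu>) else 0)"
 have e: "pmC m (b # P) \<mu> = p + pmC m P \<mu>" by (simp add: p_def)
 have h: "hom d P" "dg (snd b) = d" using Cons.prems(1) by (auto simp: hom_def)
 have p: "2 * int (degree p) \<le> int d + m" if "p \<noteq> 0"
  using that degree_pwC[of "snd b" \<mu>] h degree_smult_le[of "fst b" "pwC (snd b) \<mu>"]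
  by (auto simp: p_def split: if_splits)
 show ?case
 proof (cases "p = 0 \<or> pmC m P \<mu> = 0")
  case True
  then show ?thesis using p Cons.IH[OF h(1)] Cons.prems(2) unfolding e by auto
 next
  case False
  have "degree (p + pmC m P \<mu>) \<le> max (degree p) (degree (pmC m P \<mu>))" by (rule degree_add_le_max)
  then show ?thesis unfolding e using p Cons.IH[OF h(1)] False by auto
 qed
qed (simp add: hom_def)

lemma coeff_pmC: "hom d P ==> int d + m \<le> 2 * int M ==> coeff (pmC m P \<mu>) M = coeff (pmC m P \<nu>) M"
proof (induction P)
 case (Cons b P)
 then show ?case using coeff_pwC[of "snd b" M \<mu> \<nu>] by (auto simp: hom_def)
qed simp

lemma pm_roots_c:
 assumes "hom d P" "pm m c' P \<mu> \<noteq> 0" "!!c. c \<in> C ==> pm m c P \<mu> = 0"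
 shows "2 * int (card C) \<le> int d + m"
proof -
 have nz: "pmC m P \<mu> \<noteq> 0" using assms(2) poly_pmC[of m P \<mu> c'] by auto
 have "card C \<le> card {c. poly (pmC m P \<mu>) c = 0}"
  by (intro card_mono poly_roots_finite nz) (use assms(3) in \<open>auto simp: poly_pmC\<close>)
 also have "\<dots> \<le> degree (pmC m P \<mu>)" by (rule card_poly_roots_bound[OF nz])
 finally show ?thesis using degree_pmC[OF assms(1) nz] by linarith
qed

fun avM :: "complex => sl2b => complex poly" where
 "avM c E = [:c / 4, - 1 / 2, - 1 / 4:]" | "avM c F = 1" | "avM c H = [:0, 1:]"

fun pwM :: "complex => word => complex poly" where
 "pwM c [] = 1"
| "pwM c ((x, n) # w) = smult ((-1) ^ n) (avM c x * pcompose (pwM c w) [:2 * of_int (wx x), 1:])"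

lemma poly_pwM: "poly (pwM c w) \<mu> = pw c w \<mu>"
proof (induction w arbitrary: \<mu>)
 case (Cons b w)
 obtain x n where b: "b = (x, n)" by (cases b)
 have "poly (avM c x) \<mu> = av c x \<mu>" by (cases x) (auto simp: field_simps)
 then show ?case by (simp add: b Cons poly_pcompose add.commute)
qed simp

lemma degree_pwM: "int (degree (pwM c w)) \<le> int (dg w) + wt w"
proof (induction w)
 case (Cons b w)
 obtain x n where b: "b = (x, n)" by (cases b)
 have "degree (pwM c (b # w)) \<le> degree (avM c x) + degree (pcompose (pwM c w) [:2 * of_int (wx x), 1:])"
  unfolding b pwM.simps by (rule order_trans[OF degree_smult_le degree_mult_le])
 moreover have "int (degree (avM c x)) \<le> 1 + wx x" by (cases x) auto
 ultimately show ?case using Cons by (simp add: b degree_pcompose)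
qed simp

fun pmM :: "int => complex => comb => complex poly" where
 "pmM m c [] = 0" | "pmM m c (b # P) = (if wt (snd b) = m then smult (fst b) (pwM c (snd b)) else 0) + pmM m c P"

lemma poly_pmM: "poly (pmM m c P) \<mu> = pm m c P \<mu>"
 by (induction P) (auto simp: pm_def poly_pwM)

lemma degree_pmM: "hom d P ==> pmM m c P \<noteq> 0 ==> int (degree (pmM m c P)) \<le> int d + m"
proof (induction P)
 case (Cons b P)
 define p where "p = (if wt (snd b) = m then smult (fst b) (pwM c (snd b)) else 0)"
 have e: "pmM m c (b # P) = p + pmM m c P" by (simp add: p_def)
 have h: "hom d P" "dg (snd b) = d" using Cons.prems(1) by (auto simp: hom_def)
 have p: "int (degree p) \<le> int d + m" if "p \<noteq> 0"
  using that degree_pwM[of c "snd b"] h degree_smult_le[of "fst b" "pwM c (snd b)"]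
  by (auto simp: p_def split: if_splits)
 show ?case
 proof (cases "p = 0 \<or> pmM m c P = 0")
  case True
  then show ?thesis using p Cons.IH[OF h(1)] Cons.prems(2) unfolding e by auto
 next
  case False
  have "degree (p + pmM m c P) \<le> max (degree p) (degree (pmM m c P))" by (rule degree_add_le_max)
  then show ?thesis unfolding e using p Cons.IH[OF h(1)] False by auto
 qed
qed (simp add: hom_def)

lemma pm_roots_mu:
 assumes "hom d P" "pm m c P \<mu> \<noteq> 0" "!!\<nu>. \<nu> \<in> C ==> pm m c P \<nu> = 0"
 shows "int (card C) \<le> int d + m"
proof -
 have nz: "pmM m c P \<noteq> 0" using assms(2) poly_pmM[of m c P \<mu>] by auto
 have "card C \<le> card {\<nu>. poly (pmM m c P) \<nu> = 0}"
  by (intro card_mono poly_roots_finite nz) (use assms(3) in \<open>auto simp: poly_pmM\<close>)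
 also have "\<dots> \<le> degree (pmM m c P)" by (rule card_poly_roots_bound[OF nz])
 finally show ?thesis using degree_pmM[OF assms(1) nz] by linarith
qed

lemma pm_filter:
 assumes "!!d. pm m c (filter (%(a, w). dg w = d) P) \<mu> = 0"
 shows "pm m c P \<mu> = 0"
proof -
 have s: "(\<Sum>d\<le>D. pm m c (filter (%(a, w). dg w = d) P) \<mu>) = pm m c P \<mu>" if "\<forall>(a, w)\<in>set P. dg w \<le> D" for D
  using that
 proof (induction P)
  case (Cons b P)
  obtain a w where b: "b = (a, w)" by (cases b)
  have "(\<Sum>d\<le>D. pm m c (filter (%(a, w). dg w = d) (b # P)) \<mu>)
   = (\<Sum>d\<le>D. (if d = dg w then a * (if wt w = m then pw c w \<mu> else 0) else 0) + pm m c (filter (%(a, w). dg w = d) P) \<mu>)"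
   by (rule sum.cong) (auto simp: b pm_def)
  also have "\<dots> = a * (if wt w = m then pw c w \<mu> else 0) + pm m c P \<mu>"
   unfolding sum.distrib using Cons by (auto simp: b)
  finally show ?case by (simp add: b pm_def)
 qed simp
 have "dg w \<le> (\<Sum>(a, w)\<leftarrow>P. dg w)" if "(a, w) \<in> set P" for a w
  using that by (induction P) auto
 then have "pm m c P \<mu> = (\<Sum>d\<le>(\<Sum>(a, w)\<leftarrow>P. dg w). pm m c (filter (%(a, w). dg w = d) P) \<mu>)"
  by (intro s[symmetric]) blast
 then show ?thesis by (simp only: assms sum.neutral_const)
qed

section \<open>Vanishing of the ideal on the tops\<close>

lemma int_level:
 assumes "t = of_nat (N + 1) / (of_nat q :: complex)" "q > 0" "of_int x * t = of_int y"
 shows "x * int (N + 1) = int q * y"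
proof -
 have "of_int x * of_nat (N + 1) = (of_nat q :: complex) * of_int y"
 proof -
  have "t * of_nat q = of_nat (N + 1)" using assms(1,2) by simp
  then have "of_int x * of_nat (N + 1) = (of_int x * t) * of_nat q" by (simp only: mult.assoc)
  then show ?thesis unfolding assms(3) by (simp only: mult.commute)
 qed
 then have "of_int (x * int (N + 1)) = (of_int (int q * y) :: complex)" by (simp only: of_int_mult of_int_of_nat_eq)
 then show ?thesis by (simp only: of_int_eq_iff)
qed

lemma level_dvd: "coprime (N + 1) q ==> x * int (N + 1) = int q * y ==> int q dvd x"
proof -
 assume c: "coprime (N + 1) q" and e: "x * int (N + 1) = int q * y"
 have "int q dvd x * int (N + 1)" unfolding e by simp
 moreover have "coprime (int q) (int (N + 1))" using c by (simp only: coprime_int_iff coprime_commute)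
 ultimately show ?thesis by (simp only: coprime_dvd_mult_left_iff)
qed

lemma cas_eq: "r * (r + 2) = r' * (r' + 2) \<longleftrightarrow> r = r' \<or> r = - r' - (2 :: complex)"
proof -
 have "r * (r + 2) - r' * (r' + 2) = (r - r') * (r - (- r' - 2))" by (simp add: algebra_simps)
 moreover have "r * (r + 2) = r' * (r' + 2) \<longleftrightarrow> r * (r + 2) - r' * (r' + 2) = 0" by (rule right_minus_eq[symmetric])
 ultimately show ?thesis by (simp only: mult_eq_0_iff right_minus_eq)
qed

text \<open>The Sugawara identity is linear in the word. Stating this with letters keeps the
  coefficients opaque in the induction.\<close>

lemma sugawara_step:
 fixes A :: complex
 assumes "A * x0 = B * x0 - C * x1 - D * x2 - G * x0 + y1 + D * y2 + U * y3"
  and "A * z0 = B * z0 - C * z1 - D * z2 - G * z0 + u1 + D * u2 + U * u3"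
 shows "A * (a * x0 + z0) = B * (a * x0 + z0) - C * (a * x1 + z1) - D * (a * x2 + z2) - G * (a * x0 + z0)
  + (a * y1 + u1) + D * (a * y2 + u2) + U * (a * y3 + u3)"
proof -
 have "A * (a * x0 + z0) = a * (A * x0) + A * z0" by (simp add: algebra_simps)
 then show ?thesis unfolding assms by (simp add: algebra_simps)
qed

context Lk0 begin

definition XS :: "complex => nat => sl2b => int => comb => complex => complex" where
 "XS c d x m P \<nu> = (\<Sum>n=1..d. (-1) ^ (n - 1) * pm m c (amP x (int n) P) \<nu>)"

lemma XS_Cons: "XS c d x m (b # P) \<nu> = (if wt (snd b) = m - wx x then fst b * Xs k c d x (snd b) \<nu> else 0) + XS c d x m P \<nu>"
 by (auto simp: XS_def Xs_def pm_amP sum.distrib sum_distrib_left algebra_simps)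

lemma pm_sugawara:
 assumes "hom d P"
 shows "(k + 2) * of_nat d * pm m c P \<mu> =
  c / 2 * pm m c P \<mu> - av c E (\<mu> - 2 + 2 * of_int m) * pm m c P (\<mu> - 2) - av c E \<mu> * pm m c P (\<mu> + 2)
   - \<mu> * (\<mu> + 2 * of_int m) / 2 * pm m c P \<mu>
  + XS c d E (m + 1) P (\<mu> - 2) + av c E \<mu> * XS c d F (m - 1) P (\<mu> + 2) + \<mu> / 2 * XS c d H m P \<mu>"
 using assms
proof (induction P)
 case Nil
 then show ?case by (simp add: XS_def pm_amP)
next
 case (Cons b P)
 obtain a w where b: "b = (a, w)" by (cases b)
 have h: "hom d P" "dg w = d" using Cons.prems by (auto simp: hom_def b)
 have p: "pm m c (b # P) \<nu> = (if wt w = m then a * pw c w \<nu> else 0) + pm m c P \<nu>" for \<nu> by (simp add: pm_def b)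
 show ?case
 proof (cases "wt w = m")
  case True
  have X: "XS c d x (m + wx x) (b # P) \<nu> = a * Xs k c d x w \<nu> + XS c d x (m + wx x) P \<nu>" for x \<nu>
   unfolding XS_Cons by (simp add: b True)
  have X': "XS c d E (m + 1) (b # P) \<nu> = a * Xs k c d E w \<nu> + XS c d E (m + 1) P \<nu>"
   "XS c d F (m - 1) (b # P) \<nu> = a * Xs k c d F w \<nu> + XS c d F (m - 1) P \<nu>"
   "XS c d H m (b # P) \<nu> = a * Xs k c d H w \<nu> + XS c d H m P \<nu>" for \<nu>
   using X[of E \<nu>] X[of F \<nu>] X[of H \<nu>] by simp_all
  have p': "pm m c (b # P) \<nu> = a * pw c w \<nu> + pm m c P \<nu>" for \<nu> by (simp add: p True)
  show ?thesis unfolding X' p'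
   by (rule sugawara_step[OF sugawara_words[of w d k c \<mu>, unfolded h(2) True, OF order_refl] Cons.IH[OF h(1)]])
 next
  case False
  then show ?thesis using Cons.IH[OF h(1)] unfolding p XS_Cons by (simp add: b del: av.simps)
 qed
qed

lemma hom_amP: "hom d P ==> 1 \<le> n ==> amP x (int n) P \<noteq> [] ==> n \<le> d \<and> hom (d - n) (amP x (int n) P)"
proof -
 assume h: "hom d P" "1 \<le> n" "amP x (int n) P \<noteq> []"
 have e: "int (dg u) = int d - int n" if m: "(a, u) \<in> set (amP x (int n) P)" for a u
 proof -
  obtain b w e where "(b, w) \<in> set P" "(e, u) \<in> set (am k x (int n) w)"
   using set_bindc[of a u "am k x (int n)" P] m unfolding amP_def by blast
  then show ?thesis using am_homog[of e u k x "int n" w] h(1) by (auto simp: hom_def)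
 qed
 obtain a u where "(a, u) \<in> set (amP x (int n) P)" using h(3) by (metis list.set_sel(1) surj_pair)
 from e[OF this] have "n \<le> d" by simp
 then show ?thesis using e unfolding hom_def by fastforce
qed

lemma hom_amP0: "hom d P ==> hom d (amP x 0 P)"
proof -
 assume h: "hom d P"
 have "dg u = d" if m: "(a, u) \<in> set (amP x 0 P)" for a u
 proof -
  obtain b w e where "(b, w) \<in> set P" "(e, u) \<in> set (am k x 0 w)"
   using set_bindc[of a u "am k x 0" P] m unfolding amP_def by blast
  then show ?thesis using am_homog[of e u k x 0 w] h by (auto simp: hom_def)
 qed
 then show ?thesis unfolding hom_def by auto
qed

lemma J_hom0: "hom 0 P ==> J P ==> pm m c P \<mu> = 0"
proof -
 assume h: "hom 0 P" and J: "J P"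
 have w: "w = []" if "(a, w) \<in> set P" for a w
 proof (cases w)
  case (Cons b u)
  then show ?thesis using h that by (cases b) (auto simp: hom_def)
 qed
 have "lin sV ev P = lin sV (%_. one) P" by (rule lin_cong) (auto dest: w)
 also have "\<dots> = sV (lc (%_. 1) P) one" by (induction P) (auto simp: V.vs.scale_left_distrib)
 finally have "lc (%_. 1) P = 0" using J one_nz by (simp add: J_def)
 moreover have "pm m c P \<mu> = lc (%_. (if m = 0 then 1 else 0) * 1) P"
  unfolding pm_def by (rule lc_cong) (auto dest: w)
 ultimately show ?thesis unfolding lc_cmult by simp
qed

text \<open>Both the source weight n - 2 j and the target weight n - 2 j + 2 m occur in the (n +
  1)-dimensional module.\<close>

definition reg :: "nat => int => nat => bool" where
 "reg n m j \<longleftrightarrow> j \<le> n \<and> 0 \<le> int j - m \<and> int j - m \<le> int n"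

definition fails :: "nat => nat => int => bool" where
 "fails n d m \<longleftrightarrow> (\<exists>P j. J P \<and> hom d P \<and> reg n m j \<and> pm m (of_nat n * (of_nat n + 2)) P (of_nat n - 2 * of_nat j) \<noteq> 0)"

text \<open>A vector of minimal degree and, among those, maximal weight whose zero mode survives on the
 \<open>(n+1)\<close>-dimensional top is an eigenvector of the Sugawara operator.\<close>
lemma minimal_failure:
 assumes low: "!!d' m'. d' < d ==> \<not> fails n d' m'" and high: "!!m'. m' > m ==> \<not> fails n d m'"
  and f: "fails n d m"
 shows "(k + 2) * of_nat d = of_int (m * (m + 1))"
proof -
 define c where "c = (of_nat n * (of_nat n + 2) :: complex)"
 obtain P j where P: "J P" "hom d P" "reg n m j" "pm m c P (of_nat n - 2 * of_nat j) \<noteq> 0"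
  using f unfolding fails_def c_def by blast
 define \<mu> where "\<mu> = (of_nat n - 2 * of_nat j :: complex)"
 have j: "j \<le> n" "0 \<le> int j - m" "int j - m \<le> int n" using P(3) by (auto simp: reg_def)
 have avn: "av c E (of_nat n) = 0" "av c E (- of_nat n - 2) = 0" by (auto simp: c_def algebra_simps)
 \<comment> \<open>Positive modes lower the degree, where by minimality nothing fails at regular
   weights.\<close>
 have X: "XS c d x m' P (of_nat n - 2 * of_nat j') = 0" if r: "reg n m' j'" for x m' j'
  unfolding XS_def
 proof (rule sum.neutral, rule ballI)
  fix i assume i: "i \<in> {1..d}"
  have "pm m' c (amP x (int i) P) (of_nat n - 2 * of_nat j') = 0"
  proof (cases "amP x (int i) P = []")
   case False
   have "\<not> fails n (d - i) m'" by (rule low) (use i in auto)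
   then show ?thesis using hom_amP[OF P(2) _ False] i J_amP[OF P(1)] r unfolding fails_def c_def by auto
  qed simp
  then show "(-1) ^ (i - 1) * pm m' c (amP x (int i) P) (of_nat n - 2 * of_nat j') = 0" by simp
 qed
 \<comment> \<open>At the edge j = n the shifted source weight leaves the module, and crossing the
   weight - n - 2 gives the vanishing instead.\<close>
 have XE: "XS c d E (m + 1) P (\<mu> - 2) = 0"
 proof (cases "j < n")
  case True
  have "reg n (m + 1) (Suc j)" using j True by (auto simp: reg_def)
  from X[OF this] show ?thesis by (simp add: \<mu>_def algebra_simps)
 next
  case False
  then have "\<mu> - 2 = - of_nat n - 2" "0 < m + 1" using j by (auto simp: \<mu>_def)
  then have "pm (m + 1) c Q (\<mu> - 2) = 0" for Q using pm_crossing[of c "\<mu> - 2" 0 "m + 1" Q] avn(2) by (simp del: av.simps)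
  then show ?thesis unfolding XS_def by simp
 qed
 have XF: "av c E \<mu> * XS c d F (m - 1) P (\<mu> + 2) = 0"
 proof (cases j)
  case 0
  then show ?thesis using avn(1) by (simp add: \<mu>_def del: av.simps)
 next
  case (Suc j')
  have "reg n (m - 1) j'" using j Suc by (auto simp: reg_def)
  from X[OF this] show ?thesis by (simp add: \<mu>_def Suc algebra_simps)
 qed
 have XH: "XS c d H m P \<mu> = 0" using X[OF P(3)] by (simp add: \<mu>_def)
 \<comment> \<open>The zero mode of e(0) P is a commutator with e. It has larger weight, so by
   maximality its regular values vanish, which ties together the values of P at neighbouring
   weights.\<close>
 define Q where "Q \<nu> = pm (m + 1) c (amP E 0 P) \<nu>" for \<nu>
 have Qe: "Q \<nu> = av c E (\<nu> + 2 * of_int m) * pm m c P \<nu> - av c E \<nu> * pm m c P (\<nu> + 2)" for \<nu>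
  unfolding Q_def pm_amP0 by (simp del: av.simps)
 have Qr: "Q (of_nat n - 2 * of_nat j') = 0" if "reg n (m + 1) j'" for j'
 proof -
  have "\<not> fails n d (m + 1)" by (rule high) simp
  then show ?thesis using that hom_amP0[OF P(2)] J_amP[OF P(1)] unfolding fails_def c_def Q_def by blast
 qed
 have Q1: "Q \<mu> = 0"
 proof (cases "int j = m")
  case False
  then have "reg n (m + 1) j" using j by (auto simp: reg_def)
  from Qr[OF this] show ?thesis by (simp add: \<mu>_def)
 next
  case True
  then have mj: "(of_int m :: complex) = of_nat j" by (metis of_int_of_nat_eq)
  have 1: "av c E (\<mu> + 2 * of_int m) = 0" using avn(1) by (simp add: \<mu>_def mj del: av.simps)
  have 2: "av c E \<mu> * pm m c P (\<mu> + 2) = 0"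
  proof (cases j)
   case 0
   then show ?thesis using avn(1) by (simp add: \<mu>_def del: av.simps)
  next
   case (Suc j')
   have "\<mu> + 2 + 2 * of_int (int j') = of_nat n" by (simp add: \<mu>_def Suc)
   then have "pm m c P (\<mu> + 2) = 0" using avn(1) True Suc by (intro pm_crossing[of _ _ "int j'"]) (simp_all del: av.simps)
   then show ?thesis by simp
  qed
  show ?thesis unfolding Qe 1 2 by simp
 qed
 have Q2: "Q (\<mu> - 2) = 0"
 proof (cases "j < n")
  case True
  have "reg n (m + 1) (Suc j)" using j True by (auto simp: reg_def)
  from Qr[OF this] show ?thesis by (simp add: \<mu>_def algebra_simps)
 next
  case False
  then have e: "\<mu> - 2 = - of_nat n - 2" and m: "m \<ge> 0" using j by (auto simp: \<mu>_def)
  have "av c E (\<mu> - 2 + 2 * of_int m) * pm m c P (\<mu> - 2) = 0"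
  proof (cases "m = 0")
   case True
   then show ?thesis using avn(2) e by (simp del: av.simps)
  next
   case False
   then have "pm m c P (\<mu> - 2) = 0" using m e avn(2) by (intro pm_crossing[of _ _ 0]) (simp_all del: av.simps)
   then show ?thesis by simp
  qed
  moreover have "av c E (\<mu> - 2) = 0" unfolding e by (rule avn(2))
  ultimately show ?thesis unfolding Qe by (simp del: av.simps)
 qed
 have 1: "av c E (\<mu> - 2 + 2 * of_int m) * pm m c P (\<mu> - 2) = av c E (\<mu> - 2) * pm m c P \<mu>"
  using Q2 unfolding Qe by (simp del: av.simps)
 have 2: "av c E \<mu> * pm m c P (\<mu> + 2) = av c E (\<mu> + 2 * of_int m) * pm m c P \<mu>"
  using Q1 unfolding Qe by (simp del: av.simps)
 have "(k + 2) * of_nat d * pm m c P \<mu> = c / 2 * pm m c P \<mu> - av c E (\<mu> - 2) * pm m c P \<mu>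
   - av c E (\<mu> + 2 * of_int m) * pm m c P \<mu> - \<mu> * (\<mu> + 2 * of_int m) / 2 * pm m c P \<mu>"
  using pm_sugawara[OF P(2), of m c \<mu>] unfolding XE XF XH 1 2 by (simp del: av.simps)
 \<comment> \<open>What remains is half the Casimir on a highest weight vector of weight 2
   m.\<close>
 also have "\<dots> = of_int (m * (m + 1)) * pm m c P \<mu>" by (simp add: field_simps)
 finally show ?thesis using P(4) by (simp add: \<mu>_def)
qed

text \<open>One flow leads from the finite-dimensional top n to k - n = t - 2 - n with t = k + 2. As
  long as the weight is not an integer each further flow adds t, and only at i = q does it become
  one again.\<close>

lemma ZZ_chain:
 assumes "coprime (N + 1) q" "k + 2 = of_nat (N + 1) / of_nat q" "ZZ (of_nat n)" "Suc i \<le> q"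
 shows "ZZ (of_nat (Suc i) * (k + 2) - 2 - of_nat n)"
 using assms(4)
proof (induction i)
 case 0
 then show ?case using flow_nat[OF assms(3)] by (simp add: algebra_simps)
next
 case (Suc i)
 have "of_nat (Suc i) * (k + 2) \<notin> (\<int> :: complex set)" unfolding assms(2) by (rule not_Ints_mult[OF assms(1)]) (use Suc.prems in auto)
 then have "of_nat (Suc i) * (k + 2) + of_int (- 2 - int n) \<notin> (\<int> :: complex set)" by (rule not_Ints_shift)
 then have "of_nat (Suc i) * (k + 2) - 2 - of_nat n \<notin> (\<nat> :: complex set)"
  using Nats_subset_Ints by (auto simp: algebra_simps)
 moreover have "ZZ (of_nat (Suc i) * (k + 2) - 2 - of_nat n)" using Suc by simp
 ultimately have "ZZ (of_nat (Suc i) * (k + 2) - 2 - of_nat n + (k + 2))" by (intro flow_generic)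
 then show ?case by (simp add: algebra_simps)
qed

text \<open>Since q (k + 2) = N + 1, the complete chain ends at the integer N - 1 - n.\<close>

lemma ZZ_reflect:
 assumes "coprime (N + 1) q" "k + 2 = of_nat (N + 1) / of_nat q" "q > 0" "ZZ (of_nat n)" "n < N"
 shows "ZZ (of_nat (N - 1 - n))"
proof -
 have "of_nat q * (k + 2) = of_nat (N + 1)" using assms(2,3) by simp
 moreover have "ZZ (of_nat q * (k + 2) - 2 - of_nat n)" using ZZ_chain[OF assms(1,2,4), of "q - 1"] assms(3) by simp
 ultimately show ?thesis using assms(5) by (simp add: of_nat_diff algebra_simps)
qed

lemma level_distinct:
 assumes "coprime (N + 1) q" "k + 2 = of_nat (N + 1) / of_nat q" "0 < i" "i < q" "0 < i'" "i' < q"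
  and "of_nat i * (k + 2) - 2 - of_nat n = of_nat i' * (k + 2) - 2 - of_nat n'"
 shows "i = i' \<and> n = n'"
proof -
 have "of_int (int i - int i') * (k + 2) = of_int (int n - int n')" using assms(7) by (simp add: algebra_simps)
 then have e: "(int i - int i') * int (N + 1) = int q * (int n - int n')" using int_level[OF assms(2)] assms(3,4) by simp
 then have "int q dvd int i - int i'" by (rule level_dvd[OF assms(1)])
 then have "int i - int i' = 0" using assms(3-6) zdvd_not_zless[of "int i - int i'" "int q"] zdvd_not_zless[of "int i' - int i" "int q"]
  by (cases "int i - int i' > 0"; cases "int i' - int i > 0") (auto simp: dvd_diff_commute)
 then show ?thesis using e assms(4) by auto
qed

lemma level_opposite:
 assumes "coprime (N + 1) q" "k + 2 = of_nat (N + 1) / of_nat q" "0 < i" "i < q" "0 < i'" "i' < q"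
  and "of_nat i * (k + 2) - 2 - of_nat n = - (of_nat i' * (k + 2) - 2 - of_nat n') - 2"
 shows "i + i' = q \<and> n + n' + 2 = N + 1"
proof -
 have "of_int (int i + int i') * (k + 2) = of_int (int n + int n' + 2)" using assms(7) by (simp add: algebra_simps)
 then have e: "(int i + int i') * int (N + 1) = int q * (int n + int n' + 2)" using int_level[OF assms(2)] assms(3,4) by simp
 then have "int q dvd int i + int i'" by (rule level_dvd[OF assms(1)])
 then have "int q dvd int i + int i' - int q" by simp
 then have "int i + int i' - int q = 0"
  using assms(3-6) zdvd_not_zless[of "int i + int i' - int q" "int q"] zdvd_not_zless[of "int q - (int i + int i')" "int q"]
  by (cases "int i + int i' - int q > 0"; cases "int q - (int i + int i') > 0") (auto simp: dvd_diff_commute)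
 then have s: "int i + int i' = int q" by simp
 then have "int (N + 1) = int n + int n' + 2" using e assms(4) unfolding s by simp
 then show ?thesis using s by linarith
qed

text \<open>From |m| \<le> n and 2 n + 1 \<le> N the eigenvalue equation gives 2 d \<le> q n. The
  smaller tops already supply n zeros in the Casimir value if q = 1 and (q - 1) n otherwise, whereas
  \<open>pm_roots_c\<close> admits at most (d + m) / 2. Only q = 2 with d = m = n survives, and then
  N + 1 is even, against coprimality.\<close>

lemma failure_bound:
 assumes cop: "coprime (N + 1) q" and t: "k + 2 = of_nat (N + 1) / of_nat q" and q: "q > 0"
  and N: "2 * n + 1 \<le> N" and IH: "!!n'. n' < n ==> ZZ (of_nat n')"
  and P: "J P" "hom d P" "pm m c P \<mu> \<noteq> 0" and m: "\<bar>m\<bar> \<le> int n" and n: "n > 0"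
  and d: "int d * int (N + 1) = int q * (m * (m + 1))"
 shows False
proof -
 have mm: "m * (m + 1) \<le> int n * (int n + 1)"
 proof (cases "m \<ge> 0")
  case True
  then show ?thesis using m by (intro mult_mono) auto
 next
  case False
  have "(- m) * (- m - 1) \<le> int n * (int n + 1)" by (rule mult_mono) (use m False in auto)
  moreover have "m * (m + 1) = (- m) * (- m - 1)" by (simp add: algebra_simps)
  ultimately show ?thesis by (simp only:)
 qed
 have "int d * (2 * int n + 2) \<le> int d * int (N + 1)" using N by (intro mult_left_mono) auto
 also have "\<dots> \<le> int q * (int n * (int n + 1))" unfolding d using mm by (intro mult_left_mono) auto
 finally have "(2 * int d) * (int n + 1) \<le> (int q * int n) * (int n + 1)" by (simp add: algebra_simps)
 then have d2: "2 * int d \<le> int q * int n" by (subst (asm) mult_le_cancel_right_pos) auto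
 show False
 proof (cases "q = 1")
  case True
  have tN: "k + 2 = of_nat (N + 1)" using t True by simp
  \<comment> \<open>For q = 1 there are no nonintegral tops; the reflected finite-dimensional tops
    take their place. On each of them more than d + m weights give zero, so the coefficient vanishes
    identically in the weight.\<close>
  define C where "C = (%i. (of_nat (N - 1 - i) * (of_nat (N - 1 - i) + 2) :: complex)) ` {..<n}"
  have "pm m (of_nat (N - 1 - i) * (of_nat (N - 1 - i) + 2)) P \<mu> = 0" if i: "i < n" for i
  proof (rule ccontr)
   define n' where "n' = N - 1 - i"
   define c where "c = (of_nat n' * (of_nat n' + 2) :: complex)"
   assume "pm m (of_nat (N - 1 - i) * (of_nat (N - 1 - i) + 2)) P \<mu> \<noteq> 0"
   then have nz: "pm m c P \<mu> \<noteq> 0" by (simp add: c_def n'_def)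
   have z: "ZZ (of_nat n')" unfolding n'_def by (rule ZZ_reflect[OF cop t q IH[OF i]]) (use i N in auto)
   define R where "R = (%j. of_nat n' - 2 * of_nat j :: complex) ` {..nat (int n' + m)}"
   have m0: "int n' + m \<ge> 0" using m i N by (auto simp: n'_def)
   have "card R = card {..nat (int n' + m)}" unfolding R_def by (rule card_image) (auto simp: inj_on_def)
   then have "int (card R) = int n' + m + 1" using m0 by simp
   moreover have "int (card R) \<le> int d + m"
   proof (rule pm_roots_mu[OF P(2) nz])
    fix \<nu> assume "\<nu> \<in> R"
    then obtain j where j: "\<nu> = of_nat n' - 2 * of_nat j" "int j \<le> int n' + m" using m0 by (auto simp: R_def)
    show "pm m c P \<nu> = 0"
    proof (cases "int j < m")
     case True
     have "av c E (of_nat n') = 0" by (simp add: c_def)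
     then show ?thesis using True j(1) by (intro pm_crossing[of _ _ "int j"]) (simp_all del: av.simps)
    next
     case False
     have e: "int j - int (nat (int j - m)) = m" using False by simp
     have "nat (int j - m) \<le> n'" using j(2) False by auto
     then have "pm (int j - int (nat (int j - m))) (of_nat n' * (of_nat n' + 2)) P (of_nat n' - 2 * of_nat j) = 0"
      by (intro ZZ_range[OF z P(1)]) auto
     then show ?thesis unfolding e c_def j(1) .
    qed
   qed
   ultimately show False using d2 True i N by (simp add: n'_def)
  qed
  then have "2 * int (card C) \<le> int d + m"
   by (intro pm_roots_c[OF P(2,3)]) (auto simp: C_def)
  moreover have "card C = n"
  proof -
   have "inj_on (%i. (of_nat (N - 1 - i) * (of_nat (N - 1 - i) + 2) :: complex)) {..<n}"
   proof (rule inj_onI)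
    fix i j assume ij: "i \<in> {..<n}" "j \<in> {..<n}"
     "(of_nat (N - 1 - i) * (of_nat (N - 1 - i) + 2) :: complex) = of_nat (N - 1 - j) * (of_nat (N - 1 - j) + 2)"
    define a' b' where "a' = N - 1 - i" and "b' = N - 1 - j"
    have "(of_nat (a' * (a' + 2)) :: complex) = of_nat (b' * (b' + 2))" using ij(3) by (simp only: of_nat_mult of_nat_add of_nat_numeral a'_def b'_def)
    then have "a' * (a' + 2) = b' * (b' + 2)" by (simp only: of_nat_eq_iff)
    then have "a' = b'" using mult_strict_mono[of a' b' "a' + 2" "b' + 2"] mult_strict_mono[of b' a' "b' + 2" "a' + 2"]
     by (cases a' b' rule: linorder_cases) auto
    then show "i = j" using ij N by (auto simp: a'_def b'_def)
   qed
   then show ?thesis unfolding C_def by (simp add: card_image)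
  qed
  ultimately show False using d2 True m n by auto
 next
  case False
  then have q2: "q \<ge> 2" using q by simp
  define g where "g = (%(i, n'). of_nat i * (k + 2) - 2 - (of_nat n' :: complex))"
  \<comment> \<open>Casimir values of the nonintegral tops reached from n' < n. Two of them could
    agree only if n1 + n2 + 2 = N + 1, which is impossible below half of N.\<close>
  define C where "C = (%x. g x * (g x + 2)) ` ({1..<q} \<times> {..<n})"
  have "2 * int (card C) \<le> int d + m"
  proof (rule pm_roots_c[OF P(2,3)])
   fix c' assume "c' \<in> C"
   then obtain i n' where i: "1 \<le> i" "i < q" "n' < n" "c' = g (i, n') * (g (i, n') + 2)" by (auto simp: C_def)
   have z: "ZZ (g (i, n'))" using ZZ_chain[OF cop t IH[OF i(3)], of "i - 1"] i by (simp add: g_def)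
   have "of_nat i * (k + 2) \<notin> (\<int> :: complex set)" unfolding t by (rule not_Ints_mult[OF cop]) (use i in auto)
   then have "of_nat i * (k + 2) + of_int (- 2 - int n') \<notin> (\<int> :: complex set)" by (rule not_Ints_shift)
   then have "g (i, n') \<notin> \<nat>" using Nats_subset_Ints by (auto simp: algebra_simps g_def)
   from Good_ZZ[OF z this] show "pm m c' P \<mu> = 0" using P(1) unfolding Good_def i(4) by blast
  qed
  moreover have "card C = (q - 1) * n"
  proof -
   have "inj_on (%x. g x * (g x + 2)) ({1..<q} \<times> {..<n})"
   proof (rule inj_onI)
    fix x y assume xy: "x \<in> {1..<q} \<times> {..<n}" "y \<in> {1..<q} \<times> {..<n}" "g x * (g x + 2) = g y * (g y + 2)"
    obtain i n1 j n2 where x: "x = (i, n1)" "y = (j, n2)" by (cases x, cases y)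
    with xy have a: "i \<in> {1..<q}" "j \<in> {1..<q}" "n1 \<in> {..<n}" "n2 \<in> {..<n}"
     "g (i, n1) * (g (i, n1) + 2) = g (j, n2) * (g (j, n2) + 2)"
     by auto
    then consider (1) "g (i, n1) = g (j, n2)" | (2) "g (i, n1) = - g (j, n2) - 2" using cas_eq by blast
    then have "i = j \<and> n1 = n2"
    proof cases
     case 1
     then show ?thesis using level_distinct[OF cop t, of i j n1 n2] a by (auto simp: g_def)
    next
     case 2
     then have "n1 + n2 + 2 = N + 1" using level_opposite[OF cop t, of i j n1 n2] a by (auto simp: g_def)
     then show ?thesis using a N by auto
    qed
    then show "x = y" by (simp add: x)
   qed
   then show ?thesis unfolding C_def by (simp add: card_image card_cartesian_product)
  qed
  ultimately have c1: "2 * ((int q - 1) * int n) \<le> int d + m" using q2 by (simp add: of_nat_diff)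
  then have "4 * ((int q - 1) * int n) \<le> int q * int n + 2 * int n" using d2 m by linarith
  then have "(4 * (int q - 1)) * int n \<le> (int q + 2) * int n" by (simp add: algebra_simps)
  then have "4 * (int q - 1) \<le> int q + 2" by (subst (asm) mult_le_cancel_right_pos) (use n in auto)
  then have qq: "q = 2" using q2 by simp
  have md: "m = int n" "int d = int n" using c1 d2 m qq by auto
  then have "int n * int (N + 1) = int n * (2 * (int n + 1))" using d qq by simp
  then have "int (N + 1) = 2 * (int n + 1)" using n by simp
  then have "even (N + 1)" by presburger
  then show False using cop qq by (auto simp: coprime_iff_gcd_eq_1)
 qed
qed

lemma ZZ_small:
 assumes cop: "coprime (N + 1) q" and t: "k + 2 = of_nat (N + 1) / of_nat q" and q: "q > 0"
  and N: "2 * n + 1 \<le> N" and IH: "!!n'. n' < n ==> ZZ (of_nat n')"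
 shows "ZZ (of_nat n)"
proof -
 have nf: "\<not> fails n d m" for d m
 proof
  assume f: "fails n d m"
  define D where "D = (LEAST d. \<exists>m. fails n d m)"
  have D: "\<exists>m. fails n D m" unfolding D_def by (rule LeastI[of _ d]) (use f in blast)
  have low: "\<not> fails n d' m'" if "d' < D" for d' m' using not_less_Least[of d'] that unfolding D_def by blast
  define S where "S = {m. fails n D m}"
  have mb: "\<bar>m'\<bar> \<le> int n" if "fails n d' m'" for d' m' using that unfolding fails_def reg_def by auto
  then have "S \<subseteq> {- int n..int n}" unfolding S_def by fastforce
  then have fin: "finite S" by (rule finite_subset) simp
  define M where "M = Max S"
  have "M \<in> S" unfolding M_def using fin D by (intro Max_in) (auto simp: S_def)
  then have f: "fails n D M" by (simp add: S_def)
  have high: "\<not> fails n D m'" if "m' > M" for m'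
   using Max_ge[OF fin, of m'] that unfolding M_def S_def by auto
  have e: "(k + 2) * of_nat D = of_int (M * (M + 1))" by (rule minimal_failure[OF low high f])
  then have "of_int (int D) * (k + 2) = of_int (M * (M + 1))" by (simp only: of_int_of_nat_eq mult.commute)
  then have d: "int D * int (N + 1) = int q * (M * (M + 1))" by (rule int_level[OF t q])
  obtain P j where P: "J P" "hom D P" "pm M (of_nat n * (of_nat n + 2)) P (of_nat n - 2 * of_nat j) \<noteq> 0"
   using f unfolding fails_def by blast
  show False
  proof (cases "n = 0")
   case True
   then have "M = 0" using mb[OF f] by simp
   then have "D = 0" using d by simp
   then show False using J_hom0 P by blast
  next
   case False
   then show False using failure_bound[OF cop t q N IH P mb[OF f] _ d] by simp
  qed
 qed
 show ?thesis unfolding ZZ_def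
 proof (intro allI impI)
  fix P assume P: "J P"
  show "pm 0 (of_nat n * (of_nat n + 2)) P (of_nat n) = 0"
  proof (rule pm_filter)
   fix d
   have "hom d (filter (%(a, w). dg w = d) P)" by (auto simp: hom_def)
   moreover have "reg n 0 0" by (simp add: reg_def)
   ultimately show "pm 0 (of_nat n * (of_nat n + 2)) (filter (%(a, w). dg w = d) P) (of_nat n) = 0"
    using nf[of d 0] J_degree[OF P, of d] unfolding fails_def by fastforce
  qed
 qed
qed

text \<open>The root count works only for the lower half of the tops; reflection supplies the upper
  half.\<close>

theorem ZZ_all:
 assumes cop: "coprime (N + 1) q" and t: "k + 2 = of_nat (N + 1) / of_nat q" and q: "q > 0" and n: "n < N"
 shows "ZZ (of_nat n)"
 using n
proof (induction n rule: less_induct)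
 case (less n)
 show ?case
 proof (cases "2 * n + 1 \<le> N")
  case True
  show ?thesis by (rule ZZ_small[OF cop t q True]) (use less True in auto)
 next
  case False
  have "ZZ (of_nat (N - 1 - (N - 1 - n)))"
   by (rule ZZ_reflect[OF cop t q less.IH]) (use False less.prems in auto)
  moreover have "N - 1 - (N - 1 - n) = n" using less.prems by simp
  ultimately show ?thesis by simp
 qed
qed

end

subsection \<open>A vector obstructing all other top weights\<close>

text \<open>The zero mode coefficient of a word in e(-1) and f(0); the clause for
  \<open>True\<close> is the commutator with f.\<close>

fun pc :: "complex => bool list => complex => complex" where
 "pc c [] \<mu> = 1"
| "pc c (False # w) \<mu> = av c E \<mu> * pc c w (\<mu> + 2)"
| "pc c (True # w) \<mu> = pc c w \<mu> - pc c w (\<mu> - 2)"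

text \<open>\<open>pc\<close> as a polynomial in the highest weight r, at weight r - 2 j. A
  nonintegral j is allowed so that the Gamma quotient of \<open>coeff_gp\<close> can be kept finite
  and nonzero.\<close>

fun gp :: "bool list => complex => complex poly" where
 "gp [] j = 1"
| "gp (False # w) j = [:j * (1 - j), j:] * gp w (j - 1)"
| "gp (True # w) j = gp w j - gp w (j + 1)"

lemma poly_gp: "poly (gp w j) r = pc (r * (r + 2)) w (r - 2 * j)"
proof (induction w arbitrary: j)
 case (Cons b w)
 have "av (r * (r + 2)) E (r - 2 * j) = j * (1 - j) + j * r" by (simp add: field_simps)
 moreover have "poly (gp w (j - 1)) r = pc (r * (r + 2)) w (r - 2 * j + 2)" "poly (gp w (j + 1)) r = pc (r * (r + 2)) w (r - 2 * j - 2)"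
  using Cons[of "j - 1"] Cons[of "j + 1"] by (simp_all add: algebra_simps)
 moreover have "poly (gp (False # w) j) r = (j * (1 - j) + j * r) * poly (gp w (j - 1)) r" by (simp add: algebra_simps)
 ultimately show ?case using Cons[of j] by (cases b) (simp_all only: pc.simps gp.simps poly_diff)
qed simp

lemma degree_gp: "degree (gp w j) \<le> c0 w"
proof (induction w arbitrary: j)
 case (Cons b w)
 show ?case
 proof (cases b)
  case True
  then show ?thesis using Cons[of j] Cons[of "j + 1"] by (simp add: degree_diff_le)
 next
  case False
  have "degree ([:j * (1 - j), j:] * gp w (j - 1)) \<le> degree [:j * (1 - j), j:] + degree (gp w (j - 1))" by (rule degree_mult_le)
  also have "\<dots> \<le> 1 + c0 w" using Cons[of "j - 1"] by (intro add_mono) auto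
  finally show ?thesis using False by simp
 qed
qed simp

text \<open>In leading order e(-1) is multiplication by j with a shift and f(0) is a difference in
  j; the Gamma quotient converts these into x and -d/dx.\<close>

lemma coeff_gp:
 "j \<notin> \<int> ==> coeff (gp w j) (c0 w) = Gamma (j + 1) * rGamma (j - (of_nat (c0 w) - of_nat (c1 w)) + 1) * chr 0 w"
proof (induction w arbitrary: j)
 case Nil
 then have "j + 1 \<notin> \<int>\<^sub>\<le>\<^sub>0" by (metis Ints_1 Ints_diff add_diff_cancel_right' nonpos_Ints_subset_Ints subsetD)
 then have "Gamma (j + 1) * rGamma (j + 1) = 1" by (simp add: rGamma_inverse_Gamma Gamma_eq_zero_iff)
 then show ?case by simp
next
 case (Cons b w)
 show ?case
 proof (cases b)
  case False
  have j1: "j - 1 \<notin> \<int>" using Cons.prems by (metis Ints_1 Ints_add diff_add_cancel)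
  have jn: "j \<notin> \<int>\<^sub>\<le>\<^sub>0" using Cons.prems nonpos_Ints_subset_Ints by blast
  have "coeff (gp w (j - 1)) (Suc (c0 w)) = 0" using degree_gp[of w "j - 1"] by (intro coeff_eq_0) simp
  then have "coeff (gp (b # w) j) (c0 (b # w)) = j * coeff (gp w (j - 1)) (c0 w)" by (simp add: False)
  also have "\<dots> = (j * Gamma j) * rGamma (j - (of_nat (c0 w) - of_nat (c1 w))) * chr 0 w"
   using Cons.IH[OF j1] by (simp add: algebra_simps)
  also have "j * Gamma j = Gamma (j + 1)" using Gamma_plus1[OF jn] by simp
  finally show ?thesis by (simp add: False algebra_simps)
 next
  case True
  define d where "d = (of_nat (c0 w) - of_nat (c1 w) :: complex)"
  have j1: "j + 1 \<notin> \<int>" using Cons.prems by (metis Ints_1 Ints_diff add_diff_cancel_right')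
  then have jn: "j + 1 \<notin> \<int>\<^sub>\<le>\<^sub>0" using nonpos_Ints_subset_Ints by blast
  have 1: "Gamma (j + 1 + 1) = (j + 1) * Gamma (j + 1)" by (rule Gamma_plus1[OF jn])
  have 2: "rGamma (j - d + 1) = (j - d + 1) * rGamma (j - d + 1 + 1)" by (rule rGamma_plus1[symmetric])
  have "coeff (gp (b # w) j) (c0 (b # w)) = Gamma (j + 1) * rGamma (j - d + 1) * chr 0 w - Gamma (j + 1 + 1) * rGamma (j + 1 - d + 1) * chr 0 w"
   using Cons.IH[OF Cons.prems] Cons.IH[OF j1] by (simp add: True d_def)
  also have "j + 1 - d + 1 = j - d + 1 + 1" by simp
  also have "Gamma (j + 1) * rGamma (j - d + 1) * chr 0 w - Gamma (j + 1 + 1) * rGamma (j - d + 1 + 1) * chr 0 w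
   = Gamma (j + 1) * rGamma (j - d + 1 + 1) * (- d * chr 0 w)"
   unfolding 1 2 by (simp add: algebra_simps)
  also have "- d * chr 0 w = chr 0 (b # w)" by (simp add: True d_def)
  also have "j - d + 1 + 1 = j - (of_nat (c0 (b # w)) - of_nat (c1 (b # w))) + 1" by (simp add: True d_def algebra_simps)
  finally show ?thesis .
 qed
qed

fun gpP :: "(complex \<times> bool list) list => complex => complex poly" where
 "gpP [] j = 0" | "gpP (b # P) j = smult (fst b) (gp (snd b) j) + gpP P j"

lemma pc_nonzero:
 assumes "homog A B P" "lc (chr 0) P \<noteq> 0"
 shows "\<exists>r. lc (%w. pc (r * (r + 2)) w (r - 1)) P \<noteq> 0"
proof (rule ccontr)
 assume "\<not> ?thesis"
 then have z: "lc (%w. pc (r * (r + 2)) w (r - 2 * (1 / 2))) P = 0" for r by simp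
 have p: "poly (gpP P j) r = lc (%w. pc (r * (r + 2)) w (r - 2 * j)) P" for j r
  by (induction P) (auto simp: poly_gp)
 have "gpP P (1 / 2) = 0" using z unfolding p[symmetric] by (metis poly_all_0_iff_0)
 moreover have h: "(1 / 2 :: complex) \<notin> \<int>"
 proof
  assume "(1 / 2 :: complex) \<in> \<int>"
  then obtain i where "(1 / 2 :: complex) = of_int i" by (elim Ints_cases)
  then have "(of_int 1 :: complex) = of_int (2 * i)" by (simp add: field_simps)
  then have "1 = 2 * i" by (simp only: of_int_eq_iff)
  then show False by presburger
 qed
 have "coeff (gpP P (1 / 2)) A = Gamma (1 / 2 + 1) * rGamma (1 / 2 - (of_nat A - of_nat B) + 1) * lc (chr 0) P"
  using assms(1)
 proof (induction P)
  case (Cons b P)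
  then have b: "c0 (snd b) = A" "c1 (snd b) = B" "homog A B P" by (auto simp: homog_def)
  show ?case using Cons.IH[OF b(3)] coeff_gp[OF h, of "snd b"] unfolding b by (simp add: algebra_simps)
 qed simp
 moreover have "(1 / 2 + 1 :: complex) \<notin> \<int>\<^sub>\<le>\<^sub>0" "(1 / 2 - (of_nat A - of_nat B) + 1 :: complex) \<notin> \<int>\<^sub>\<le>\<^sub>0"
 proof -
  have "(1 / 2 :: complex) + of_int 1 \<notin> \<int>" "(1 / 2 :: complex) + of_int (int B - int A + 1) \<notin> \<int>"
   by (rule not_Ints_shift[OF h])+
  then have "(1 / 2 + 1 :: complex) \<notin> \<int>" "(1 / 2 - (of_nat A - of_nat B) + 1 :: complex) \<notin> \<int>"
   by (simp_all add: algebra_simps)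
  then show "(1 / 2 + 1 :: complex) \<notin> \<int>\<^sub>\<le>\<^sub>0" "(1 / 2 - (of_nat A - of_nat B) + 1 :: complex) \<notin> \<int>\<^sub>\<le>\<^sub>0"
   using nonpos_Ints_subset_Ints by blast+
 qed
 ultimately show False using assms(2) by (simp add: Gamma_eq_zero_iff rGamma_eq_zero_iff)
qed

lemma polyf_prod: "finite I ==> (!!i. i \<in> I ==> polyf (f i)) ==> polyf (%x. \<Prod>i\<in>I. f i x)"
 by (induction I rule: finite_induct) (auto intro: polyf_intros)

lemma poly_by_roots:
 fixes p :: "complex poly"
 assumes "finite R" "degree p \<le> card R" "!!x. x \<in> R ==> poly p x = 0"
 shows "p = smult (coeff p (card R)) (\<Prod>x\<in>R. [:- x, 1:])"
proof (rule ccontr)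
 define u where "u = (\<Prod>x\<in>R. [:- x, 1 :: complex:])"
 have du: "degree u = card R" unfolding u_def by (subst degree_prod_eq_sum_degree) auto
 have lu: "coeff u (card R) = 1" unfolding du[symmetric] u_def lead_coeff_prod by simp
 define D where "D = p - smult (coeff p (card R)) u"
 assume "p \<noteq> smult (coeff p (card R)) (\<Prod>x\<in>R. [:- x, 1:])"
 then have D: "D \<noteq> 0" by (simp add: D_def u_def)
 have "degree D \<le> card R" unfolding D_def using assms(2) degree_smult_le[of "coeff p (card R)" u] by (intro degree_diff_le) (auto simp: du)
 moreover have "coeff D (card R) = 0" by (simp add: D_def lu)
 ultimately have "degree D < card R" using D by (metis le_neq_implies_less leading_coeff_0_iff)
 moreover have "card R \<le> card {x. poly D x = 0}"
  by (intro card_mono poly_roots_finite D) (use assms in \<open>auto simp: D_def u_def poly_prod\<close>)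
 moreover have "card {x. poly D x = 0} \<le> degree D" by (rule card_poly_roots_bound[OF D])
 ultimately show False by simp
qed

context Lk0 begin

lemma lc_conv: "lc (%u. pw c u \<mu>) (conv w) = pc c w \<mu>"
proof (induction w arbitrary: \<mu>)
 case (Cons b w)
 show ?case
 proof (cases b)
  case True
  have "lc (%u. pw c u \<mu>) (conv (b # w)) = lc (%u. px k c F 0 u \<mu>) (conv w)"
   by (simp add: True amP_def lc_bindc px_def)
  also have "\<dots> = pc c w \<mu> - pc c w (\<mu> - 2)" by (simp add: px_0 lc_diff Cons)
  finally show ?thesis by (simp add: True)
 next
  case False
  then show ?thesis using lc_cmult[of "av c E \<mu>" "%u. pw c u (\<mu> + 2)" "conv w"] Cons by (simp del: av.simps)
 qed
qed simp

lemma Good_level: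
 assumes cop: "coprime (N + 1) q" and t: "k + 2 = of_nat (N + 1) / of_nat q" and q: "q > 0"
  and i: "i \<in> {1..<q}" "n < N"
 shows "Good ((of_nat i * (k + 2) - 2 - of_nat n) * (of_nat i * (k + 2) - 2 - of_nat n + 2))"
proof (rule Good_ZZ)
 show "ZZ (of_nat i * (k + 2) - 2 - of_nat n)"
  using ZZ_chain[OF cop t ZZ_all[OF cop t q i(2)], of "i - 1"] i by simp
 have "of_nat i * (k + 2) \<notin> (\<int> :: complex set)" unfolding t by (rule not_Ints_mult[OF cop]) (use i in auto)
 then have "of_nat i * (k + 2) + of_int (- 2 - int n) \<notin> (\<int> :: complex set)" by (rule not_Ints_shift)
 then show "of_nat i * (k + 2) - 2 - of_nat n \<notin> \<nat>" using Nats_subset_Ints by (auto simp: algebra_simps)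
qed

text \<open>The known zeros exhaust the degree: a' forced by crossing and the values in C. Hence the
  zero mode factors completely up to a constant \<kappa>, which \<open>pc_nonzero\<close> shows to
  be nonzero, and at c = r (r + 2) with target weight r each factor vanishes only for r in the
  excluded list.\<close>

theorem obstruction:
 assumes cop: "coprime (N + 1) q" and t: "k + 2 = of_nat (N + 1) / of_nat q" and q: "q > 0" and N: "N > 0"
  and r: "!!i n. 1 \<le> i ==> i \<le> q ==> n < N ==> r \<noteq> of_nat i * (k + 2) - 2 - of_nat n"
 shows "\<exists>Q d a. J Q \<and> hom d Q \<and> (\<forall>(b, u)\<in>set Q. wt u = int a) \<and> pm (int a) (r * (r + 2)) Q (r - 2 * of_nat a) \<noteq> 0"
proof -
 obtain A B where AB: "bad (k + 2 - 2) 0 0 A B" "B \<le> A" "A \<le> B + N" "B \<le> (q - 1) * N"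
  using null_vector_exists[OF cop t N q] by blast
 then obtain P where P: "homog A B P" "Rad k 0 P" "lc (chr 0) P \<noteq> 0" by (auto simp: bad_def)
 define Q where "Q = bindc conv P"
 define a' where "a' = A - B"
 have JQ: "J Q" using Rad_zero[OF P(1,2)] by (simp add: J_def Q_def V.vs.lin_bindc lin_conv)
 have hQ: "wt u = int a' \<and> dg u = A" if m: "(c, u) \<in> set Q" for c u
 proof -
  obtain b w e where "(b, w) \<in> set P" "(e, u) \<in> set (conv w)"
   using set_bindc[of c u conv P] m unfolding Q_def by blast
  then show ?thesis using conv_homog[of e u w] P(1) AB(2) by (auto simp: homog_def a'_def)
 qed
 have hom: "hom A Q" using hQ unfolding hom_def by auto
 have pmQ: "pm (int a') c Q \<mu> = lc (%w. pc c w \<mu>) P" for c \<mu>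
 proof -
  have "pm (int a') c Q \<mu> = lc (%u. pw c u \<mu>) Q" unfolding pm_def by (rule lc_cong) (use hQ in auto)
  then show ?thesis by (simp add: Q_def lc_bindc lc_conv)
 qed
 define g where "g = (%(i, n). of_nat i * (k + 2) - 2 - (of_nat n :: complex))"
 define Dm where "Dm = {1..<q} \<times> {..<N}"
 define C where "C = (%x. x * (x + 2)) ` g ` Dm"
 have finC: "finite C" by (simp add: C_def Dm_def)
 \<comment> \<open>The weights x and - x - 2 share a Casimir value, so at most half of the values
   are lost.\<close>
 have cardC: "(q - 1) * N \<le> 2 * card C"
 proof -
  have "inj_on g Dm"
  proof (rule inj_onI)
   fix x y assume xy: "x \<in> Dm" "y \<in> Dm" "g x = g y"
   obtain i n i' n' where e: "x = (i, n)" "y = (i', n')" by (cases x, cases y)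
   show "x = y" using level_distinct[OF cop t, of i i' n n'] xy unfolding e g_def Dm_def by auto
  qed
  then have "(q - 1) * N = card (g ` Dm)" by (simp add: card_image Dm_def card_cartesian_product)
  also have "\<dots> = (\<Sum>x\<in>g ` Dm. 1)" by simp
  also have "\<dots> = (\<Sum>c\<in>C. \<Sum>x\<in>{x \<in> g ` Dm. x * (x + 2) = c}. 1)"
   unfolding C_def by (rule sum.image_gen) (simp add: Dm_def)
  also have "\<dots> \<le> (\<Sum>c\<in>C. 2)"
  proof (rule sum_mono)
   fix c assume "c \<in> C"
   then obtain x where x: "c = x * (x + 2)" by (auto simp: C_def)
   have "card {y \<in> g ` Dm. y * (y + 2) = c} \<le> card {x, - x - 2}"
    unfolding x by (rule card_mono) (use cas_eq[of _ x] in auto)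
   also have "\<dots> \<le> 2" by (simp add: card_insert_if)
   finally show "(\<Sum>x\<in>{x \<in> g ` Dm. x * (x + 2) = c}. 1) \<le> (2::nat)" by simp
  qed
  finally show ?thesis by simp
 qed
 define M where "M = a' + card C"
 \<comment> \<open>A + a' = 2 a' + B, and B is at most (q - 1) N, hence at most twice the size of
   C.\<close>
 have deg: "int A + int a' \<le> 2 * int M" using cardC AB by (simp add: M_def a'_def)
 define \<kappa> where "\<kappa> = coeff (pmC (int a') Q 0) M"
 have \<kappa>: "coeff (pmC (int a') Q \<mu>) M = \<kappa>" for \<mu> unfolding \<kappa>_def by (rule coeff_pmC[OF hom deg])
 \<comment> \<open>At natural weights beyond every element of C the crossing values are distinct and
   avoid C, so all roots are simple; polynomiality in \<mu> removes the restriction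
   afterwards.\<close>
 obtain n0 :: nat where n0: "!!c. c \<in> C ==> norm c < of_nat n0"
 proof -
  obtain b where b: "\<forall>c\<in>C. norm c \<le> b" using finite_imp_bounded[OF finC] unfolding bounded_iff by blast
  obtain n0 :: nat where "b < of_nat n0" using reals_Archimedean2 by blast
  with b show ?thesis by (intro that[of n0]) fastforce
 qed
 have gen: "pm (int a') c Q (of_nat n) = \<kappa> * ((\<Prod>i<a'. c - (of_nat n + 2 * of_nat i) * (of_nat n + 2 * of_nat i + 2)) * (\<Prod>x\<in>C. c - x))"
  if n: "n \<ge> n0" for n c
 proof -
  define h where "h i = ((of_nat n + 2 * of_nat i) * (of_nat n + 2 * of_nat i + 2) :: complex)" for i
  have h: "h i = of_nat ((n + 2 * i) * (n + 2 * i + 2))" for i by (simp only: h_def of_nat_mult of_nat_add of_nat_numeral)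
  have inj: "inj_on h {..<a'}"
  proof (rule inj_onI)
   fix i j assume "h i = h j"
   then have "(n + 2 * i) * (n + 2 * i + 2) = (n + 2 * j) * (n + 2 * j + 2)" unfolding h by (simp only: of_nat_eq_iff)
   then show "i = j"
    using mult_strict_mono[of "n + 2 * i" "n + 2 * j" "n + 2 * i + 2" "n + 2 * j + 2"]
     mult_strict_mono[of "n + 2 * j" "n + 2 * i" "n + 2 * j + 2" "n + 2 * i + 2"]
    by (cases i j rule: linorder_cases) auto
  qed
  have dis: "h ` {..<a'} \<inter> C = {}"
  proof -
   have "h i \<notin> C" for i
   proof
    assume "h i \<in> C"
    from n0[OF this] have "(n + 2 * i) * (n + 2 * i + 2) < n0" unfolding h norm_of_nat by (simp only: of_nat_less_iff)
    moreover have "n \<le> (n + 2 * i) * (n + 2 * i + 2)" by (simp add: algebra_simps)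
    ultimately show False using n by simp
   qed
   then show ?thesis by auto
  qed
  define R where "R = h ` {..<a'} \<union> C"
  have cR: "card R = M" unfolding R_def M_def using dis finC inj by (simp add: card_Un_disjoint card_image)
  have "pmC (int a') Q (of_nat n) = smult (coeff (pmC (int a') Q (of_nat n)) (card R)) (\<Prod>x\<in>R. [:- x, 1:])"
  proof (rule poly_by_roots)
   show "degree (pmC (int a') Q (of_nat n)) \<le> card R"
    using degree_pmC[OF hom, of "int a'" "of_nat n"] deg unfolding cR by (cases "pmC (int a') Q (of_nat n) = 0") auto
   fix x assume "x \<in> R"
   then consider i where "i < a'" "x = h i" | "x \<in> C" by (auto simp: R_def)
   then show "poly (pmC (int a') Q (of_nat n)) x = 0" unfolding poly_pmC
   proof cases
    case (1 i)
    then show "pm (int a') x Q (of_nat n) = 0"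
    proof (intro pm_crossing[of _ _ "int i"])
     show "av x E (of_nat n + 2 * of_int (int i)) = 0" unfolding 1(2) h_def by (simp only: av.simps of_int_of_nat_eq diff_self div_0)
    qed simp_all
   next
    case 2
    then obtain i n' where "i \<in> {1..<q}" "n' < N" "x = g (i, n') * (g (i, n') + 2)" by (auto simp: C_def Dm_def)
    then have "Good x" using Good_level[OF cop t q, of i n'] by (simp add: g_def)
    then show "pm (int a') x Q (of_nat n) = 0" using JQ unfolding Good_def by blast
   qed
  qed (simp add: R_def finC)
  then have "pm (int a') c Q (of_nat n) = poly (smult \<kappa> (\<Prod>x\<in>R. [:- x, 1:])) c"
   unfolding cR \<kappa> using poly_pmC[of "int a'" Q "of_nat n" c] by simp
  also have "\<dots> = \<kappa> * (\<Prod>x\<in>R. c - x)" by (simp add: poly_prod)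
  also have "(\<Prod>x\<in>R. c - x) = (\<Prod>x\<in>h ` {..<a'}. c - x) * (\<Prod>x\<in>C. c - x)"
   unfolding R_def by (rule prod.union_disjoint) (use dis finC in auto)
  also have "(\<Prod>x\<in>h ` {..<a'}. c - x) = (\<Prod>i<a'. c - h i)" by (simp add: prod.reindex[OF inj])
  finally show ?thesis by (simp only: h_def)
 qed
 have all: "pm (int a') c Q \<mu> = \<kappa> * ((\<Prod>i<a'. c - (\<mu> + 2 * of_nat i) * (\<mu> + 2 * of_nat i + 2)) * (\<Prod>x\<in>C. c - x))" for c \<mu>
 proof -
  have "polyf (%\<mu>. pm (int a') c Q \<mu> - \<kappa> * ((\<Prod>i<a'. c - (\<mu> + 2 * of_nat i) * (\<mu> + 2 * of_nat i + 2)) * (\<Prod>x\<in>C. c - x)))"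
   by (intro polyf_intros polyf_pm polyf_prod) auto
  from polyf_zero[OF this, of n0 \<mu>] gen[of _ c] show ?thesis by simp
 qed
 obtain r' where "pm (int a') (r' * (r' + 2)) Q (r' - 1) \<noteq> 0" using pc_nonzero[OF P(1,3)] pmQ by auto
 then have "\<kappa> \<noteq> 0" unfolding all by auto
 \<comment> \<open>With s = a' - i between 1 and N the factor is 4 s (r - s + 1); its root s - 1 is
   the excluded weight with i = q and n = N - s.\<close>
 moreover have "r * (r + 2) - (r - 2 * of_nat a' + 2 * of_nat i) * (r - 2 * of_nat a' + 2 * of_nat i + 2) \<noteq> 0" if i: "i < a'" for i
 proof
  define s where "s = a' - i"
  have s: "of_nat a' = of_nat i + (of_nat s :: complex)" "1 \<le> s" "s \<le> N" using i AB(3) by (auto simp: s_def a'_def of_nat_diff)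
  assume "r * (r + 2) - (r - 2 * of_nat a' + 2 * of_nat i) * (r - 2 * of_nat a' + 2 * of_nat i + 2) = 0"
  then have "4 * of_nat s * (r - of_nat s + 1) = 0" unfolding s(1) by (simp add: algebra_simps)
  then have "r - of_nat s + 1 = 0" using s(2) by simp
  then have "r = of_nat s - 1" by (simp add: diff_add_eq eq_diff_eq)
  also have "\<dots> = of_nat q * (k + 2) - 2 - of_nat (N - s)" using s(3) q unfolding t by (simp add: of_nat_diff)
  finally show False using r[of q "N - s"] q s N by simp
 qed
 \<comment> \<open>The second root - g - 2 belongs to the excluded list as well, by i -> q - i and n
   -> N - 1 - n.\<close>
 moreover have "r * (r + 2) - x \<noteq> 0" if x: "x \<in> C" for x
 proof
  assume e: "r * (r + 2) - x = 0"
  obtain i n where i: "i \<in> {1..<q}" "n < N" "x = g (i, n) * (g (i, n) + 2)" using x by (auto simp: C_def Dm_def)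
  then consider "r = g (i, n)" | "r = - g (i, n) - 2" using e cas_eq[of r "g (i, n)"] by auto
  then show False
  proof cases
   case 1
   then show False using r[of i n] i by (simp add: g_def)
  next
   case 2
   have "of_nat q * (k + 2) = of_nat N + 1" using t q by simp
   then have "- g (i, n) - 2 = of_nat (q - i) * (k + 2) - 2 - of_nat (N - 1 - n)"
    using i by (simp add: g_def of_nat_diff algebra_simps)
   moreover have "1 \<le> q - i" "q - i \<le> q" "N - 1 - n < N" using i by auto
   ultimately show False using r[of "q - i" "N - 1 - n"] 2 by simp
  qed
 qed
 ultimately have "pm (int a') (r * (r + 2)) Q (r - 2 * of_nat a') \<noteq> 0" unfolding all using finC by simp
 moreover have "\<forall>(b, u)\<in>set Q. wt u = int a'" using hQ by auto
 ultimately show ?thesis using JQ hom by blast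
qed

end

subsection \<open>Fields and their products\<close>

definition evz :: "(nat => 'm::ab_group_add) => bool" where "evz f \<longleftrightarrow> (\<exists>M. \<forall>i\<ge>M. f i = 0)"

text \<open>The sum of an eventually vanishing sequence as a total function; by \<open>fs_eq\<close>
  the chosen cut-off does not matter.\<close>

definition fs :: "(nat => 'm::ab_group_add) => 'm" where "fs f = (\<Sum>i<(SOME M. \<forall>i\<ge>M. f i = 0). f i)"

lemma fs_eq:
 assumes "!!i. i \<ge> M ==> f i = 0" shows "fs f = (\<Sum>i<M. f i)"
proof -
 define M' where "M' = (SOME M. \<forall>i\<ge>M. f i = 0)"
 have M': "\<forall>i\<ge>M'. f i = 0" unfolding M'_def by (rule someI[where x = M]) (use assms in blast)
 have "(\<Sum>i<M'. f i) = (\<Sum>i<max M M'. f i)" by (rule sum.mono_neutral_left) (use M' in auto)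
 also have "\<dots> = (\<Sum>i<M. f i)" by (rule sum.mono_neutral_right) (use assms in auto)
 finally show ?thesis by (simp add: fs_def M'_def)
qed

lemma evzE: "evz f ==> (\<forall>\<^sub>F M in sequentially. fs f = (\<Sum>i<M. f i))"
 unfolding evz_def eventually_sequentially by (metis fs_eq order_trans)

lemma evzI: "(!!i. i \<ge> M ==> f i = 0) ==> evz f" unfolding evz_def by blast

lemma evz_ops:
 "evz f ==> evz g ==> evz (%i. f i + g i)" "evz f ==> evz g ==> evz (%i. f i - g i)" "evz (%i. 0)"
 "evz f ==> evz (%i. f (Suc i))"
 "evz f ==> evz (%i. - f i)"
proof -
 show "evz (%i. f i + g i)" "evz (%i. f i - g i)" if "evz f" "evz g"
 proof -
  from that obtain M N where "\<forall>i\<ge>M. f i = 0" "\<forall>i\<ge>N. g i = 0" by (auto simp: evz_def)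
  then show "evz (%i. f i + g i)" "evz (%i. f i - g i)" by (auto intro!: evzI[of "max M N"])
 qed
qed (auto simp: evz_def intro: le_SucI)

lemma fs_add: "evz f ==> evz g ==> fs (%i. f i + g i) = fs f + fs g"
proof -
 assume f: "evz f" and g: "evz g"
 from eventually_conj[OF evzE[OF f] eventually_conj[OF evzE[OF g] evzE[OF evz_ops(1)[OF f g]]]]
 obtain M where "fs f = (\<Sum>i<M. f i)" "fs g = (\<Sum>i<M. g i)" "fs (%i. f i + g i) = (\<Sum>i<M. f i + g i)"
  unfolding eventually_sequentially by blast
 then show ?thesis by (simp add: sum.distrib)
qed

lemma fs_diff: "evz f ==> evz g ==> fs (%i. f i - g i) = fs f - fs g"
proof -
 assume f: "evz f" and g: "evz g"
 from eventually_conj[OF evzE[OF f] eventually_conj[OF evzE[OF g] evzE[OF evz_ops(2)[OF f g]]]]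
 obtain M where "fs f = (\<Sum>i<M. f i)" "fs g = (\<Sum>i<M. g i)" "fs (%i. f i - g i) = (\<Sum>i<M. f i - g i)"
  unfolding eventually_sequentially by blast
 then show ?thesis by (simp add: sum_subtractf)
qed

lemma fs_0 [simp]: "fs (%i. 0) = 0" using fs_eq[of 0 "%i. 0"] by simp

lemma fs_Suc: "evz f ==> fs f = f 0 + fs (%i. f (Suc i))"
proof -
 assume "evz f"
 then obtain M where M: "\<forall>i\<ge>M. f i = 0" by (auto simp: evz_def)
 have "fs f = (\<Sum>i<Suc M. f i)" by (rule fs_eq) (use M in auto)
 also have "\<dots> = f 0 + (\<Sum>i<M. f (Suc i))" by (rule sum.lessThan_Suc_shift)
 also have "(\<Sum>i<M. f (Suc i)) = fs (%i. f (Suc i))" by (rule fs_eq[symmetric]) (use M in auto)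
 finally show ?thesis .
qed

lemma fs_single: "(!!i. i \<noteq> j ==> f i = 0) ==> fs f = f j"
proof -
 assume z: "!!i. i \<noteq> j ==> f i = 0"
 have "fs f = (\<Sum>i<Suc j. f i)" by (rule fs_eq) (use z in auto)
 also have "\<dots> = f j" using z by (simp add: sum.neutral)
 finally show ?thesis .
qed

lemma fs_sum: "finite Q ==> (!!q. q \<in> Q ==> evz (f q)) ==> fs (%i. \<Sum>q\<in>Q. f q i) = (\<Sum>q\<in>Q. fs (f q)) \<and> evz (%i. \<Sum>q\<in>Q. f q i)"
 by (induction Q rule: finite_induct) (auto simp: fs_add evz_ops)

lemma fs_triangle:
 assumes "!!i j. i + j \<ge> M ==> f i j = 0"
 shows "fs (%i. fs (f i)) = fs (%n. \<Sum>i\<le>n. f i (n - i))"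
proof -
 have "fs (f i) = (\<Sum>j<M. f i j)" for i by (rule fs_eq) (use assms in auto)
 then have "fs (%i. fs (f i)) = fs (%i. \<Sum>j<M. f i j)" by simp
 also have "\<dots> = (\<Sum>i<M. \<Sum>j<M. f i j)" by (rule fs_eq) (use assms in auto)
 also have "\<dots> = (\<Sum>(i, j)\<in>{..<M} \<times> {..<M}. f i j)" by (rule sum.cartesian_product)
 also have "\<dots> = (\<Sum>(i, j)\<in>{(i, j). i + j < M}. f i j)"
 proof (rule sum.mono_neutral_right)
  show "\<forall>x\<in>{..<M} \<times> {..<M} - {(i, j). i + j < M}. (case x of (i, j) => f i j) = 0"
  proof
   fix x assume x: "x \<in> {..<M} \<times> {..<M} - {(i, j). i + j < M}"
   then show "(case x of (i, j) => f i j) = 0" using assms[of "fst x" "snd x"] by (auto simp: case_prod_beta)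
  qed
 qed auto
 also have "\<dots> = (\<Sum>n<M. \<Sum>i\<le>n. f i (n - i))" by (rule sum.triangle_reindex)
 also have "\<dots> = fs (%n. \<Sum>i\<le>n. f i (n - i))" by (rule fs_eq[symmetric]) (use assms in auto)
 finally show ?thesis .
qed

lemma fs_swap:
 assumes "!!i j. j \<ge> M ==> f i j = 0" "!!j. evz (%i. f i j)"
 shows "fs (%i. fs (f i)) = fs (%j. fs (%i. f i j))" "evz (%i. fs (f i))"
proof -
 have "\<exists>N. \<forall>j<M. \<forall>i\<ge>N. f i j = 0"
 proof -
  obtain g where "!!j. \<forall>i\<ge>g j. f i j = 0" using assms(2) unfolding evz_def by metis
  moreover have "g j \<le> (\<Sum>j<M. g j)" if "j < M" for j using that by (intro member_le_sum) auto
  ultimately show ?thesis by (intro exI[of _ "\<Sum>j<M. g j"]) (meson order_trans)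
 qed
 then obtain N where N: "!!i j. i \<ge> N ==> f i j = 0" using assms(1) by (metis not_le)
 have "fs (%i. fs (f i)) = fs (%i. \<Sum>j<M. f i j)" by (rule arg_cong[where f = fs], rule ext, rule fs_eq) (use assms(1) in auto)
 also have "\<dots> = (\<Sum>i<N. \<Sum>j<M. f i j)" by (rule fs_eq) (use N in auto)
 also have "\<dots> = (\<Sum>j<M. \<Sum>i<N. f i j)" by (rule sum.swap)
 also have "\<dots> = fs (%j. \<Sum>i<N. f i j)" by (rule fs_eq[symmetric]) (use assms(1) in auto)
 also have "\<dots> = fs (%j. fs (%i. f i j))" by (rule arg_cong[where f = fs], rule ext, rule fs_eq[symmetric]) (use N in auto)
 finally show "fs (%i. fs (f i)) = fs (%j. fs (%i. f i j))" .
 show "evz (%i. fs (f i))"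
 proof (rule evzI[of N])
  fix i assume "i \<ge> N"
  then have "f i = (%j. 0)" using N by auto
  then show "fs (f i) = 0" by simp
 qed
qed

abbreviation gch :: "int => nat => complex" where "gch l i \<equiv> (of_int l :: complex) gchoose i"
abbreviation sg :: "int => complex" where "sg l \<equiv> (- 1 :: complex) powi l"

lemma sg_simps: "sg (l + 1) = - sg l" "sg (m + l) = sg m * sg l" "sg (int i) = (-1) ^ i"
 by (auto simp: power_int_add)

lemma gch_Suc: "gch (l + 1) (Suc i) = gch l i + gch l (Suc i)"
 using gbinomial_Suc_Suc[of "of_int l :: complex" i] by simp

lemma gch_0: "i \<noteq> 0 ==> gch 0 i = 0" by (cases i) auto

context cvs begin

lemma evz_scale: "evz f ==> evz (%i. s (c i) (f i))" unfolding evz_def by auto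

lemma fs_scale: "evz f ==> fs (%i. s c (f i)) = s c (fs f)"
proof -
 assume f: "evz f"
 from eventually_conj[OF evzE[OF f] evzE[OF evz_scale[OF f, of "%_. c"]]]
 obtain M where "fs f = (\<Sum>i<M. f i)" "fs (%i. s c (f i)) = (\<Sum>i<M. s c (f i))"
  unfolding eventually_sequentially by blast
 then show ?thesis by (simp add: scale_sum_right)
qed

lemma fs_lin: "Vector_Spaces.linear s s g ==> evz f ==> g (fs f) = fs (%i. g (f i))"
proof -
 assume g: "Vector_Spaces.linear s s g" and "evz f"
 interpret g: Vector_Spaces.linear s s g by fact
 obtain M where M: "\<forall>i\<ge>M. f i = 0" using \<open>evz f\<close> by (auto simp: evz_def)
 have "fs f = (\<Sum>i<M. f i)" "fs (%i. g (f i)) = (\<Sum>i<M. g (f i))" by (rule fs_eq; use M g.zero in auto)+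
 then show ?thesis by (simp add: g.sum)
qed

lemma evz_lin: "Vector_Spaces.linear s s g ==> evz f ==> evz (%i. g (f i))"
proof -
 assume g: "Vector_Spaces.linear s s g" and "evz f"
 interpret g: Vector_Spaces.linear s s g by fact
 obtain M where "\<forall>i\<ge>M. f i = 0" using \<open>evz f\<close> by (auto simp: evz_def)
 then show ?thesis by (intro evzI[of M]) (simp add: g.zero)
qed

text \<open>The coefficients of (z - w)^l f(z, w), with the power expanded for |z| > |w|.\<close>

definition K :: "int => (int => int => 'm) => int => int => 'm" where
 "K l f m n = fs (%i. s ((-1) ^ i * gch l i) (f (m + l - int i) (n + int i)))"

definition tame :: "(int => int => 'm) => bool" where
 "tame f \<longleftrightarrow> (\<forall>N. \<exists>M. \<forall>b\<ge>M. f (N - b) b = 0)"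

lemma tame_evz: "tame f ==> evz (%i. f (m - int i) (n + int i))"
proof -
 assume "tame f"
 then obtain M where M: "!!b. b \<ge> M ==> f (m + n - b) b = 0" unfolding tame_def by blast
 have "f (m - int i) (n + int i) = 0" if "i \<ge> nat (M - n)" for i
  using M[of "n + int i"] that by (simp add: algebra_simps)
 then show ?thesis by (rule evzI)
qed

lemma K_0: "K 0 f m n = f m n"
proof -
 have "K 0 f m n = s ((-1) ^ 0 * gch 0 0) (f (m + 0 - int 0) (n + int 0))"
  unfolding K_def by (rule fs_single) (simp add: gch_0[simplified])
 then show ?thesis by simp
qed

lemma K_succ:
 assumes "tame f" shows "K (l + 1) f m n = K l f (m + 1) n - K l f m (n + 1)"
proof -
 define h where "h i = f (m + l + 1 - int i) (n + int i)" for i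
 have h: "evz h" unfolding h_def by (rule tame_evz[OF assms])
 have hS: "evz (%i. h (Suc i))" by (rule evz_ops(4)[OF h])
 have 1: "K (l + 1) f m n = fs (%i. s ((-1) ^ i * gch (l + 1) i) (h i))"
  and 2: "K l f (m + 1) n = fs (%i. s ((-1) ^ i * gch l i) (h i))"
  and 3: "K l f m (n + 1) = fs (%i. s ((-1) ^ i * gch l i) (h (Suc i)))"
  unfolding K_def h_def by (simp_all add: algebra_simps)
 have "K (l + 1) f m n = h 0 + fs (%i. s ((-1) ^ Suc i * gch (l + 1) (Suc i)) (h (Suc i)))"
  unfolding 1 by (subst fs_Suc) (simp_all add: evz_scale h)
 moreover have "K l f (m + 1) n = h 0 + fs (%i. s ((-1) ^ Suc i * gch l (Suc i)) (h (Suc i)))"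
  unfolding 2 by (subst fs_Suc) (simp_all add: evz_scale h)
 moreover have "fs (%i. s ((-1) ^ Suc i * gch (l + 1) (Suc i)) (h (Suc i)))
   = fs (%i. s ((-1) ^ Suc i * gch l (Suc i)) (h (Suc i))) - fs (%i. s ((-1) ^ i * gch l i) (h (Suc i)))"
 proof -
  have "(-1) ^ Suc i * gch (l + 1) (Suc i) = (-1) ^ Suc i * gch l (Suc i) - (-1) ^ i * gch l i" for i
   unfolding gch_Suc by (simp add: algebra_simps)
  then show ?thesis by (simp only: scale_left_diff_distrib) (rule fs_diff[OF evz_scale[OF hS] evz_scale[OF hS]])
 qed
 ultimately show ?thesis unfolding 3 by simp
qed

lemma K_lin:
 "tame f ==> tame g ==> K l (%a b. f a b + g a b) m n = K l f m n + K l g m n"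
 "tame f ==> tame g ==> K l (%a b. f a b - g a b) m n = K l f m n - K l g m n"
 "tame f ==> K l (%a b. s c (f a b)) m n = s c (K l f m n)"
proof -
 assume f: "tame f"
 show "tame g ==> K l (%a b. f a b + g a b) m n = K l f m n + K l g m n"
  "tame g ==> K l (%a b. f a b - g a b) m n = K l f m n - K l g m n"
  unfolding K_def using f by (simp_all add: scale_right_distrib scale_right_diff_distrib fs_add fs_diff evz_scale tame_evz)
 show "K l (%a b. s c (f a b)) m n = s c (K l f m n)"
  unfolding K_def scale_left_commute[of _ c] by (rule fs_scale[OF evz_scale[OF tame_evz[OF f]]])
qed

definition field :: "(int => 'm => 'm) => bool" where
 "field A \<longleftrightarrow> (\<forall>n. Vector_Spaces.linear s s (A n)) \<and> (\<forall>w. \<exists>M. \<forall>n\<ge>M. A n w = 0)"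

lemma fieldD: "field A ==> Vector_Spaces.linear s s (A n)" "field A ==> \<exists>M. \<forall>n\<ge>M. A n w = 0"
 unfolding field_def by blast+

lemma field_ops:
 assumes "field A"
 shows "A n 0 = 0" "A n (u + v) = A n u + A n v" "A n (u - v) = A n u - A n v" "A n (s c u) = s c (A n u)"
proof -
 interpret Vector_Spaces.linear s s "A n" by (rule fieldD(1)[OF assms])
 show "A n 0 = 0" "A n (u + v) = A n u + A n v" "A n (u - v) = A n u - A n v" "A n (s c u) = s c (A n u)"
  by (rule zero add diff scale)+
qed

lemma field_evz: "field A ==> evz (%i. A (n + int i) w)"
proof -
 assume "field A"
 then obtain M where M: "\<forall>n\<ge>M. A n w = 0" using fieldD(2) by blast
 show ?thesis by (rule evzI[of "nat (M - n)"]) (use M in auto)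
qed

lemma tame_field: "field A ==> field B ==> tame (%a b. A a (B b w))"
 unfolding tame_def by (metis fieldD(2) field_ops(1))

text \<open>The right side of the Borcherds identity: each order of the product with the expansion
  of (z - w)^l that suits it. The sign turns (w - z)^l into (z - w)^l.\<close>

definition R :: "int => (int => 'm => 'm) => (int => 'm => 'm) => int => int => 'm => 'm" where
 "R l A B m n w = K l (%a b. A a (B b w)) m n - s (sg l) (K l (%b a. B b (A a w)) n m)"

lemma R_0: "R 0 A B m n w = A m (B n w) - B n (A m w)"
 by (simp add: R_def K_0)

lemma R_succ: "field A ==> field B ==> R (l + 1) A B m n w = R l A B (m + 1) n w - R l A B m (n + 1) w"
 unfolding R_def by (simp add: K_succ tame_field sg_simps(1) scale_right_diff_distrib)

text \<open>The l-th product of two fields; m = 0 is the residue in the first variable.\<close>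

definition nprod :: "int => (int => 'm => 'm) => (int => 'm => 'm) => int => 'm => 'm" where
 "nprod l A B n w = R l A B 0 n w"

text \<open>For a natural exponent both expansions agree, so this is (z - w)^k [A(z), B(w)] =
  0.\<close>

definition loc :: "(int => 'm => 'm) => (int => 'm => 'm) => bool" where
 "loc A B \<longleftrightarrow> (\<exists>k::nat. \<forall>m n w. R (int k) A B m n w = 0)"

lemma R_zero:
 assumes "field A" "field B" "!!m n w. R (int k) A B m n w = 0" "l \<ge> int k"
 shows "R l A B m n w = 0"
 using assms(4)
proof (induction l arbitrary: m n rule: int_ge_induct)
 case (step l)
 then show ?case by (simp add: R_succ assms(1,2))
qed (rule assms(3))

lemma nprod_scale: "field A ==> field B ==> nprod l A B n (s c w) = s c (nprod l A B n w)"
 unfolding nprod_def R_def by (simp add: field_ops K_lin(3) tame_field scale_right_diff_distrib scale_left_commute)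

lemma nprod_add: "field A ==> field B ==> nprod l A B n (u + w) = nprod l A B n u + nprod l A B n w"
 unfolding nprod_def R_def by (simp add: field_ops K_lin(1) tame_field scale_right_distrib)

lemma field_nprod:
 assumes A: "field A" and B: "field B" shows "field (nprod l A B)"
 unfolding field_def
proof (intro conjI allI)
 show "Vector_Spaces.linear s s (nprod l A B n)" for n
  unfolding Vector_Spaces.linear_iff
  by (intro conjI allI vector_space_axioms nprod_add[OF A B] nprod_scale[OF A B])
 fix w
 obtain M where M: "\<forall>n\<ge>M. B n w = 0" using fieldD(2)[OF B] by blast
 obtain M1 where M1: "\<forall>n\<ge>M1. A n w = 0" using fieldD(2)[OF A] by blast
 have "\<forall>i. \<exists>M. \<forall>n\<ge>M. B n (A (int i) w) = 0" by (intro allI fieldD(2)[OF B])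
 from choice[OF this] obtain g where g: "!!i. \<forall>n\<ge>g i. B n (A (int i) w) = 0" by blast
 define M2 where "M2 = (\<Sum>i<nat M1. \<bar>g i\<bar>) + \<bar>l\<bar> + \<bar>M1\<bar> + \<bar>M\<bar>"
 have M2: "nprod l A B n w = 0" if n: "n \<ge> M2" for n
 proof -
  have s0: "(\<Sum>i<nat M1. \<bar>g i\<bar>) \<ge> 0" by (rule sum_nonneg) simp
  have "B (n + l - int i) (A (0 + int i) w) = 0" for i
  proof (cases "i < nat M1")
   case True
   have "\<bar>g i\<bar> \<le> (\<Sum>i<nat M1. \<bar>g i\<bar>)" using True by (intro member_le_sum) auto
   then have "n + l - int i \<ge> g i" using n True unfolding M2_def by linarith
   then show ?thesis using g by simp
  next
   case False
   then show ?thesis using M1 by (simp add: field_ops B)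
  qed
  moreover have "A (0 + l - int i) (B (n + int i) w) = 0" for i
  proof -
   have "n + int i \<ge> M" using n s0 unfolding M2_def by linarith
   then show ?thesis using M by (simp add: field_ops A)
  qed
  ultimately show ?thesis unfolding nprod_def R_def K_def by (simp only: scale_zero_right fs_0 diff_self)
 qed
 then show "\<exists>M. \<forall>n\<ge>M. nprod l A B n w = 0" by blast
qed

text \<open>Both sides obey the same Pascal recursion, agree at m = 0 by definition of
  \<open>nprod\<close>, and vanish for l >= k. Downward induction on l and induction on m in both
  directions cover the rest.\<close>

theorem local_borcherds:
 assumes A: "field A" and B: "field B" and k: "!!m n w. R (int k) A B m n w = 0"
 shows "fs (%i. s (gch m i) (nprod (l + int i) A B (m + n - int i) w)) = R l A B m n w"
proof -
 define L where "L l m n = fs (%i. s (gch m i) (R (l + int i) A B 0 (m + n - int i) w))" for l m n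
 have ev: "evz (%i. s (c i) (R (l + int i) A B 0 (g i) w))" for l c g
  by (rule evzI[of "nat (int k - l)"]) (simp add: R_zero[OF A B k])
 have P: "L l (m + 1) n = L l m (n + 1) + L (l + 1) m n" for l m n
 proof -
  have "L l (m + 1) n = R l A B 0 (m + 1 + n) w + fs (%i. s (gch (m + 1) (Suc i)) (R (l + int (Suc i)) A B 0 (m + 1 + n - int (Suc i)) w))"
   unfolding L_def by (subst fs_Suc[OF ev]) simp
  also have "fs (%i. s (gch (m + 1) (Suc i)) (R (l + int (Suc i)) A B 0 (m + 1 + n - int (Suc i)) w))
   = fs (%i. s (gch m i) (R ((l + 1) + int i) A B 0 (m + n - int i) w)
     + s (gch m (Suc i)) (R (l + int (Suc i)) A B 0 (m + (n + 1) - int (Suc i)) w))"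
   unfolding gch_Suc scale_left_distrib by (simp add: algebra_simps)
  also have "\<dots> = L (l + 1) m n + fs (%i. s (gch m (Suc i)) (R (l + int (Suc i)) A B 0 (m + (n + 1) - int (Suc i)) w))"
   unfolding L_def by (rule fs_add[OF ev evz_ops(4)[OF ev]])
  finally show ?thesis unfolding L_def[of l m "n + 1"] by (subst fs_Suc[OF ev]) (simp add: algebra_simps)
 qed
 have z: "L l 0 n = R l A B 0 n w" for l n
 proof -
  have "L l 0 n = s (gch 0 0) (R (l + int 0) A B 0 (0 + n - int 0) w)"
   unfolding L_def by (rule fs_single) (simp add: gch_0[simplified])
  then show ?thesis by simp
 qed
 have "L l m n = R l A B m n w" for m n
 proof (induction "nat (int k - l)" arbitrary: l m n rule: less_induct)
  case less
  show ?case
  proof (cases "l \<ge> int k")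
   case True
   then show ?thesis unfolding L_def by (simp add: R_zero[OF A B k])
  next
   case False
   have IH: "L (l + 1) m n = R (l + 1) A B m n w" for m n by (rule less) (use False in auto)
   show ?thesis
   proof (induction m arbitrary: n rule: int_induct[of _ 0])
    case base
    show ?case by (rule z)
   next
    case (step1 m)
    then show ?case using P[of l m n] IH[of m n] R_succ[OF A B, of l m n w] by simp
   next
    case (step2 m)
    then show ?case using P[of l "m - 1" "n - 1"] IH[of "m - 1" "n - 1"] R_succ[OF A B, of l "m - 1" "n - 1" w] by simp
   qed
  qed
 qed
 then show ?thesis unfolding nprod_def L_def by simp
qed

end

subsection \<open>Dong's lemma\<close>

type_synonym 'm fun3 = "int => int => int => 'm"

text \<open>Multiplication of three-variable coefficients by z_1 - z_2; likewise \<open>d13\<close>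
  and \<open>d23\<close>.\<close>

definition d12 :: "'m fun3 => 'm::ab_group_add fun3" where "d12 f m n p = f (m + 1) n p - f m (n + 1) p"
definition d13 :: "'m fun3 => 'm::ab_group_add fun3" where "d13 f m n p = f (m + 1) n p - f m n (p + 1)"
definition d23 :: "'m fun3 => 'm::ab_group_add fun3" where "d23 f m n p = f m (n + 1) p - f m n (p + 1)"

abbreviation z3 :: "'m::ab_group_add fun3" where "z3 \<equiv> (%m n p. 0)"

lemma d_pow_z: "(d13 ^^ k) z3 = z3" "(d23 ^^ k) z3 = z3"
proof -
 have d: "d13 z3 = z3" "d23 z3 = z3" by (auto simp: d13_def d23_def fun_eq_iff)
 show "(d13 ^^ k) z3 = z3" by (induction k) (simp_all only: funpow.simps id_apply o_apply d)
 show "(d23 ^^ k) z3 = z3" by (induction k) (simp_all only: funpow.simps id_apply o_apply d)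
qed

lemma d_pow_diff: "(d13 ^^ k) (%m n p. f m n p - g m n p) = (%m n p. (d13 ^^ k) f m n p - (d13 ^^ k) g m n p)"
 "(d23 ^^ k) (%m n p. f m n p - g m n p) = (%m n p. (d23 ^^ k) f m n p - (d23 ^^ k) g m n p)"
proof -
 show "(d13 ^^ k) (%m n p. f m n p - g m n p) = (%m n p. (d13 ^^ k) f m n p - (d13 ^^ k) g m n p)"
  by (induction k) (auto simp: d13_def fun_eq_iff)
 show "(d23 ^^ k) (%m n p. f m n p - g m n p) = (%m n p. (d23 ^^ k) f m n p - (d23 ^^ k) g m n p)"
  by (induction k) (auto simp: d23_def fun_eq_iff)
qed

lemma d_comm: "d13 (d23 f) = d23 (d13 f)" by (auto simp: d13_def d23_def fun_eq_iff)

lemma d_pow_comm1: "(d23 ^^ k) (d13 f) = d13 ((d23 ^^ k) f)" by (induction k) (auto simp: d_comm)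
lemma d_pow_comm1': "(d13 ^^ k) (d23 f) = d23 ((d13 ^^ k) f)" by (induction k) (auto simp: d_comm)
lemma d_pow_comm: "(d23 ^^ k) ((d13 ^^ j) f) = (d13 ^^ j) ((d23 ^^ k) f)" by (induction j) (auto simp: d_pow_comm1)

lemma d23_eq: "d23 f = (%m n p. d13 f m n p - d12 f m n p)" by (auto simp: d13_def d23_def d12_def fun_eq_iff)

text \<open>Since z_2 - z_3 = (z_1 - z_3) - (z_1 - z_2), each further factor z_2 - z_3 either raises
  the power of z_1 - z_3 or raises l. After \<open>N\<close> of them one of the two vanishing
  hypotheses applies to every term.\<close>

lemma dong_elimination:
 assumes step: "!!l. d12 (f l) = f (l + 1)" and z: "!!l. l \<ge> int L ==> f l = z3"
  and kk: "!!l. (d23 ^^ k) ((d13 ^^ k) (f l)) = z3" and "int i + l + int N \<ge> int k + int L"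
 shows "(d23 ^^ (k + N)) ((d13 ^^ i) (f l)) = z3"
 using assms(4)
proof (induction N arbitrary: i l)
 case 0
 show ?case
 proof (cases "i \<ge> k")
  case True
  have "(d13 ^^ i) (f l) = (d13 ^^ (i - k)) ((d13 ^^ k) (f l))"
  proof -
   have "(d13 ^^ (i - k + k)) (f l) = (d13 ^^ (i - k)) ((d13 ^^ k) (f l))" by (simp only: funpow_add o_apply)
   then show ?thesis using True by simp
  qed
  moreover have "(d23 ^^ k) ((d13 ^^ (i - k)) ((d13 ^^ k) (f l))) = (d13 ^^ (i - k)) ((d23 ^^ k) ((d13 ^^ k) (f l)))" by (rule d_pow_comm)
  ultimately show ?thesis by (simp add: kk d_pow_z)
 next
  case False
  then have "l \<ge> int L" using 0 by linarith
  then show ?thesis by (simp add: z d_pow_z)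
 qed
next
 case (Suc N)
 have "(d23 ^^ (k + Suc N)) ((d13 ^^ i) (f l)) = (d23 ^^ (k + N)) ((d13 ^^ i) (d23 (f l)))"
  by (simp add: funpow_swap1 d_pow_comm1')
 also have "\<dots> = (%m n p. (d23 ^^ (k + N)) ((d13 ^^ Suc i) (f l)) m n p - (d23 ^^ (k + N)) ((d13 ^^ i) (f (l + 1))) m n p)"
  unfolding d23_eq d_pow_diff step by (simp add: funpow_swap1)
 also have "\<dots> = z3" using Suc.IH[of "Suc i" l] Suc.IH[of i "l + 1"] Suc.prems by simp
 finally show ?case .
qed

definition sw :: "'m fun3 => 'm fun3" where "sw f m n p = f n m p"

lemma d_sw: "(d23 ^^ k) (sw f) = sw ((d13 ^^ k) f)" "(d13 ^^ k) (sw f) = sw ((d23 ^^ k) f)"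
proof -
 have 1: "d23 (sw f) = sw (d13 f)" "d13 (sw f) = sw (d23 f)" for f :: "'a fun3"
  by (auto simp: d13_def d23_def sw_def fun_eq_iff)
 show "(d23 ^^ k) (sw f) = sw ((d13 ^^ k) f)" "(d13 ^^ k) (sw f) = sw ((d23 ^^ k) f)"
  by (induction k) (auto simp: 1)
qed

context cvs begin

definition tame3 :: "'m fun3 => bool" where "tame3 q \<longleftrightarrow> (\<forall>p. tame (%a b. q a b p))"

lemma tame_diff: "tame f ==> tame g ==> tame (%a b. f a b - g a b)"
 unfolding tame_def
proof
 fix N assume f: "\<forall>N. \<exists>M. \<forall>b\<ge>M. f (N - b) b = 0" and g: "\<forall>N. \<exists>M. \<forall>b\<ge>M. g (N - b) b = 0"
 obtain M M' where "\<forall>b\<ge>M. f (N - b) b = 0" "\<forall>b\<ge>M'. g (N - b) b = 0" using f g by blast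
 then show "\<exists>M. \<forall>b\<ge>M. f (N - b) b - g (N - b) b = 0" by (intro exI[of _ "max M M'"]) auto
qed

lemma tame_shift: "tame f ==> tame (%a b. f (a + 1) b)" "tame f ==> tame (%a b. f a (b + 1))"
proof -
 assume f: "tame f"
 show "tame (%a b. f (a + 1) b)"
  unfolding tame_def
 proof
  fix N
  obtain M where "\<forall>b\<ge>M. f (N + 1 - b) b = 0" using f unfolding tame_def by blast
  then show "\<exists>M. \<forall>b\<ge>M. f (N - b + 1) b = 0" by (intro exI[of _ M]) (auto simp: algebra_simps)
 qed
 show "tame (%a b. f a (b + 1))"
  unfolding tame_def
 proof
  fix N
  obtain M where M: "\<forall>b\<ge>M. f (N + 1 - b) b = 0" using f unfolding tame_def by blast
  have "f (N - b) (b + 1) = 0" if "b \<ge> M - 1" for b using M[rule_format, of "b + 1"] that by simp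
  then show "\<exists>M. \<forall>b\<ge>M. f (N - b) (b + 1) = 0" by blast
 qed
qed

lemma tame3_d: "tame3 q ==> tame3 ((d13 ^^ k) q)" "tame3 q ==> tame3 ((d23 ^^ k) q)"
proof -
 have "tame3 (d13 q)" "tame3 (d23 q)" if "tame3 q" for q
  using that unfolding tame3_def d13_def d23_def by (auto intro!: tame_diff tame_shift(1)[of "%a b. q a b _"] tame_shift(2)[of "%a b. q a b _"])
 then show "tame3 q ==> tame3 ((d13 ^^ k) q)" "tame3 q ==> tame3 ((d23 ^^ k) q)" by (induction k) auto
qed

definition KK :: "int => 'm fun3 => 'm fun3" where "KK l q m n p = K l (%a b. q a b p) m n"

lemma KK_d: "tame3 q ==> (d13 ^^ k) (KK l q) = KK l ((d13 ^^ k) q)" "tame3 q ==> (d23 ^^ k) (KK l q) = KK l ((d23 ^^ k) q)"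
proof -
 have K1: "K l f (m + 1) n = K l (%a b. f (a + 1) b) m n" and K2: "K l f m (n + 1) = K l (%a b. f a (b + 1)) m n" for f m n
  unfolding K_def by (simp_all add: algebra_simps)
 have "d13 (KK l q) = KK l (d13 q)" "d23 (KK l q) = KK l (d23 q)" if q: "tame3 q" for q
 proof -
  have t: "tame (%a b. q a b p)" for p using q by (simp add: tame3_def)
  show "d13 (KK l q) = KK l (d13 q)"
   by (intro ext) (simp only: d13_def KK_def K1 K_lin(2)[OF tame_shift(1)[OF t] t])
  show "d23 (KK l q) = KK l (d23 q)"
   by (intro ext) (simp only: d23_def KK_def K2 K_lin(2)[OF tame_shift(2)[OF t] t])
 qed
 then show "tame3 q ==> (d13 ^^ k) (KK l q) = KK l ((d13 ^^ k) q)" "tame3 q ==> (d23 ^^ k) (KK l q) = KK l ((d23 ^^ k) q)"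
  using tame3_d by (induction k) auto
qed

definition qf :: "(int => 'm => 'm) => (int => 'm => 'm) => (int => 'm => 'm) => 'm => 'm fun3" where
 "qf A B C w a b p = A a (B b (C p w)) - C p (A a (B b w))"

lemma qf_tame: "field A ==> field B ==> field C ==> tame3 (qf A B C w)"
 unfolding tame3_def qf_def
proof (intro allI tame_diff)
 fix p assume f: "field A" "field B" "field C"
 show "tame (%a b. A a (B b (C p w)))" by (rule tame_field[OF f(1,2)])
 show "tame (%a b. C p (A a (B b w)))" using tame_field[OF f(1,2), of w] unfolding tame_def by (metis field_ops(1)[OF f(3)])
qed

text \<open>[A B, C] = A [B, C] + [A, C] B; the factors z_2 - z_3 kill the first term and the
  factors z_1 - z_3 the second.\<close>

lemma qf_zero:
 assumes f: "field A" "field B" "field C"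
  and BC: "!!m n w. R (int k) B C m n w = 0" and AC: "!!m n w. R (int k) A C m n w = 0"
 shows "(d23 ^^ k) ((d13 ^^ k) (qf A B C w)) = z3"
proof -
 define q1 q2 where "q1 a b p = A a (R 0 B C b p w)" and "q2 a b p = - R 0 A C a p (B b w)" for a b p
 have q: "qf A B C w = (%a b p. q1 a b p - q2 a b p)"
  by (intro ext) (simp add: qf_def q1_def q2_def R_0 field_ops[OF f(1)])
 have "(d23 ^^ j) q1 = (%a b p. A a (R (int j) B C b p w))" for j
 proof (induction j)
  case (Suc j)
  have "d23 (%a b p. A a (R (int j) B C b p w)) = (%a b p. A a (R (int j + 1) B C b p w))"
   by (intro ext) (simp add: d23_def R_succ[OF f(2,3)] field_ops[OF f(1)])
  then show ?case using Suc by (simp add: add.commute)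
 qed (simp add: q1_def fun_eq_iff)
 then have 1: "(d23 ^^ k) q1 = z3" by (simp add: BC field_ops[OF f(1)])
 have "(d13 ^^ j) q2 = (%a b p. - R (int j) A C a p (B b w))" for j
 proof (induction j)
  case (Suc j)
  have "d13 (%a b p. - R (int j) A C a p (B b w)) = (%a b p. - R (int j + 1) A C a p (B b w))"
   by (intro ext) (simp add: d13_def R_succ[OF f(1,3)])
  then show ?case using Suc by (simp add: add.commute)
 qed (simp add: q2_def fun_eq_iff)
 then have 2: "(d13 ^^ k) q2 = z3" by (simp add: AC)
 show ?thesis unfolding q d_pow_diff 2 d_pow_comm[of k k q1] 1 by (simp add: d_pow_z)
qed

theorem dong:
 assumes f: "field A" "field B" "field C" and AB: "loc A B" and AC: "loc A C" and BC: "loc B C"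
 shows "loc (nprod l A B) C"
proof -
 obtain L where L: "!!m n w. R (int L) A B m n w = 0" using AB unfolding loc_def by blast
 obtain k1 where k1: "!!m n w. R (int k1) A C m n w = 0" using AC unfolding loc_def by blast
 obtain k2 where k2: "!!m n w. R (int k2) B C m n w = 0" using BC unfolding loc_def by blast
 define k where "k = max k1 k2"
 have kA: "R (int k) A C m n w = 0" for m n w by (rule R_zero[OF f(1,3) k1]) (simp add: k_def)
 have kB: "R (int k) B C m n w = 0" for m n w by (rule R_zero[OF f(2,3) k2]) (simp add: k_def)
 define F where "F w l m n p = R l A B m n (C p w) - C p (R l A B m n w)" for w l m n p
 have step: "d12 (F w l) = F w (l + 1)" for w l
  by (intro ext) (simp add: d12_def F_def R_succ[OF f(1,2)] field_ops[OF f(3)])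
 have z: "F w l = z3" if "l \<ge> int L" for w l
  by (intro ext) (simp add: F_def R_zero[OF f(1,2) L that] field_ops[OF f(3)])
 have CK: "C p (K l g m n) = K l (%a b. C p (g a b)) m n" if "tame g" for p l g m n
  unfolding K_def using fs_lin[OF fieldD(1)[OF f(3)] evz_scale[OF tame_evz[OF that]]] by (simp add: field_ops[OF f(3)])
 have tC: "tame (%a b. C p (g a b))" if "tame g" for p g
  using that unfolding tame_def by (metis field_ops(1)[OF f(3)])
 have Fe: "F w l = (%m n p. KK l (qf A B C w) m n p - sw (KK l (%b a p. s (sg l) (qf B A C w b a p))) m n p)" for w l
 proof (intro ext)
  fix m n p
  have t: "tame (%a b. A a (B b v))" "tame (%b a. B b (A a v))" for v by (rule tame_field[OF f(1,2)] tame_field[OF f(2,1)])+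
  have "K l (%b a. s (sg l) (qf B A C w b a p)) n m = s (sg l) (K l (%b a. B b (A a (C p w))) n m - K l (%b a. C p (B b (A a w))) n m)"
   unfolding qf_def by (subst K_lin(3)) (simp_all add: tame_diff t tC K_lin(2))
  moreover have "K l (%a b. qf A B C w a b p) m n = K l (%a b. A a (B b (C p w))) m n - K l (%a b. C p (A a (B b w))) m n"
   unfolding qf_def by (rule K_lin(2)[OF t(1) tC[OF t(1)]])
  ultimately show "F w l m n p = KK l (qf A B C w) m n p - sw (KK l (%b a p. s (sg l) (qf B A C w b a p))) m n p"
   unfolding F_def R_def KK_def sw_def
   by (simp add: field_ops[OF f(3)] CK t scale_right_diff_distrib algebra_simps)
 qed
 have kk: "(d23 ^^ k) ((d13 ^^ k) (F w l)) = z3" for w l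
 proof -
  have K0: "KK l z3 = z3" by (intro ext) (simp add: KK_def K_def)
  have t1: "tame3 (qf A B C w)" by (rule qf_tame[OF f])
  have t2: "tame3 (%b a p. s (sg l) (qf B A C w b a p))"
   using qf_tame[OF f(2,1,3), of w] unfolding tame3_def tame_def by (metis scale_zero_right)
  have sd: "(d13 ^^ j) (%b a p. s c (g b a p)) = (%b a p. s c ((d13 ^^ j) g b a p))"
   "(d23 ^^ j) (%b a p. s c (g b a p)) = (%b a p. s c ((d23 ^^ j) g b a p))" for j c g
   by (induction j) (auto simp: d13_def d23_def scale_right_diff_distrib fun_eq_iff)
  have 1: "(d23 ^^ k) ((d13 ^^ k) (KK l (qf A B C w))) = z3"
   using KK_d(1)[OF t1] KK_d(2)[OF tame3_d(1)[OF t1]] qf_zero[OF f kB kA] by (simp add: K0)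
  have "(d13 ^^ k) ((d23 ^^ k) (KK l (%b a p. s (sg l) (qf B A C w b a p)))) = z3"
   unfolding KK_d(2)[OF t2] KK_d(1)[OF tame3_d(2)[OF t2]] d_pow_comm[symmetric]
   unfolding sd qf_zero[OF f(2,1,3) kA kB] by (simp add: K0)
  then have 2: "(d23 ^^ k) ((d13 ^^ k) (sw (KK l (%b a p. s (sg l) (qf B A C w b a p))))) = z3"
   unfolding d_sw by (simp add: sw_def fun_eq_iff)
  show ?thesis unfolding Fe d_pow_diff 1 2 by simp
 qed
 define N where "N = nat (int k + int L - l)"
 have D: "R (int j) (nprod l A B) C n p w = (d23 ^^ j) (F w l) 0 n p" for j n p w
 proof (induction j arbitrary: n p)
  case 0
  show ?case by (simp add: R_0 F_def nprod_def)
 next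
  case (Suc j)
  then show ?case using R_succ[OF field_nprod[OF f(1,2)] f(3), of "int j" l n p w] by (simp add: d23_def add.commute)
 qed
 have "(d23 ^^ (k + N)) ((d13 ^^ 0) (F w l)) = z3" for w
  by (rule dong_elimination[where f = "F w" and L = L, OF step z kk]) (simp_all add: N_def)
 then have "R (int (k + N)) (nprod l A B) C n p w = 0" for n p w unfolding D by simp
 then show ?thesis unfolding loc_def by blast
qed

lemma loc_sym: "field A ==> field B ==> loc A B ==> loc B A"
proof -
 assume f: "field A" "field B" and "loc A B"
 then obtain k where k: "!!m n w. R (int k) A B m n w = 0" unfolding loc_def by blast
 have "R (int j) B A n m w = s (- ((-1) ^ j)) (R (int j) A B m n w)" for j m n w
  unfolding R_def by (simp add: sg_simps scale_right_diff_distrib power_mult_distrib[symmetric])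
 then show ?thesis unfolding loc_def using k by (metis scale_zero_right)
qed

end

subsection \<open>The commutator identity for products of fields\<close>

lemma trinomial_swap: "gch m i * ((of_int m - of_nat i) gchoose q) = gch m q * ((of_int m - of_nat q) gchoose i)"
proof -
 have "gch m (i + q) * (of_nat (i + q) gchoose i) = gch m i * ((of_int m - of_nat i) gchoose q)"
  using gbinomial_trinomial_revision[of i "i + q" "of_int m :: complex"] by simp
 moreover have "gch m (i + q) * (of_nat (i + q) gchoose q) = gch m q * ((of_int m - of_nat q) gchoose i)"
  using gbinomial_trinomial_revision[of q "i + q" "of_int m :: complex"] by simp
 moreover have "(of_nat (i + q) gchoose i :: complex) = of_nat (i + q) gchoose q"
  unfolding binomial_gbinomial[symmetric] using binomial_symmetric[of i "i + q"] by simp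
 ultimately show ?thesis by simp
qed

lemma vandermonde: "(\<Sum>i\<le>n. (a gchoose i) * (b gchoose (n - i))) = ((a + b :: complex) gchoose n)"
 using gbinomial_Vandermonde[of a b n] by (simp add: atLeast0AtMost)

lemma sign_split: "i \<le> n ==> (-1) ^ i * (-1) ^ (n - i) = ((-1) ^ n :: complex)"
 by (simp add: power_add[symmetric])

text \<open>The coefficient collected on the antidiagonal i + j = n when X_a U_b - U_b X_a is
  expanded: trinomial revision pulls out q and Vandermonde sums the rest. In \<open>coeff2\<close>,
  for the other side of C, the terms i < q vanish and the index moves by q.\<close>

lemma coeff1: "(\<Sum>i\<le>n. ((-1) ^ i * gch m i) * ((-1) ^ (n - i) * gch l (n - i)) * gch (m - int i) q)
  = gch m q * ((-1) ^ n * gch (m + l - int q) n)"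
proof -
 have "((-1) ^ i * gch m i) * ((-1) ^ (n - i) * gch l (n - i)) * gch (m - int i) q
   = (-1) ^ n * gch m q * (((of_int m - of_nat q) gchoose i) * (of_int l gchoose (n - i)))" if "i \<le> n" for i
  using trinomial_swap[of m i q] sign_split[OF that] by (simp add: algebra_simps)
 then have "(\<Sum>i\<le>n. ((-1) ^ i * gch m i) * ((-1) ^ (n - i) * gch l (n - i)) * gch (m - int i) q)
   = (\<Sum>i\<le>n. (-1) ^ n * gch m q * (((of_int m - of_nat q) gchoose i) * (of_int l gchoose (n - i))))"
  by (intro sum.cong) auto
 also have "\<dots> = (-1) ^ n * gch m q * (\<Sum>i\<le>n. ((of_int m - of_nat q) gchoose i) * (of_int l gchoose (n - i)))"
  by (rule sum_distrib_left[symmetric])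
 finally show ?thesis unfolding vandermonde by (simp add: algebra_simps)
qed

lemma coeff2: "(\<Sum>i\<le>n. ((-1) ^ i * gch m i) * ((-1) ^ (n - i) * gch l (n - i)) * gch (int i) q)
  = (if n < q then 0 else gch m q * ((-1) ^ n * gch (m + l - int q) (n - q)))"
proof -
 have small: "gch (int i) q = 0" if "i < q" for i using that by (simp add: binomial_gbinomial[symmetric])
 show ?thesis
 proof (cases "n < q")
  case True
  then show ?thesis using small by (auto intro!: sum.neutral)
 next
  case False
  have t: "((-1) ^ (i + q) * gch m (i + q)) * ((-1) ^ (n - (i + q)) * gch l (n - (i + q))) * gch (int (i + q)) q
   = (-1) ^ n * gch m q * (((of_int m - of_nat q) gchoose i) * (of_int l gchoose (n - q - i)))" if "i \<le> n - q" for i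
  proof -
   have g: "gch m (i + q) * gch (int (i + q)) q = gch m q * ((of_int m - of_nat q) gchoose i)"
    using gbinomial_trinomial_revision[of q "i + q" "of_int m :: complex"] by simp
   have n: "n - (i + q) = n - q - i" by simp
   have sgn: "(-1) ^ (i + q) * (-1) ^ (n - q - i) = ((-1) ^ n :: complex)"
    using sign_split[of "i + q" n] that False by (simp add: n)
   have "((-1) ^ (i + q) * gch m (i + q)) * ((-1) ^ (n - (i + q)) * gch l (n - (i + q))) * gch (int (i + q)) q
    = ((-1) ^ (i + q) * (-1) ^ (n - q - i)) * (gch m (i + q) * gch (int (i + q)) q) * gch l (n - q - i)"
    unfolding n by (simp only: mult_ac)
   then show ?thesis unfolding g sgn by (simp only: mult_ac)
  qed
  have "(\<Sum>i\<le>n. ((-1) ^ i * gch m i) * ((-1) ^ (n - i) * gch l (n - i)) * gch (int i) q)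
   = (\<Sum>i=q..n. ((-1) ^ i * gch m i) * ((-1) ^ (n - i) * gch l (n - i)) * gch (int i) q)"
   by (rule sum.mono_neutral_right) (use small in auto)
  also have "\<dots> = (\<Sum>i\<le>n - q. ((-1) ^ (i + q) * gch m (i + q)) * ((-1) ^ (n - (i + q)) * gch l (n - (i + q))) * gch (int (i + q)) q)"
   by (rule sum.reindex_bij_witness[of _ "%i. i + q" "%i. i - q"]) (use False in auto)
  also have "\<dots> = (\<Sum>i\<le>n - q. (-1) ^ n * gch m q * (((of_int m - of_nat q) gchoose i) * (of_int l gchoose (n - q - i))))"
   by (rule sum.cong) (use t in auto)
  also have "\<dots> = (-1) ^ n * gch m q * ((of_int m - of_nat q + of_int l) gchoose (n - q))"
   unfolding sum_distrib_left[symmetric] vandermonde ..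
  finally show ?thesis using False by (simp add: algebra_simps)
 qed
qed

lemma fs_shift: "(!!i. i < q ==> f i = 0) ==> evz f ==> fs f = fs (%i. f (i + q))"
proof (induction q arbitrary: f)
 case (Suc q)
 have "fs f = fs (%i. f (Suc i))" using fs_Suc[OF Suc.prems(2)] Suc.prems(1)[of 0] by simp
 also have "\<dots> = fs (%i. f (Suc (i + q)))" by (rule Suc.IH) (use Suc.prems evz_ops(4) in auto)
 finally show ?case by simp
qed simp

lemma evz_map: "evz f ==> (!!i. f i = 0 ==> g i = 0) ==> evz g" unfolding evz_def by blast

definition dfin :: "(nat => nat => 'm::ab_group_add) => bool" where
 "dfin f \<longleftrightarrow> (\<exists>M. \<forall>i j. i \<ge> M \<or> j \<ge> M \<longrightarrow> f i j = 0)"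

lemma dfinI1:
 assumes "!!i j. i \<ge> M ==> f i j = 0" "!!i. evz (f i)" shows "dfin f"
proof -
 have "\<forall>i. \<exists>N. \<forall>j\<ge>N. f i j = 0" using assms(2) by (auto simp: evz_def)
 from choice[OF this] obtain g where g: "!!i j. j \<ge> g i ==> f i j = 0" by blast
 have "f i j = 0" if "j \<ge> M + (\<Sum>i<M. g i)" for i j
 proof (cases "i < M")
  case True
  have "g i \<le> (\<Sum>i<M. g i)" using True by (intro member_le_sum) auto
  then show ?thesis using g[of i j] that by simp
 qed (use assms(1) in auto)
 moreover have "f i j = 0" if "i \<ge> M + (\<Sum>i<M. g i)" for i j using assms(1)[of i j] that by simp
 ultimately show ?thesis unfolding dfin_def by (intro exI[of _ "M + (\<Sum>i<M. g i)"]) auto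
qed

lemma dfin_flip: "dfin f ==> dfin (%i j. f j i)" unfolding dfin_def by blast
lemma dfin_evz: "dfin f ==> evz (f i)" "dfin f ==> evz (%i. fs (f i))"
proof -
 assume "dfin f"
 then obtain M where M: "!!i j. i \<ge> M \<or> j \<ge> M ==> f i j = 0" unfolding dfin_def by blast
 show "evz (f i)" by (rule evzI[of M]) (simp add: M)
 have "f i = (%j. 0)" if "i \<ge> M" for i using M that by auto
 then show "evz (%i. fs (f i))" by (intro evzI[of M]) simp
qed
lemma dfin_swap: "dfin f ==> fs (%i. fs (f i)) = fs (%j. fs (%i. f i j))"
proof -
 assume d: "dfin f"
 then obtain M where M: "!!i j. i \<ge> M \<or> j \<ge> M ==> f i j = 0" unfolding dfin_def by blast
 show ?thesis by (rule fs_swap[of M]) (use M dfin_evz(1)[OF dfin_flip[OF d]] in auto)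
qed

context cvs begin

lemma dfin_scale: "dfin f ==> dfin (%i j. s (c i j) (f i j))" unfolding dfin_def by auto

lemma nprod_eq: "nprod m A B n w = fs (%i. s ((-1) ^ i * gch m i) (A (m - int i) (B (n + int i) w)))
  - s (sg m) (fs (%i. s ((-1) ^ i * gch m i) (B (n + m - int i) (A (int i) w))))"
 by (simp add: nprod_def R_def K_def)

text \<open>The double sum with the coefficients of (z_1 - w)^m (z_2 - w)^l.\<close>

definition DD :: "int => int => (nat => nat => 'm) => 'm" where
 "DD m l f = fs (%i. fs (%j. s (((-1) ^ i * gch m i) * ((-1) ^ j * gch l j)) (f i j)))"

lemma DD_flip: "dfin f ==> DD l m (%j i. f i j) = DD m l f"
 unfolding DD_def using dfin_swap[OF dfin_scale, of f] by (simp add: mult.commute)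

lemma DD_diff: "dfin f ==> dfin g ==> DD m l (%i j. f i j - g i j) = DD m l f - DD m l g"
 unfolding DD_def by (simp add: scale_right_diff_distrib fs_diff evz_scale dfin_evz(1) dfin_evz(2)[OF dfin_scale])

lemma dfin_modes:
 assumes f: "field X" "field U" "field C"
 shows "dfin (%i j. X (m - int i) (U (l - int j) (C (n + int i + int j) w)))"
  "dfin (%i j. X (m - int i) (C (n + int i + l - int j) (U (int j) w)))"
  "dfin (%i j. U (l - int j) (C (n + m - int i + int j) (X (int i) w)))"
  "dfin (%i j. C (n + m - int i + l - int j) (U (int j) (X (int i) w)))"
proof -
 note f0 = field_ops(1)[OF f(1)] field_ops(1)[OF f(2)] field_ops(1)[OF f(3)]
 have e: "evz (%i. C (int i + n) v)" for n v using field_evz[OF f(3), of n v] by (simp add: add.commute)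
 have eU: "evz (%i. U (int i) v)" for v using field_evz[OF f(2), of 0 v] by simp
 have eX: "evz (%i. X (int i) v)" for v using field_evz[OF f(1), of 0 v] by simp
 obtain M where M: "!!i. i \<ge> M ==> C (int i + n) w = 0" using e[of n w] unfolding evz_def by blast
 have "C (n + int i + int j) w = 0" if "i \<ge> M \<or> j \<ge> M" for i j
 proof -
  have "i + j \<ge> M" using that by auto
  from M[OF this] show ?thesis by (simp add: algebra_simps)
 qed
 then show "dfin (%i j. X (m - int i) (U (l - int j) (C (n + int i + int j) w)))"
  unfolding dfin_def by (intro exI[of _ M]) (simp add: f0)
 obtain MX where MX: "!!i. i \<ge> MX ==> X (int i) w = 0" using eX unfolding evz_def by blast
 obtain MU where MU: "!!i. i \<ge> MU ==> U (int i) w = 0" using eU unfolding evz_def by blast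
 show "dfin (%i j. X (m - int i) (C (n + int i + l - int j) (U (int j) w)))"
 proof (rule dfin_flip, rule dfinI1[of MU])
  show "evz (%i. X (m - int i) (C (n + int i + l - int j) (U (int j) w)))" for j
   by (rule evz_map[OF e[of "n + l - int j" "U (int j) w"]]) (simp add: f0 algebra_simps)
 qed (simp add: MU f0)
 show "dfin (%i j. U (l - int j) (C (n + m - int i + int j) (X (int i) w)))"
 proof (rule dfinI1[of MX])
  show "evz (%j. U (l - int j) (C (n + m - int i + int j) (X (int i) w)))" for i
   by (rule evz_map[OF e[of "n + m - int i" "X (int i) w"]]) (simp add: f0 algebra_simps)
 qed (simp add: MX f0)
 show "dfin (%i j. C (n + m - int i + l - int j) (U (int j) (X (int i) w)))"
 proof (rule dfinI1[of MX])
  show "evz (%j. C (n + m - int i + l - int j) (U (int j) (X (int i) w)))" for i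
   by (rule evz_map[OF eU[of "X (int i) w"]]) (simp add: f0)
 qed (simp add: MX f0)
qed

lemma DD_outer:
 assumes "dfin f"
 shows "fs (%i. s ((-1) ^ i * gch m i) (fs (%j. s ((-1) ^ j * gch l j) (f i j)))) = DD m l f"
  "evz (%i. s ((-1) ^ i * gch m i) (fs (%j. s ((-1) ^ j * gch l j) (f i j))))"
proof -
 have e: "s c (fs (%j. s ((-1) ^ j * gch l j) (f i j))) = fs (%j. s (c * ((-1) ^ j * gch l j)) (f i j))" for c i
  using fs_scale[OF evz_scale[OF dfin_evz(1)[OF assms]], of c "%j. (-1) ^ j * gch l j" i] by simp
 show "fs (%i. s ((-1) ^ i * gch m i) (fs (%j. s ((-1) ^ j * gch l j) (f i j)))) = DD m l f"
  unfolding e DD_def ..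
 show "evz (%i. s ((-1) ^ i * gch m i) (fs (%j. s ((-1) ^ j * gch l j) (f i j))))"
  unfolding e by (rule dfin_evz(2)[OF dfin_scale[OF assms]])
qed

lemma fs_diff_scale: "evz f ==> evz g ==> fs (%i. f i - s c (g i)) = fs f - s c (fs g)"
 using fs_diff[OF _ evz_scale, of f g "%_. c"] by (simp add: fs_scale)

lemma nprod_expand:
 assumes f: "field X" "field U" "field C"
 shows "nprod m X (nprod l U C) n w =
  DD m l (%i j. X (m - int i) (U (l - int j) (C (n + int i + int j) w)))
 - s (sg l) (DD m l (%i j. X (m - int i) (C (n + int i + l - int j) (U (int j) w))))
 - s (sg m) (DD m l (%i j. U (l - int j) (C (n + m - int i + int j) (X (int i) w))))
 + s (sg m * sg l) (DD m l (%i j. C (n + m - int i + l - int j) (U (int j) (X (int i) w))))"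
proof -
 note d = dfin_modes[OF f, where m = m and l = l and n = n and w = w]
 have X: "X a (fs g) = fs (%j. X a (g j))" if "evz g" for a g by (rule fs_lin[OF fieldD(1)[OF f(1)] that])
 have eU: "evz (%j. s (c j) (U (l - int j) (C (p + int j) v)))" for p v c
  by (intro evz_scale evz_map[OF field_evz[OF f(3), of p v]]) (simp add: field_ops(1)[OF f(2)])
 have eC: "evz (%j. s (c j) (C (p - int j) (U (int j) v)))" for p v c
  by (intro evz_scale evz_map[OF field_evz[OF f(2), of 0 v]]) (simp add: field_ops(1)[OF f(3)])
 have 1: "fs (%i. s ((-1) ^ i * gch m i) (X (m - int i) (nprod l U C (n + int i) w)))
  = DD m l (%i j. X (m - int i) (U (l - int j) (C (n + int i + int j) w)))
  - s (sg l) (DD m l (%i j. X (m - int i) (C (n + int i + l - int j) (U (int j) w))))"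
 proof -
  have e: "s ((-1) ^ i * gch m i) (X (m - int i) (nprod l U C (n + int i) w))
   = s ((-1) ^ i * gch m i) (fs (%j. s ((-1) ^ j * gch l j) (X (m - int i) (U (l - int j) (C (n + int i + int j) w)))))
   - s (sg l) (s ((-1) ^ i * gch m i) (fs (%j. s ((-1) ^ j * gch l j) (X (m - int i) (C (n + int i + l - int j) (U (int j) w))))))" for i
   unfolding nprod_eq field_ops(3,4)[OF f(1)] X[OF eU] X[OF eC] scale_right_diff_distrib
   by (simp only: scale_left_commute)
  show ?thesis unfolding e

   by (rule trans[OF fs_diff_scale[OF DD_outer(2)[OF d(1), where m = m and l = l] DD_outer(2)[OF d(2), where m = m and l = l]]])
    (simp only: DD_outer(1)[OF d(1)] DD_outer(1)[OF d(2)])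
 qed
 have 2: "fs (%i. s ((-1) ^ i * gch m i) (nprod l U C (n + m - int i) (X (int i) w)))
  = DD m l (%i j. U (l - int j) (C (n + m - int i + int j) (X (int i) w)))
  - s (sg l) (DD m l (%i j. C (n + m - int i + l - int j) (U (int j) (X (int i) w))))"
 proof -
  have e: "s ((-1) ^ i * gch m i) (nprod l U C (n + m - int i) (X (int i) w))
   = s ((-1) ^ i * gch m i) (fs (%j. s ((-1) ^ j * gch l j) (U (l - int j) (C (n + m - int i + int j) (X (int i) w)))))
   - s (sg l) (s ((-1) ^ i * gch m i) (fs (%j. s ((-1) ^ j * gch l j) (C (n + m - int i + l - int j) (U (int j) (X (int i) w))))))" for i
   unfolding nprod_eq scale_right_diff_distrib by (simp only: scale_left_commute)
  show ?thesis unfolding e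

   by (rule trans[OF fs_diff_scale[OF DD_outer(2)[OF d(3), where m = m and l = l] DD_outer(2)[OF d(4), where m = m and l = l]]])
    (simp only: DD_outer(1)[OF d(3)] DD_outer(1)[OF d(4)])
 qed
 show ?thesis unfolding nprod_eq[of m X] 1 2 by (simp add: scale_right_diff_distrib)
qed

end

context cvs begin

lemma fs_triangle_scaled:
 assumes "!!i j. i + j \<ge> M ==> g (i + j) = 0"
 shows "fs (%i. fs (%j. s (c i j) (g (i + j)))) = fs (%n. s (\<Sum>i\<le>n. c i (n - i)) (g n))"
proof -
 have "fs (%i. fs (%j. s (c i j) (g (i + j)))) = fs (%n. \<Sum>i\<le>n. s (c i (n - i)) (g (i + (n - i))))"
  by (rule fs_triangle[of M]) (use assms in simp)
 also have "\<dots> = fs (%n. s (\<Sum>i\<le>n. c i (n - i)) (g n))" by (simp add: scale_sum_left)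
 finally show ?thesis .
qed

lemma fs_fs_sum:
 assumes "finite Q" "!!q. q \<in> Q ==> dfin (f q)"
 shows "fs (%i. fs (%j. \<Sum>q\<in>Q. f q i j)) = (\<Sum>q\<in>Q. fs (%i. fs (f q i)))"
proof -
 have "fs (%j. \<Sum>q\<in>Q. f q i j) = (\<Sum>q\<in>Q. fs (f q i))" for i
  using fs_sum[OF assms(1), of "%q. f q i"] dfin_evz(1)[OF assms(2)] by simp
 then show ?thesis using fs_sum[OF assms(1), of "%q i. fs (f q i)"] dfin_evz(2)[OF assms(2)] by simp
qed

lemma dfin_diag: "(!!i j. i + j \<ge> M ==> f i j = 0) ==> dfin f"
 unfolding dfin_def by (intro exI[of _ M]) auto

text \<open>Each nested product is a sum over four orderings of X, U and C. Those with C in the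
  middle cancel; the others combine to commutators of modes of X and U, which locality expands into
  finitely many products.\<close>

theorem nprod_commutator:
 assumes f: "field X" "field U" "field C" and XU: "loc X U"
 shows "nprod m X (nprod l U C) n w - nprod l U (nprod m X C) n w
  = fs (%q. s (gch m q) (nprod (m + l - int q) (nprod (int q) X U) C n w))"
proof -
 obtain k where k: "!!m n w. R (int k) X U m n w = 0" using XU unfolding loc_def by blast
 define P where "P q = nprod (int q) X U" for q
 have P: "field (P q)" for q unfolding P_def by (rule field_nprod[OF f(1,2)])
 have P0: "P q a v = 0" if "q \<ge> k" for q a v
  unfolding P_def nprod_def by (rule R_zero[OF f(1,2) k]) (use that in simp)
 have comm: "X a (U b v) - U b (X a v) = (\<Sum>q<k. s (gch a q) (P q (a + b - int q) v))" for a b v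
 proof -
  have "X a (U b v) - U b (X a v) = fs (%i. s (gch a i) (nprod (0 + int i) X U (a + b - int i) v))"
   unfolding local_borcherds[OF f(1,2) k] R_0 ..
  also have "\<dots> = (\<Sum>q<k. s (gch a q) (P q (a + b - int q) v))"
   unfolding P_def[symmetric] add_0_left by (rule fs_eq) (simp add: P0)
  finally show ?thesis .
 qed
 note d = dfin_modes[OF f, where m = m and l = l and n = n and w = w]
 note d' = dfin_modes[OF f(2,1,3), where m = l and l = m and n = n and w = w]
 let ?c = "%i j. ((-1) ^ i * gch m i) * ((-1) ^ j * gch l j)"
 have e1: "DD l m (%i j. U (l - int i) (X (m - int j) (C (n + int i + int j) w)))
   = DD m l (%i j. U (l - int j) (X (m - int i) (C (n + int i + int j) w)))"
  using DD_flip[OF dfin_flip[OF d'(1)], of l m] by (simp add: add_ac)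
 have e2: "DD l m (%i j. U (l - int i) (C (n + int i + m - int j) (X (int j) w)))
   = DD m l (%i j. U (l - int j) (C (n + m - int i + int j) (X (int i) w)))"
  using DD_flip[OF d(3), of l m] by (simp add: algebra_simps)
 have e3: "DD l m (%i j. X (m - int j) (C (n + l - int i + int j) (U (int i) w)))
   = DD m l (%i j. X (m - int i) (C (n + int i + l - int j) (U (int j) w)))"
  using DD_flip[OF d(2), of l m] by (simp add: algebra_simps)
 have e4: "DD l m (%i j. C (n + l - int i + m - int j) (X (int j) (U (int i) w)))
   = DD m l (%i j. C (n + m - int i + l - int j) (X (int i) (U (int j) w)))"
  using DD_flip[OF dfin_flip[OF d'(4)], of l m] by (simp add: algebra_simps)
 have f1: "dfin (%i j. U (l - int j) (X (m - int i) (C (n + int i + int j) w)))"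
  using dfin_flip[OF d'(1)] by (simp add: add_ac)
 have f4: "dfin (%i j. C (n + m - int i + l - int j) (X (int i) (U (int j) w)))"
  using dfin_flip[OF d'(4)] by (simp add: algebra_simps)
 have alg: "(a1 - s (sg l) a2 - s (sg m) a3 + s (sg m * sg l) a4) - (b1 - s (sg m) a3 - s (sg l) a2 + s (sg l * sg m) b4)
   = (a1 - b1) - s (sg m * sg l) (b4 - a4)" for a1 a2 a3 a4 b1 b4
  by (simp add: scale_right_diff_distrib mult.commute[of "sg l"])
 have split: "nprod m X (nprod l U C) n w - nprod l U (nprod m X C) n w
  = DD m l (%i j. X (m - int i) (U (l - int j) (C (n + int i + int j) w)) - U (l - int j) (X (m - int i) (C (n + int i + int j) w)))
  - s (sg m * sg l) (DD m l (%i j. C (n + m - int i + l - int j) (X (int i) (U (int j) w)) - C (n + m - int i + l - int j) (U (int j) (X (int i) w))))"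
  unfolding nprod_expand[OF f] nprod_expand[OF f(2,1,3)] e1 e2 e3 e4 DD_diff[OF d(1) f1] DD_diff[OF f4 d(4)]
  by (rule alg)
 have Cz: "\<exists>M. \<forall>i\<ge>M. C (n + int i) w = 0"
  using field_evz[OF f(3), of n w] by (simp add: evz_def)
 then obtain M where M: "!!i. i \<ge> M ==> C (n + int i) w = 0" by blast
 \<comment> \<open>\<open>T1\<close> gathers the terms with X and U both to the left of C,
   \<open>T2\<close> those with both to the right.\<close>
 have T1: "DD m l (%i j. X (m - int i) (U (l - int j) (C (n + int i + int j) w)) - U (l - int j) (X (m - int i) (C (n + int i + int j) w)))
  = (\<Sum>q<k. s (gch m q) (fs (%j. s ((-1) ^ j * gch (m + l - int q) j) (P q (m + l - int q - int j) (C (n + int j) w)))))"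
 proof -
  define g where "g q j = P q (m + l - int q - int j) (C (n + int j) w)" for q j
  have gz: "g q j = 0" if "j \<ge> M" for q j using M[OF that] by (simp add: g_def field_ops(1)[OF P])
  have ge: "evz (%j. s (c j) (g q j))" for q c by (rule evzI[of M]) (simp add: gz)
  have "X (m - int i) (U (l - int j) (C (n + int i + int j) w)) - U (l - int j) (X (m - int i) (C (n + int i + int j) w))
   = (\<Sum>q<k. s (gch (m - int i) q) (g q (i + j)))" for i j
   unfolding comm g_def by (rule sum.cong) (simp_all add: algebra_simps)
  then have "DD m l (%i j. X (m - int i) (U (l - int j) (C (n + int i + int j) w)) - U (l - int j) (X (m - int i) (C (n + int i + int j) w)))
   = fs (%i. fs (%j. \<Sum>q<k. s (?c i j * gch (m - int i) q) (g q (i + j))))"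
   unfolding DD_def by (simp only: scale_sum_right scale_scale)
  also have "\<dots> = (\<Sum>q<k. fs (%i. fs (%j. s (?c i j * gch (m - int i) q) (g q (i + j)))))"
   by (rule fs_fs_sum) (auto intro!: dfin_diag[of M] simp: gz)
  also have "\<dots> = (\<Sum>q<k. fs (%j. s (gch m q * ((-1) ^ j * gch (m + l - int q) j)) (g q j)))"
   by (rule sum.cong[OF refl], subst fs_triangle_scaled[of M]) (simp_all only: gz coeff1)
  also have "\<dots> = (\<Sum>q<k. s (gch m q) (fs (%j. s ((-1) ^ j * gch (m + l - int q) j) (g q j))))"
   unfolding scale_scale[symmetric] using fs_scale[OF ge] by (intro sum.cong) simp_all
  finally show ?thesis unfolding g_def .
 qed
 have T2: "DD m l (%i j. C (n + m - int i + l - int j) (X (int i) (U (int j) w)) - C (n + m - int i + l - int j) (U (int j) (X (int i) w)))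
  = (\<Sum>q<k. s (gch m q) (s ((-1) ^ q) (fs (%j. s ((-1) ^ j * gch (m + l - int q) j) (C (n + (m + l - int q) - int j) (P q (int j) w))))))"
 proof -
  define g where "g q j = C (n + m + l - int j) (P q (int j - int q) w)" for q j
  have gE: "\<exists>M. \<forall>j\<ge>M. g q j = 0" for q
  proof -
   have "evz (%j. P q (- int q + int j) w)" by (rule field_evz[OF P])
   then have "evz (g q)" by (rule evz_map) (simp add: g_def field_ops(1)[OF f(3)])
   then show ?thesis unfolding evz_def .
  qed
  have gd: "dfin (%i j. s (c i j) (g q (i + j)))" for q c
  proof -
   obtain M where "\<forall>j\<ge>M. g q j = 0" using gE by blast
   then show ?thesis by (intro dfin_diag[of M]) simp
  qed
  have ge: "evz (%j. s (c j) (g q j))" for q c by (rule evz_scale) (use gE evz_def in blast)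
  have "C (n + m - int i + l - int j) (X (int i) (U (int j) w)) - C (n + m - int i + l - int j) (U (int j) (X (int i) w))
   = (\<Sum>q<k. s (gch (int i) q) (g q (i + j)))" for i j
  proof -
   interpret C: Vector_Spaces.linear s s "C (n + m - int i + l - int j)" by (rule fieldD(1)[OF f(3)])
   show ?thesis unfolding C.diff[symmetric] comm C.sum C.scale g_def by (rule sum.cong) (simp_all add: algebra_simps)
  qed
  then have "DD m l (%i j. C (n + m - int i + l - int j) (X (int i) (U (int j) w)) - C (n + m - int i + l - int j) (U (int j) (X (int i) w)))
   = fs (%i. fs (%j. \<Sum>q<k. s (?c i j * gch (int i) q) (g q (i + j))))"
   unfolding DD_def by (simp only: scale_sum_right scale_scale)
  also have "\<dots> = (\<Sum>q<k. fs (%i. fs (%j. s (?c i j * gch (int i) q) (g q (i + j)))))"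
   by (rule fs_fs_sum) (simp_all only: finite_lessThan gd)
  also have "\<dots> = (\<Sum>q<k. s (gch m q) (s ((-1) ^ q) (fs (%j. s ((-1) ^ j * gch (m + l - int q) j) (g q (j + q))))))"
  proof (rule sum.cong[OF refl])
   fix q
   obtain M where M: "!!j. j \<ge> M ==> g q j = 0" using gE by blast
   have "fs (%i. fs (%j. s (?c i j * gch (int i) q) (g q (i + j))))
    = fs (%j. s (if j < q then 0 else gch m q * ((-1) ^ j * gch (m + l - int q) (j - q))) (g q j))"
    by (subst fs_triangle_scaled[of M]) (simp_all only: M coeff2)
   also have "\<dots> = fs (%j. s (if j + q < q then 0 else gch m q * ((-1) ^ (j + q) * gch (m + l - int q) (j + q - q))) (g q (j + q)))"
    by (rule fs_shift) (simp_all only: ge if_True scale_zero_left)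
   also have "\<dots> = fs (%j. s (gch m q) (s ((-1) ^ q) (s ((-1) ^ j * gch (m + l - int q) j) (g q (j + q)))))"
    by (simp add: power_add mult_ac)
   also have "\<dots> = s (gch m q) (s ((-1) ^ q) (fs (%j. s ((-1) ^ j * gch (m + l - int q) j) (g q (j + q)))))"
   proof -
    have "evz (%j. g q (j + q))" by (rule evzI[of M]) (simp add: M)
    then show ?thesis by (simp only: fs_scale evz_scale)
   qed
   finally show "fs (%i. fs (%j. s (?c i j * gch (int i) q) (g q (i + j))))
    = s (gch m q) (s ((-1) ^ q) (fs (%j. s ((-1) ^ j * gch (m + l - int q) j) (g q (j + q)))))" .
  qed
  finally show ?thesis unfolding g_def by (simp add: algebra_simps)
 qed
 have sgq: "sg (m + l - int q) = sg m * sg l * (-1) ^ q" for q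
  using sg_simps(2)[of "m + l - int q" "int q"] sg_simps(2)[of m l] by (simp add: power_mult_distrib[symmetric])
 have "fs (%q. s (gch m q) (nprod (m + l - int q) (P q) C n w)) = (\<Sum>q<k. s (gch m q) (nprod (m + l - int q) (P q) C n w))"
 proof (rule fs_eq)
  fix q assume "q \<ge> k"
  then have "P q = (%a v. 0)" using P0 by (intro ext)
  then show "s (gch m q) (nprod (m + l - int q) (P q) C n w) = 0" unfolding nprod_eq by (simp add: field_ops(1)[OF f(3)])
 qed
 then show ?thesis unfolding split T1 T2 P_def[symmetric] nprod_eq[of _ "P _"] sgq
  by (simp add: scale_right_diff_distrib sum_subtractf scale_sum_right mult_ac)
qed

definition dr :: "(int => 'm => 'm) => int => 'm => 'm" where "dr A n w = s (- of_int n) (A (n - 1) w)"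

text \<open>The Leibniz rule for the derivative of A_l B, with - l A_(l-1) B already written for the
  product of the derivative of A with B.\<close>

lemma dr_nprod:
 assumes A: "field A" and B: "field B"
 shows "dr (nprod l A B) n w = nprod l A (dr B) n w - s (of_int l) (nprod (l - 1) A B n w)"
proof -
 define h where "h i = A (l - int i) (B (n - 1 + int i) w)" for i
 define e where "e i = B (n - 1 + l - int i) (A (int i) w)" for i
 have h: "evz h" unfolding h_def by (rule evz_map[OF field_evz[OF B, of "n - 1" w]]) (simp add: field_ops(1)[OF A])
 have e: "evz e" unfolding e_def by (rule evz_map[OF field_evz[OF A, of 0 w]]) (simp add: field_ops(1)[OF B])
 let ?c = "%l i. (-1) ^ i * gch l i"
 have ab: "of_nat (Suc i) * ?c l (Suc i) = - of_int l * ?c (l - 1) i" for i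
 proof -
  have g: "of_nat (Suc i) * gch l (Suc i) = of_int l * gch (l - 1) i"
   using gbinomial_absorption[of i "of_int l :: complex"] by simp
  have "of_nat (Suc i) * ?c l (Suc i) = - ((-1) ^ i) * (of_nat (Suc i) * gch l (Suc i))" by (simp del: of_nat_Suc)
  then show ?thesis unfolding g by simp
 qed
 have bc: "(of_int l - of_nat i) * ?c l i = of_int l * ?c (l - 1) i" for i
 proof -
  have "(of_int l - of_nat i) * gch l i = of_int l * gch (l - 1) i"
   using gbinomial_absorption[of i "of_int l :: complex"] gbinomial_mult_1[of "of_int l :: complex" i] by (simp add: algebra_simps)
  then show ?thesis by (metis mult.left_commute)
 qed
 have 1: "nprod l A B (n - 1) w = fs (%i. s (?c l i) (h i)) - s (sg l) (fs (%i. s (?c l i) (e i)))"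
  unfolding nprod_eq h_def e_def by simp
 have 2: "nprod l A (dr B) n w = fs (%i. s (?c l i * (- of_int n - of_nat i)) (h i)) - s (sg l) (fs (%i. s (?c l i * (- of_int n - of_int l + of_nat i)) (e i)))"
  unfolding nprod_eq h_def e_def dr_def field_ops(4)[OF A] by (simp add: algebra_simps)
 have "fs (%i. s (?c (l - 1) i) (A (l - 1 - int i) (B (n + int i) w))) = fs (%i. s (?c (l - 1) i) (h (Suc i)))"
  unfolding h_def by (simp add: algebra_simps)
 moreover have "fs (%i. s (?c (l - 1) i) (B (n + (l - 1) - int i) (A (int i) w))) = fs (%i. s (?c (l - 1) i) (e i))"
  unfolding e_def by (simp add: algebra_simps)
 moreover have "sg (l - 1) = - sg l" using sg_simps(1)[of "l - 1"] by simp
 ultimately have 3: "nprod (l - 1) A B n w = fs (%i. s (?c (l - 1) i) (h (Suc i))) + s (sg l) (fs (%i. s (?c (l - 1) i) (e i)))"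
  unfolding nprod_eq[of "l - 1"] by simp
 have H: "fs (%i. s (?c l i * (- of_int n - of_nat i)) (h i)) = s (- of_int n) (fs (%i. s (?c l i) (h i))) + s (of_int l) (fs (%i. s (?c (l - 1) i) (h (Suc i))))"
 proof -
  have "fs (%i. s (?c l i * (- of_int n - of_nat i)) (h i)) = fs (%i. s (- of_int n) (s (?c l i) (h i)) - s (of_nat i * ?c l i) (h i))"
   by (simp add: scale_left_diff_distrib[symmetric] algebra_simps)
  also have "\<dots> = s (- of_int n) (fs (%i. s (?c l i) (h i))) - fs (%i. s (of_nat i * ?c l i) (h i))"
   by (simp only: fs_diff fs_scale evz_scale h)
  also have "fs (%i. s (of_nat i * ?c l i) (h i)) = fs (%i. s (of_nat (Suc i) * ?c l (Suc i)) (h (Suc i)))"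
   by (subst fs_Suc) (simp_all add: evz_scale h)
  also have "\<dots> = fs (%i. s (- of_int l) (s (?c (l - 1) i) (h (Suc i))))" by (simp only: ab scale_scale)
  also have "\<dots> = s (- of_int l) (fs (%i. s (?c (l - 1) i) (h (Suc i))))"
   by (rule fs_scale[OF evz_scale[OF evz_ops(4)[OF h]]])
  finally show ?thesis by simp
 qed
 have E: "fs (%i. s (?c l i * (- of_int n - of_int l + of_nat i)) (e i)) = s (- of_int n) (fs (%i. s (?c l i) (e i))) - s (of_int l) (fs (%i. s (?c (l - 1) i) (e i)))"
 proof -
  have c: "?c l i * (- of_int n - of_int l + of_nat i) = - of_int n * ?c l i - of_int l * ?c (l - 1) i" for i
   unfolding bc[symmetric] by (simp add: algebra_simps)
  have "fs (%i. s (?c l i * (- of_int n - of_int l + of_nat i)) (e i)) = fs (%i. s (- of_int n) (s (?c l i) (e i)) - s (of_int l) (s (?c (l - 1) i) (e i)))"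
   unfolding c scale_left_diff_distrib scale_scale ..
  then show ?thesis by (simp only: fs_diff fs_scale evz_scale e)
 qed
 show ?thesis unfolding 2 3 H E unfolding dr_def 1
  by (simp add: scale_right_diff_distrib scale_right_distrib scale_left_commute[of "sg l"] mult.commute)
qed

definition idf :: "int => 'm => 'm" where "idf n w = (if n = -1 then w else 0)"

lemma field_idf: "field idf"
 unfolding field_def
proof (intro conjI allI)
 show "Vector_Spaces.linear s s (idf n)" for n
  unfolding Vector_Spaces.linear_iff by (intro conjI allI vector_space_axioms) (simp_all add: idf_def)
 show "\<exists>M. \<forall>n\<ge>M. idf n w = 0" for w by (rule exI[of _ 0]) (simp add: idf_def)
qed

lemma R_idf: "field A ==> R (int 0) A idf m n w = 0" "field A ==> R (int 0) idf A m n w = 0"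
 by (simp_all add: R_0 idf_def field_ops)

lemma nprod_idf_nonneg: "field A ==> l \<ge> 0 ==> nprod l A idf n w = 0"
 unfolding nprod_def by (rule R_zero[of _ _ 0]) (simp_all add: field_idf R_idf[simplified])

lemma nprod_idf: "field A ==> nprod (-1) A idf n w = A n w"
proof -
 assume A: "field A"
 have c: "(-1) ^ i * gch (-1) i = 1" for i
  by (simp add: gbinomial_minus[of 1 i, simplified] binomial_gbinomial[symmetric] power_mult_distrib[symmetric])
 show ?thesis
 proof (cases "n \<ge> 0")
  case True
  have "fs (%i. A (-1 - int i) (idf (n + int i) w)) = 0" using True by (simp add: idf_def field_ops(1)[OF A])
  moreover have "fs (%i. idf (n + - 1 - int i) (A (int i) w)) = A n w"
   using True by (subst fs_single[of "nat n"]) (auto simp: idf_def)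
  ultimately show ?thesis unfolding nprod_eq c by simp
 next
  case False
  have "fs (%i. A (-1 - int i) (idf (n + int i) w)) = A n w"
   using False by (subst fs_single[of "nat (- n - 1)"]) (auto simp: idf_def field_ops(1)[OF A])
  moreover have "fs (%i. idf (n + - 1 - int i) (A (int i) w)) = 0" using False by (simp add: idf_def)
  ultimately show ?thesis unfolding nprod_eq c by simp
 qed
qed

lemma dr_idf: "dr idf n w = 0" by (simp add: dr_def idf_def)

end

context cvs begin

lemma field_zero: "field (%n w. 0)"
 unfolding field_def Vector_Spaces.linear_iff by (intro conjI allI vector_space_axioms) simp_all

lemma field_add: "field A ==> field B ==> field (%n w. A n w + B n w)"
proof -
 assume A: "field A" and B: "field B"
 show ?thesis
  unfolding field_def Vector_Spaces.linear_iff
 proof (intro conjI allI vector_space_axioms)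
  fix w
  obtain M M' where "\<forall>n\<ge>M. A n w = 0" "\<forall>n\<ge>M'. B n w = 0" using fieldD(2)[OF A] fieldD(2)[OF B] by blast
  then show "\<exists>M. \<forall>n\<ge>M. A n w + B n w = 0" by (intro exI[of _ "max M M'"]) simp
 qed (simp_all add: field_ops[OF A] field_ops[OF B] scale_right_distrib)
qed

lemma field_scale: "field A ==> field (%n w. s c (A n w))"
proof -
 assume A: "field A"
 show ?thesis
  unfolding field_def Vector_Spaces.linear_iff
 proof (intro conjI allI vector_space_axioms)
  fix w
  obtain M where "\<forall>n\<ge>M. A n w = 0" using fieldD(2)[OF A] by blast
  then show "\<exists>M. \<forall>n\<ge>M. s c (A n w) = 0" by (intro exI[of _ M]) simp
 qed (simp_all add: field_ops[OF A] scale_right_distrib mult.commute)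
qed

lemma R_add1: "field A ==> field B ==> field C ==> R l (%n w. A n w + B n w) C m n w = R l A C m n w + R l B C m n w"
 unfolding R_def by (simp add: field_ops K_lin(1) tame_field scale_right_distrib)
lemma R_add2: "field A ==> field B ==> field C ==> R l C (%n w. A n w + B n w) m n w = R l C A m n w + R l C B m n w"
 unfolding R_def by (simp add: field_ops K_lin(1) tame_field scale_right_distrib)
lemma R_scale1: "field A ==> field C ==> R l (%n w. s c (A n w)) C m n w = s c (R l A C m n w)"
 unfolding R_def by (simp add: field_ops K_lin(3) tame_field scale_right_diff_distrib scale_left_commute mult.commute)
lemma R_scale2: "field A ==> field C ==> R l C (%n w. s c (A n w)) m n w = s c (R l C A m n w)"
 unfolding R_def by (simp add: field_ops K_lin(3) tame_field scale_right_diff_distrib scale_left_commute mult.commute)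
lemma R_zero1: "field C ==> R l (%n w. 0) C m n w = 0"
 unfolding R_def K_def by (simp add: field_ops)
lemma R_zero2: "field C ==> R l C (%n w. 0) m n w = 0"
 unfolding R_def K_def by (simp add: field_ops)

definition linf :: "('a => int => 'm => 'm) => (complex \<times> 'a) list => int => 'm => 'm" where
 "linf g P n w = lin s (%u. g u n w) P"

lemma linf_simps: "linf g [] = (%n w. 0)" "linf g (b # P) = (%n w. s (fst b) (g (snd b) n w) + linf g P n w)"
 by (auto simp: linf_def fun_eq_iff)

lemma field_linf: "(!!u. field (g u)) ==> field (linf g P)"
 by (induction P) (simp_all add: linf_simps field_zero field_add field_scale)

lemma R_linf1: "(!!u. field (g u)) ==> field C ==> R l (linf g P) C m n w = lin s (%u. R l (g u) C m n w) P"
 by (induction P) (simp_all add: linf_simps R_zero1 R_add1 R_scale1 field_scale field_linf)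
lemma R_linf2: "(!!u. field (g u)) ==> field C ==> R l C (linf g P) m n w = lin s (%u. R l C (g u) m n w) P"
 by (induction P) (simp_all add: linf_simps R_zero2 R_add2 R_scale2 field_scale field_linf)

lemma loc_add1: "field A ==> field B ==> field C ==> loc A C ==> loc B C ==> loc (%n w. A n w + B n w) C"
proof -
 assume f: "field A" "field B" "field C" and "loc A C" "loc B C"
 then obtain k k' where k: "!!m n w. R (int k) A C m n w = 0" "!!m n w. R (int k') B C m n w = 0" unfolding loc_def by blast
 have "R (int (max k k')) (%n w. A n w + B n w) C m n w = 0" for m n w
  unfolding R_add1[OF f] using R_zero[OF f(1,3) k(1), of "int (max k k')"] R_zero[OF f(2,3) k(2), of "int (max k k')"] by simp
 then show ?thesis unfolding loc_def by blast
qed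

lemma loc_linf1: "(!!u. field (g u)) ==> field C ==> (!!u. loc (g u) C) ==> loc (linf g P) C"
proof (induction P)
 case Nil
 then show ?case by (auto simp: linf_simps loc_def R_zero1)
next
 case (Cons b P)
 have "loc (%n w. s (fst b) (g (snd b) n w)) C"
  using Cons.prems(3)[of "snd b"] unfolding loc_def R_scale1[OF Cons.prems(1,2)] by (metis scale_zero_right)
 then show ?case unfolding linf_simps
  by (intro loc_add1 field_scale field_linf Cons.IH Cons.prems)
qed

lemma nprod_idf1: "field C ==> nprod l idf C n w = (if l = -1 then C n w else 0)"
proof -
 assume C: "field C"
 show ?thesis
 proof (cases "l \<ge> 0")
  case True
  then show ?thesis unfolding nprod_def by (subst R_zero[of _ _ 0]) (simp_all add: field_idf C R_idf(2)[simplified])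
 next
  case False
  have "fs (%i. s ((-1) ^ i * gch l i) (idf (l - int i) (C (n + int i) w))) = s ((-1) ^ 0 * gch l 0) (idf (l - int 0) (C (n + int 0) w))"
   by (rule fs_single) (use False in \<open>auto simp: idf_def\<close>)
  then show ?thesis using False unfolding nprod_eq by (auto simp: idf_def field_ops(1)[OF C])
 qed
qed

lemma nprod_mem:
 assumes "subspace U" "!!n u. u \<in> U ==> A n u \<in> U" "!!n u. u \<in> U ==> B n u \<in> U" "w \<in> U"
 shows "nprod l A B n w \<in> U"
proof -
 have m: "fs f \<in> U" if "!!i. f i \<in> U" for f unfolding fs_def by (rule subspace_sum[OF assms(1)]) (rule that)
 show ?thesis unfolding nprod_eq
  by (intro subspace_diff subspace_scale m assms)
qed

end

section \<open>Vertex operators on restricted modules\<close>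

locale Lk0_mod = Lk0 k sV Y one a Vg
 for k :: complex and sV :: "complex => 'v::ab_group_add => 'v" and Y and one and a and Vg +
 fixes sW :: "complex => 'w::ab_group_add => 'w" and aw :: "sl2b => int => 'w => 'w"
 assumes gmW: "ghat_module k sW aw"
  and restr: "!!w. \<exists>M. \<forall>n\<ge>M. \<forall>x. aw x n w = 0"
begin

sublocale W: ghat k sW aw by unfold_locales (rule gmW)

lemma field_aw: "W.vs.field (aw x)"
 unfolding W.vs.field_def using W.lin_act restr by blast

text \<open>One factor z - w removes the bracket term of the current commutator and turns the
  derivative of the delta function into the delta function; a second factor removes that
  too.\<close>

lemma R_aw:
 "W.vs.R 0 (aw x) (aw y) m n w = lin sW (%z. aw z (m + n) w) (brk x y) + (if m + n = 0 then sW (of_int m * trf x y * k) w else 0)"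
 "W.vs.R 1 (aw x) (aw y) m n w = (if m + n = -1 then sW (trf x y * k) w else 0)"
 "W.vs.R 2 (aw x) (aw y) m n w = 0"
proof -
 show 0: "W.vs.R 0 (aw x) (aw y) m n w = lin sW (%z. aw z (m + n) w) (brk x y) + (if m + n = 0 then sW (of_int m * trf x y * k) w else 0)" for m n
  unfolding W.vs.R_0 W.comm[of x m y n w] lin_def by simp
 have 1: "W.vs.R 1 (aw x) (aw y) m n w = (if m + n = -1 then sW (trf x y * k) w else 0)" for m n
 proof -
  have "W.vs.R (0 + 1) (aw x) (aw y) m n w = W.vs.R 0 (aw x) (aw y) (m + 1) n w - W.vs.R 0 (aw x) (aw y) m (n + 1) w"
   by (rule W.vs.R_succ[OF field_aw field_aw])
  also have "\<dots> = (if m + 1 + n = 0 then sW (of_int (m + 1) * trf x y * k) w else 0) - (if m + 1 + n = 0 then sW (of_int m * trf x y * k) w else 0)"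
   unfolding 0 by (simp add: algebra_simps)
  also have "\<dots> = (if m + 1 + n = 0 then sW (trf x y * k) w else 0)"
   by (auto simp: W.vs.scale_left_diff_distrib[symmetric] algebra_simps)
  also have "(m + 1 + n = 0) = (m + n = -1)" by auto
  finally show ?thesis by simp
 qed
 then show "W.vs.R 1 (aw x) (aw y) m n w = (if m + n = -1 then sW (trf x y * k) w else 0)" .
 have "W.vs.R (1 + 1) (aw x) (aw y) m n w = W.vs.R 1 (aw x) (aw y) (m + 1) n w - W.vs.R 1 (aw x) (aw y) m (n + 1) w"
  by (rule W.vs.R_succ[OF field_aw field_aw])
 then show "W.vs.R 2 (aw x) (aw y) m n w = 0" unfolding 1 by (simp add: algebra_simps)
qed

lemma loc_aw: "W.vs.loc (aw x) (aw y)"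
 unfolding W.vs.loc_def using R_aw(3) by (intro exI[of _ 2]) simp

text \<open>On words no relation has to be respected. Whether the assignment descends to V is a
  separate question, taken up in \<open>Lk0_wd\<close>.\<close>

fun fw :: "word => int => 'w => 'w" where
 "fw [] = W.vs.idf" | "fw ((x, n) # w) = W.vs.nprod (- int n - 1) (aw x) (fw w)"

lemma field_fw: "W.vs.field (fw w)"
 by (induction w rule: fw.induct) (simp_all add: W.vs.field_idf W.vs.field_nprod field_aw)

lemma loc_idf: "W.vs.field A ==> W.vs.loc W.vs.idf A"
 unfolding W.vs.loc_def using W.vs.R_idf(2) by blast

lemma loc_fw_aw: "W.vs.loc (fw w) (aw y)"
proof (induction w arbitrary: y rule: fw.induct)
 case 1
 show ?case by (simp add: loc_idf field_aw)
next
 case (2 x n w)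
 have "W.vs.loc (aw x) (fw w)" by (rule W.vs.loc_sym[OF field_fw field_aw 2])
 then show ?case using 2 by (simp add: W.vs.dong field_aw field_fw loc_aw)
qed

lemma loc_fw: "W.vs.loc (fw u) (fw w)"
proof (induction u rule: fw.induct)
 case 1
 show ?case by (simp add: loc_idf field_fw)
next
 case (2 x n u)
 show ?case unfolding fw.simps
  by (rule W.vs.dong[OF field_aw field_fw field_fw W.vs.loc_sym[OF field_fw field_aw loc_fw_aw]
    W.vs.loc_sym[OF field_fw field_aw loc_fw_aw] 2])
qed

lemma nprod_aw:
 "W.vs.nprod 0 (aw x) (aw y) = W.vs.linf aw (brk x y)"
 "W.vs.nprod 1 (aw x) (aw y) = (%n w. sW (trf x y * k) (W.vs.idf n w))"
 "i \<ge> 2 ==> W.vs.nprod i (aw x) (aw y) = (%n w. 0)"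
proof -
 show "W.vs.nprod 0 (aw x) (aw y) = W.vs.linf aw (brk x y)"
  by (intro ext) (simp add: W.vs.nprod_def R_aw W.vs.linf_def)
 show "W.vs.nprod 1 (aw x) (aw y) = (%n w. sW (trf x y * k) (W.vs.idf n w))"
  by (intro ext) (simp add: W.vs.nprod_def R_aw W.vs.idf_def)
 show "W.vs.nprod i (aw x) (aw y) = (%n w. 0)" if "i \<ge> 2"
  using W.vs.R_zero[of "aw x" "aw y" 2 i] R_aw(3) field_aw that by (intro ext) (simp add: W.vs.nprod_def)
qed

text \<open>Currents are local of order two, so in the commutator identity only q = 0, the bracket,
  and q = 1, the level, remain. The space of fields thereby carries the affine relations.\<close>

lemma nprod_aw_commute:
 assumes C: "W.vs.field C"
 shows "W.vs.nprod n (aw x) (W.vs.nprod l (aw y) C) p v = W.vs.nprod l (aw y) (W.vs.nprod n (aw x) C) p v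
  + (\<Sum>(d, z)\<leftarrow>brk x y. sW d (W.vs.nprod (n + l) (aw z) C p v)) + (if n + l = 0 then sW (of_int n * trf x y * k) (C p v) else 0)"
proof -
 define g where "g q = sW (gch n q) (W.vs.nprod (n + l - int q) (W.vs.nprod (int q) (aw x) (aw y)) C p v)" for q
 have z: "g q = 0" if "q \<ge> 2" for q
 proof -
  have "int q \<ge> 2" using that by simp
  then show ?thesis unfolding g_def nprod_aw(3)[OF \<open>int q \<ge> 2\<close>] by (simp add: W.vs.nprod_def W.vs.R_zero1[OF C])
 qed
 have "fs g = (\<Sum>q<2. g q)" by (rule fs_eq) (rule z)
 also have "\<dots> = g 0 + g 1" by (simp add: numeral_2_eq_2)
 also have "g 0 = (\<Sum>(d, z)\<leftarrow>brk x y. sW d (W.vs.nprod (n + l) (aw z) C p v))"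
  unfolding g_def by (simp add: nprod_aw(1)) (simp add: W.vs.nprod_def W.vs.R_linf1[OF field_aw C] lin_def)
 also have "g 1 = (if n + l = 0 then sW (of_int n * trf x y * k) (C p v) else 0)"
 proof -
  have "W.vs.nprod (n + l - 1) (%n w. sW (trf x y * k) (W.vs.idf n w)) C p v = sW (trf x y * k) (if n + l - 1 = - 1 then C p v else 0)"
   using W.vs.nprod_idf1[OF C, of "n + l - 1" p v] by (simp only: W.vs.nprod_def W.vs.R_scale1[OF W.vs.field_idf C])
  then show ?thesis unfolding g_def by (auto simp: nprod_aw(2) mult.assoc)
 qed
 finally have "fs g = (\<Sum>(d, z)\<leftarrow>brk x y. sW d (W.vs.nprod (n + l) (aw z) C p v)) + (if n + l = 0 then sW (of_int n * trf x y * k) (C p v) else 0)" .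
 moreover have "W.vs.nprod n (aw x) (W.vs.nprod l (aw y) C) p v - W.vs.nprod l (aw y) (W.vs.nprod n (aw x) C) p v = fs g"
  unfolding g_def by (rule W.vs.nprod_commutator[OF field_aw field_aw C loc_aw])
 ultimately show ?thesis by (simp add: diff_eq_eq add_ac)
qed

lemma aw_fw: "W.vs.nprod n (aw x) (fw w) p v = lin sW (%u. fw u p v) (am k x n w)"
proof (induction w arbitrary: x n p v)
 case Nil
 have "- int (nat (- n - 1)) - 1 = n" if "n < 0" using that by auto
 then show ?case using W.vs.nprod_idf_nonneg[OF field_aw] by (auto simp: not_less)
next
 case (Cons b w)
 obtain y m where b: "b = (y, m)" by (cases b)
 show ?case
 proof (cases "n < 0")
  case True
  then have "- int (nat (- n - 1)) - 1 = n" by auto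
  then show ?thesis using True by (simp add: b)
 next
  case False
  then have n: "n \<ge> 0" by simp
  have c: "lin sW (%u. fw u p v) (concat (map (%(d, z). scl d (am k z (n - int m - 1) w)) L))
   = (\<Sum>(d, z)\<leftarrow>L. sW d (W.vs.nprod (n - int m - 1) (aw z) (fw w) p v))" for L
   by (induction L) (auto simp: W.vs.lin_scl Cons)
  have e: "n + (- int m - 1) = n - int m - 1" by simp
  have "W.vs.nprod n (aw x) (fw w) = W.vs.linf fw (am k x n w)"
   by (intro ext) (simp add: Cons W.vs.linf_def)
  then have "W.vs.nprod (- int m - 1) (aw y) (W.vs.nprod n (aw x) (fw w)) p v = lin sW (%u. fw ((y, m) # u) p v) (am k x n w)"
   by (simp add: W.vs.nprod_def W.vs.R_linf2[OF field_fw field_aw])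
  then show ?thesis
   using n nprod_aw_commute[OF field_fw, of n x "- int m - 1" y w p v] unfolding e
   by (auto simp: b W.vs.lin_pre c)
 qed
qed

end

section \<open>Commutators and translation in the vertex algebra\<close>

context Lk0 begin

lemma Y_lin: "Vector_Spaces.linear sV sV (Y u n)" and Y_lin1: "Vector_Spaces.linear sV sV (%u. Y u n v)"
 and Y_trunc: "\<exists>N. \<forall>n\<ge>N. Y u n v = 0"
 and Y_one: "Y one n v = (if n = -1 then v else 0)" and Y_vac: "n \<ge> 0 ==> Y u n one = 0" and Y_create: "Y u (-1) one = u"
 and Y_bor: "borcherds sV Y Y"
 using vaV unfolding vertex_algebra_def by blast+

lemma Y_add: "Y u n (v + v') = Y u n v + Y u n v'" "Y (u + u') n v = Y u n v + Y u' n v"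
 and Y_scale: "Y u n (sV c v) = sV c (Y u n v)" "Y (sV c u) n v = sV c (Y u n v)"
 and Y_zero: "Y u n 0 = 0" "Y 0 n v = 0"
proof -
 interpret A: Vector_Spaces.linear sV sV "Y u n" by (rule Y_lin)
 interpret B: Vector_Spaces.linear sV sV "%u. Y u n v" by (rule Y_lin1)
 show "Y u n (v + v') = Y u n v + Y u n v'" "Y (u + u') n v = Y u n v + Y u' n v"
  "Y u n (sV c v) = sV c (Y u n v)" "Y (sV c u) n v = sV c (Y u n v)" "Y u n 0 = 0" "Y 0 n v = 0"
  by (rule A.add B.add A.scale B.scale A.zero B.zero)+
qed

lemma Y_lin_comb: "Y u n (lin sV f P) = lin sV (%w. Y u n (f w)) P" "Y (lin sV f P) n v = lin sV (%w. Y (f w) n v) P"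
 by (induction P) (auto simp: Y_zero Y_add Y_scale)

lemma V_commutator: "\<forall>\<^sub>F B in sequentially. (\<Sum>i<B. sV (gch m i) (Y (Y u (int i) v) (m + n - int i) w)) = Y u m (Y v n w) - Y v n (Y u m w)"
proof -
 have "\<forall>\<^sub>F B in sequentially.
  (\<Sum>i<B. sV (gch m i) (Y (Y u (0 + int i) v) (m + n - int i) w)) =
  (\<Sum>i<B. sV ((-1) ^ i * gch 0 i) (Y u (m + 0 - int i) (Y v (n + int i) w) - sV (sg 0) (Y v (n + 0 - int i) (Y u (m + int i) w))))"
  using Y_bor unfolding borcherds_def by blast
 moreover have "\<forall>\<^sub>F B in sequentially. B \<ge> Suc 0" by (rule eventually_ge_at_top)
 ultimately show ?thesis
 proof eventually_elim
  case (elim B)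
  have "(\<Sum>i<B. sV ((-1) ^ i * gch 0 i) (Y u (m + 0 - int i) (Y v (n + int i) w) - sV (sg 0) (Y v (n + 0 - int i) (Y u (m + int i) w))))
   = (\<Sum>i\<in>{0}. sV ((-1) ^ i * gch 0 i) (Y u (m + 0 - int i) (Y v (n + int i) w) - sV (sg 0) (Y v (n + 0 - int i) (Y u (m + int i) w))))"
   by (rule sum.mono_neutral_right) (use elim(2) in \<open>auto simp: gch_0[simplified]\<close>)
  then show ?case using elim(1) by simp
 qed
qed

text \<open>The Borcherds identity at m = 0 and n = -2 on the vacuum; creation leaves two terms on
  the right.\<close>

lemma V_translate: "Y (Y u l v) (-2) one = (\<Sum>i<2. sV ((-1) ^ i * gch l i) (Y u (l - int i) (Y v (-2 + int i) one)))"
proof -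
 have "\<forall>\<^sub>F B in sequentially.
  (\<Sum>i<B. sV (gch 0 i) (Y (Y u (l + int i) v) (0 + (-2) - int i) one)) =
  (\<Sum>i<B. sV ((-1) ^ i * gch l i) (Y u (0 + l - int i) (Y v (-2 + int i) one) - sV (sg l) (Y v (-2 + l - int i) (Y u (0 + int i) one))))"
  using Y_bor unfolding borcherds_def by blast
 moreover have "\<forall>\<^sub>F B in sequentially. B \<ge> Suc (Suc 0)" by (rule eventually_ge_at_top)
 ultimately have "\<forall>\<^sub>F B in sequentially. Y (Y u l v) (-2) one = (\<Sum>i<2. sV ((-1) ^ i * gch l i) (Y u (l - int i) (Y v (-2 + int i) one)))"
 proof eventually_elim
  case (elim B)
  have "(\<Sum>i<B. sV (gch 0 i) (Y (Y u (l + int i) v) (0 + (-2) - int i) one)) = (\<Sum>i\<in>{0}. sV (gch 0 i) (Y (Y u (l + int i) v) (0 + (-2) - int i) one))"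
   by (rule sum.mono_neutral_right) (use elim(2) in \<open>auto simp: gch_0[simplified]\<close>)
  moreover have "(\<Sum>i<B. sV ((-1) ^ i * gch l i) (Y u (0 + l - int i) (Y v (-2 + int i) one) - sV (sg l) (Y v (-2 + l - int i) (Y u (0 + int i) one))))
   = (\<Sum>i<2. sV ((-1) ^ i * gch l i) (Y u (0 + l - int i) (Y v (-2 + int i) one) - sV (sg l) (Y v (-2 + l - int i) (Y u (0 + int i) one))))"
   by (rule sum.mono_neutral_right) (use elim(2) in \<open>auto simp: Y_vac Y_zero\<close>)
  ultimately show ?case using elim(1) by (simp add: Y_vac Y_zero)
 qed
 from eventually_happens'[OF sequentially_bot this] show ?thesis by blast
qed

definition T :: "'v => 'v" where "T v = Y v (-2) one"

lemma T_one: "T one = 0" by (simp add: T_def Y_one)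

lemma T_create: "T (Y u (- int j - 1) one) = sV (of_nat (Suc j)) (Y u (- int (Suc j) - 1) one)"
proof -
 have e: "- int j - 1 - 1 = - int (Suc j) - 1" by simp
 show ?thesis unfolding T_def V_translate using e by (simp add: numeral_2_eq_2 Y_one Y_zero add.commute)
qed

lemma T_act: "T (act x m v) = act x m (T v) - sV (of_int m) (act x (m - 1) v)"
 unfolding T_def act_def V_translate by (simp add: numeral_2_eq_2 Y_create)

lemma a_act: "a x = act x (-1) one" by (simp add: act_def Y_create)

end

section \<open>The module structure when the ideal acts by zero\<close>

locale Lk0_wd = Lk0_mod +
 assumes wd: "!!P p v. J P ==> lin sW (%w. fw w p v) P = 0"
begin

definition YW :: "'a => int => 'b => 'b" where "YW u p v = lin sW (%w. fw w p v) (SOME P. u = lin sV ev P)"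

lemma YW_lin: "YW (lin sV ev P) = W.vs.linf fw P"
proof (intro ext)
 fix p v
 define Q where "Q = (SOME Q. lin sV ev P = lin sV ev Q)"
 have "lin sV ev P = lin sV ev Q" unfolding Q_def by (rule someI[where x = P]) simp
 then have "J (P @ scl (- 1) Q)" by (simp add: J_def V.vs.lin_scl)
 from wd[OF this, of p v] show "YW (lin sV ev P) p v = W.vs.linf fw P p v"
  by (simp add: YW_def Q_def[symmetric] W.vs.lin_scl W.vs.linf_def)
qed

lemma field_YW: "W.vs.field (YW u)"
proof -
 obtain P where "u = lin sV ev P" using span_ev by blast
 then show ?thesis by (simp add: YW_lin W.vs.field_linf field_fw)
qed

lemma YW_add: "YW (u + v) p w = YW u p w + YW v p w"
proof -
 obtain P Q where "u = lin sV ev P" "v = lin sV ev Q" using span_ev by blast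
 then show ?thesis using YW_lin[of "P @ Q"] by (simp add: YW_lin W.vs.linf_def)
qed

lemma YW_scale: "YW (sV c u) p w = sW c (YW u p w)"
proof -
 obtain P where "u = lin sV ev P" using span_ev by blast
 then show ?thesis using YW_lin[of "scl c P"] by (simp add: YW_lin W.vs.linf_def V.vs.lin_scl W.vs.lin_scl)
qed

lemma YW_0: "YW 0 p w = 0" using YW_scale[of 0 0 p w] by simp
lemma YW_diff: "YW (u - v) p w = YW u p w - YW v p w"
 using YW_add[of "u - v" v p w] by (simp add: eq_diff_eq)
lemma YW_sum: "YW (\<Sum>i\<in>I. f i) p w = (\<Sum>i\<in>I. YW (f i) p w)"
 by (induction I rule: infinite_finite_induct) (simp_all add: YW_0 YW_add)
lemma YW_ev: "YW (ev w) = fw w" using YW_lin[of "[(1, w)]"] by (simp add: W.vs.linf_simps)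
lemma YW_one: "YW one = W.vs.idf" using YW_ev[of "[]"] by simp

lemma YW_act: "YW (act x n u) = W.vs.nprod n (aw x) (YW u)"
proof -
 obtain P where P: "u = lin sV ev P" using span_ev by blast
 have "YW (act x n u) = W.vs.linf fw (amP x n P)" unfolding P lin_amP[symmetric] by (rule YW_lin)
 also have "\<dots> = W.vs.nprod n (aw x) (W.vs.linf fw P)"
  unfolding W.vs.nprod_def W.vs.linf_def amP_def W.vs.lin_bindc
  by (intro ext) (simp add: W.vs.R_linf2[OF field_fw field_aw, unfolded W.vs.linf_def] aw_fw[unfolded W.vs.nprod_def])
 finally show ?thesis by (simp add: P YW_lin)
qed

lemma YW_a: "YW (a x) = aw x"
 unfolding a_act YW_act YW_one by (intro ext) (rule W.vs.nprod_idf[OF field_aw])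

lemma loc_YW: "W.vs.loc (YW u) (YW v)"
proof -
 obtain P Q where u: "u = lin sV ev P" and v: "v = lin sV ev Q" using span_ev by blast
 have f: "W.vs.field (W.vs.linf fw P)" for P by (rule W.vs.field_linf[OF field_fw])
 have 1: "W.vs.loc (W.vs.linf fw P) (fw w)" for w by (rule W.vs.loc_linf1[OF field_fw field_fw loc_fw])
 have "W.vs.loc (W.vs.linf fw Q) (W.vs.linf fw P)"
  by (rule W.vs.loc_linf1[OF field_fw f]) (rule W.vs.loc_sym[OF f field_fw 1])
 then show ?thesis unfolding u v YW_lin by (rule W.vs.loc_sym[OF f f])
qed

lemma YW_T: "YW (T u) = W.vs.dr (YW u)"
proof -
 have e: "YW (T (ev w)) = W.vs.dr (fw w)" for w
 proof (induction w)
  case Nil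
  show ?case by (intro ext) (simp add: T_one YW_0 W.vs.dr_idf)
 next
  case (Cons b w)
  obtain x n where b: "b = (x, n)" by (cases b)
  show ?case
  proof (intro ext)
   fix p v
   show "YW (T (ev (b # w))) p v = W.vs.dr (fw (b # w)) p v"
    unfolding b evw.simps fw.simps T_act YW_diff YW_scale YW_act Cons YW_ev W.vs.dr_nprod[OF field_aw field_fw] ..
  qed
 qed
 obtain P where P: "u = lin sV ev P" using span_ev by blast
 have "YW (T (lin sV ev P)) p v = W.vs.dr (W.vs.linf fw P) p v" for p v
 proof (induction P)
  case Nil
  show ?case by (simp add: T_def Y_zero YW_0 W.vs.dr_def W.vs.linf_simps)
 next
  case (Cons b P)
  have "T (lin sV ev (b # P)) = sV (fst b) (T (ev (snd b))) + T (lin sV ev P)" by (simp add: T_def Y_add Y_scale)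
  then show ?case using Cons by (simp add: YW_add YW_scale e W.vs.dr_def W.vs.linf_simps W.vs.scale_right_distrib W.vs.scale_left_commute mult.commute)
 qed
 then show ?thesis unfolding P YW_lin by (intro ext)
qed

text \<open>Translation in V and the derivative of fields both lower the mode by one and multiply by
  the same nonzero number, so l = -1 yields all negative l.\<close>

lemma YW_create: "YW (Y u l one) = W.vs.nprod l (YW u) W.vs.idf"
proof (cases "l \<ge> 0")
 case True
 then show ?thesis by (intro ext) (simp add: Y_vac YW_0 W.vs.nprod_idf_nonneg[OF field_YW])
next
 case False
 have "YW (Y u (- int j - 1) one) = W.vs.nprod (- int j - 1) (YW u) W.vs.idf" for j
 proof (induction j)
  case 0
  show ?case by (intro ext) (simp add: Y_create W.vs.nprod_idf[OF field_YW])
 next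
  case (Suc j)
  show ?case
  proof (intro ext)
   fix p v
   have dz: "W.vs.dr W.vs.idf = (%n w. 0)" by (intro ext) (rule W.vs.dr_idf)
   have e: "- int j - 1 - 1 = - int (Suc j) - 1" by simp
   have "sW (of_nat (Suc j)) (YW (Y u (- int (Suc j) - 1) one) p v) = W.vs.dr (YW (Y u (- int j - 1) one)) p v"
    unfolding YW_T[symmetric] T_create YW_scale ..
   also have "\<dots> = sW (- of_int (- int j - 1)) (W.vs.nprod (- int (Suc j) - 1) (YW u) W.vs.idf p v)"
    unfolding Suc W.vs.dr_nprod[OF field_YW W.vs.field_idf] dz e
    by (simp only: W.vs.nprod_def W.vs.R_zero2[OF field_YW] diff_0 W.vs.scale_minus_left)
   also have "(- of_int (- int j - 1) :: complex) = of_nat (Suc j)" by simp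
   finally show "YW (Y u (- int (Suc j) - 1) one) p v = W.vs.nprod (- int (Suc j) - 1) (YW u) W.vs.idf p v"
    using of_nat_neq_0[of j, where 'a = complex] by (simp only: W.vs.scale_left_imp_eq)
  qed
 qed
 from this[of "nat (- l - 1)"] False show ?thesis by simp
qed

text \<open>Induction on the word of v: the leading x(m) is commuted past u on both sides, where
  \<open>V_commutator\<close> and \<open>nprod_commutator\<close> have the same shape. The
  commutator involves vectors other than u, so all u are treated at once.\<close>

theorem YW_Y: "YW (Y u l v) = W.vs.nprod l (YW u) (YW v)"
proof -
 have w: "YW (Y u l (ev w)) = W.vs.nprod l (YW u) (fw w)" for w u l
 proof (induction w arbitrary: u l)
  case Nil
  show ?case by (simp only: evw.simps fw.simps YW_create)
 next
  case (Cons b w)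
  obtain x n where b: "b = (x, n)" by (cases b)
  define m where "m = - int n - 1"
  show ?case
  proof (intro ext)
   fix p v
   obtain kk where kk: "!!m n w. W.vs.R (int kk) (aw x) (YW u) m n w = 0"
    using loc_YW[of "a x" u] unfolding YW_a W.vs.loc_def by blast
   define g where "g i = sW (gch m i) (W.vs.nprod (m + l - int i) (W.vs.nprod (int i) (aw x) (YW u)) (fw w) p v)" for i
   have gz: "g i = 0" if "i \<ge> kk" for i
   proof -
    have "W.vs.nprod (int i) (aw x) (YW u) = (%n w. 0)"
     unfolding W.vs.nprod_def by (intro ext, rule W.vs.R_zero[OF field_aw field_YW kk]) (use that in simp)
    then show ?thesis unfolding g_def by (simp add: W.vs.nprod_def W.vs.R_zero1[OF field_fw])
   qed
   from eventually_happens'[OF sequentially_bot eventually_conj[OF eventually_ge_at_top[of kk] V_commutator[of m "a x" u l "ev w"]]]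
   obtain B where B: "B \<ge> kk" "(\<Sum>i<B. sV (gch m i) (Y (Y (a x) (int i) u) (m + l - int i) (ev w))) = Y (a x) m (Y u l (ev w)) - Y u l (Y (a x) m (ev w))"
    by blast
   have "Y u l (act x m (ev w)) = act x m (Y u l (ev w)) - (\<Sum>i<B. sV (gch m i) (Y (act x (int i) u) (m + l - int i) (ev w)))"
    unfolding act_def B(2) by simp
   then have "YW (Y u l (ev (b # w))) p v = W.vs.nprod m (aw x) (W.vs.nprod l (YW u) (fw w)) p v - (\<Sum>i<B. g i)"
    by (simp only: b evw.simps m_def[symmetric] YW_diff YW_sum YW_scale YW_act Cons g_def)
   also have "(\<Sum>i<B. g i) = fs g" by (rule fs_eq[symmetric]) (use gz B(1) in auto)
   also have "fs g = W.vs.nprod m (aw x) (W.vs.nprod l (YW u) (fw w)) p v - W.vs.nprod l (YW u) (W.vs.nprod m (aw x) (fw w)) p v"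
    unfolding g_def using W.vs.nprod_commutator[OF field_aw field_YW field_fw, of x u m l w p v] loc_YW[of "a x" u] by (simp add: YW_a)
   finally show "YW (Y u l (ev (b # w))) p v = W.vs.nprod l (YW u) (fw (b # w)) p v" by (simp add: b m_def)
  qed
 qed
 obtain P where P: "v = lin sV ev P" using span_ev by blast
 have "YW (lin sV f P) q z = lin sW (%w. YW (f w) q z) P" for f q z
  by (induction P) (simp_all add: YW_0 YW_add YW_scale)
 then show ?thesis unfolding P Y_lin_comb(1) YW_lin
  by (intro ext) (simp add: w W.vs.nprod_def W.vs.R_linf2[OF field_fw field_YW])
qed

lemma borcherds_YW: "borcherds sW Y YW"
 unfolding borcherds_def
proof (intro allI)
 fix u v w m n l
 obtain kk where kk: "!!m n w. W.vs.R (int kk) (YW u) (YW v) m n w = 0" using loc_YW unfolding W.vs.loc_def by blast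
 define f1 where "f1 i = sW (gch m i) (YW (Y u (l + int i) v) (m + n - int i) w)" for i
 define f2 where "f2 i = sW ((-1) ^ i * gch l i) (YW u (m + l - int i) (YW v (n + int i) w))" for i
 define f3 where "f3 i = sW ((-1) ^ i * gch l i) (YW v (n + l - int i) (YW u (m + int i) w))" for i
 have e1: "evz f1" unfolding f1_def YW_Y W.vs.nprod_def
  by (rule evzI[of "nat (int kk - l)"]) (simp add: W.vs.R_zero[OF field_YW field_YW kk])
 have e2: "evz f2" unfolding f2_def by (rule W.vs.evz_scale[OF W.vs.tame_evz[OF W.vs.tame_field[OF field_YW field_YW]]])
 have e3: "evz f3" unfolding f3_def by (rule W.vs.evz_scale[OF W.vs.tame_evz[OF W.vs.tame_field[OF field_YW field_YW]]])
 have eq: "fs f1 = fs f2 - sW (sg l) (fs f3)"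
  using W.vs.local_borcherds[OF field_YW field_YW kk, of m l n w] unfolding f1_def f2_def f3_def YW_Y W.vs.R_def W.vs.K_def .
 from evzE[OF e1] evzE[OF e2] evzE[OF e3]
 show "\<forall>\<^sub>F B in sequentially. (\<Sum>i<B. sW (gch m i) (YW (Y u (l + int i) v) (m + n - int i) w)) =
  (\<Sum>i<B. sW ((-1) ^ i * gch l i) (YW u (m + l - int i) (YW v (n + int i) w) - sW (sg l) (YW v (n + l - int i) (YW u (m + int i) w))))"
 proof eventually_elim
  case (elim B)
  have "(\<Sum>i<B. sW ((-1) ^ i * gch l i) (YW u (m + l - int i) (YW v (n + int i) w) - sW (sg l) (YW v (n + l - int i) (YW u (m + int i) w))))
   = (\<Sum>i<B. f2 i) - sW (sg l) (\<Sum>i<B. f3 i)"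
   unfolding f2_def f3_def W.vs.scale_sum_right sum_subtractf[symmetric]
   by (rule sum.cong) (simp_all add: W.vs.scale_right_diff_distrib mult.commute)
  moreover have "(\<Sum>i<B. sW (gch m i) (YW (Y u (l + int i) v) (m + n - int i) w)) = (\<Sum>i<B. f1 i)" by (simp add: f1_def)
  ultimately show ?case using eq elim by simp
 qed
qed

theorem va_module_YW: "va_module sV Y one sW YW"
 unfolding va_module_def
proof (intro conjI allI)
 show "vector_space sW" by (rule W.vs.vector_space_axioms)
 show "Vector_Spaces.linear sW sW (YW u n)" for u n by (rule W.vs.fieldD(1)[OF field_YW])
 show "Vector_Spaces.linear sV sW (%u. YW u n w)" for n w
  unfolding Vector_Spaces.linear_iff
  by (intro conjI allI V.vs.vector_space_axioms W.vs.vector_space_axioms YW_add YW_scale)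
 show "\<exists>N. \<forall>n\<ge>N. YW u n w = 0" for u w by (rule W.vs.fieldD(2)[OF field_YW])
 show "YW one n w = (if n = -1 then w else 0)" for n w by (simp add: YW_one W.vs.idf_def)
 show "borcherds sW Y YW" by (rule borcherds_YW)
qed

end

subsection \<open>Zero modes on highest weight vectors\<close>

lemma sg_minus: "- sg (- int n - 1) = (-1) ^ n"
 by (cases "even n") (auto simp: power_int_diff power_int_minus)

context Lk0_mod begin

definition topv :: "'w => bool" where "topv t \<longleftrightarrow> (\<forall>x n. n \<ge> 1 \<longrightarrow> aw x n t = 0)"

lemma top_act: "topv t ==> topv (aw y 0 t)"
 unfolding topv_def
proof (intro allI impI)
 fix x and n :: int assume t: "\<forall>x n. n \<ge> 1 \<longrightarrow> aw x n t = 0" and n: "n \<ge> 1"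
 have "(\<Sum>(d, z)\<leftarrow>L. sW d (aw z (n + 0) t)) = 0" for L by (induction L) (use t n in auto)
 then show "aw x n (aw y 0 t) = 0" unfolding W.comm[of x n y 0 t] using t n by simp
qed

text \<open>On a top vector the first sum in the product vanishes by degree and the second keeps
  only i = 0. This yields the sign and places x(0) to the right, the rule behind
  \<open>pw\<close>.\<close>

lemma fw_top:
 "topv t ==> (p \<ge> int (dg w) \<longrightarrow> fw w p t = 0)
  \<and> (\<forall>x n. fw ((x, n) # w) (int (dg w) + int n) t = sW ((-1) ^ n) (fw w (int (dg w) - 1) (aw x 0 t)))"
proof (induction w arbitrary: t p)
 case Nil
 have "fw [(x, n)] (int n) t = sW ((-1) ^ n) (W.vs.idf (-1) (aw x 0 t))" for x n
 proof -
  have "fs (%i. sW ((-1) ^ i * gch (- int n - 1) i) (aw x (- int n - 1 - int i) (W.vs.idf (int n + int i) t))) = 0"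
   by (simp add: W.vs.idf_def)
  moreover have "fs (%i. sW ((-1) ^ i * gch (- int n - 1) i) (W.vs.idf (int n + (- int n - 1) - int i) (aw x (int i) t)))
   = sW ((-1) ^ 0 * gch (- int n - 1) 0) (W.vs.idf (int n + (- int n - 1) - int 0) (aw x (int 0) t))"
   by (rule fs_single) (simp add: W.vs.idf_def)
  ultimately show ?thesis unfolding fw.simps W.vs.nprod_eq sg_minus[symmetric]
   by (simp only: W.vs.scale_minus_left) simp
 qed
 then show ?case by (simp add: W.vs.idf_def)
next
 case (Cons b w)
 obtain y m where b: "b = (y, m)" by (cases b)
 have z0: "fw w p t = 0" if "p \<ge> int (dg w)" "topv t" for p t using Cons.IH[OF that(2), of p] that by simp
 have gen: "fw ((x, n) # w) p t = sW ((-1) ^ n) (fw w (p - int n - 1) (aw x 0 t))"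
  if p: "p \<ge> int (dg w)" and t: "topv t" and z: "!!p t. p \<ge> int (dg w) ==> topv t ==> fw w p t = 0" for x n p t w
 proof -
  have "fs (%i. sW ((-1) ^ i * gch (- int n - 1) i) (aw x (- int n - 1 - int i) (fw w (p + int i) t))) = 0"
   using p t z by simp
  moreover have "fs (%i. sW ((-1) ^ i * gch (- int n - 1) i) (fw w (p + (- int n - 1) - int i) (aw x (int i) t)))
   = sW ((-1) ^ 0 * gch (- int n - 1) 0) (fw w (p + (- int n - 1) - int 0) (aw x (int 0) t))"
   by (rule fs_single) (use t in \<open>simp add: topv_def W.vs.field_ops(1)[OF field_fw]\<close>)
  ultimately have "fw ((x, n) # w) p t = - sW (sg (- int n - 1)) (fw w (p + (- int n - 1)) (aw x 0 t))"
   unfolding fw.simps W.vs.nprod_eq by (simp only:) simp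
  moreover have "p + (- int n - 1) = p - int n - 1" by simp
  ultimately show ?thesis unfolding sg_minus[symmetric] W.vs.scale_minus_left by (simp only:)
 qed
 have z1: "fw (b # w) p t = 0" if "p \<ge> int (dg (b # w))" "topv t" for p t
  unfolding b using gen[of w p t y m] z0[of "p - int m - 1" "aw y 0 t"] z0 that top_act[OF that(2)] by (simp add: b)
 show ?case
 proof (intro conjI impI allI)
  show "fw (b # w) p t = 0" if "p \<ge> int (dg (b # w))" using z1 that Cons.prems by simp
  show "fw ((x, n) # b # w) (int (dg (b # w)) + int n) t = sW ((-1) ^ n) (fw (b # w) (int (dg (b # w)) - 1) (aw x 0 t))" for x n
   using gen[of "b # w" "int (dg (b # w)) + int n" t x n] z1 Cons.prems by simp
 qed
qed

lemma fw_zero: "topv t ==> p \<ge> int (dg w) ==> fw w p t = 0" using fw_top by blast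

definition ft :: "'w => nat => 'w" where "ft w j = (aw F 0 ^^ j) w"

lemma ft_simps: "ft w 0 = w" "ft w (Suc j) = aw F 0 (ft w j)" by (simp_all add: ft_def)

lemma top_ft: "topv w ==> topv (ft w j)" by (induction j) (auto simp: ft_simps top_act)

context
 fixes r w0 assumes hw: "topv w0" "aw E 0 w0 = 0" "aw H 0 w0 = sW r w0"
begin

lemma ft_H: "aw H 0 (ft w0 j) = sW (r - 2 * of_nat j) (ft w0 j)"
proof (induction j)
 case (Suc j)
 have "aw H 0 (aw F 0 (ft w0 j)) = sW (r - 2 * of_nat j - 2) (aw F 0 (ft w0 j))"
  unfolding W.comm_HF Suc W.act_scale by (simp add: W.vs.scale_left_diff_distrib)
 moreover have "r - 2 * of_nat j - 2 = r - 2 * of_nat (Suc j)" by (simp add: algebra_simps)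
 ultimately show ?case by (simp only: ft_simps)
qed (simp add: ft_simps hw)

lemma ft_E: "aw E 0 (ft w0 (Suc j)) = sW (of_nat (Suc j) * (r - of_nat j)) (ft w0 j)"
proof (induction j)
 case 0
 show ?case using W.comm_EF[of 0 0 w0] hw by (simp add: ft_simps)
next
 case (Suc j)
 have "aw E 0 (ft w0 (Suc (Suc j))) = aw F 0 (aw E 0 (ft w0 (Suc j))) + aw H 0 (ft w0 (Suc j))"
  using W.comm_EF[of 0 0 "ft w0 (Suc j)"] by (simp add: ft_simps)
 also have "\<dots> = sW (of_nat (Suc j) * (r - of_nat j) + (r - 2 * of_nat (Suc j))) (ft w0 (Suc j))"
  unfolding Suc ft_H W.act_scale by (simp only: W.vs.scale_left_distrib ft_simps)
 also have "of_nat (Suc j) * (r - of_nat j) + (r - 2 * of_nat (Suc j)) = of_nat (Suc (Suc j)) * (r - of_nat (Suc j))"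
  by (simp add: algebra_simps)
 finally show ?case .
qed

text \<open>The vectors f^j w0 realise the basis of weights r - 2 j. If the target index is
  negative, \<open>nat\<close> cuts it off at 0, but then the path crosses r and the coefficient is
  0.\<close>

theorem zero_mode:
 "fw w (int (dg w) - 1) (ft w0 j) = sW (pw (r * (r + 2)) w (r - 2 * of_nat j)) (ft w0 (nat (int j - wt w)))"
proof (induction w arbitrary: j)
 case Nil
 show ?case by (simp add: W.vs.idf_def)
next
 case (Cons b w)
 obtain x n where b: "b = (x, n)" by (cases b)
 have "fw (b # w) (int (dg (b # w)) - 1) (ft w0 j) = sW ((-1) ^ n) (fw w (int (dg w) - 1) (aw x 0 (ft w0 j)))"
 proof -
  have "int (dg (b # w)) - 1 = int (dg w) + int n" by (simp add: b)
  then show ?thesis unfolding b using fw_top[OF top_ft[OF hw(1)], where w = w] by (simp only:)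
 qed
 also have "fw w (int (dg w) - 1) (aw x 0 (ft w0 j)) = sW (av (r * (r + 2)) x (r - 2 * of_nat j)
   * pw (r * (r + 2)) w (r - 2 * of_nat j + 2 * of_int (wx x))) (ft w0 (nat (int j - wt (b # w))))"
 proof (cases x)
  case F
  have "int (Suc j) - wt w = int j - wt (b # w)" by (simp add: b F)
  moreover have "r - 2 * of_nat (Suc j) = r - 2 * of_nat j + 2 * of_int (wx F)" by (simp add: algebra_simps)
  ultimately show ?thesis using Cons[of "Suc j"] by (simp only: F ft_simps av.simps mult_1)
 next
  case H
  show ?thesis unfolding H ft_H W.vs.field_ops(4)[OF field_fw] Cons by (simp add: b H)
 next
  case E
  show ?thesis
  proof (cases j)
   case 0
   have "av (r * (r + 2)) E (r - 2 * of_nat j) = 0" by (simp add: 0)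
   then show ?thesis unfolding E by (simp only: 0 ft_simps hw W.vs.field_ops(1)[OF field_fw] mult_zero_left W.vs.scale_zero_left)
  next
   case (Suc i)
   have "av (r * (r + 2)) E (r - 2 * of_nat j) = of_nat (Suc i) * (r - of_nat i)" by (simp add: Suc field_simps)
   moreover have "r - 2 * of_nat i = r - 2 * of_nat j + 2 * of_int (wx E)" by (simp add: Suc algebra_simps)
   moreover have "int i - wt w = int j - wt (b # w)" by (simp add: b E Suc)
   ultimately show ?thesis unfolding E Suc ft_E W.vs.field_ops(4)[OF field_fw] Cons W.vs.scale_scale by (simp only: Suc)
  qed
 qed
 finally show ?case by (simp add: b mult.assoc)
qed

end

end

context Lk0_wd begin

text \<open>For a weight outside the list the obstructing vector of weight j carries f^j w0 to a
  nonzero multiple of w0, while the ideal acts by zero.\<close>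

theorem top_weight:
 assumes cop: "coprime (N + 1) q" and t: "k + 2 = of_nat (N + 1) / of_nat q" and q: "q > 0" and N: "N > 0"
  and hw: "topv w0" "aw E 0 w0 = 0" "aw H 0 w0 = sW r w0" "w0 \<noteq> 0"
 shows "\<exists>i n. 1 \<le> i \<and> i \<le> q \<and> n < N \<and> r = of_nat i * (k + 2) - 2 - of_nat n"
proof (rule ccontr)
 assume "\<not> ?thesis"
 then have nr: "r \<noteq> of_nat i * (k + 2) - 2 - of_nat n" if "1 \<le> i" "i \<le> q" "n < N" for i n using that by blast
 obtain Q d j where Q: "J Q" "hom d Q" "\<forall>(b, u)\<in>set Q. wt u = int j" "pm (int j) (r * (r + 2)) Q (r - 2 * of_nat j) \<noteq> 0"
  using obstruction[OF cop t q N nr] by blast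
 have "0 = lin sW (%w. fw w (int d - 1) (ft w0 j)) Q" using wd[OF Q(1)] by simp
 also have "\<dots> = lin sW (%w. sW (if wt w = int j then pw (r * (r + 2)) w (r - 2 * of_nat j) else 0) w0) Q"
 proof (rule lin_cong)
  fix c w assume "(c, w) \<in> set Q"
  then have "dg w = d" "wt w = int j" using Q(2,3) by (auto simp: hom_def)
  then show "fw w (int d - 1) (ft w0 j) = sW (if wt w = int j then pw (r * (r + 2)) w (r - 2 * of_nat j) else 0) w0"
   using zero_mode[OF hw(1-3), of w j] by (simp add: ft_simps)
 qed
 also have "\<dots> = sW (pm (int j) (r * (r + 2)) Q (r - 2 * of_nat j)) w0"
  unfolding pm_def by (induction Q) (auto simp: W.vs.scale_left_distrib)
 finally show False using Q(4) hw(4) by simp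
qed

end

subsection \<open>The Sugawara operator and the grading of irreducible modules\<close>

context ghat begin

lemma comm_EH: "act E m (act H n w) = act H n (act E m w) - s 2 (act E (m + n) w)"
 using comm_HE[of n m w] by (simp add: add.commute)
lemma comm_FH: "act F m (act H n w) = act H n (act F m w) + s 2 (act F (m + n) w)"
 using comm_HF[of n m w] by (simp add: add.commute)

text \<open>Brackets with h(1) and h(-1) shift the modes of e and f, and e(n) with f(0) gives h(n).
  \<open>P'\<close> is the property handed to a bracket.\<close>

lemma act_generated:
 fixes P :: "sl2b => int => bool"
 assumes br: "!!x m y n. P x m ==> P y n ==> P' x m y n"
  and EF: "!!m n. P' E m F n ==> P H (m + n)"
  and HE: "!!m n. P' H m E n ==> P E (m + n)" and HF: "!!m n. P' H m F n ==> P F (m + n)"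
  and P: "P E 0" "P F 0" "P H 1" "P H (-1)"
 shows "P x n"
proof -
 have e: "P E n" for n
 proof (induction n rule: int_induct[of _ 0])
  case (step1 i)
  then show ?case using HE[OF br[OF P(3) step1(2)]] by (simp add: add.commute)
 next
  case (step2 i)
  then show ?case using HE[OF br[OF P(4) step2(2)]] by simp
 qed (rule P)
 have f: "P F n" for n
 proof (induction n rule: int_induct[of _ 0])
  case (step1 i)
  then show ?case using HF[OF br[OF P(3) step1(2)]] by (simp add: add.commute)
 next
  case (step2 i)
  then show ?case using HF[OF br[OF P(4) step2(2)]] by simp
 qed (rule P)
 have h: "P H n" using EF[OF br[OF e[of n] f[of 0]]] by simp
 show ?thesis by (cases x) (use e f h in auto)
qed

fun ey :: "'m => bool list => 'm" where
 "ey w [] = w" | "ey w (False # u) = act E (-1) (ey w u)" | "ey w (True # u) = act F 0 (ey w u)"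

lemma ey_H:
 assumes w: "act H 0 w = s r w"
 shows "act H 0 (ey w u) = s (r + 2 * of_nat (c0 u) - 2 * of_nat (c1 u)) (ey w u)"
proof (induction u)
 case Nil
 show ?case using w by simp
next
 case (Cons b u)
 define c where "c = r + 2 * of_nat (c0 u) - 2 * of_nat (c1 u)"
 have IH: "act H 0 (ey w u) = s c (ey w u)" unfolding c_def by (rule Cons)
 show ?case
 proof (cases b)
  case True
  have "act H 0 (act F 0 (ey w u)) = s c (act F 0 (ey w u)) - s 2 (act F 0 (ey w u))"
   using comm_HF[of 0 0 "ey w u"] unfolding IH act_scale by simp
  also have "\<dots> = s (c - 2) (act F 0 (ey w u))" by (rule vs.scale_left_diff_distrib[symmetric])
  also have "c - 2 = r + 2 * of_nat (c0 (b # u)) - 2 * of_nat (c1 (b # u))" by (simp add: True c_def)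
  finally show ?thesis by (simp add: True)
 next
  case False
  have "act H 0 (act E (-1) (ey w u)) = s c (act E (-1) (ey w u)) + s 2 (act E (-1) (ey w u))"
   using comm_HE[of 0 "-1" "ey w u"] unfolding IH act_scale by simp
  also have "\<dots> = s (c + 2) (act E (-1) (ey w u))" by (rule vs.scale_left_distrib[symmetric])
  also have "c + 2 = r + 2 * of_nat (c0 (b # u)) - 2 * of_nat (c1 (b # u))" by (simp add: False c_def)
  finally show ?thesis by (simp add: False)
 qed
qed

text \<open>The span is stable under e(-1) and f(0) by construction and under e(0) and f(1) by
  induction on words; these four generate all modes.\<close>

lemma ey_span:
 assumes irr: "ghat_irred s act" and w: "act E 0 w = 0" "act F 1 w = 0" "act H 0 w = s r w" "w \<noteq> 0"
 shows "v \<in> vs.span (range (ey w))"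
proof -
 let ?U = "vs.span (range (ey w))"
 have lift: "act x n v \<in> ?U" if "!!u. act x n (ey w u) \<in> ?U" "v \<in> ?U" for x n v
  using that(2)
 proof (induction rule: vs.span_induct_alt)
  case (step c b z)
  then show ?case using that(1) by (auto simp: act_add act_scale intro!: vs.span_add vs.span_scale)
 qed (simp add: vs.span_zero)
 have b: "ey w u \<in> ?U" for u by (rule vs.span_base) simp
 have E1: "act E (-1) v \<in> ?U" if "v \<in> ?U" for v by (rule lift[OF _ that]) (use b[of "False # _"] in simp)
 have F0: "act F 0 v \<in> ?U" if "v \<in> ?U" for v by (rule lift[OF _ that]) (use b[of "True # _"] in simp)
 have Hs: "act H 0 (ey w u) \<in> ?U" for u unfolding ey_H[OF w(3)] by (intro vs.span_scale b)
 have e0: "act E 0 (ey w u) \<in> ?U" for u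
 proof (induction u)
  case (Cons x u)
  show ?case
  proof (cases x)
   case True
   have "act E 0 (act F 0 (ey w u)) = act F 0 (act E 0 (ey w u)) + act H 0 (ey w u)" using comm_EF[of 0 0 "ey w u"] by simp
   then show ?thesis using F0[OF Cons] Hs[of u] by (simp add: True vs.span_add)
  next
   case False
   then show ?thesis using comm_EE[of 0 "-1" "ey w u"] E1[OF Cons] by simp
  qed
 qed (simp add: w vs.span_zero)
 have f1: "act F 1 (ey w u) \<in> ?U" for u
 proof (induction u)
  case (Cons x u)
  show ?case
  proof (cases x)
   case True
   then show ?thesis using comm_FF[of 1 0 "ey w u"] F0[OF Cons] by simp
  next
   case False
   have "act F 1 (act E (-1) (ey w u)) = act E (-1) (act F 1 (ey w u)) - act H 0 (ey w u) + s k (ey w u)"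
    using comm_FE[of 1 "-1" "ey w u"] by simp
   then show ?thesis using E1[OF Cons] Hs[of u] b[of u] by (simp add: False vs.span_add vs.span_diff vs.span_scale)
  qed
 qed (simp add: w vs.span_zero)
 define P where "P x n \<longleftrightarrow> (\<forall>v\<in>?U. act x n v \<in> ?U)" for x n
 define P' where "P' x m y n \<longleftrightarrow> (\<forall>v\<in>?U. act x m (act y n v) - act y n (act x m v) \<in> ?U)" for x m y n
 have br: "P x m ==> P y n ==> P' x m y n" for x m y n unfolding P_def P'_def by (simp add: vs.span_diff)
 have EF: "P H (m + n)" if "P' E m F n" for m n
  unfolding P_def
 proof
  fix v assume v: "v \<in> ?U"
  have e: "act H (m + n) v = (act E m (act F n v) - act F n (act E m v)) - (if m + n = 0 then s (of_int m * k) v else 0)"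
   using comm_EF[of m n v] by (simp only: add.assoc add_diff_cancel_left' add_diff_cancel_right')
  have "(if m + n = 0 then s (of_int m * k) v else 0) \<in> ?U" using v by (simp add: vs.span_scale vs.span_zero)
  moreover have "act E m (act F n v) - act F n (act E m v) \<in> ?U" using that v unfolding P'_def by blast
  ultimately show "act H (m + n) v \<in> ?U" unfolding e by (rule vs.span_diff[rotated])
 qed
 have half: "u \<in> ?U" if "s 2 u \<in> ?U" for u
 proof -
  have "s (1 / 2) (s 2 u) \<in> ?U" by (rule vs.span_scale[OF that])
  then show ?thesis by simp
 qed
 have HE: "P E (m + n)" if "P' H m E n" for m n
  unfolding P_def
 proof
  fix v assume v: "v \<in> ?U"
  have e: "s 2 (act E (m + n) v) = act H m (act E n v) - act E n (act H m v)" using comm_HE[of m n v] by (simp only: add_diff_cancel_left')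
  have "act H m (act E n v) - act E n (act H m v) \<in> ?U" using that v unfolding P'_def by blast
  then show "act E (m + n) v \<in> ?U" unfolding e[symmetric] by (rule half)
 qed
 have HF: "P F (m + n)" if "P' H m F n" for m n
  unfolding P_def
 proof
  fix v assume v: "v \<in> ?U"
  have e: "s 2 (act F (m + n) v) = - (act H m (act F n v) - act F n (act H m v))" using comm_HF[of m n v] by (simp only: diff_diff_eq2 minus_diff_eq diff_diff_add) simp
  have "- (act H m (act F n v) - act F n (act H m v)) \<in> ?U" using that v unfolding P'_def by (intro vs.span_neg) blast
  then show "act F (m + n) v \<in> ?U" unfolding e[symmetric] by (rule half)
 qed
 have p1: "P E 0" unfolding P_def using lift[of E 0, OF e0] by blast
 have p2: "P F 1" unfolding P_def using lift[of F 1, OF f1] by blast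
 have p3: "P E (-1)" unfolding P_def using E1 by blast
 have p4: "P F 0" unfolding P_def using F0 by blast
 have h: "P H 1" "P H (-1)" using EF[OF br[OF p1 p2]] EF[OF br[OF p3 p4]] by simp_all
 have P: "P x n" for x n by (rule act_generated[of P P', OF br EF HE HF p1 p4 h])
 show ?thesis
  by (rule subspace_full[OF irr vs.subspace_span, of "range (ey w)" w]) (use P b[of "[]"] w(4) in \<open>auto simp: P_def\<close>)
qed

end

context cvs begin

lemma eig_indep:
 assumes lin: "Vector_Spaces.linear s s A" "Vector_Spaces.linear s s B" and "finite Fs"
  and "!!\<omega>. \<omega> \<in> Fs ==> A (g \<omega>) = s (fst \<omega>) (g \<omega>) \<and> B (g \<omega>) = s (snd \<omega>) (g \<omega>)" "(\<Sum>\<omega>\<in>Fs. g \<omega>) = 0" "\<omega> \<in> Fs"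
 shows "g \<omega> = 0"
 using assms(3-6)
proof (induction Fs arbitrary: g \<omega> rule: finite_induct)
 case (insert \<omega>0 Fs)
 interpret A: Vector_Spaces.linear s s A by (rule lin)
 interpret B: Vector_Spaces.linear s s B by (rule lin)
 have s0: "g \<omega>0 + (\<Sum>\<omega>\<in>Fs. g \<omega>) = 0" using insert.prems(2) insert.hyps by simp
 have z: "g \<omega> = 0" if w: "\<omega> \<in> Fs" for \<omega>
 proof -
  have "A (g \<omega>0 + (\<Sum>\<omega>\<in>Fs. g \<omega>)) - s (fst \<omega>0) (g \<omega>0 + (\<Sum>\<omega>\<in>Fs. g \<omega>)) = 0" unfolding s0 by (simp add: A.zero)
  then have "(\<Sum>\<omega>\<in>Fs. A (g \<omega>) - s (fst \<omega>0) (g \<omega>)) = 0"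
   using insert.prems(1)[of \<omega>0] by (simp add: A.add A.sum scale_right_distrib scale_sum_right sum_subtractf)
  moreover have "(\<Sum>\<omega>\<in>Fs. A (g \<omega>) - s (fst \<omega>0) (g \<omega>)) = (\<Sum>\<omega>\<in>Fs. s (fst \<omega> - fst \<omega>0) (g \<omega>))"
   by (rule sum.cong) (use insert.prems(1) in \<open>auto simp: scale_left_diff_distrib\<close>)
  ultimately have a: "s (fst \<omega> - fst \<omega>0) (g \<omega>) = 0"
   using insert.IH[of "%\<omega>. s (fst \<omega> - fst \<omega>0) (g \<omega>)" \<omega>] insert.prems(1) w by (simp add: A.scale B.scale mult.commute)
  have "B (g \<omega>0 + (\<Sum>\<omega>\<in>Fs. g \<omega>)) - s (snd \<omega>0) (g \<omega>0 + (\<Sum>\<omega>\<in>Fs. g \<omega>)) = 0" unfolding s0 by (simp add: B.zero)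
  then have "(\<Sum>\<omega>\<in>Fs. B (g \<omega>) - s (snd \<omega>0) (g \<omega>)) = 0"
   using insert.prems(1)[of \<omega>0] by (simp add: B.add B.sum scale_right_distrib scale_sum_right sum_subtractf)
  moreover have "(\<Sum>\<omega>\<in>Fs. B (g \<omega>) - s (snd \<omega>0) (g \<omega>)) = (\<Sum>\<omega>\<in>Fs. s (snd \<omega> - snd \<omega>0) (g \<omega>))"
   by (rule sum.cong) (use insert.prems(1) in \<open>auto simp: scale_left_diff_distrib\<close>)
  ultimately have b: "s (snd \<omega> - snd \<omega>0) (g \<omega>) = 0"
   using insert.IH[of "%\<omega>. s (snd \<omega> - snd \<omega>0) (g \<omega>)" \<omega>] insert.prems(1) w by (simp add: A.scale B.scale mult.commute)
  have "\<omega> \<noteq> \<omega>0" using w insert.hyps by blast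
  then have "fst \<omega> - fst \<omega>0 \<noteq> 0 \<or> snd \<omega> - snd \<omega>0 \<noteq> 0" by (simp add: prod_eq_iff)
  then show ?thesis using a b by auto
 qed
 then have "g \<omega>0 = 0" using s0 by simp
 then show ?case using z[of \<omega>] insert.prems(3) by (cases "\<omega> = \<omega>0") simp_all
qed simp

lemma span_homogeneous:
 assumes "v \<in> span (range b)"
 shows "\<exists>Fs g. finite Fs \<and> Fs \<subseteq> range \<delta> \<and> (\<forall>\<omega>\<in>Fs. g \<omega> \<in> span (b ` {u. \<delta> u = \<omega>})) \<and> v = (\<Sum>\<omega>\<in>Fs. g \<omega>)"
 using assms
proof (induction rule: span_induct_alt)
 case base
 show ?case by (rule exI[of _ "{}"]) simp
next
 case (step c x y)
 from step.IH obtain Fs g where "finite Fs \<and> Fs \<subseteq> range \<delta> \<and> (\<forall>\<omega>\<in>Fs. g \<omega> \<in> span (b ` {u. \<delta> u = \<omega>})) \<and> y = (\<Sum>\<omega>\<in>Fs. g \<omega>)"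
  by (elim exE)
 then have I: "finite Fs" "Fs \<subseteq> range \<delta>" "!!\<omega>. \<omega> \<in> Fs ==> g \<omega> \<in> span (b ` {u. \<delta> u = \<omega>})" "y = (\<Sum>\<omega>\<in>Fs. g \<omega>)"
  by blast+
 obtain u where u: "x = b u" using step.hyps by blast
 define g' where "g' \<omega> = (if \<omega> = \<delta> u then s c x else 0) + (if \<omega> \<in> Fs then g \<omega> else 0)" for \<omega>
 have "(\<Sum>\<omega>\<in>insert (\<delta> u) Fs. g' \<omega>) = (\<Sum>\<omega>\<in>insert (\<delta> u) Fs. if \<omega> = \<delta> u then s c x else 0) + (\<Sum>\<omega>\<in>insert (\<delta> u) Fs. if \<omega> \<in> Fs then g \<omega> else 0)"
  by (simp only: g'_def sum.distrib)
 also have "(\<Sum>\<omega>\<in>insert (\<delta> u) Fs. if \<omega> \<in> Fs then g \<omega> else 0) = y"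
  unfolding I(4) using I(1) by (intro sum.mono_neutral_cong_right) auto
 also have "(\<Sum>\<omega>\<in>insert (\<delta> u) Fs. if \<omega> = \<delta> u then s c x else 0) = s c x"
  using I(1) by (simp add: sum.delta)
 finally have 1: "s c x + y = (\<Sum>\<omega>\<in>insert (\<delta> u) Fs. g' \<omega>)" by simp
 have 2: "g' \<omega> \<in> span (b ` {u. \<delta> u = \<omega>})" for \<omega>
  unfolding g'_def
 proof (rule span_add)
  show "(if \<omega> = \<delta> u then s c x else 0) \<in> span (b ` {u. \<delta> u = \<omega>})"
  proof (cases "\<omega> = \<delta> u")
   case True
   have "x \<in> span (b ` {v. \<delta> v = \<delta> u})" unfolding u by (rule span_base) auto
   then show ?thesis using True by (simp add: span_scale)
  qed (simp add: span_zero)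
  show "(if \<omega> \<in> Fs then g \<omega> else 0) \<in> span (b ` {u. \<delta> u = \<omega>})" using I(3) by (simp add: span_zero)
 qed
 show ?case
  by (rule exI[of _ "insert (\<delta> u) Fs"], rule exI[of _ g']) (use I(1,2) 1 2 in auto)
qed

end

lemma fs_telescope: "evz g ==> fs (%i. g (Suc i) - g i) = - g 0" "evz g ==> fs (%i. g i - g (Suc i)) = g 0"
proof -
 assume g: "evz g"
 show "fs (%i. g (Suc i) - g i) = - g 0" "fs (%i. g i - g (Suc i)) = g 0"
  unfolding fs_diff[OF evz_ops(4)[OF g] g] fs_diff[OF g evz_ops(4)[OF g]] fs_Suc[OF g] by simp_all
qed

locale rghat = ghat k s act for k and s :: "complex => 'm::ab_group_add => 'm" and act +
 assumes restr: "!!w. \<exists>M. \<forall>n\<ge>M. \<forall>x. act x n w = 0"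
begin

lemma field_act: "vs.field (act x)"
 unfolding vs.field_def using lin_act restr by blast

lemma evz_act: "evz (%i. act y (m i) (act x (n + int i) v))"
 by (rule evz_map[OF vs.field_evz[OF field_act[of x], where n = n and w = v]]) simp

definition On :: "int => 'm => 'm" where
 "On n v = act E (- n) (act F n v) + act F (- n) (act E n v) + s (1 / 2) (act H (- n) (act H n v))"

text \<open>Twice (k + 2) L_0 of the Sugawara construction. Positive modes stand on the right, so
  the sum is finite on every vector of a restricted module.\<close>

definition Om :: "'m => 'm" where "Om v = On 0 v + s 2 (fs (%i. On (1 + int i) v))"

lemma evz_On: "evz (%i. On (1 + int i) v)"
 unfolding On_def by (intro evz_ops(1) vs.evz_scale evz_act)

lemma half: "s (1 / 2) (s 2 u) = u" by simp

lemma On_E0: "On n (act E 0 v) = act E 0 (On n v)"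
proof -
 have 1: "act E 0 (act E (- n) (act F n v)) = act E (- n) (act F n (act E 0 v)) + act E (- n) (act H n v)"
  using comm_EE[of 0 "- n" "act F n v"] comm_EF[of 0 n v] by (simp add: act_add)
 have 2: "act E 0 (act F (- n) (act E n v)) = act F (- n) (act E n (act E 0 v)) + act H (- n) (act E n v)"
  using comm_EF[of 0 "- n" "act E n v"] comm_EE[of 0 n v] by (simp add: act_add)
 have 3: "act E 0 (act H (- n) (act H n v)) = act H (- n) (act H n (act E 0 v)) - s 2 (act H (- n) (act E n v)) - s 2 (act E (- n) (act H n v))"
  using comm_EH[of 0 "- n" "act H n v"] comm_EH[of 0 n v] by (simp add: act_diff act_scale)
 show ?thesis unfolding On_def act_add act_scale 1 2 3 vs.scale_right_diff_distrib half by simp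
qed

lemma On_F0: "On n (act F 0 v) = act F 0 (On n v)"
proof -
 have 1: "act F 0 (act E (- n) (act F n v)) = act E (- n) (act F n (act F 0 v)) - act H (- n) (act F n v)"
  using comm_FE[of 0 "- n" "act F n v"] comm_FF[of 0 n v] by (simp add: act_add)
 have 2: "act F 0 (act F (- n) (act E n v)) = act F (- n) (act E n (act F 0 v)) - act F (- n) (act H n v)"
  using comm_FF[of 0 "- n" "act E n v"] comm_FE[of 0 n v] by (simp add: act_diff)
 have 3: "act F 0 (act H (- n) (act H n v)) = act H (- n) (act H n (act F 0 v)) + s 2 (act H (- n) (act F n v)) + s 2 (act F (- n) (act H n v))"
  using comm_FH[of 0 "- n" "act H n v"] comm_FH[of 0 n v] by (simp add: act_add act_scale)
 show ?thesis unfolding On_def act_add act_scale 1 2 3 vs.scale_right_distrib half by simp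
qed

lemma act_fs: "evz f ==> act x n (fs f) = fs (%i. act x n (f i))" by (rule vs.fs_lin[OF lin_act])
lemma evz_act_lin: "evz f ==> evz (%i. act x n (f i))" by (rule vs.evz_lin[OF lin_act])

lemma Om_diff: "Om (act x n v) - act x n (Om v) = (On 0 (act x n v) - act x n (On 0 v))
  + s 2 (fs (%i. On (1 + int i) (act x n v) - act x n (On (1 + int i) v)))"
 unfolding Om_def act_add act_scale act_fs[OF evz_On] fs_diff[OF evz_On evz_act_lin[OF evz_On]] vs.scale_right_diff_distrib
 by simp

lemma On_H1:
 assumes "n \<ge> 0"
 shows "On n (act H 1 v) - act H 1 (On n v) =
  s 2 (act E (- n) (act F (n + 1) v)) - s 2 (act E (1 - n) (act F n v)) - s 2 (act F (- n) (act E (n + 1) v)) + s 2 (act F (1 - n) (act E n v))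
  - (if n = 1 then s k (act H 1 v) else 0)"
proof -
 have 1: "act E (- n) (act F n (act H 1 v)) = act H 1 (act E (- n) (act F n v)) - s 2 (act E (1 - n) (act F n v)) + s 2 (act E (- n) (act F (n + 1) v))"
  using comm_FH[of n 1 v] comm_EH[of "- n" 1 "act F n v"] by (simp add: act_add act_scale)
 have 2: "act F (- n) (act E n (act H 1 v)) = act H 1 (act F (- n) (act E n v)) + s 2 (act F (1 - n) (act E n v)) - s 2 (act F (- n) (act E (n + 1) v))"
  using comm_EH[of n 1 v] comm_FH[of "- n" 1 "act E n v"] by (simp add: act_diff act_scale)
 have 3: "act H (- n) (act H n (act H 1 v)) = act H 1 (act H (- n) (act H n v)) - (if n = 1 then s 2 (s k (act H 1 v)) else 0)"
 proof -
  have "act H n (act H 1 v) = act H 1 (act H n v)" using comm_HH[of n 1 v] assms by simp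
  moreover have "(- n + 1 = 0) = (n = 1)" by auto
  ultimately show ?thesis using comm_HH[of "- n" 1 "act H n v"] by (auto simp: mult.assoc)
 qed
 show ?thesis unfolding On_def act_add act_scale 1 2 3 by (simp add: vs.scale_right_diff_distrib)
qed

text \<open>The commutators with the positive summands telescope. The boundary terms left at the
  modes 0 and 1 produce the summand 2 in k + 2, and the level comes from the central term at n =
  1.\<close>

lemma Om_H1: "Om (act H 1 v) - act H 1 (Om v) = s (- (2 * (k + 2))) (act H 1 v)"
proof -
 define g where "g i = s 2 (act E (- int i) (act F (1 + int i) v)) - s 2 (act F (- int i) (act E (1 + int i) v))" for i
 have g: "evz g" unfolding g_def by (intro evz_ops(2) vs.evz_scale evz_act)
 have d: "evz (%i::nat. if i = 0 then u else (0::'m))" for u by (rule evzI[of 1]) simp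
 have i: "On (1 + int i) (act H 1 v) - act H 1 (On (1 + int i) v) = (g (Suc i) - g i) - (if i = 0 then s k (act H 1 v) else 0)" for i
 proof -
  have e: "- (1 + int i) = - int (Suc i)" "1 + int i + 1 = 1 + int (Suc i)" "1 - (1 + int i) = - int i" "(1 + int i = 1) = (i = 0)" by auto
  show ?thesis by (subst On_H1) (simp_all only: e g_def, simp_all)
 qed
 have "fs (%i. On (1 + int i) (act H 1 v) - act H 1 (On (1 + int i) v)) = - g 0 - s k (act H 1 v)"
  unfolding i fs_diff[OF evz_ops(2)[OF evz_ops(4)[OF g] g] d] fs_telescope(1)[OF g]
  by (subst fs_single[of 0]) simp_all
 moreover have "On 0 (act H 1 v) - act H 1 (On 0 v) = s 2 (act E 0 (act F 1 v)) - s 2 (act E 1 (act F 0 v)) - s 2 (act F 0 (act E 1 v)) + s 2 (act F 1 (act E 0 v))"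
  by (subst On_H1) simp_all
 ultimately have "Om (act H 1 v) - act H 1 (Om v) = s 2 (act E 0 (act F 1 v)) - s 2 (act E 1 (act F 0 v)) - s 2 (act F 0 (act E 1 v)) + s 2 (act F 1 (act E 0 v))
  + s 2 (- (s 2 (act E 0 (act F 1 v)) - s 2 (act F 0 (act E 1 v))) - s k (act H 1 v))"
  unfolding Om_diff by (simp add: g_def)
 also have "\<dots> = s (- (2 * (k + 2))) (act H 1 v)"
 proof -
  have ef: "act E 0 (act F 1 v) = act F 1 (act E 0 v) + act H 1 v" "act E 1 (act F 0 v) = act F 0 (act E 1 v) + act H 1 v"
   using comm_EF[of 0 1 v] comm_EF[of 1 0 v] by simp_all
  have "s 2 (f1 + h) - s 2 (f0 + h) - s 2 f0 + s 2 f1 + s 2 (- (s 2 (f1 + h) - s 2 f0) - s k h) = s (- (2 * (k + 2))) h" for f0 f1 h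
  proof -
   have four: "s 4 u = s 2 u + s 2 u" for u using vs.scale_left_distrib[of 2 2 u] by simp
   have e: "s (- (2 * (k + 2))) h = s (-2) h + s (-2) h + s (- (2 * k)) h"
    unfolding vs.scale_left_distrib[symmetric] by (simp add: distrib_left)
   show ?thesis unfolding e
    by (simp add: vs.scale_right_distrib vs.scale_right_diff_distrib four)
  qed
  then show ?thesis unfolding ef .
 qed
 finally show ?thesis .
qed

lemma On_Hm1:
 assumes "n \<ge> 0"
 shows "On n (act H (-1) v) - act H (-1) (On n v) =
  s 2 (act E (- n) (act F (n - 1) v)) - s 2 (act E (- n - 1) (act F n v)) - s 2 (act F (- n) (act E (n - 1) v)) + s 2 (act F (- n - 1) (act E n v))
  + (if n = 1 then s k (act H (-1) v) else 0)"
proof -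
 have 1: "act E (- n) (act F n (act H (-1) v)) = act H (-1) (act E (- n) (act F n v)) - s 2 (act E (- n - 1) (act F n v)) + s 2 (act E (- n) (act F (n - 1) v))"
  using comm_FH[of n "-1" v] comm_EH[of "- n" "-1" "act F n v"] by (simp add: act_add act_scale)
 have 2: "act F (- n) (act E n (act H (-1) v)) = act H (-1) (act F (- n) (act E n v)) + s 2 (act F (- n - 1) (act E n v)) - s 2 (act F (- n) (act E (n - 1) v))"
  using comm_EH[of n "-1" v] comm_FH[of "- n" "-1" "act E n v"] by (simp add: act_diff act_scale)
 have 3: "act H (- n) (act H n (act H (-1) v)) = act H (-1) (act H (- n) (act H n v)) + (if n = 1 then s 2 (s k (act H (-1) v)) else 0)"
 proof -
  have "act H (- n) (act H (-1) u) = act H (-1) (act H (- n) u)" for u using comm_HH[of "- n" "-1" u] assms by simp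
  moreover have "(n + - 1 = 0) = (n = 1)" by auto
  ultimately show ?thesis using comm_HH[of n "-1" v] by (auto simp: mult.assoc act_add act_scale)
 qed
 show ?thesis unfolding On_def act_add act_scale 1 2 3 by (simp add: vs.scale_right_distrib)
qed

lemma Om_Hm1: "Om (act H (-1) v) - act H (-1) (Om v) = s (2 * (k + 2)) (act H (-1) v)"
proof -
 define g where "g i = s 2 (act E (- int i - 1) (act F (0 + int i) v)) - s 2 (act F (- int i - 1) (act E (0 + int i) v))" for i
 have g: "evz g" unfolding g_def by (intro evz_ops(2) vs.evz_scale evz_act)
 have d: "evz (%i::nat. if i = 0 then u else (0::'m))" for u by (rule evzI[of 1]) simp
 have i: "On (1 + int i) (act H (-1) v) - act H (-1) (On (1 + int i) v) = (g i - g (Suc i)) + (if i = 0 then s k (act H (-1) v) else 0)" for i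
 proof -
  have e: "1 + int i = int (Suc i)" "int (Suc i) - 1 = int i" "- int (Suc i) = - int i - 1" "(int (Suc i) = 1) = (i = 0)" "0 \<le> int (Suc i)" by auto
  show ?thesis unfolding e(1) On_Hm1[OF e(5)] g_def by (simp_all only: e(2-4) add_0_left) simp
 qed
 have "fs (%i. On (1 + int i) (act H (-1) v) - act H (-1) (On (1 + int i) v)) = g 0 + s k (act H (-1) v)"
  unfolding i fs_add[OF evz_ops(2)[OF g evz_ops(4)[OF g]] d] fs_telescope(2)[OF g]
  by (subst fs_single[of 0]) simp_all
 moreover have "On 0 (act H (-1) v) - act H (-1) (On 0 v) = s 2 (act E 0 (act F (-1) v)) - s 2 (act E (-1) (act F 0 v)) - s 2 (act F 0 (act E (-1) v)) + s 2 (act F (-1) (act E 0 v))"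
  by (subst On_Hm1) simp_all
 ultimately have "Om (act H (-1) v) - act H (-1) (Om v) = s 2 (act E 0 (act F (-1) v)) - s 2 (act E (-1) (act F 0 v)) - s 2 (act F 0 (act E (-1) v)) + s 2 (act F (-1) (act E 0 v))
  + s 2 ((s 2 (act E (-1) (act F 0 v)) - s 2 (act F (-1) (act E 0 v))) + s k (act H (-1) v))"
  unfolding Om_diff by (simp add: g_def)
 also have "\<dots> = s (2 * (k + 2)) (act H (-1) v)"
 proof -
  have ef: "act E 0 (act F (-1) v) = act F (-1) (act E 0 v) + act H (-1) v" "act E (-1) (act F 0 v) = act F 0 (act E (-1) v) + act H (-1) v"
   using comm_EF[of 0 "-1" v] comm_EF[of "-1" 0 v] by simp_all
  have "s 2 (f1 + h) - s 2 (f0 + h) - s 2 f0 + s 2 f1 + s 2 ((s 2 (f0 + h) - s 2 f1) + s k h) = s (2 * (k + 2)) h" for f0 f1 h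
  proof -
   have four: "s 4 u = s 2 u + s 2 u" for u using vs.scale_left_distrib[of 2 2 u] by simp
   show ?thesis
    by (simp add: vs.scale_right_distrib vs.scale_right_diff_distrib vs.scale_left_distrib four distrib_left)
  qed
  then show ?thesis unfolding ef .
 qed
 finally show ?thesis .
qed

lemma linear_Om: "Om (u + v) = Om u + Om v" "Om (s c v) = s c (Om v)"
proof -
 have a: "On n (u + v) = On n u + On n v" for n by (simp add: On_def act_add vs.scale_right_distrib)
 have c: "On n (s c v) = s c (On n v)" for n by (simp add: On_def act_scale vs.scale_right_distrib mult.commute)
 show "Om (u + v) = Om u + Om v" unfolding Om_def a fs_add[OF evz_On evz_On] by (simp add: vs.scale_right_distrib)
 show "Om (s c v) = s c (Om v)" unfolding Om_def c vs.fs_scale[OF evz_On] by (simp add: vs.scale_right_distrib mult.commute)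
qed

lemma Om_diffl: "Om (u - v) = Om u - Om v" using linear_Om(1)[of "u - v" v] by (simp add: eq_diff_eq)

text \<open>The rule is inherited by brackets, so it needs checking only on e(0), f(0), h(1) and
  h(-1).\<close>

lemma Om_act: "Om (act x n v) = act x n (Om v) + s (- (2 * (k + 2) * of_int n)) (act x n v)"
proof -
 define P where "P x n \<longleftrightarrow> (\<forall>v. Om (act x n v) = act x n (Om v) + s (- (2 * (k + 2) * of_int n)) (act x n v))" for x n
 define B where "B x m y n v = act x m (act y n v) - act y n (act x m v)" for x m y n v
 define P' where "P' x m y n \<longleftrightarrow> (\<forall>v. Om (B x m y n v) = B x m y n (Om v) + s (- (2 * (k + 2) * of_int (m + n))) (B x m y n v))" for x m y n
 have br: "P' x m y n" if "P x m" "P y n" for x m y n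
  unfolding P'_def
 proof
  fix v
  have px: "Om (act x m u) = act x m (Om u) + s (- (2 * (k + 2) * of_int m)) (act x m u)" for u
   using that(1) unfolding P_def by (rule spec)
  have py: "Om (act y n u) = act y n (Om u) + s (- (2 * (k + 2) * of_int n)) (act y n u)" for u
   using that(2) unfolding P_def by (rule spec)
  have 1: "Om (act x m (act y n v)) = act x m (act y n (Om v)) + s (- (2 * (k + 2) * of_int (m + n))) (act x m (act y n v))"
  proof -
   have "Om (act x m (act y n v)) = act x m (act y n (Om v)) + (s (- (2 * (k + 2) * of_int n)) (act x m (act y n v)) + s (- (2 * (k + 2) * of_int m)) (act x m (act y n v)))"
    unfolding px py act_add act_scale by (rule add.assoc)
   also have "s (- (2 * (k + 2) * of_int n)) u + s (- (2 * (k + 2) * of_int m)) u = s (- (2 * (k + 2) * of_int (m + n))) u" for u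
    unfolding vs.scale_left_distrib[symmetric] by (simp add: distrib_left add.commute)
   finally show ?thesis .
  qed
  have 2: "Om (act y n (act x m v)) = act y n (act x m (Om v)) + s (- (2 * (k + 2) * of_int (m + n))) (act y n (act x m v))"
  proof -
   have "Om (act y n (act x m v)) = act y n (act x m (Om v)) + (s (- (2 * (k + 2) * of_int m)) (act y n (act x m v)) + s (- (2 * (k + 2) * of_int n)) (act y n (act x m v)))"
    unfolding px py act_add act_scale by (rule add.assoc)
   also have "s (- (2 * (k + 2) * of_int m)) u + s (- (2 * (k + 2) * of_int n)) u = s (- (2 * (k + 2) * of_int (m + n))) u" for u
    unfolding vs.scale_left_distrib[symmetric] by (simp add: distrib_left)
   finally show ?thesis .
  qed
  show "Om (B x m y n v) = B x m y n (Om v) + s (- (2 * (k + 2) * of_int (m + n))) (B x m y n v)"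
   unfolding B_def Om_diffl 1 2 vs.scale_right_diff_distrib by simp
 qed
 have EF: "P H (m + n)" if "P' E m F n" for m n
  unfolding P_def
 proof
  fix v
  have b: "B E m F n u = act H (m + n) u + (if m + n = 0 then s (of_int m * k) u else 0)" for u unfolding B_def comm_EF by simp
  have "Om (act H (m + n) v + (if m + n = 0 then s (of_int m * k) v else 0)) = act H (m + n) (Om v) + (if m + n = 0 then s (of_int m * k) (Om v) else 0)
   + s (- (2 * (k + 2) * of_int (m + n))) (act H (m + n) v + (if m + n = 0 then s (of_int m * k) v else 0))"
   by (rule that[unfolded P'_def b, THEN spec])
  then show "Om (act H (m + n) v) = act H (m + n) (Om v) + s (- (2 * (k + 2) * of_int (m + n))) (act H (m + n) v)"
   by (cases "m + n = 0") (simp_all add: linear_Om)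
 qed
 have canc: "u = v" if "s 2 u = s 2 v" for u v :: 'm using that by simp
 have HE: "P E (m + n)" if "P' H m E n" for m n
  unfolding P_def
 proof
  fix v
  have b: "B H m E n u = s 2 (act E (m + n) u)" for u unfolding B_def comm_HE by simp
  have "s 2 (Om (act E (m + n) v)) = s 2 (act E (m + n) (Om v)) + s (- (2 * (k + 2) * of_int (m + n))) (s 2 (act E (m + n) v))"
   by (rule that[unfolded P'_def b linear_Om, THEN spec])
  then show "Om (act E (m + n) v) = act E (m + n) (Om v) + s (- (2 * (k + 2) * of_int (m + n))) (act E (m + n) v)"
   by - (rule canc, simp only: vs.scale_right_distrib vs.scale_left_commute[of 2])
 qed
 have HF: "P F (m + n)" if "P' H m F n" for m n
  unfolding P_def
 proof
  fix v
  have b: "B H m F n u = s (-2) (act F (m + n) u)" for u unfolding B_def comm_HF by simp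
  have canc': "u = v" if "s (-2) u = s (-2) v" for u v :: 'm using that by simp
  have "s (-2) (Om (act F (m + n) v)) = s (-2) (act F (m + n) (Om v)) + s (- (2 * (k + 2) * of_int (m + n))) (s (-2) (act F (m + n) v))"
   by (rule that[unfolded P'_def b linear_Om, THEN spec])
  then show "Om (act F (m + n) v) = act F (m + n) (Om v) + s (- (2 * (k + 2) * of_int (m + n))) (act F (m + n) v)"
   by - (rule canc', simp only: vs.scale_right_distrib vs.scale_left_commute[of "-2"])
 qed
 have PI: "P x n" if "!!v. Om (act x n v) - act x n (Om v) = s (- (2 * (k + 2) * of_int n)) (act x n v)" for x n
  unfolding P_def
 proof
  fix v
  show "Om (act x n v) = act x n (Om v) + s (- (2 * (k + 2) * of_int n)) (act x n v)"
   using that[of v] by (simp only: diff_eq_eq add.commute)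
 qed
 have 0: "P E 0" "P F 0" by (rule PI, unfold Om_diff On_E0 On_F0, simp)+
 have 1: "P H 1" by (rule PI, unfold Om_H1, simp)
 have m1: "P H (-1)" by (rule PI, unfold Om_Hm1, simp)
 have "P x n" by (rule act_generated[of P P', OF br EF HE HF 0 1 m1])
 then show ?thesis unfolding P_def by (rule spec)
qed

theorem derivation_exists:
 assumes k: "k + 2 \<noteq> 0" and w: "act E 0 w = 0" "act H 0 w = s r w" "!!x n. n \<ge> 1 ==> act x n w = 0"
 shows "\<exists>D. Vector_Spaces.linear s s D \<and> (\<forall>x n v. D (act x n v) - act x n (D v) = s (of_int n) (act x n v)) \<and> D w = 0"
proof -
 \<comment> \<open>The value of \<open>Om\<close> on w: e f + f e + h h / 2 gives r + r^2 / 2.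
   Subtracting it normalises D w = 0.\<close>
 define c where "c = r + r * r / 2"
 define D where "D v = s (- 1 / (2 * (k + 2))) (Om v - s c v)" for v
 have "On (1 + int i) w = 0" for i by (simp add: On_def w(3))
 then have "Om w = On 0 w" by (simp add: Om_def)
 also have "\<dots> = s c w"
  using comm_EF[of 0 0 w] w(1,2) by (simp add: On_def act_scale c_def vs.scale_left_distrib)
 finally have "D w = 0" by (simp add: D_def)
 moreover have "Vector_Spaces.linear s s D"
  unfolding Vector_Spaces.linear_iff D_def
  by (intro conjI allI vs.vector_space_axioms) (simp_all add: linear_Om vs.scale_right_distrib vs.scale_right_diff_distrib vs.scale_left_commute mult.commute)
 moreover have "D (act x n v) - act x n (D v) = s (of_int n) (act x n v)" for x n v
 proof -
  have "D (act x n v) - act x n (D v) = s (- 1 / (2 * (k + 2))) (s (- (2 * (k + 2) * of_int n)) (act x n v))"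
   unfolding D_def Om_act act_scale act_diff by (simp add: vs.scale_right_distrib vs.scale_right_diff_distrib)
  also have "\<dots> = s (- 1 / (2 * (k + 2)) * (- (2 * (k + 2) * of_int n))) (act x n v)" by (rule vs.scale_scale)
  also have "- 1 / (2 * (k + 2)) * (- (2 * (k + 2) * of_int n)) = of_int n"
  proof -
   have "- 1 / c * (- (c * z)) = z" if "c \<noteq> 0" for c z :: complex using that by simp
   moreover have "2 * (k + 2) \<noteq> 0" using k by (simp only: mult_eq_0_iff) simp
   ultimately show ?thesis by blast
  qed
  finally show ?thesis .
 qed
 ultimately show ?thesis by blast
qed

end

context cvs begin

lemma lin_by_key:
 assumes "!!d. lin s f (filter (%(c, w). \<kappa> w = d) P) = 0"
 shows "lin s f P = 0"
 using assms
proof (induction "length P" arbitrary: P rule: less_induct)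
 case less
 show ?case
 proof (cases P)
  case (Cons b P')
  define d where "d = \<kappa> (snd b)"
  define Q where "Q = filter (%(c, w). \<kappa> w \<noteq> d) P"
  have split: "lin s f R = lin s f (filter (%(c, w). \<kappa> w = d) R) + lin s f (filter (%(c, w). \<kappa> w \<noteq> d) R)" for R
   by (induction R) (auto simp: add_ac)
  have "length Q < length P"
   unfolding Q_def Cons by (simp add: d_def case_prod_beta less_Suc_eq_le)
  moreover have "lin s f (filter (%(c, w). \<kappa> w = e) Q) = 0" for e
  proof (cases "e = d")
   case True
   have "filter (%(c, w). \<kappa> w = e) Q = []" unfolding Q_def True by (auto simp: filter_empty_conv)
   then show ?thesis by simp
  next
   case False
   have "filter (%(c, w). \<kappa> w = e) Q = filter (%(c, w). \<kappa> w = e) P"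
    unfolding Q_def filter_filter by (rule filter_cong) (use False in auto)
   then show ?thesis using less.prems by simp
  qed
  ultimately have "lin s f Q = 0" by (rule less.hyps)
  then show ?thesis using split[of P] less.prems[of d] by (simp add: Q_def)
 qed simp
qed

lemma lin_filter_sum:
 "finite I ==> (!!c w. (c, w) \<in> set P ==> dg w \<in> I) ==> (\<Sum>e\<in>I. lin s f (filter (%(c, w). dg w = e) P)) = lin s f P"
proof (induction P)
 case (Cons b P)
 obtain c w where b: "b = (c, w)" by (cases b)
 have "(\<Sum>e\<in>I. lin s f (filter (%(c, w). dg w = e) (b # P)))
  = (\<Sum>e\<in>I. (if e = dg w then s c (f w) else 0) + lin s f (filter (%(c, w). dg w = e) P))"
  by (rule sum.cong) (auto simp: b)
 also have "\<dots> = s c (f w) + lin s f P"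
  unfolding sum.distrib using Cons by (auto simp: b)
 finally show ?case by (simp add: b)
qed simp

lemma eig_indep1:
 assumes D: "Vector_Spaces.linear s s D" and I: "finite I" "inj_on \<nu> I" "!!i. i \<in> I ==> D (g i) = s (\<nu> i) (g i)"
  and z: "(\<Sum>i\<in>I. g i) = 0" "i \<in> I"
 shows "g i = 0"
proof -
 define h where "h i = (\<nu> i, \<nu> i)" for i
 have inj: "inj_on h I" using I(2) by (auto simp: inj_on_def h_def)
 define g' where "g' \<omega> = g (the_inv_into I h \<omega>)" for \<omega>
 have g': "g' (h i) = g i" if "i \<in> I" for i by (simp add: g'_def the_inv_into_f_f[OF inj that])
 have "(\<Sum>\<omega>\<in>h ` I. g' \<omega>) = (\<Sum>i\<in>I. g i)" by (subst sum.reindex[OF inj]) (auto simp: g' intro!: sum.cong)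
 then have s0: "(\<Sum>\<omega>\<in>h ` I. g' \<omega>) = 0" using z(1) by simp
 have "g' (h i) = 0"
 proof (rule eig_indep[OF D D _ _ s0])
  show "finite (h ` I)" using I(1) by simp
  show "h i \<in> h ` I" using z(2) by simp
  fix \<omega> assume "\<omega> \<in> h ` I"
  then obtain j where j: "j \<in> I" "\<omega> = h j" by blast
  have "fst \<omega> = \<nu> j" "snd \<omega> = \<nu> j" by (simp_all add: j(2) h_def)
  then show "D (g' \<omega>) = s (fst \<omega>) (g' \<omega>) \<and> D (g' \<omega>) = s (snd \<omega>) (g' \<omega>)"
   using I(3)[OF j(1)] g'[OF j(1)] j(2) by simp
 qed
 then show ?thesis using g'[OF z(2)] by simp
qed

end

context Lk0 begin

lemma Vg_hom: assumes v: "v \<in> Vg d" shows "\<exists>P. hom d P \<and> v = lin sV ev P"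
proof -
 obtain P where P: "v = lin sV ev P" using span_ev by blast
 define I where "I = insert d ((%(c, w). dg w) ` set P)"
 define g where "g e = lin sV ev (filter (%(c, w). dg w = e) P) - (if e = d then v else 0)" for e
 have fI: "finite I" by (simp add: I_def)
 have "(\<Sum>e\<in>I. g e) = (\<Sum>e\<in>I. lin sV ev (filter (%(c, w). dg w = e) P)) - (\<Sum>e\<in>I. if e = d then v else 0)"
  unfolding g_def by (rule sum_subtractf)
 also have "(\<Sum>e\<in>I. lin sV ev (filter (%(c, w). dg w = e) P)) = v"
  unfolding P by (rule V.vs.lin_filter_sum[OF fI]) (force simp: I_def)
 also have "(\<Sum>e\<in>I. if e = d then v else 0) = v" using fI by (simp add: I_def)
 finally have s0: "(\<Sum>e\<in>I. g e) = 0" by simp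
 have mem: "g e \<in> Vg e" if "e \<in> I" for e
 proof -
  have "lin sV ev (filter (%(c, w). dg w = e) P) \<in> Vg e"
  proof (rule V.vs.lin_mem[OF sub_Vg])
   fix c w assume "(c, w) \<in> set (filter (%(c, w). dg w = e) P)"
   then show "ev w \<in> Vg e" using ev_Gr[of w] by (auto simp: Gr_def)
  qed
  moreover have "(if e = d then v else 0) \<in> Vg e" using v V.vs.subspace_0[OF sub_Vg] by simp
  ultimately show ?thesis unfolding g_def by (rule V.vs.subspace_diff[OF sub_Vg])
 qed
 have "g d = 0" by (rule graded_indep[OF V.vs.vector_space_axioms grV fI mem s0]) (simp_all add: I_def)
 then have "v = lin sV ev (filter (%(c, w). dg w = d) P)" by (simp add: g_def)
 moreover have "hom d (filter (%(c, w). dg w = d) P)" by (auto simp: hom_def)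
 ultimately show ?thesis by blast
qed

end

context Lk0_mod begin

lemma field_linf_fw: "W.vs.field (W.vs.linf fw P)" by (rule W.vs.field_linf[OF field_fw])

lemma nprod_linf_fw: "W.vs.nprod n (aw x) (W.vs.linf fw P) = W.vs.linf fw (amP x n P)"
 unfolding W.vs.nprod_def W.vs.linf_def amP_def W.vs.lin_bindc
 by (intro ext) (simp add: W.vs.R_linf2[OF field_fw field_aw, unfolded W.vs.linf_def] aw_fw[unfolded W.vs.nprod_def])

lemma comm_linf: "aw x n (W.vs.linf fw P p v) - W.vs.linf fw P p (aw x n v)
  = fs (%i. sW (gch n i) (W.vs.linf fw (amP x (int i) P) (n + p - int i) v))"
proof -
 have "W.vs.loc (aw x) (W.vs.linf fw P)"
  by (rule W.vs.loc_sym[OF field_linf_fw field_aw W.vs.loc_linf1[OF field_fw field_aw loc_fw_aw]])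
 then obtain kk where kk: "!!m n w. W.vs.R (int kk) (aw x) (W.vs.linf fw P) m n w = 0" unfolding W.vs.loc_def by blast
 show ?thesis using W.vs.local_borcherds[OF field_aw field_linf_fw kk, of n 0 p v]
  unfolding W.vs.R_0 nprod_linf_fw add_0_left by (rule sym)
qed

end

locale Lk0_hw = Lk0_mod +
 fixes r and w0 and D
 assumes irrW: "ghat_irred sW aw" and w0_nz: "w0 \<noteq> 0"
  and w0_E: "aw E 0 w0 = 0" and w0_H: "aw H 0 w0 = sW r w0" and w0_top: "n \<ge> 1 ==> aw x n w0 = 0"
  and D_lin: "Vector_Spaces.linear sW sW D"
  and D_act: "D (aw x n v) - aw x n (D v) = sW (of_int n) (aw x n v)" and D_w0: "D w0 = 0"
begin

lemma D_act': "D (aw x n v) = aw x n (D v) + sW (of_int n) (aw x n v)"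
 using D_act[of x n v] by (simp add: diff_eq_eq add.commute)

lemma D_ops: "D (u + v) = D u + D v" "D (sW c v) = sW c (D v)" "D 0 = 0"
proof -
 interpret D: Vector_Spaces.linear sW sW D by (rule D_lin)
 show "D (u + v) = D u + D v" "D (sW c v) = sW c (D v)" "D 0 = 0" by (rule D.add D.scale D.zero)+
qed

lemma D_ey: "D u = sW \<nu> u ==> D (W.ey u b) = sW (\<nu> - of_nat (c0 b)) (W.ey u b)"
proof (induction b)
 case (Cons x b)
 define c where "c = \<nu> - of_nat (c0 b)"
 have IH: "D (W.ey u b) = sW c (W.ey u b)" unfolding c_def by (rule Cons.IH[OF Cons.prems])
 show ?case
 proof (cases x)
  case True
  have "D (aw F 0 (W.ey u b)) = sW c (aw F 0 (W.ey u b))" unfolding D_act' IH W.act_scale by simp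
  moreover have "c = \<nu> - of_nat (c0 (x # b))" by (simp add: c_def True)
  ultimately show ?thesis by (simp add: True)
 next
  case False
  have "D (aw E (-1) (W.ey u b)) = sW (c + of_int (-1)) (aw E (-1) (W.ey u b))"
   unfolding D_act' IH W.act_scale by (rule W.vs.scale_left_distrib[symmetric])
  moreover have "c + of_int (-1) = \<nu> - of_nat (c0 (x # b))" by (simp add: c_def False)
  ultimately show ?thesis by (simp add: False)
 qed
qed simp

definition sing where "sing u \<rho> \<nu> \<longleftrightarrow> u \<noteq> 0 \<and> aw E 0 u = 0 \<and> aw F 1 u = 0 \<and> aw H 0 u = sW \<rho> u \<and> D u = sW \<nu> u"

definition wgt :: "complex => complex => bool list => complex \<times> complex" where
 "wgt \<rho> \<nu> b = (\<rho> + 2 * of_nat (c0 b) - 2 * of_nat (c1 b), \<nu> - of_nat (c0 b))"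

lemma eigen_span:
 assumes u: "sing u \<rho> \<nu>" and v: "v \<in> W.vs.span (W.ey u ` {b. wgt \<rho> \<nu> b = \<omega>})"
 shows "aw H 0 v = sW (fst \<omega>) v \<and> D v = sW (snd \<omega>) v"
 using v
proof (induction rule: W.vs.span_induct_alt)
 case (step c x y)
 then obtain b where b: "x = W.ey u b" "\<omega> = wgt \<rho> \<nu> b" by blast
 have "aw H 0 x = sW (fst \<omega>) x" "D x = sW (snd \<omega>) x"
  using u W.ey_H[of u \<rho> b] D_ey[of u \<nu> b] unfolding b wgt_def sing_def by simp_all
 then show ?case using step by (simp add: W.act_add W.act_scale D_ops W.vs.scale_right_distrib mult.commute)
qed (simp add: D_ops)

lemma weight_decomp:
 assumes u: "sing u \<rho> \<nu>"
 shows "\<exists>Fs g. finite Fs \<and> Fs \<subseteq> range (wgt \<rho> \<nu>) \<and> (\<forall>\<omega>\<in>Fs. g \<omega> \<in> W.vs.span (W.ey u ` {b. wgt \<rho> \<nu> b = \<omega>})) \<and> v = (\<Sum>\<omega>\<in>Fs. g \<omega>)"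
proof (rule W.vs.span_homogeneous)
 show "v \<in> W.vs.span (range (W.ey u))"
  by (rule W.ey_span[OF irrW]) (use u in \<open>auto simp: sing_def\<close>)
qed

lemma H_lin: "Vector_Spaces.linear sW sW (aw H 0)" by (rule W.lin_act)

lemma weight_span:
 assumes u: "sing u \<rho> \<nu>" and v: "aw H 0 v = sW \<mu> v" "D v = sW \<xi> v"
 shows "v \<in> W.vs.span (W.ey u ` {b. wgt \<rho> \<nu> b = (\<mu>, \<xi>)})"
proof -
 from weight_decomp[OF u, of v] obtain Fs g
  where "finite Fs \<and> Fs \<subseteq> range (wgt \<rho> \<nu>) \<and> (\<forall>\<omega>\<in>Fs. g \<omega> \<in> W.vs.span (W.ey u ` {b. wgt \<rho> \<nu> b = \<omega>})) \<and> v = (\<Sum>\<omega>\<in>Fs. g \<omega>)"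
  by (elim exE)
 then have I: "finite Fs" "!!\<omega>. \<omega> \<in> Fs ==> g \<omega> \<in> W.vs.span (W.ey u ` {b. wgt \<rho> \<nu> b = \<omega>})" "v = (\<Sum>\<omega>\<in>Fs. g \<omega>)"
  by blast+
 define \<omega>0 where "\<omega>0 = (\<mu>, \<xi>)"
 define h where "h \<omega> = (if \<omega> \<in> Fs then g \<omega> else 0) - (if \<omega> = \<omega>0 then v else 0)" for \<omega>
 have "(\<Sum>\<omega>\<in>insert \<omega>0 Fs. h \<omega>) = (\<Sum>\<omega>\<in>insert \<omega>0 Fs. if \<omega> \<in> Fs then g \<omega> else 0) - (\<Sum>\<omega>\<in>insert \<omega>0 Fs. if \<omega> = \<omega>0 then v else 0)"
  unfolding h_def by (rule sum_subtractf)
 also have "(\<Sum>\<omega>\<in>insert \<omega>0 Fs. if \<omega> \<in> Fs then g \<omega> else 0) = v"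
  unfolding I(3) using I(1) by (intro sum.mono_neutral_cong_right) auto
 also have "(\<Sum>\<omega>\<in>insert \<omega>0 Fs. if \<omega> = \<omega>0 then v else 0) = v" using I(1) by (simp add: sum.delta)
 finally have s0: "(\<Sum>\<omega>\<in>insert \<omega>0 Fs. h \<omega>) = 0" by simp
 have ei: "aw H 0 (h \<omega>) = sW (fst \<omega>) (h \<omega>) \<and> D (h \<omega>) = sW (snd \<omega>) (h \<omega>)" for \<omega>
 proof -
  have m: "D (- v') = - D v'" for v' using D_ops(2)[of "-1" v'] by simp
  have a: "aw H 0 (if \<omega> \<in> Fs then g \<omega> else 0) = sW (fst \<omega>) (if \<omega> \<in> Fs then g \<omega> else 0)"
   "D (if \<omega> \<in> Fs then g \<omega> else 0) = sW (snd \<omega>) (if \<omega> \<in> Fs then g \<omega> else 0)"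
   using eigen_span[OF u I(2)] by (auto simp: D_ops)
  have b: "aw H 0 (if \<omega> = \<omega>0 then v else 0) = sW (fst \<omega>) (if \<omega> = \<omega>0 then v else 0)"
   "D (if \<omega> = \<omega>0 then v else 0) = sW (snd \<omega>) (if \<omega> = \<omega>0 then v else 0)"
   using v by (auto simp: \<omega>0_def D_ops)
  have d: "D (x - y) = D x - D y" for x y using D_ops(1)[of x "- y"] by (simp add: m)
  show ?thesis unfolding h_def W.act_diff d a b W.vs.scale_right_diff_distrib by simp
 qed
 have "h \<omega>0 = 0" by (rule W.vs.eig_indep[OF H_lin D_lin, of "insert \<omega>0 Fs"]) (use ei s0 I(1) in auto)
 then have "v = (if \<omega>0 \<in> Fs then g \<omega>0 else 0)" by (simp add: h_def)
 then show ?thesis using I(2)[of \<omega>0] unfolding \<omega>0_def by (auto simp: W.vs.span_zero split: if_splits)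
qed

lemma sing_w0: "sing w0 r 0"
 by (simp add: sing_def w0_nz w0_E w0_H w0_top D_w0)

lemma topv_w0: "topv w0" by (simp add: topv_def w0_top)

text \<open>A singular vector generates the irreducible module, so the weight of w0 arises from its
  weight by subtracting simple roots.\<close>

lemma sing_top: assumes "sing u \<rho> \<nu>" shows "\<exists>b. wgt \<rho> \<nu> b = (r, 0)"
proof (rule ccontr)
 assume "\<not> ?thesis"
 then have e: "{b. wgt \<rho> \<nu> b = (r, 0)} = {}" by blast
 have "w0 \<in> W.vs.span (W.ey u ` {b. wgt \<rho> \<nu> b = (r, 0)})" by (rule weight_span[OF assms w0_H]) (simp add: D_w0)
 then show False using w0_nz unfolding e by simp
qed

text \<open>If nonzero, f^(n+1) w0 would be singular of the same D-eigenvalue and strictly smaller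
  h(0)-weight, and w0 could not be reached from it.\<close>

lemma ft_zero: assumes rn: "r = of_nat n" and j: "j > n" shows "ft w0 j = 0"
proof -
 have D: "D (ft w0 i) = sW 0 (ft w0 i)" for i
  by (induction i) (simp_all add: ft_simps D_w0 D_act')
 have "ft w0 (Suc n) = 0"
 proof (rule ccontr)
  assume nz: "ft w0 (Suc n) \<noteq> 0"
  have "aw E 0 (ft w0 (Suc n)) = 0" unfolding ft_E[OF topv_w0 w0_E w0_H] by (simp add: rn)
  moreover have "aw F 1 (ft w0 (Suc n)) = 0" using top_ft[OF topv_w0, of "Suc n"] by (simp add: topv_def)
  ultimately have "sing (ft w0 (Suc n)) (r - 2 * of_nat (Suc n)) 0"
   unfolding sing_def using nz ft_H[OF topv_w0 w0_E w0_H, of "Suc n"] D[of "Suc n"] by simp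
  from sing_top[OF this] obtain b where "wgt (r - 2 * of_nat (Suc n)) 0 b = (r, 0)" by blast
  then have w: "r - 2 * of_nat (Suc n) + 2 * of_nat (c0 b) - 2 * of_nat (c1 b) = r" and "0 - of_nat (c0 b) = (0 :: complex)"
   by (simp_all only: wgt_def prod.inject)
  then have c: "c0 b = 0" by simp
  have "of_nat (2 * (Suc n + c1 b)) = r - (r - 2 * of_nat (Suc n) + 2 * of_nat (c0 b) - 2 * of_nat (c1 b))"
   by (simp add: c algebra_simps)
  also have "\<dots> = 0" unfolding w by simp
  finally show False by (simp only: of_nat_eq_0_iff) simp
 qed
 moreover obtain i where "j = i + Suc n" using j by (metis add.commute less_imp_Suc_add add_Suc_right)
 moreover have "(aw F 0 ^^ i) 0 = 0" for i by (induction i) simp_all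
 moreover have "ft w0 (i + Suc n) = (aw F 0 ^^ i) (ft w0 (Suc n))" for i by (simp only: ft_def funpow_add o_apply)
 ultimately show ?thesis by simp
qed

subsection \<open>The action of the maximal ideal\<close>

definition Grw :: "int => 'b set" where "Grw d = {v. D v = sW (- of_int d) v}"

end

context Lk0_hw begin

lemma D_fs: "evz f ==> D (fs f) = fs (%i. D (f i))" by (rule W.vs.fs_lin[OF D_lin])

text \<open>The offset is one less than the conformal weight: 0 for currents, degree minus 1 for the
  field of a word.\<close>

definition hmg :: "(int => 'b => 'b) => int => bool" where
 "hmg A h \<longleftrightarrow> (\<forall>n v. D (A n v) = A n (D v) + sW (of_int (n - h)) (A n v))"

lemma hmg_nprod:
 assumes A: "W.vs.field A" "hmg A hA" and B: "W.vs.field B" "hmg B hB"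
 shows "hmg (W.vs.nprod l A B) (hA + hB - l)"
 unfolding hmg_def
proof (intro allI)
 fix n v
 define N where "N = n - (hA + hB - l)"
 have two: "D (A a (B b v)) = A a (B b (D v)) + sW (of_int (a + b - hA - hB)) (A a (B b v))" for a b v
 proof -
  have "D (A a (B b v)) = A a (B b (D v)) + (sW (of_int (b - hB)) (A a (B b v)) + sW (of_int (a - hA)) (A a (B b v)))"
   using A(2) B(2) unfolding hmg_def by (simp only: W.vs.field_ops[OF A(1)] add.assoc)
  also have "sW (of_int (b - hB)) z + sW (of_int (a - hA)) z = sW (of_int (a + b - hA - hB)) z" for z
   unfolding W.vs.scale_left_distrib[symmetric] of_int_add[symmetric] by (simp add: algebra_simps)
  finally show ?thesis .
 qed
 have two': "D (B b (A a v)) = B b (A a (D v)) + sW (of_int (a + b - hA - hB)) (B b (A a v))" for a b v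
 proof -
  have "D (B b (A a v)) = B b (A a (D v)) + (sW (of_int (a - hA)) (B b (A a v)) + sW (of_int (b - hB)) (B b (A a v)))"
   using A(2) B(2) unfolding hmg_def by (simp only: W.vs.field_ops[OF B(1)] add.assoc)
  also have "sW (of_int (a - hA)) z + sW (of_int (b - hB)) z = sW (of_int (a + b - hA - hB)) z" for z
   unfolding W.vs.scale_left_distrib[symmetric] of_int_add[symmetric] by (simp add: algebra_simps)
  finally show ?thesis .
 qed
 define f where "f v i = sW ((-1) ^ i * gch l i) (A (l - int i) (B (n + int i) v))" for v i
 define g where "g v i = sW ((-1) ^ i * gch l i) (B (n + l - int i) (A (int i) v))" for v i
 have ef: "evz (f v)" for v unfolding f_def
  by (intro W.vs.evz_scale evz_map[OF W.vs.field_evz[OF B(1), of n v]]) (simp add: W.vs.field_ops(1)[OF A(1)])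
 have eg: "evz (g v)" for v unfolding g_def
  by (intro W.vs.evz_scale evz_map[OF W.vs.field_evz[OF A(1), of 0 v]]) (simp add: W.vs.field_ops(1)[OF B(1)])
 have Df: "D (f v i) = f (D v) i + sW (of_int N) (f v i)" for i
 proof -
  have "l - int i + (n + int i) - hA - hB = N" by (simp add: N_def)
  then show ?thesis unfolding f_def D_ops two by (simp add: W.vs.scale_right_distrib W.vs.scale_left_commute mult.commute)
 qed
 have Dg: "D (g v i) = g (D v) i + sW (of_int N) (g v i)" for i
 proof -
  have "int i + (n + l - int i) - hA - hB = N" by (simp add: N_def)
  then show ?thesis unfolding g_def D_ops two' by (simp add: W.vs.scale_right_distrib W.vs.scale_left_commute mult.commute)
 qed
 have F: "D (fs (f v)) = fs (f (D v)) + sW (of_int N) (fs (f v))"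
  unfolding D_fs[OF ef] Df fs_add[OF ef W.vs.evz_scale[OF ef]] W.vs.fs_scale[OF ef] ..
 have G: "D (fs (g v)) = fs (g (D v)) + sW (of_int N) (fs (g v))"
  unfolding D_fs[OF eg] Dg fs_add[OF eg W.vs.evz_scale[OF eg]] W.vs.fs_scale[OF eg] ..
 have np: "W.vs.nprod l A B n v = fs (f v) - sW (sg l) (fs (g v))" for v
  unfolding W.vs.nprod_eq f_def g_def ..
 have Dd: "D (x - y) = D x - D y" for x y using D_ops(1)[of "x - y" y] by (simp add: eq_diff_eq)
 show "D (W.vs.nprod l A B n v) = W.vs.nprod l A B n (D v) + sW (of_int (n - (hA + hB - l))) (W.vs.nprod l A B n v)"
  unfolding np Dd D_ops F G N_def[symmetric]
  by (simp add: W.vs.scale_right_distrib W.vs.scale_right_diff_distrib mult.commute)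
qed

lemma hmg_fw: "hmg (fw w) (int (dg w) - 1)"
proof (induction w rule: fw.induct)
 case 1
 show ?case by (auto simp: hmg_def W.vs.idf_def D_ops)
next
 case (2 x n w)
 have "hmg (aw x) 0" by (simp add: hmg_def D_act')
 from hmg_nprod[OF field_aw this field_fw 2, of "- int n - 1"] show ?case by (simp add: algebra_simps)
qed

lemma D_fw:
 assumes "D v = sW \<nu> v"
 shows "D (fw w p v) = sW (\<nu> + of_int (p + 1 - int (dg w))) (fw w p v)"
proof -
 have "D (fw w p v) = fw w p (D v) + sW (of_int (p - (int (dg w) - 1))) (fw w p v)"
  using hmg_fw[of w] unfolding hmg_def by (elim allE)
 also have "p - (int (dg w) - 1) = p + 1 - int (dg w)" by simp
 finally show ?thesis unfolding assms W.vs.field_ops(4)[OF field_fw] W.vs.scale_left_distrib .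
qed

lemma D_linf: "hom d P ==> D v = sW \<nu> v ==> D (W.vs.linf fw P p v) = sW (\<nu> + of_int (p + 1 - int d)) (W.vs.linf fw P p v)"
proof (induction P)
 case Nil
 then show ?case by (simp add: W.vs.linf_simps D_ops)
next
 case (Cons b P)
 then have "hom d P" "dg (snd b) = d" by (auto simp: hom_def)
 then show ?case using Cons D_fw[OF Cons.prems(2), of "snd b" p]
  by (simp add: W.vs.linf_simps D_ops W.vs.scale_right_distrib mult.commute)
qed

lemma Grw_sub: "W.vs.subspace (Grw d)"
 unfolding W.vs.subspace_def Grw_def by (simp add: D_ops W.vs.scale_right_distrib mult.commute)

lemma Grw_act: "v \<in> Grw d ==> aw x n v \<in> Grw (d - n)"
 unfolding Grw_def by (simp add: D_act' W.act_scale W.vs.scale_left_distrib[symmetric] W.vs.scale_minus_left[symmetric] del: W.vs.scale_minus_left)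

lemma Grw_indep: "finite I ==> (!!d. d \<in> I ==> g d \<in> Grw d) ==> (\<Sum>d\<in>I. g d) = 0 ==> d \<in> I ==> g d = 0"
 by (rule W.vs.eig_indep1[OF D_lin, of I "%d. - of_int d" g d]) (auto simp: Grw_def inj_on_def)

text \<open>Components of weight m > 0 vanish by crossing r. For m \<le> 0 either
  \<open>ZZ_range\<close> applies, or r is a natural number below - m and f^(-m) w0 = 0.\<close>

lemma zero_mode_w0:
 assumes J: "J P" and d: "hom d P" and z: "ZZ r"
 shows "W.vs.linf fw P (int d - 1) w0 = 0"
proof -
 define c where "c = r * (r + 2)"
 have "W.vs.linf fw P (int d - 1) w0 = lin sW (%w. sW (pw c w r) (ft w0 (nat (- wt w)))) P"
  unfolding W.vs.linf_def
 proof (rule lin_cong)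
  fix a w assume "(a, w) \<in> set P"
  then have "dg w = d" using d by (auto simp: hom_def)
  then show "fw w (int d - 1) w0 = sW (pw c w r) (ft w0 (nat (- wt w)))"
   using zero_mode[OF topv_w0 w0_E w0_H, of w 0] by (simp add: ft_simps c_def)
 qed
 also have "\<dots> = 0"
 proof (rule W.vs.lin_by_key[of _ wt])
  fix m
  have "lin sW (%w. sW (pw c w r) (ft w0 (nat (- wt w)))) (filter (%(b, w). wt w = m) P) = sW (pm m c P r) (ft w0 (nat (- m)))"
   by (induction P) (auto simp: pm_def W.vs.scale_left_distrib)
  also have "\<dots> = 0"
  proof (cases "m > 0")
   case True
   have "pm m c P r = 0" by (rule pm_crossing[of _ _ 0]) (use True in \<open>auto simp: c_def\<close>)
   then show ?thesis by simp
  next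
   case False
   show ?thesis
   proof (cases "\<exists>n<nat (- m). r = of_nat n")
    case True
    then show ?thesis using ft_zero by auto
   next
    case nn: False
    have "pm (int 0 - int (nat (- m))) (r * (r + 2)) P (r - 2 * of_nat 0) = 0"
     by (rule ZZ_range[OF z J]) (use nn in blast)
    moreover have "int 0 - int (nat (- m)) = m" using False by simp
    ultimately show ?thesis by (simp add: c_def)
   qed
  qed
  finally show "lin sW (%w. sW (pw c w r) (ft w0 (nat (- wt w)))) (filter (%(b, w). wt w = m) P) = 0" .
 qed
 finally show ?thesis .
qed

text \<open>Induction on the depth of the result. Above the top it is 0, on the top it is a zero
  mode, and below the top the positive modes send it to results of smaller depth for other elements
  of the ideal; so it is singular, hence 0.\<close>

lemma modes_w0:
 assumes z: "ZZ r"
 shows "J P ==> hom d P ==> W.vs.linf fw P p w0 = 0"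
proof (induction "nat (int d - 1 - p)" arbitrary: P d p rule: less_induct)
 case less
 consider "p \<ge> int d" | "p = int d - 1" | "p < int d - 1" by linarith
 then show ?case
 proof cases
  case 1
  have "W.vs.linf fw P p w0 = lin sW (%w. 0) P"
   unfolding W.vs.linf_def by (rule lin_cong) (use less.prems(2) 1 fw_zero[OF topv_w0] in \<open>auto simp: hom_def\<close>)
  then show ?thesis by (simp add: W.vs.lin_zero)
 next
  case 2
  then show ?thesis using zero_mode_w0[OF less.prems z] by simp
 next
  case 3
  define v where "v = W.vs.linf fw P p w0"
  have killed: "aw x n v = 0" if n: "n \<ge> 1" for x n
  proof -
   have t: "W.vs.linf fw (amP x (int i) P) (n + p - int i) w0 = 0" for i
   proof (cases "i = 0")
    case True
    have "W.vs.linf fw (amP x 0 P) (n + p) w0 = 0"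
     by (rule less.hyps[of d]) (use 3 n J_amP[OF less.prems(1)] hom_amP0[OF less.prems(2)] in auto)
    then show ?thesis by (simp add: True)
   next
    case False
    then have i: "1 \<le> i" by simp
    show ?thesis
    proof (cases "amP x (int i) P = []")
     case True
     then show ?thesis by (simp add: W.vs.linf_simps)
    next
     case False
     then have h: "i \<le> d" "hom (d - i) (amP x (int i) P)" using hom_amP[OF less.prems(2) i] by auto
     show ?thesis
      by (rule less.hyps[of "d - i"]) (use 3 n h J_amP[OF less.prems(1)] in \<open>auto simp: of_nat_diff\<close>)
    qed
   qed
   have "aw x n v - W.vs.linf fw P p (aw x n w0) = 0"
    unfolding v_def comm_linf t by simp
   then show ?thesis using w0_top[OF n] by (simp add: W.vs.field_ops(1)[OF field_linf_fw])
  qed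
  have "v \<in> Grw (int d - 1 - p)"
   using D_linf[OF less.prems(2), of w0 0 p] D_w0 unfolding Grw_def v_def by (simp add: algebra_simps)
  then have "v = 0"
   using killed 3 Grw_sub Grw_act Grw_indep D_w0 w0_nz
   by (intro W.no_singular[OF irrW, of v Grw "int d - 1 - p" w0]) (auto simp: Grw_def)
  then show ?thesis by (simp add: v_def)
 qed
qed

text \<open>By the commutator formula the vectors killed by all modes of the ideal form a submodule,
  and it contains w0.\<close>

lemma modes_zero:
 assumes z: "ZZ r" and J: "J P"
 shows "W.vs.linf fw P p v = 0"
proof -
 define U where "U = {v. \<forall>P p. J P \<longrightarrow> W.vs.linf fw P p v = 0}"
 have "W.vs.subspace U"
  unfolding W.vs.subspace_def U_def by (simp add: W.vs.field_ops[OF field_linf_fw])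
 moreover have "aw x n u \<in> U" if u: "u \<in> U" for x n u
  unfolding U_def
 proof (intro CollectI allI impI)
  fix P p assume P: "J P"
  have "aw x n (W.vs.linf fw P p u) - W.vs.linf fw P p (aw x n u) = 0"
   unfolding comm_linf using u J_amP[OF P] unfolding U_def by simp
  moreover have "W.vs.linf fw P p u = 0" using u P unfolding U_def by blast
  ultimately show "W.vs.linf fw P p (aw x n u) = 0" by simp
 qed
 moreover have "w0 \<in> U"
  unfolding U_def
 proof (intro CollectI allI impI)
  fix P p assume P: "J P"
  show "W.vs.linf fw P p w0 = 0"
   unfolding W.vs.linf_def
  proof (rule W.vs.lin_by_key[of _ dg])
   fix d
   have "hom d (filter (%(c, w). dg w = d) P)" by (auto simp: hom_def)
   from modes_w0[OF z J_degree[OF P] this]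
   show "lin sW (%u. fw u p w0) (filter (%(c, w). dg w = d) P) = 0" unfolding W.vs.linf_def .
  qed
 qed
 ultimately have "v \<in> U" by (rule W.subspace_full[OF irrW _ _ _ w0_nz])
 then show ?thesis using J unfolding U_def by blast
qed

definition Wg :: "nat => 'b set" where "Wg d = {v. D v = sW (- of_nat d) v}"

lemma depth_decomp:
 obtains Fs g where "finite Fs" "!!d. d \<in> Fs ==> g d \<in> Wg d" "v = (\<Sum>d\<in>Fs. g d)"
proof -
 have "v \<in> W.vs.span (range (W.ey w0))" by (rule W.ey_span[OF irrW w0_E _ w0_H w0_nz]) (simp add: w0_top)
 from W.vs.span_homogeneous[OF this, of c0] obtain Fs g
  where I: "finite Fs" "!!d. d \<in> Fs ==> g d \<in> W.vs.span (W.ey w0 ` {u. c0 u = d})" "v = (\<Sum>d\<in>Fs. g d)" by blast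
 have mem: "x \<in> Wg d" if "x \<in> W.vs.span (W.ey w0 ` {u. c0 u = d})" for x d
  using that
 proof (induction rule: W.vs.span_induct_alt)
  case (step c x y)
  then obtain u where "x = W.ey w0 u" "c0 u = d" by blast
  then have "D x = sW (- of_nat d) x" using D_ey[of w0 0 u] D_w0 by simp
  then show ?case using step by (simp add: Wg_def D_ops W.vs.scale_right_distrib mult.commute)
 qed (simp add: Wg_def D_ops)
 show ?thesis by (rule that[OF I(1) mem[OF I(2)] I(3)])
qed

lemma Wg_sub: "W.vs.subspace (Wg d)"
 using Grw_sub[of "int d"] by (simp add: Grw_def Wg_def)

lemma Wg_indep: "finite I ==> (!!d. d \<in> I ==> g d \<in> Wg d) ==> (\<Sum>d\<in>I. g d) = 0 ==> d \<in> I ==> g d = 0"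
 by (rule W.vs.eig_indep1[OF D_lin, of I "%d. - of_nat d" g d]) (auto simp: Wg_def inj_on_def)

lemma graded_W: "graded_decomp sW Wg"
 unfolding graded_decomp_def
proof (intro conjI allI)
 show "W.vs.subspace (Wg d)" for d by (rule Wg_sub)
 fix v
 obtain Fs g where I: "finite Fs" "!!d. d \<in> Fs ==> g d \<in> Wg d" "v = (\<Sum>d\<in>Fs. g d)" by (rule depth_decomp[of v]) (rule that)
 define Q where "Q c \<longleftrightarrow> (\<forall>d. c d \<in> Wg d) \<and> finite {d. c d \<noteq> 0} \<and> v = (\<Sum>d\<in>{d. c d \<noteq> 0}. c d)" for c
 define c where "c d = (if d \<in> Fs then g d else 0)" for d
 have "\<exists>!c. Q c"
 proof (rule ex1I[of _ c])
  have f: "finite {d. c d \<noteq> 0}" by (rule finite_subset[OF _ I(1)]) (auto simp: c_def)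
  have "(\<Sum>d\<in>{d. c d \<noteq> 0}. c d) = (\<Sum>d\<in>Fs. c d)" using I(1) by (intro sum.mono_neutral_left) (auto simp: c_def)
  also have "\<dots> = v" unfolding I(3) by (rule sum.cong) (auto simp: c_def)
  finally show "Q c" unfolding Q_def using f I(2) W.vs.subspace_0[OF Wg_sub] by (auto simp: c_def)
 next
  fix c' assume c': "Q c'"
  define S where "S = Fs \<union> {d. c' d \<noteq> 0}"
  have fS: "finite S" using I(1) c' by (simp add: S_def Q_def)
  have "(\<Sum>d\<in>S. c' d) = v"
   using c' fS by (auto simp: Q_def S_def intro!: sum.mono_neutral_right)
  moreover have "(\<Sum>d\<in>S. c d) = v"
   unfolding I(3) using fS by (intro sum.mono_neutral_cong_right) (auto simp: c_def S_def)
  ultimately have s0: "(\<Sum>d\<in>S. c' d - c d) = 0" by (simp add: sum_subtractf)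
  have "c' d - c d \<in> Wg d" for d
   using c' I(2) W.vs.subspace_0[OF Wg_sub] by (intro W.vs.subspace_diff[OF Wg_sub]) (auto simp: Q_def c_def)
  then have "c' d = c d" if "d \<in> S" for d using Wg_indep[OF fS _ s0 that] by simp
  moreover have "c' d = c d" if "d \<notin> S" for d using that by (simp add: S_def c_def)
  ultimately show "c' = c" by (intro ext) blast
 qed
 then show "\<exists>!c. (\<forall>d. c d \<in> Wg d) \<and> finite {d. c d \<noteq> 0} \<and> v = (\<Sum>d\<in>{d. c d \<noteq> 0}. c d)" unfolding Q_def .
qed

lemma D_eigenvalue:
 assumes "D v = sW \<nu> v" "v \<noteq> 0" shows "\<exists>d. \<nu> = - of_nat d"
proof (rule ccontr)
 assume n: "\<not> ?thesis"
 obtain Fs g where I: "finite Fs" "!!d. d \<in> Fs ==> g d \<in> Wg d" "v = (\<Sum>d\<in>Fs. g d)" by (rule depth_decomp[of v]) (rule that)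
 \<comment> \<open>The hypothetical eigenvector enters as an extra index \<open>None\<close>, so
   that independence applies to one family with distinct eigenvalues.\<close>
 define h where "h i = (case i of None => - v | Some d => g d)" for i
 define e where "e i = (case i of None => \<nu> | Some d => - of_nat d)" for i
 have m: "D (- v) = - D v" using D_ops(2)[of "-1" v] by simp
 have "h None = 0"
 proof (rule W.vs.eig_indep1[OF D_lin, of "insert None (Some ` Fs)" e])
  show "inj_on e (insert None (Some ` Fs))" using n by (auto simp: inj_on_def e_def)
  show "D (h i) = sW (e i) (h i)" if "i \<in> insert None (Some ` Fs)" for i
   using that I(2) assms(1) by (auto simp: h_def e_def m Wg_def)
  have "(\<Sum>i\<in>insert None (Some ` Fs). h i) = - v + (\<Sum>i\<in>Some ` Fs. h i)"
   by (subst sum.insert) (auto simp: I(1) h_def)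
  also have "(\<Sum>i\<in>Some ` Fs. h i) = v" unfolding I(3) by (subst sum.reindex) (auto simp: h_def)
  finally show "(\<Sum>i\<in>insert None (Some ` Fs). h i) = 0" by simp
 qed (auto simp: I(1))
 then show False using assms(2) by (simp add: h_def)
qed

theorem cat_O: "in_cat_O k sW aw"
 unfolding in_cat_O_def Let_def case_prod_beta fst_conv snd_conv
proof (intro conjI, rule gmW, rule exI[of _ D], rule exI[of _ "{(r, 0)}"], intro conjI allI impI)
 let ?w = "%\<omega>. {w. aw H 0 w = sW (fst \<omega>) w \<and> D w = sW (snd \<omega>) w}"
 show "Vector_Spaces.linear sW sW D" by (rule D_lin)
 show "D (aw x n w) - aw x n (D w) = sW (of_int n) (aw x n w)" for x n w by (rule D_act)
 show "finite {(r, 0 :: complex)}" by simp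
 show "\<exists>Fs g. finite Fs \<and> (\<forall>\<omega>\<in>Fs. g \<omega> \<in> ?w \<omega>) \<and> w = (\<Sum>\<omega>\<in>Fs. g \<omega>)" for w

 proof -
  from weight_decomp[OF sing_w0, of w] obtain Fs g
   where "finite Fs \<and> Fs \<subseteq> range (wgt r 0) \<and> (\<forall>\<omega>\<in>Fs. g \<omega> \<in> W.vs.span (W.ey w0 ` {b. wgt r 0 b = \<omega>})) \<and> w = (\<Sum>\<omega>\<in>Fs. g \<omega>)"
   by (elim exE)
  then have I: "finite Fs" "!!\<omega>. \<omega> \<in> Fs ==> g \<omega> \<in> W.vs.span (W.ey w0 ` {b. wgt r 0 b = \<omega>})" "w = (\<Sum>\<omega>\<in>Fs. g \<omega>)"
   by blast+
  show ?thesis by (rule exI[of _ Fs], rule exI[of _ g]) (use I(1,3) eigen_span[OF sing_w0 I(2)] in simp)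
 qed
 show "fin_dim sW (?w \<omega>)" for \<omega>
 proof -
  \<comment> \<open>A weight determines both letter counts, hence the length of the word.\<close>
  have "finite {b. wgt r 0 b = \<omega>}"
  proof (cases "{b. wgt r 0 b = \<omega>} = {}")
   case False
   then obtain b where b: "wgt r 0 b = \<omega>" by blast
   have "length b' = length b" if "wgt r 0 b' = \<omega>" for b'
   proof -
    have "wgt r 0 b' = wgt r 0 b" using b that by simp
    then have "c0 b' = c0 b \<and> c1 b' = c1 b" by (auto simp: wgt_def)
    then show ?thesis by (simp add: length_c)
   qed
   then have "{b. wgt r 0 b = \<omega>} \<subseteq> {b'. set b' \<subseteq> UNIV \<and> length b' = length b}" by auto
   then show ?thesis using finite_lists_length_eq[of UNIV "length b"] by (rule finite_subset) simp
  qed simp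
  then have "finite (W.ey w0 ` {b. wgt r 0 b = \<omega>})" by simp
  moreover have "?w \<omega> \<subseteq> W.vs.span (W.ey w0 ` {b. wgt r 0 b = \<omega>})"
   using weight_span[OF sing_w0, of _ "fst \<omega>" "snd \<omega>"] by auto
  ultimately show ?thesis unfolding fin_dim_def by blast
 qed
 fix \<mu> \<nu> assume "{w. aw H 0 w = sW \<mu> w \<and> D w = sW \<nu> w} \<noteq> {0}"
 moreover have "0 \<in> {w. aw H 0 w = sW \<mu> w \<and> D w = sW \<nu> w}" by (simp add: D_ops)
 ultimately obtain v where v: "aw H 0 v = sW \<mu> v" "D v = sW \<nu> v" "v \<noteq> 0" by blast
 have "v \<in> W.vs.span (W.ey w0 ` {b. wgt r 0 b = (\<mu>, \<nu>)})" by (rule weight_span[OF sing_w0 v(1,2)])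
 then have "{b. wgt r 0 b = (\<mu>, \<nu>)} \<noteq> {}"
  using v(3) by (cases "{b. wgt r 0 b = (\<mu>, \<nu>)} = {}") simp_all
 then obtain b where "wgt r 0 b = (\<mu>, \<nu>)" by blast
 then have "r - \<mu> = - 2 * of_nat (c0 b) + 2 * of_nat (c1 b)" "0 - \<nu> = of_nat (c0 b)" by (auto simp: wgt_def)
 then show "\<exists>x\<in>{(r, 0)}. \<exists>a b. fst x - \<mu> = - 2 * of_nat a + 2 * of_nat b \<and> snd x - \<nu> = of_nat a"
  by (intro bexI[of _ "(r, 0)"] exI[of _ "c0 b"] exI[of _ "c1 b"]) simp_all
qed

theorem module_structure:
 assumes z: "ZZ r"
 shows "\<exists>YW Wg. graded_module sV Y one Vg sW YW Wg \<and> (\<forall>x n. YW (a x) n = aw x n) \<and> va_module_irred sW YW"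
proof -
 interpret M: Lk0_wd k sV Y one a Vg sW aw
  by unfold_locales (use modes_zero[OF z] in \<open>simp add: W.vs.linf_def\<close>)
 have "grading_compat Vg Wg M.YW"
  unfolding grading_compat_def
 proof (intro allI impI)
  fix d e v w m assume v: "v \<in> Vg d" and w: "w \<in> Wg e"
  obtain P where P: "hom d P" "v = lin sV ev P" using Vg_hom[OF v] by blast
  have "D w = sW (- of_nat e) w" using w by (simp add: Wg_def)
  then have eig: "D (M.YW v m w) = sW (- of_int (int e + int d - m - 1)) (M.YW v m w)"
   using D_linf[OF P(1), of w "- of_nat e" m] unfolding P(2) M.YW_lin by (simp add: algebra_simps)
  show "M.YW v m w \<in> (if int e + int d - m - 1 \<ge> 0 then Wg (nat (int e + int d - m - 1)) else {0})"
  proof (cases "int e + int d - m - 1 \<ge> 0")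
   case True
   then have "of_nat (nat (int e + int d - m - 1)) = (of_int (int e + int d - m - 1) :: complex)" by (simp add: of_nat_nat)
   then show ?thesis using eig True by (simp only: Wg_def if_True mem_Collect_eq)
  next
   case False
   have "M.YW v m w = 0"
   proof (rule ccontr)
    assume "M.YW v m w \<noteq> 0"
    from D_eigenvalue[OF eig this] obtain j where "- of_int (int e + int d - m - 1) = (- of_nat j :: complex)" by blast
    then have "of_int (int e + int d - m - 1) = (of_int (int j) :: complex)" by (simp only: neg_equal_iff_equal of_int_of_nat_eq)
    then have "int e + int d - m - 1 = int j" by (simp only: of_int_eq_iff)
    then show False using False by simp
   qed
   then show ?thesis using False by simp
  qed
 qed
 then have "graded_module sV Y one Vg sW M.YW Wg"
  unfolding graded_module_def using M.va_module_YW graded_W by blast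
 moreover have "\<forall>x n. M.YW (a x) n = aw x n" by (simp add: M.YW_a)
 moreover have "va_module_irred sW M.YW"
  unfolding va_module_irred_def
 proof (intro conjI allI impI)
  show "\<exists>w::'b. w \<noteq> 0" using w0_nz by blast
  fix U assume U: "W.vs.subspace U \<and> (\<forall>v n. \<forall>w\<in>U. M.YW v n w \<in> U) \<and> U \<noteq> {0}"
  then have "\<forall>x n. \<forall>w\<in>U. aw x n w \<in> U" using M.YW_a by metis
  then show "U = UNIV" using irrW U unfolding ghat_irred_def by blast
 qed
 ultimately show ?thesis by blast
qed

end

subsection \<open>Modules with a given field structure\<close>

locale Lk0_va = Lk0 k sV Y one a Vg
 for k :: complex and sV :: "complex => 'v::ab_group_add => 'v" and Y and one and a and Vg +
 fixes sW :: "complex => 'w::ab_group_add => 'w" and YW :: "'v => int => 'w => 'w"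
 assumes va: "va_module sV Y one sW YW" and gmYW: "ghat_module k sW (%x n. YW (a x) n)"
begin

abbreviation aw :: "sl2b => int => 'w => 'w" where "aw \<equiv> %x n. YW (a x) n"

lemma va_trunc: "\<exists>M. \<forall>n\<ge>M. YW u n w = 0" and va_lin: "Vector_Spaces.linear sW sW (YW u n)"
 and va_lin1: "Vector_Spaces.linear sV sW (%u. YW u n w)" and va_one: "YW one n w = (if n = -1 then w else 0)"
 and va_bor: "borcherds sW Y YW"
 using va unfolding va_module_def by blast+

sublocale M: Lk0_mod k sV Y one a Vg sW aw
proof unfold_locales
 show "ghat_module k sW aw" by (rule gmYW)
 fix w
 obtain M1 M2 M3 where "\<forall>n\<ge>M1. YW (a E) n w = 0" "\<forall>n\<ge>M2. YW (a F) n w = 0" "\<forall>n\<ge>M3. YW (a H) n w = 0"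
  using va_trunc[of "a E" w] va_trunc[of "a F" w] va_trunc[of "a H" w] by (elim exE)
 then have "YW (a x) n w = 0" if "n \<ge> max M1 (max M2 M3)" for x n using that by (cases x) simp_all
 then show "\<exists>M. \<forall>n\<ge>M. \<forall>x. aw x n w = 0" by blast
qed

lemma field_YW: "M.W.vs.field (YW u)"
 unfolding M.W.vs.field_def by (intro conjI allI va_lin va_trunc)

text \<open>The Borcherds identity at m = 0. It shows that any module structure is the one built
  from products of its currents.\<close>

lemma YW_assoc: "YW (Y u l v) n w = M.W.vs.nprod l (YW u) (YW v) n w"
proof -
 define f where "f i = sW ((-1) ^ i * gch l i) (YW u (l - int i) (YW v (n + int i) w))" for i
 define g where "g i = sW ((-1) ^ i * gch l i) (YW v (n + l - int i) (YW u (int i) w))" for i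
 have ef: "evz f" unfolding f_def
  by (intro M.W.vs.evz_scale evz_map[OF M.W.vs.field_evz[OF field_YW[of v], where n = n and w = w]]) (simp add: M.W.vs.field_ops(1)[OF field_YW])
 have eg: "evz g" unfolding g_def
  by (intro M.W.vs.evz_scale evz_map[OF M.W.vs.field_evz[OF field_YW[of u], where n = 0 and w = w]]) (simp add: M.W.vs.field_ops(1)[OF field_YW])
 have np: "M.W.vs.nprod l (YW u) (YW v) n w = fs f - sW (sg l) (fs g)"
  unfolding M.W.vs.nprod_eq f_def g_def ..
 have "\<forall>\<^sub>F B in sequentially.
  (\<Sum>i<B. sW (gch 0 i) (YW (Y u (l + int i) v) (0 + n - int i) w)) =
  (\<Sum>i<B. sW ((-1) ^ i * gch l i) (YW u (0 + l - int i) (YW v (n + int i) w) - sW (sg l) (YW v (n + l - int i) (YW u (0 + int i) w))))"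
  using va_bor unfolding borcherds_def by (elim allE)
 moreover have "\<forall>\<^sub>F B in sequentially. B \<ge> Suc 0" by (rule eventually_ge_at_top)
 ultimately have "\<forall>\<^sub>F B in sequentially. YW (Y u l v) n w = M.W.vs.nprod l (YW u) (YW v) n w"
  using evzE[OF ef] evzE[OF eg]
 proof eventually_elim
  case (elim B)
  have "(\<Sum>i<B. sW (gch 0 i) (YW (Y u (l + int i) v) (0 + n - int i) w)) = (\<Sum>i\<in>{0}. sW (gch 0 i) (YW (Y u (l + int i) v) (0 + n - int i) w))"
   by (rule sum.mono_neutral_right) (use elim(2) in \<open>auto simp: gch_0[simplified]\<close>)
  also have "\<dots> = YW (Y u l v) n w" by simp
  finally have 1: "(\<Sum>i<B. sW (gch 0 i) (YW (Y u (l + int i) v) (0 + n - int i) w)) = YW (Y u l v) n w" .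
  have 2: "(\<Sum>i<B. sW ((-1) ^ i * gch l i) (YW u (0 + l - int i) (YW v (n + int i) w) - sW (sg l) (YW v (n + l - int i) (YW u (0 + int i) w))))
   = (\<Sum>i<B. f i) - sW (sg l) (\<Sum>i<B. g i)"
   unfolding f_def g_def M.W.vs.scale_sum_right sum_subtractf[symmetric]
   by (rule sum.cong) (simp_all add: M.W.vs.scale_right_diff_distrib mult.commute)
  show ?case using elim(1) unfolding 1 2 np elim(3,4) .
 qed
 from eventually_happens'[OF sequentially_bot this] show ?thesis by blast
qed

lemma fw_YW: "M.fw w = YW (ev w)"
proof (induction w)
 case Nil
 show ?case by (intro ext) (simp add: M.W.vs.idf_def va_one)
next
 case (Cons b w)
 obtain x n where b: "b = (x, n)" by (cases b)
 show ?case by (intro ext) (simp add: b Cons act_def YW_assoc)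
qed

lemma YW_lin: "YW (lin sV ev P) n w = lin sW (%u. M.fw u n w) P"
proof -
 interpret B: Vector_Spaces.linear sV sW "%u. YW u n w" by (rule va_lin1)
 show ?thesis by (induction P) (simp_all add: B.zero B.add B.scale fw_YW)
qed

sublocale Mw: Lk0_wd k sV Y one a Vg sW aw
proof unfold_locales
 fix P p v assume "J P"
 then have "lin sV ev P = 0" by (simp add: J_def)
 then have "lin sW (%w. M.fw w p v) P = YW 0 p v" using YW_lin[of P p v] by simp
 also have "\<dots> = 0"
 proof -
  interpret B: Vector_Spaces.linear sV sW "%u. YW u p v" by (rule va_lin1)
  show ?thesis by (rule B.zero)
 qed
 finally show "lin sW (%w. M.fw w p v) P = 0" .
qed

lemma irred_ghat:
 assumes "va_module_irred sW YW" shows "ghat_irred sW aw"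
 unfolding ghat_irred_def
proof (intro conjI allI impI)
 show "\<exists>w::'w. w \<noteq> 0" using assms unfolding va_module_irred_def by blast
 fix U assume U: "M.W.vs.subspace U \<and> (\<forall>x n. \<forall>w\<in>U. aw x n w \<in> U) \<and> U \<noteq> {0}"
 have fw: "M.fw w n u \<in> U" if "u \<in> U" for w n u
  using that
 proof (induction w arbitrary: n u)
  case Nil
  then show ?case using M.W.vs.subspace_0[of U] U by (simp add: M.W.vs.idf_def)
 next
  case (Cons b w)
  obtain x m where b: "b = (x, m)" by (cases b)
  show ?case unfolding b M.fw.simps
   by (rule M.W.vs.nprod_mem[OF conjunct1[OF U] _ Cons.IH Cons.prems]) (use U in blast)+
 qed
 have "YW v n w \<in> U" if w: "w \<in> U" for v n w
 proof -
  obtain P where P: "v = lin sV ev P" using span_ev by blast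
  show ?thesis unfolding P YW_lin by (rule M.W.vs.lin_mem[OF conjunct1[OF U]]) (rule fw[OF w])
 qed
 then show "U = UNIV" using assms U unfolding va_module_irred_def by blast
qed

text \<open>Climbing with e(0) and f(1) must stop, because category O has finitely many maximal
  weights; a weight of greatest height above a given one carries the vector.\<close>

lemma hw_vector:
 assumes O: "in_cat_O k sW aw" and nz: "\<exists>w::'w. w \<noteq> 0"
 shows "\<exists>w r. w \<noteq> 0 \<and> aw E 0 w = 0 \<and> aw F 1 w = 0 \<and> aw H 0 w = sW r w"
proof -
 define ws where "ws D \<mu> \<nu> = {w. aw H 0 w = sW \<mu> w \<and> D w = sW \<nu> w}" for D \<mu> \<nu>
 define Q where "Q D Lams \<longleftrightarrow> Vector_Spaces.linear sW sW D \<and> (\<forall>x n w. D (aw x n w) - aw x n (D w) = sW (of_int n) (aw x n w)) \<and>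
   (\<forall>w. \<exists>Fs g. finite Fs \<and> (\<forall>\<omega>\<in>Fs. g \<omega> \<in> ws D (fst \<omega>) (snd \<omega>)) \<and> w = (\<Sum>\<omega>\<in>Fs. g \<omega>)) \<and>
   (\<forall>\<omega>. fin_dim sW (ws D (fst \<omega>) (snd \<omega>))) \<and> finite Lams \<and>
   (\<forall>\<mu> \<nu>. ws D \<mu> \<nu> \<noteq> {0} \<longrightarrow> (\<exists>l\<in>Lams. \<exists>a b::nat. fst l - \<mu> = - 2 * of_nat a + 2 * of_nat b \<and> snd l - \<nu> = of_nat a))" for D Lams
 have "\<exists>D Lams. Q D Lams"
  using O unfolding in_cat_O_def Let_def case_prod_beta fst_conv snd_conv ws_def Q_def by (rule conjunct2)
 then obtain D Lams where Q: "Q D Lams" by (elim exE)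
 have D2: "\<forall>x n w. D (aw x n w) - aw x n (D w) = sW (of_int n) (aw x n w)"
  and dec: "\<forall>w. \<exists>Fs g. finite Fs \<and> (\<forall>\<omega>\<in>Fs. g \<omega> \<in> ws D (fst \<omega>) (snd \<omega>)) \<and> w = (\<Sum>\<omega>\<in>Fs. g \<omega>)"
  and fin: "finite Lams"
  and bd: "\<forall>\<mu> \<nu>. ws D \<mu> \<nu> \<noteq> {0} \<longrightarrow> (\<exists>l\<in>Lams. \<exists>a b::nat. fst l - \<mu> = - 2 * of_nat a + 2 * of_nat b \<and> snd l - \<nu> = of_nat a)"
  using Q unfolding Q_def by - (elim conjE, assumption)+
 from nz obtain w :: 'w where w: "w \<noteq> 0" by blast
 obtain Fs g where g: "finite Fs \<and> (\<forall>\<omega>\<in>Fs. g \<omega> \<in> ws D (fst \<omega>) (snd \<omega>)) \<and> w = (\<Sum>\<omega>\<in>Fs. g \<omega>)"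
  using spec[OF dec, of w] by (elim exE) (rule that)
 note I1 = bspec[OF conjunct1[OF conjunct2[OF g]]] and I2 = conjunct2[OF conjunct2[OF g]]
 have "\<exists>\<omega>\<in>Fs. g \<omega> \<noteq> 0"
 proof (rule ccontr)
  assume "\<not> ?thesis"
  then have "(\<Sum>\<omega>\<in>Fs. g \<omega>) = 0" by (intro sum.neutral) blast
  then show False using w I2 by simp
 qed
 then obtain \<omega> where \<omega>: "\<omega> \<in> Fs" "g \<omega> \<noteq> 0" by blast
 define \<mu>0 \<nu>0 where "\<mu>0 = fst \<omega>" and "\<nu>0 = snd \<omega>"
 define wt' where "wt' u v = ws D (\<mu>0 - 2 * of_nat u + 2 * of_nat v) (\<nu>0 + of_nat u)" for u v :: nat
 define A where "A = {m. \<exists>u v. m = u + v \<and> (\<exists>x\<in>wt' u v. x \<noteq> 0)}"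
 \<comment> \<open>For l above the starting weight by a times \<alpha>_0 and b times \<alpha>_1 this
   is a + b, the height that bounds all climbs.\<close>
 define \<kappa> where "\<kappa> l = (fst l - \<mu>0) / 2 + 2 * (snd l - \<nu>0)" for l
 define b where "b = (\<Sum>l\<in>Lams. norm (\<kappa> l))"
 have "real m \<le> b" if mA: "m \<in> A" for m
 proof -
  from mA obtain u v x where m: "m = u + v" "x \<in> wt' u v" "x \<noteq> 0" unfolding A_def by blast
  then have "wt' u v \<noteq> {0}" by blast
  then obtain l a' b' where l: "l \<in> Lams" "fst l - (\<mu>0 - 2 * of_nat u + 2 * of_nat v) = - 2 * of_nat a' + 2 * of_nat b'"
   "snd l - (\<nu>0 + of_nat u) = of_nat a'" using bd[THEN spec, THEN spec, THEN mp] unfolding wt'_def by blast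
  have e1: "snd l - \<nu>0 = of_nat a' + of_nat u" using l(3) by (simp add: algebra_simps)
  have "fst l - \<mu>0 = - 2 * of_nat a' + 2 * of_nat b' - 2 * of_nat u + 2 * of_nat v" using l(2) by (simp add: algebra_simps)
  then have "\<kappa> l = of_nat (u + v + a' + b')" unfolding \<kappa>_def e1 by (simp add: field_simps)
  then have "norm (\<kappa> l) = real (u + v + a' + b')" by (simp only: norm_of_nat)
  moreover have "norm (\<kappa> l) \<le> b" unfolding b_def by (rule member_le_sum) (use l(1) fin in auto)
  ultimately show ?thesis unfolding m(1) by simp
 qed
 then have "A \<subseteq> {..nat \<lfloor>b\<rfloor>}" by (auto simp: le_nat_floor)
 then have fA: "finite A" by (rule finite_subset) simp
 have "0 \<in> A" unfolding A_def
  using I1[OF \<omega>(1)] \<omega>(2) by (auto intro!: exI[of _ 0] bexI[of _ "g \<omega>"] simp: wt'_def \<mu>0_def \<nu>0_def)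
 then have "Max A \<in> A" using fA by (intro Max_in) auto
 then obtain u v x where m: "Max A = u + v" "x \<in> wt' u v" "x \<noteq> 0" unfolding A_def by blast
 have up: "y = 0" if "y \<in> wt' u' v'" "u' + v' = Suc (u + v)" for y u' v'
 proof (rule ccontr)
  assume "y \<noteq> 0"
  then have "Suc (u + v) \<in> A" using that unfolding A_def by (intro CollectI exI[of _ u'] exI[of _ v']) auto
  then have "Suc (u + v) \<le> Max A" using fA by (intro Max_ge)
  then show False using m(1) by simp
 qed
 have D': "D (aw y n z) = aw y n (D z) + sW (of_int n) (aw y n z)" for y n z
  using D2[THEN spec, THEN spec, THEN spec, of y n z] by (simp add: diff_eq_eq add.commute)
 have x: "aw H 0 x = sW (\<mu>0 - 2 * of_nat u + 2 * of_nat v) x" "D x = sW (\<nu>0 + of_nat u) x"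
  using m(2) unfolding wt'_def ws_def by blast+
 have "aw E 0 x \<in> wt' u (Suc v)"
 proof -
  have "aw H 0 (aw E 0 x) = sW (\<mu>0 - 2 * of_nat u + 2 * of_nat v) (aw E 0 x) + sW 2 (aw E 0 x)"
   using M.W.comm_HE[of 0 0 x] unfolding x M.W.act_scale by simp
  also have "\<dots> = sW (\<mu>0 - 2 * of_nat u + 2 * of_nat (Suc v)) (aw E 0 x)"
   unfolding M.W.vs.scale_left_distrib[symmetric] by (simp add: algebra_simps)
  finally have 1: "aw H 0 (aw E 0 x) = sW (\<mu>0 - 2 * of_nat u + 2 * of_nat (Suc v)) (aw E 0 x)" .
  have "D (aw E 0 x) = sW (\<nu>0 + of_nat u) (aw E 0 x)" unfolding D' x M.W.act_scale by simp
  then show ?thesis using 1 unfolding wt'_def ws_def by blast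
 qed
 then have e0: "aw E 0 x = 0" using up by simp
 have "aw F 1 x \<in> wt' (Suc u) v"
 proof -
  have "aw H 0 (aw F 1 x) = sW (\<mu>0 - 2 * of_nat u + 2 * of_nat v) (aw F 1 x) - sW 2 (aw F 1 x)"
   using M.W.comm_HF[of 0 1 x] unfolding x M.W.act_scale by simp
  also have "\<dots> = sW (\<mu>0 - 2 * of_nat (Suc u) + 2 * of_nat v) (aw F 1 x)"
   unfolding M.W.vs.scale_left_diff_distrib[symmetric] by (simp add: algebra_simps)
  finally have 1: "aw H 0 (aw F 1 x) = sW (\<mu>0 - 2 * of_nat (Suc u) + 2 * of_nat v) (aw F 1 x)" .
  have "D (aw F 1 x) = sW (\<nu>0 + of_nat u) (aw F 1 x) + sW (of_int 1) (aw F 1 x)" unfolding D' x M.W.act_scale ..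
  also have "\<dots> = sW (\<nu>0 + of_nat (Suc u)) (aw F 1 x)"
   unfolding M.W.vs.scale_left_distrib[symmetric] by (simp add: algebra_simps)
  finally show ?thesis using 1 unfolding wt'_def ws_def by blast
 qed
 then have "aw F 1 x = 0" using up by simp
 then show ?thesis using e0 x(1) m(3) by blast
qed

theorem highest_weight:
 assumes cop: "coprime (N + 1) q" and t: "k + 2 = of_nat (N + 1) / of_nat q" and q: "q > 0" and N: "N > 0"
  and O: "in_cat_O k sW aw" and irr: "va_module_irred sW YW"
 shows "\<exists>r. (\<exists>i n. 1 \<le> i \<and> i \<le> q \<and> n < N \<and> r = of_nat i * (k + 2) - 2 - of_nat n) \<and> hw_irrep k sW aw r"
proof -
 have "\<exists>w::'w. w \<noteq> 0" using irr unfolding va_module_irred_def by blast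
 from hw_vector[OF O this] obtain w r where w: "w \<noteq> 0" "aw E 0 w = 0" "aw F 1 w = 0" "aw H 0 w = sW r w" by (elim exE conjE)
 have top: "aw x n w = 0" if "n \<ge> 1" for x n by (rule M.W.nplus[OF w(2,3) that])
 then have "M.topv w" by (simp add: M.topv_def)
 from Mw.top_weight[OF cop t q N this w(2,4,1)]
 have "\<exists>i n. 1 \<le> i \<and> i \<le> q \<and> n < N \<and> r = of_nat i * (k + 2) - 2 - of_nat n" .
 moreover have "hw_irrep k sW aw r"
  unfolding hw_irrep_def
  by (intro conjI gmYW irred_ghat[OF irr] exI[of _ w] w allI impI top)
 ultimately show ?thesis by blast
qed

end

section \<open>The set S and the final assembly\<close>

text \<open>With t = k + 2 and q t = N + 1, N - i t - j = (q - i) t - 2 - (j - 1).\<close>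

lemma S_set_eq:
 assumes adm: "admissible p q" and N: "N = nat (2 * int q + p - 1)"
 shows "r \<in> S_set p q \<longleftrightarrow> (\<exists>i n. 1 \<le> i \<and> i \<le> q \<and> n < N \<and> r = of_nat i * (lev p q + 2) - 2 - of_nat n)"
  "lev p q + 2 = of_nat (N + 1) / of_nat q" "coprime (N + 1) q" "q > 0" "N > 0"
proof -
 have q: "q \<ge> 1" "gcd p (int q) = 1" "2 * int q + p - 2 \<ge> 0" using adm by (auto simp: admissible_def)
 then show "q > 0" "N > 0" by (auto simp: N)
 have iN: "int N = 2 * int q + p - 1" using q by (simp add: N)
 have cN: "of_int (2 * int q + p - 1) = (of_nat N :: complex)" using iN by (metis of_int_of_nat_eq)
 have p: "(of_int p :: complex) = of_nat N + 1 - 2 * of_nat q" using cN by (simp add: algebra_simps)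
 show t: "lev p q + 2 = of_nat (N + 1) / of_nat q" using q(1) by (simp add: lev_def p field_simps)
 have "gcd (int (N + 1)) (int q) = gcd (p + 2 * int q) (int q)" by (simp add: iN add.commute)
 also have "\<dots> = 1" using q(2) by (metis gcd_add_mult add.commute gcd.commute)
 finally show "coprime (N + 1) q" by (simp only: coprime_int_iff[symmetric] coprime_iff_gcd_eq_1)
 have qt: "of_nat q * (lev p q + 2) = of_nat N + 1" using t q(1) by simp
 show "r \<in> S_set p q \<longleftrightarrow> (\<exists>i n. 1 \<le> i \<and> i \<le> q \<and> n < N \<and> r = of_nat i * (lev p q + 2) - 2 - of_nat n)"
 proof
  assume "r \<in> S_set p q"
  then obtain i j where ij: "i \<le> q - 1" "1 \<le> j" "j \<le> 2 * int q + p - 1" "r = of_nat N - of_nat i * (lev p q + 2) - of_int j"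
   unfolding S_set_def cN by blast
  have j: "(of_int j :: complex) = of_nat (nat (j - 1)) + 1" using ij(2) by (simp add: of_nat_nat)
  have "r = of_nat (q - i) * (lev p q + 2) - 2 - of_nat (nat (j - 1))"
   using ij(1) q(1) qt unfolding ij(4) j by (simp add: of_nat_diff left_diff_distrib)
  moreover have "1 \<le> q - i" "q - i \<le> q" "nat (j - 1) < N" using ij q iN by auto
  ultimately show "\<exists>i n. 1 \<le> i \<and> i \<le> q \<and> n < N \<and> r = of_nat i * (lev p q + 2) - 2 - of_nat n" by blast
 next
  assume "\<exists>i n. 1 \<le> i \<and> i \<le> q \<and> n < N \<and> r = of_nat i * (lev p q + 2) - 2 - of_nat n"
  then obtain i n where i: "1 \<le> i" "i \<le> q" "n < N" "r = of_nat i * (lev p q + 2) - 2 - of_nat n" by blast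
  have "r = of_nat N - of_nat (q - i) * (lev p q + 2) - of_int (int n + 1)"
   using i(2) qt unfolding i(4) by (simp add: of_nat_diff left_diff_distrib)
  moreover have "q - i \<le> q - 1" "1 \<le> int n + 1" "int n + 1 \<le> 2 * int q + p - 1" using i iN by auto
  ultimately show "r \<in> S_set p q" unfolding S_set_def cN by blast
 qed
qed

text \<open>The substitution is n = N - j.\<close>

lemma S_set_P_set: "S_set p q = snd ` P_set p q"
proof (intro set_eqI iffI)
 fix r assume "r \<in> S_set p q"
 then obtain i j where ij: "i \<le> q - 1" "1 \<le> j" "j \<le> 2 * int q + p - 1" "r = of_int (2 * int q + p - 1) - of_nat i * (lev p q + 2) - of_int j"
  unfolding S_set_def by blast
 define n where "n = nat (2 * int q + p - 1 - j)"
 have n: "int n = 2 * int q + p - 1 - j" using ij(3) by (simp add: n_def)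
 then have "(of_nat n :: complex) = of_int (2 * int q + p - 1 - j)" by (metis of_int_of_nat_eq)
 then have "r = of_nat n - of_nat i * (lev p q + 2)" unfolding ij(4) by simp
 moreover have "int n \<le> 2 * int q + p - 2" using n ij(2) by simp
 ultimately show "r \<in> snd ` P_set p q" using ij(1) unfolding P_set_def by force
next
 fix r assume "r \<in> snd ` P_set p q"
 then obtain m n where mn: "int n \<le> 2 * int q + p - 2" "m \<le> q - 1" "r = of_nat n - of_nat m * (lev p q + 2)"
  unfolding P_set_def by auto
 have "(of_nat n :: complex) = of_int (2 * int q + p - 1) - of_int (2 * int q + p - 1 - int n)" by simp
 then have "r = of_int (2 * int q + p - 1) - of_nat m * (lev p q + 2) - of_int (2 * int q + p - 1 - int n)" unfolding mn(3) by simp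
 moreover have "1 \<le> 2 * int q + p - 1 - int n" "2 * int q + p - 1 - int n \<le> 2 * int q + p - 1" using mn(1) by auto
 ultimately show "r \<in> S_set p q" using mn(2) unfolding S_set_def by blast
qed

lemma (in Lk0) hw_module:
 fixes sW :: "complex => 'w::ab_group_add => 'w" and aw :: "sl2b => int => 'w => 'w"
 assumes z: "ZZ r" and k: "k + 2 \<noteq> 0" and hw: "hw_irrep k sW aw r"
 shows "\<exists>YW Wg. graded_module sV Y one Vg sW YW Wg \<and> (\<forall>x n. YW (a x) n = aw x n) \<and> va_module_irred sW YW \<and> in_cat_O k sW aw"
proof -
 have gm: "ghat_module k sW aw" and irr: "ghat_irred sW aw" using hw unfolding hw_irrep_def by blast+
 obtain w0 where w0: "w0 \<noteq> 0" "!!x n. n \<ge> 1 ==> aw x n w0 = 0" "aw E 0 w0 = 0" "aw H 0 w0 = sW r w0"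
  using hw unfolding hw_irrep_def by blast
 interpret G: ghat k sW aw by unfold_locales (rule gm)
 \<comment> \<open>Fields require a restricted module. The vectors killed by all sufficiently large
   modes form a submodule containing w0.\<close>
 have rs: "\<exists>M. \<forall>n\<ge>M. \<forall>x. aw x n w = 0" for w
 proof -
  define U where "U = {w. \<exists>M. \<forall>n\<ge>M. \<forall>x. aw x n w = 0}"
  have "G.vs.subspace U"
   unfolding G.vs.subspace_def
  proof (intro conjI ballI allI)
   show "0 \<in> U" by (simp add: U_def)
   show "u + v \<in> U" if uv: "u \<in> U" "v \<in> U" for u v
   proof -
    from uv obtain M M' where "\<forall>n\<ge>M. \<forall>x. aw x n u = 0" "\<forall>n\<ge>M'. \<forall>x. aw x n v = 0" unfolding U_def by blast
    then have "\<forall>n\<ge>max M M'. \<forall>x. aw x n (u + v) = 0" by (simp add: G.act_add)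
    then show ?thesis unfolding U_def by blast
   qed
   show "sW c u \<in> U" if u: "u \<in> U" for c u
   proof -
    from u obtain M where "\<forall>n\<ge>M. \<forall>x. aw x n u = 0" unfolding U_def by blast
    then have "\<forall>n\<ge>M. \<forall>x. aw x n (sW c u) = 0" by (simp add: G.act_scale)
    then show ?thesis unfolding U_def by blast
   qed
  qed
  moreover have "aw y m u \<in> U" if u: "u \<in> U" for y m u
  proof -
   from u obtain M where M: "!!n x. n \<ge> M ==> aw x n u = 0" unfolding U_def by blast
   have "aw x n (aw y m u) = 0" if n: "n \<ge> max M (max (M - m) (1 - m))" for x n
   proof -
    have "(\<Sum>(d, z)\<leftarrow>L. sW d (aw z (n + m) u)) = 0" for L by (induction L) (use M n in auto)
    then show ?thesis unfolding G.comm[of x n y m u] using M[of n x] n by simp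
   qed
   then show ?thesis unfolding U_def by blast
  qed
  moreover have "w0 \<in> U" unfolding U_def using w0(2) by blast
  ultimately have "w \<in> U" by (rule G.subspace_full[OF irr _ _ _ w0(1)])
  then show ?thesis unfolding U_def by blast
 qed
 interpret G: rghat k sW aw by unfold_locales (rule rs)
 obtain D where D: "Vector_Spaces.linear sW sW D" "\<forall>x n v. D (aw x n v) - aw x n (D v) = sW (of_int n) (aw x n v)" "D w0 = 0"
  using G.derivation_exists[OF k w0(3,4,2)] by blast
 interpret Hw: Lk0_hw k sV Y one a Vg sW aw r w0 D
 proof -
  interpret Dl: Vector_Spaces.linear sW sW D by (rule D(1))
  show "Lk0_hw k sV Y one a Vg sW aw r w0 D"
   by unfold_locales (rule gm rs irr w0 Dl.add Dl.scale D(2)[rule_format] D(3) | assumption)+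
 qed
 show ?thesis using Hw.module_structure[OF z] Hw.cat_O by blast
qed

theorem theorem3p4:
  fixes p :: int and q :: nat
    and sV :: "complex \<Rightarrow> 'v::ab_group_add \<Rightarrow> 'v" and Y :: "'v \<Rightarrow> int \<Rightarrow> 'v \<Rightarrow> 'v"
    and one :: 'v and a :: "sl2b \<Rightarrow> 'v" and Vg :: "nat \<Rightarrow> 'v set"
  assumes "admissible p q"
    and "is_Lk0 (lev p q) sV Y one a Vg"
  shows
    "(\<forall>(sW :: complex \<Rightarrow> 'w::ab_group_add \<Rightarrow> 'w) YW Wg.
        graded_module sV Y one Vg sW YW Wg \<and> va_module_irred sW YW \<and>
        in_cat_O (lev p q) sW (\<lambda>x n. YW (a x) n)
        \<longrightarrow> (\<exists>r\<in>S_set p q. hw_irrep (lev p q) sW (\<lambda>x n. YW (a x) n) r))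
     \<and> (\<forall>(sW :: complex \<Rightarrow> 'w::ab_group_add \<Rightarrow> 'w) act. \<forall>r\<in>S_set p q.
        hw_irrep (lev p q) sW act r
        \<longrightarrow> (\<exists>YW Wg. graded_module sV Y one Vg sW YW Wg \<and> (\<forall>x n. YW (a x) n = act x n) \<and>
               va_module_irred sW YW \<and> in_cat_O (lev p q) sW act))
     \<and> S_set p q = snd ` P_set p q \<and> (\<forall>w\<in>P_set p q. fst w + snd w = lev p q)"
proof -
 interpret L: Lk0 "lev p q" sV Y one a Vg by unfold_locales (rule assms(2))
 define N where "N = nat (2 * int q + p - 1)"
 note S = S_set_eq[OF assms(1) N_def]
 show ?thesis
 proof (intro conjI allI impI ballI)
  fix sW :: "complex => 'w => 'w" and YW Wg
  assume h: "graded_module sV Y one Vg sW YW Wg \<and> va_module_irred sW YW \<and> in_cat_O (lev p q) sW (%x n. YW (a x) n)"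
  then have va: "va_module sV Y one sW YW" and gm: "ghat_module (lev p q) sW (%x n. YW (a x) n)"
   unfolding graded_module_def in_cat_O_def by blast+
  interpret M: Lk0_va "lev p q" sV Y one a Vg sW YW by unfold_locales (rule va, rule gm)
  show "\<exists>r\<in>S_set p q. hw_irrep (lev p q) sW (%x n. YW (a x) n) r"
   using M.highest_weight[OF S(3,2,4,5)] h unfolding Bex_def S(1) by blast
 next
  fix sW :: "complex => 'w => 'w" and act r
  assume r: "r \<in> S_set p q" and hw: "hw_irrep (lev p q) sW act r"
  from r obtain i n where i: "1 \<le> i" "i \<le> q" "n < N" "r = of_nat i * (lev p q + 2) - 2 - of_nat n" unfolding S(1) by blast
  \<comment> \<open>One flow from the (n + 1)-dimensional top and i - 1 generic ones lead to
    r.\<close>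
  have "L.ZZ r" using L.ZZ_chain[OF S(3,2) L.ZZ_all[OF S(3,2,4) i(3)], of "i - 1"] i by simp
  moreover have "lev p q + 2 \<noteq> 0" unfolding S(2) using S(4) by (simp del: of_nat_add of_nat_Suc)
  ultimately show "\<exists>YW Wg. graded_module sV Y one Vg sW YW Wg \<and> (\<forall>x n. YW (a x) n = act x n) \<and>
       va_module_irred sW YW \<and> in_cat_O (lev p q) sW act"
   by (rule L.hw_module[OF _ _ hw])
 next
  show "S_set p q = snd ` P_set p q" by (rule S_set_P_set)
  show "fst w + snd w = lev p q" if "w \<in> P_set p q" for w using that by (auto simp: P_set_def)
 qed
qed

end
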